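(* Let $A$ be a finite dimensional symmetric algebra over a field $k$, and $P\in K^{\mathrm b}(\mathrm{proj}\,A)$ a partial tilting complex of length $2$. Then $\Theta_n(P,A)$ is a tilting complex for any $n\ge1$.
   Context: $A$ is symmetric if $A\cong\mathrm{Hom}_k(A,k)$ as $A$-bimodules. Modules are right modules; $D(A)$ is the derived category of $\mathrm{Mod}\,A$, $K(A)$ the homotopy category of complexes of $A$-modules, $K^{\mathrm b}(\mathrm{proj}\,A)$ the bounded homotopy category of finitely generated projectives, and $\mathrm{add}\,M$ consists of summands of finite direct sums of copies of $M$. A partial tilting complex is a perfect complex $P$ with $\mathrm{Hom}_{D(A)}(P,P[n])=0$ for $n\neq0$; it is a tilting complex if moreover $\mathrm{add}\,P$ generates $K^{\mathrm b}(\mathrm{proj}\,A)$ as a triangulated category. The length of a complex $X$ is $l(X)=\max\{n:H^n(X)\ne0\}-\min\{n:H^n(X)\neq0\}+1$. Construction: let $M$ be a finitely generated $A$-module and $P: P^{s-r}\to\cdots\to P^{s-1}\to P^s$ a partial tilting complex in $K^{\mathrm b}(\mathrm{proj}\,A)$ of length $r+1$ (so $r=1$ for length $2$). Put $\Delta_0(P,M)=M$. For $n\geq1$ define inductively $\Delta_n(P,M)$ by a triangle \[ P_n[n+s-r-1]\xrightarrow{g_n}\Delta_{n-1}(P,M)\xrightarrow{h_n}\Delta_n(P,M)\to P_n[n+s-r]: \] if $\mathrm{Hom}_{K(A)}(P,\Delta_{n-1}(P,M)[r-s-n+1])=0$ put $P_n=0$; otherwise take $P_n\in\mathrm{add}\,P$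 and $g_n':P_n\to\Delta_{n-1}(P,M)[r-s-n+1]$ such that $\mathrm{Hom}_{K(A)}(P,g_n')$ is a projective cover of $\mathrm{End}_{D(A)}(P)$-modules, and $g_n=g_n'[n+s-r-1]$. Put $\Theta_n(P,M)=\Delta_n(P,M)\oplus P[n+s-r]$. *)

theory Defs
  imports "HOL-Algebra.Module" "HOL-Algebra.AbelCoset"
begin

section \<open>Finite dimensional symmetric algebras\<close>

text \<open>The library locale \<open>algebra\<close> is confined to commutative algebras.\<close>

locale fd_algebra = K?: field K + V?: module K A + A?: ring A
  for K :: "('k, 'z) ring_scheme" (structure) and A :: "('k, 'a) module" (structure) +
  assumes smult_mult_left:
    "\<lbrakk>c \<in> carrier K; x \<in> carrier A; y \<in> carrier A\<rbrakk>
      \<Longrightarrow> c \<odot>\<^bsub>A\<^esub> (x \<otimes>\<^bsub>A\<^esub> y) = (c \<odot>\<^bsub>A\<^esub> x) \<otimes>\<^bsub>A\<^esub> y"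
    and smult_mult_right:
    "\<lbrakk>c \<in> carrier K; x \<in> carrier A; y \<in> carrier A\<rbrakk>
      \<Longrightarrow> c \<odot>\<^bsub>A\<^esub> (x \<otimes>\<^bsub>A\<^esub> y) = x \<otimes>\<^bsub>A\<^esub> (c \<odot>\<^bsub>A\<^esub> y)"
    and finite_spanning_set:
    "\<exists>S. finite S \<and> S \<subseteq> carrier A \<and>
      (\<forall>x\<in>carrier A. \<exists>c \<in> S \<rightarrow> carrier K. x = (\<Oplus>\<^bsub>A\<^esub>b\<in>S. c b \<odot>\<^bsub>A\<^esub> b))"

definition linear_dual :: "('k, 'z) ring_scheme \<Rightarrow> ('k, 'a) module \<Rightarrow> ('a \<Rightarrow> 'k) set" where
  "linear_dual K A = {f \<in> carrier A \<rightarrow>\<^sub>E carrier K.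
     (\<forall>x\<in>carrier A. \<forall>y\<in>carrier A. f (x \<oplus>\<^bsub>A\<^esub> y) = f x \<oplus>\<^bsub>K\<^esub> f y) \<and>
     (\<forall>c\<in>carrier K. \<forall>x\<in>carrier A. f (c \<odot>\<^bsub>A\<^esub> x) = c \<otimes>\<^bsub>K\<^esub> f x)}"

text \<open>The bimodule structure of the dual is \<open>(a f b) y = f (b y a)\<close>.\<close>

definition symmetric_algebra :: "('k, 'z) ring_scheme \<Rightarrow> ('k, 'a) module \<Rightarrow> bool" where
  "symmetric_algebra K A \<longleftrightarrow> (\<exists>\<phi>. bij_betw \<phi> (carrier A) (linear_dual K A) \<and>
     (\<forall>x\<in>carrier A. \<forall>x'\<in>carrier A. \<forall>y\<in>carrier A.
        \<phi> (x \<oplus>\<^bsub>A\<^esub> x') y = \<phi> x y \<oplus>\<^bsub>K\<^esub> \<phi> x' y) \<and>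
     (\<forall>a\<in>carrier A. \<forall>x\<in>carrier A. \<forall>b\<in>carrier A. \<forall>y\<in>carrier A.
        \<phi> (a \<otimes>\<^bsub>A\<^esub> x \<otimes>\<^bsub>A\<^esub> b) y = \<phi> x (b \<otimes>\<^bsub>A\<^esub> y \<otimes>\<^bsub>A\<^esub> a)))"


section \<open>Right modules\<close>

text \<open>
  The library record \<open>module\<close> is used for right modules: \<open>r \<odot>\<^bsub>M\<^esub> x\<close> stands for \<open>x r\<close>. Its
  fields \<open>mult\<close> and \<open>one\<close> are ignored.
\<close>

locale right_module = R?: ring R + M?: abelian_group M
  for R :: "('r, 'z) ring_scheme" (structure) and M :: "('r, 'm) module" (structure) +
  assumes act_closed: "\<lbrakk>r \<in> carrier R; x \<in> carrier M\<rbrakk> \<Longrightarrow> r \<odot>\<^bsub>M\<^esub> x \<in> carrier M"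
    and act_add_ring: "\<lbrakk>r \<in> carrier R; r' \<in> carrier R; x \<in> carrier M\<rbrakk>
      \<Longrightarrow> (r \<oplus>\<^bsub>R\<^esub> r') \<odot>\<^bsub>M\<^esub> x = r \<odot>\<^bsub>M\<^esub> x \<oplus>\<^bsub>M\<^esub> r' \<odot>\<^bsub>M\<^esub> x"
    and act_add: "\<lbrakk>r \<in> carrier R; x \<in> carrier M; y \<in> carrier M\<rbrakk>
      \<Longrightarrow> r \<odot>\<^bsub>M\<^esub> (x \<oplus>\<^bsub>M\<^esub> y) = r \<odot>\<^bsub>M\<^esub> x \<oplus>\<^bsub>M\<^esub> r \<odot>\<^bsub>M\<^esub> y"
    and act_mult: "\<lbrakk>r \<in> carrier R; r' \<in> carrier R; x \<in> carrier M\<rbrakk>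
      \<Longrightarrow> (r \<otimes>\<^bsub>R\<^esub> r') \<odot>\<^bsub>M\<^esub> x = r' \<odot>\<^bsub>M\<^esub> (r \<odot>\<^bsub>M\<^esub> x)"
    and act_one: "x \<in> carrier M \<Longrightarrow> \<one>\<^bsub>R\<^esub> \<odot>\<^bsub>M\<^esub> x = x"

definition module_homs ::
    "('r, 'z) ring_scheme \<Rightarrow> ('r, 'm) module \<Rightarrow> ('r, 'n) module \<Rightarrow> ('m \<Rightarrow> 'n) set" where
  "module_homs R M N = {f \<in> carrier M \<rightarrow> carrier N.
     (\<forall>x\<in>carrier M. \<forall>y\<in>carrier M. f (x \<oplus>\<^bsub>M\<^esub> y) = f x \<oplus>\<^bsub>N\<^esub> f y) \<and>
     (\<forall>r\<in>carrier R. \<forall>x\<in>carrier M. f (r \<odot>\<^bsub>M\<^esub> x) = r \<odot>\<^bsub>N\<^esub> f x)}"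

definition module_iso ::
    "('r, 'z) ring_scheme \<Rightarrow> ('r, 'm) module \<Rightarrow> ('r, 'n) module \<Rightarrow> bool" where
  "module_iso R M N \<longleftrightarrow> (\<exists>f \<in> module_homs R M N. bij_betw f (carrier M) (carrier N))"

definition regular :: "('r, 'z) ring_scheme \<Rightarrow> ('r, 'r) module" where
  "regular R = \<lparr>carrier = carrier R, mult = mult R, one = one R,
     zero = zero R, add = add R, smult = (\<lambda>r x. x \<otimes>\<^bsub>R\<^esub> r)\<rparr>"

definition module_sum :: "('r, 'm) module \<Rightarrow> ('r, 'n) module \<Rightarrow> ('r, 'm \<times> 'n) module" where
  "module_sum M N = \<lparr>carrier = carrier M \<times> carrier N, mult = undefined, one = undefined,
     zero = (\<zero>\<^bsub>M\<^esub>, \<zero>\<^bsub>N\<^esub>),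
     add = (\<lambda>(x, y) (x', y'). (x \<oplus>\<^bsub>M\<^esub> x', y \<oplus>\<^bsub>N\<^esub> y')),
     smult = (\<lambda>r (x, y). (r \<odot>\<^bsub>M\<^esub> x, r \<odot>\<^bsub>N\<^esub> y))\<rparr>"

definition module_power :: "('r, 'm) module \<Rightarrow> nat \<Rightarrow> ('r, nat \<Rightarrow> 'm) module" where
  "module_power M n = \<lparr>carrier = {..<n} \<rightarrow>\<^sub>E carrier M, mult = undefined, one = undefined,
     zero = (\<lambda>j\<in>{..<n}. \<zero>\<^bsub>M\<^esub>),
     add = (\<lambda>x y. \<lambda>j\<in>{..<n}. x j \<oplus>\<^bsub>M\<^esub> y j),
     smult = (\<lambda>r x. \<lambda>j\<in>{..<n}. r \<odot>\<^bsub>M\<^esub> x j)\<rparr>"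

text \<open>
  Finitely generated projective: a direct summand of a free module of finite rank. A complement
  is isomorphic to a submodule of the free module, so the type of \<open>N\<close> is no restriction.
\<close>

definition fg_projective :: "('r, 'z) ring_scheme \<Rightarrow> ('r, 'm) module \<Rightarrow> bool" where
  "fg_projective R M \<longleftrightarrow> right_module R M \<and>
     (\<exists>n. \<exists>N :: ('r, nat \<Rightarrow> 'r) module. right_module R N \<and>
        module_iso R (module_sum M N) (module_power (regular R) n))"

definition projective_cover ::
    "('r, 'z) ring_scheme \<Rightarrow> ('r, 'm) module \<Rightarrow> ('r, 'n) module \<Rightarrow> ('m \<Rightarrow> 'n) \<Rightarrow> bool" where
  "projective_cover R Q M f \<longleftrightarrow> fg_projective R Q \<and> right_module R M \<and>
     f \<in> module_homs R Q M \<and> f ` carrier Q = carrier M \<and>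
     (\<forall>L. submodule L R Q \<and> L <+>\<^bsub>Q\<^esub> a_kernel Q M f = carrier Q \<longrightarrow> L = carrier Q)"


section \<open>Complexes and the homotopy category\<close>

record ('r, 'm) cx =
  obj :: "int \<Rightarrow> ('r, 'm) module"
  diff :: "int \<Rightarrow> 'm \<Rightarrow> 'm"

definition cochain_complex :: "('r, 'z) ring_scheme \<Rightarrow> ('r, 'm) cx \<Rightarrow> bool" where
  "cochain_complex R X \<longleftrightarrow> (\<forall>i. right_module R (obj X i) \<and>
     diff X i \<in> module_homs R (obj X i) (obj X (i + 1)) \<and>
     (\<forall>x\<in>carrier (obj X i). diff X (i + 1) (diff X i x) = \<zero>\<^bsub>obj X (i + 2)\<^esub>))"

definition stalk :: "('r, 'm) module \<Rightarrow> ('r, 'm) cx" where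
  "stalk M = \<lparr>obj = (\<lambda>i. if i = 0 then M else M\<lparr>carrier := {\<zero>\<^bsub>M\<^esub>}\<rparr>),
              diff = (\<lambda>i x. \<zero>\<^bsub>M\<^esub>)\<rparr>"

definition zero_complex :: "('r, 'm) cx \<Rightarrow> bool" where
  "zero_complex X \<longleftrightarrow> (\<forall>i. carrier (obj X i) = {\<zero>\<^bsub>obj X i\<^esub>})"

definition shift :: "('r, 'm) cx \<Rightarrow> int \<Rightarrow> ('r, 'm) cx" where
  "shift X m = \<lparr>obj = (\<lambda>i. obj X (i + m)),
     diff = (\<lambda>i x. if even m then diff X (i + m) x
                   else \<ominus>\<^bsub>obj X (i + m + 1)\<^esub> diff X (i + m) x)\<rparr>"

definition shift_map :: "(int \<Rightarrow> 'm \<Rightarrow> 'n) \<Rightarrow> int \<Rightarrow> int \<Rightarrow> 'm \<Rightarrow> 'n" where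
  "shift_map f m = (\<lambda>i. f (i + m))"

definition complex_sum :: "('r, 'm) cx \<Rightarrow> ('r, 'n) cx \<Rightarrow> ('r, 'm \<times> 'n) cx" where
  "complex_sum X Y = \<lparr>obj = (\<lambda>i. module_sum (obj X i) (obj Y i)),
                      diff = (\<lambda>i. map_prod (diff X i) (diff Y i))\<rparr>"

definition complex_power :: "('r, 'm) cx \<Rightarrow> nat \<Rightarrow> ('r, nat \<Rightarrow> 'm) cx" where
  "complex_power X n = \<lparr>obj = (\<lambda>i. module_power (obj X i) n),
                        diff = (\<lambda>i x. \<lambda>j\<in>{..<n}. diff X i (x j))\<rparr>"

definition chain_maps ::
    "('r, 'z) ring_scheme \<Rightarrow> ('r, 'm) cx \<Rightarrow> ('r, 'n) cx \<Rightarrow> (int \<Rightarrow> 'm \<Rightarrow> 'n) set" where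
  "chain_maps R X Y = {f. \<forall>i. f i \<in> module_homs R (obj X i) (obj Y i) \<and>
     (\<forall>x\<in>carrier (obj X i). f (i + 1) (diff X i x) = diff Y i (f i x))}"

definition map_comp_cx :: "(int \<Rightarrow> 'n \<Rightarrow> 'p) \<Rightarrow> (int \<Rightarrow> 'm \<Rightarrow> 'n) \<Rightarrow> int \<Rightarrow> 'm \<Rightarrow> 'p"
    (infixl \<open>\<bullet>\<close> 70) where
  "g \<bullet> f = (\<lambda>i. g i \<circ> f i)"

definition id_map :: "int \<Rightarrow> 'm \<Rightarrow> 'm" where
  "id_map = (\<lambda>i x. x)"

definition zero_map :: "('r, 'n) cx \<Rightarrow> int \<Rightarrow> 'm \<Rightarrow> 'n" where
  "zero_map Y = (\<lambda>i x. \<zero>\<^bsub>obj Y i\<^esub>)"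

definition add_map ::
    "('r, 'n) cx \<Rightarrow> (int \<Rightarrow> 'm \<Rightarrow> 'n) \<Rightarrow> (int \<Rightarrow> 'm \<Rightarrow> 'n) \<Rightarrow> int \<Rightarrow> 'm \<Rightarrow> 'n" where
  "add_map Y f g = (\<lambda>i x. f i x \<oplus>\<^bsub>obj Y i\<^esub> g i x)"

definition homotopic ::
    "('r, 'z) ring_scheme \<Rightarrow> ('r, 'm) cx \<Rightarrow> ('r, 'n) cx \<Rightarrow>
     (int \<Rightarrow> 'm \<Rightarrow> 'n) \<Rightarrow> (int \<Rightarrow> 'm \<Rightarrow> 'n) \<Rightarrow> bool" where
  "homotopic R X Y f g \<longleftrightarrow> (\<exists>h. \<forall>i. h i \<in> module_homs R (obj X i) (obj Y (i - 1)) \<and>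
     (\<forall>x\<in>carrier (obj X i).
        f i x \<ominus>\<^bsub>obj Y i\<^esub> g i x = diff Y (i - 1) (h i x) \<oplus>\<^bsub>obj Y i\<^esub> h (i + 1) (diff X i x)))"

definition homotopy_equivalence ::
    "('r, 'z) ring_scheme \<Rightarrow> ('r, 'm) cx \<Rightarrow> ('r, 'n) cx \<Rightarrow> (int \<Rightarrow> 'm \<Rightarrow> 'n) \<Rightarrow> bool" where
  "homotopy_equivalence R X Y f \<longleftrightarrow> f \<in> chain_maps R X Y \<and>
     (\<exists>g \<in> chain_maps R Y X.
        homotopic R X X (g \<bullet> f) id_map \<and> homotopic R Y Y (f \<bullet> g) id_map)"

definition K_iso :: "('r, 'z) ring_scheme \<Rightarrow> ('r, 'm) cx \<Rightarrow> ('r, 'n) cx \<Rightarrow> bool" where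
  "K_iso R X Y \<longleftrightarrow> (\<exists>f. homotopy_equivalence R X Y f)"

definition homotopy_class ::
    "('r, 'z) ring_scheme \<Rightarrow> ('r, 'm) cx \<Rightarrow> ('r, 'n) cx \<Rightarrow>
     (int \<Rightarrow> 'm \<Rightarrow> 'n) \<Rightarrow> (int \<Rightarrow> 'm \<Rightarrow> 'n) set" where
  "homotopy_class R X Y f = {g \<in> chain_maps R X Y. homotopic R X Y g f}"

text \<open>
  Operations on homotopy classes are written as unions over representatives; all the classes in
  such a union coincide.
\<close>

definition K_comp ::
    "('r, 'z) ring_scheme \<Rightarrow> ('r, 'm) cx \<Rightarrow> ('r, 'p) cx \<Rightarrow>
     (int \<Rightarrow> 'n \<Rightarrow> 'p) set \<Rightarrow> (int \<Rightarrow> 'm \<Rightarrow> 'n) set \<Rightarrow> (int \<Rightarrow> 'm \<Rightarrow> 'p) set" where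
  "K_comp R X Z d c = (\<Union>g\<in>d. \<Union>f\<in>c. homotopy_class R X Z (g \<bullet> f))"

definition K_add ::
    "('r, 'z) ring_scheme \<Rightarrow> ('r, 'm) cx \<Rightarrow> ('r, 'n) cx \<Rightarrow>
     (int \<Rightarrow> 'm \<Rightarrow> 'n) set \<Rightarrow> (int \<Rightarrow> 'm \<Rightarrow> 'n) set \<Rightarrow> (int \<Rightarrow> 'm \<Rightarrow> 'n) set" where
  "K_add R X Y c d = (\<Union>f\<in>c. \<Union>g\<in>d. homotopy_class R X Y (add_map Y f g))"

definition K_end :: "('r, 'z) ring_scheme \<Rightarrow> ('r, 'm) cx \<Rightarrow> (int \<Rightarrow> 'm \<Rightarrow> 'm) set ring" where
  "K_end R X = \<lparr>carrier = homotopy_class R X X ` chain_maps R X X,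
     mult = K_comp R X X, one = homotopy_class R X X id_map,
     zero = homotopy_class R X X (zero_map X), add = K_add R X X\<rparr>"

text \<open>Morphisms \<open>X \<rightarrow> Y\<close> in the homotopy category, as a right module over the endomorphisms of \<open>X\<close>.\<close>

definition K_hom ::
    "('r, 'z) ring_scheme \<Rightarrow> ('r, 'm) cx \<Rightarrow> ('r, 'n) cx \<Rightarrow>
     ((int \<Rightarrow> 'm \<Rightarrow> 'm) set, (int \<Rightarrow> 'm \<Rightarrow> 'n) set) module" where
  "K_hom R X Y = \<lparr>carrier = homotopy_class R X Y ` chain_maps R X Y,
     mult = undefined, one = undefined,
     zero = homotopy_class R X Y (zero_map Y), add = K_add R X Y,
     smult = (\<lambda>e c. K_comp R X Y c e)\<rparr>"

definition K_hom_map ::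
    "('r, 'z) ring_scheme \<Rightarrow> ('r, 'm) cx \<Rightarrow> ('r, 'n) cx \<Rightarrow> ('r, 'p) cx \<Rightarrow>
     (int \<Rightarrow> 'n \<Rightarrow> 'p) \<Rightarrow> (int \<Rightarrow> 'm \<Rightarrow> 'n) set \<Rightarrow> (int \<Rightarrow> 'm \<Rightarrow> 'p) set" where
  "K_hom_map R X Y Z g = K_comp R X Z (homotopy_class R Y Z g)"


section \<open>Distinguished triangles\<close>

definition cone :: "('r, 'm) cx \<Rightarrow> ('r, 'n) cx \<Rightarrow> (int \<Rightarrow> 'm \<Rightarrow> 'n) \<Rightarrow> ('r, 'm \<times> 'n) cx" where
  "cone X Y f = \<lparr>obj = (\<lambda>i. module_sum (obj X (i + 1)) (obj Y i)),
     diff = (\<lambda>i (x, y). (\<ominus>\<^bsub>obj X (i + 2)\<^esub> diff X (i + 1) x,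
                         f (i + 1) x \<oplus>\<^bsub>obj Y (i + 1)\<^esub> diff Y i y))\<rparr>"

definition cone_incl :: "('r, 'm) cx \<Rightarrow> int \<Rightarrow> 'n \<Rightarrow> 'm \<times> 'n" where
  "cone_incl X = (\<lambda>i y. (\<zero>\<^bsub>obj X (i + 1)\<^esub>, y))"

definition cone_proj :: "int \<Rightarrow> 'm \<times> 'n \<Rightarrow> 'm" where
  "cone_proj = (\<lambda>i. fst)"

text \<open>
  \<open>X \<rightarrow> Y \<rightarrow> Z \<rightarrow> X[1]\<close> is distinguished if it is isomorphic in the homotopy category to the
  triangle of some mapping cone.
\<close>

definition triangle ::
    "('r, 'z) ring_scheme \<Rightarrow> ('r, 'm) cx \<Rightarrow> ('r, 'm) cx \<Rightarrow> ('r, 'm) cx \<Rightarrow>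
     (int \<Rightarrow> 'm \<Rightarrow> 'm) \<Rightarrow> (int \<Rightarrow> 'm \<Rightarrow> 'm) \<Rightarrow> (int \<Rightarrow> 'm \<Rightarrow> 'm) \<Rightarrow> bool" where
  "triangle R X Y Z u v w \<longleftrightarrow>
     cochain_complex R X \<and> cochain_complex R Y \<and> cochain_complex R Z \<and>
     u \<in> chain_maps R X Y \<and> v \<in> chain_maps R Y Z \<and> w \<in> chain_maps R Z (shift X 1) \<and>
     (\<exists>(X' :: ('r, 'm) cx) (Y' :: ('r, 'm) cx) f a b c.
        cochain_complex R X' \<and> cochain_complex R Y' \<and> f \<in> chain_maps R X' Y' \<and>
        homotopy_equivalence R X X' a \<and> homotopy_equivalence R Y Y' b \<and>
        homotopy_equivalence R Z (cone X' Y' f) c \<and>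
        homotopic R X Y' (f \<bullet> a) (b \<bullet> u) \<and>
        homotopic R Y (cone X' Y' f) (cone_incl X' \<bullet> b) (c \<bullet> v) \<and>
        homotopic R Z (shift X' 1) (cone_proj \<bullet> c) (shift_map a 1 \<bullet> w))"


section \<open>Cohomology and the derived category\<close>

definition cocycles :: "('r, 'm) cx \<Rightarrow> int \<Rightarrow> 'm set" where
  "cocycles X n = {x \<in> carrier (obj X n). diff X n x = \<zero>\<^bsub>obj X (n + 1)\<^esub>}"

definition coboundaries :: "('r, 'm) cx \<Rightarrow> int \<Rightarrow> 'm set" where
  "coboundaries X n = diff X (n - 1) ` carrier (obj X (n - 1))"

definition cohomology :: "('r, 'm) cx \<Rightarrow> int \<Rightarrow> 'm set set" where
  "cohomology X n = (\<lambda>z. coboundaries X n +>\<^bsub>obj X n\<^esub> z) ` cocycles X n"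

definition cohomology_map ::
    "('r, 'n) cx \<Rightarrow> (int \<Rightarrow> 'm \<Rightarrow> 'n) \<Rightarrow> int \<Rightarrow> 'm set \<Rightarrow> 'n set" where
  "cohomology_map Y f n c = (\<Union>z\<in>c. coboundaries Y n +>\<^bsub>obj Y n\<^esub> f n z)"

definition cohomology_degrees :: "('r, 'm) cx \<Rightarrow> int set" where
  "cohomology_degrees X = {n. cohomology X n \<noteq> {coboundaries X n}}"

definition cx_length :: "('r, 'm) cx \<Rightarrow> int" where
  "cx_length X = (if cohomology_degrees X = {} then 0
     else Max (cohomology_degrees X) - Min (cohomology_degrees X) + 1)"

definition quasi_iso ::
    "('r, 'z) ring_scheme \<Rightarrow> ('r, 'm) cx \<Rightarrow> ('r, 'n) cx \<Rightarrow> (int \<Rightarrow> 'm \<Rightarrow> 'n) \<Rightarrow> bool" where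
  "quasi_iso R X Y f \<longleftrightarrow> f \<in> chain_maps R X Y \<and>
     (\<forall>n. bij_betw (cohomology_map Y f n) (cohomology X n) (cohomology Y n))"

text \<open>
  Objects of \<open>D(R)\<close> are represented by complexes whose terms have their elements in the type
  \<open>nat \<Rightarrow> 'r\<close>. Every countably generated right \<open>R\<close>-module is isomorphic to one of this kind, so
  every object of \<open>K\<^sup>b(proj R)\<close> occurs. Auxiliary complexes (sums, powers, cones) live in other
  types and enter only up to isomorphism. Every quasi-isomorphism onto a bounded complex of
  projectives splits up to homotopy, so the morphisms of \<open>D(R)\<close> out of a perfect complex do not
  depend on the size of the modules admitted in roofs.
\<close>

type_synonym 'r ucx = "('r, nat \<Rightarrow> 'r) cx"

text \<open>A morphism \<open>X \<rightarrow> Y\<close> of \<open>D(R)\<close> is a roof \<open>X \<leftarrow> Z \<rightarrow> Y\<close>, up to the usual equivalence.\<close>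

definition is_roof ::
    "('r, 'z) ring_scheme \<Rightarrow> 'r ucx \<Rightarrow> 'r ucx \<Rightarrow> 'r ucx \<Rightarrow>
     (int \<Rightarrow> (nat \<Rightarrow> 'r) \<Rightarrow> nat \<Rightarrow> 'r) \<Rightarrow> (int \<Rightarrow> (nat \<Rightarrow> 'r) \<Rightarrow> nat \<Rightarrow> 'r) \<Rightarrow> bool" where
  "is_roof R X Y Z s f \<longleftrightarrow> cochain_complex R Z \<and> quasi_iso R Z X s \<and> f \<in> chain_maps R Z Y"

definition roof_equiv ::
    "('r, 'z) ring_scheme \<Rightarrow> 'r ucx \<Rightarrow> 'r ucx \<Rightarrow>
     'r ucx \<Rightarrow> (int \<Rightarrow> (nat \<Rightarrow> 'r) \<Rightarrow> nat \<Rightarrow> 'r) \<Rightarrow> (int \<Rightarrow> (nat \<Rightarrow> 'r) \<Rightarrow> nat \<Rightarrow> 'r) \<Rightarrow>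
     'r ucx \<Rightarrow> (int \<Rightarrow> (nat \<Rightarrow> 'r) \<Rightarrow> nat \<Rightarrow> 'r) \<Rightarrow> (int \<Rightarrow> (nat \<Rightarrow> 'r) \<Rightarrow> nat \<Rightarrow> 'r) \<Rightarrow> bool" where
  "roof_equiv R X Y Z s f Z' s' f' \<longleftrightarrow>
     (\<exists>(W :: 'r ucx) t t'. cochain_complex R W \<and>
        t \<in> chain_maps R W Z \<and> t' \<in> chain_maps R W Z' \<and> quasi_iso R W X (s \<bullet> t) \<and>
        homotopic R W X (s \<bullet> t) (s' \<bullet> t') \<and> homotopic R W Y (f \<bullet> t) (f' \<bullet> t'))"

definition D_hom_zero :: "('r, 'z) ring_scheme \<Rightarrow> 'r ucx \<Rightarrow> 'r ucx \<Rightarrow> bool" where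
  "D_hom_zero R X Y \<longleftrightarrow>
     (\<forall>Z s f. is_roof R X Y Z s f \<longrightarrow> roof_equiv R X Y Z s f X id_map (zero_map Y))"

definition D_iso :: "('r, 'z) ring_scheme \<Rightarrow> ('r, 'm) cx \<Rightarrow> ('r, 'n) cx \<Rightarrow> bool" where
  "D_iso R X Y \<longleftrightarrow>
     (\<exists>(Z :: 'r ucx) s t. cochain_complex R Z \<and> quasi_iso R Z X s \<and> quasi_iso R Z Y t)"


section \<open>Tilting complexes\<close>

definition Kb_proj :: "('r, 'z) ring_scheme \<Rightarrow> 'r ucx set" where
  "Kb_proj R = {X. cochain_complex R X \<and> (\<forall>i. fg_projective R (obj X i)) \<and>
     (\<exists>a b. \<forall>i. i < a \<or> b < i \<longrightarrow> carrier (obj X i) = {\<zero>\<^bsub>obj X i\<^esub>})}"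

definition perfect :: "('r, 'z) ring_scheme \<Rightarrow> 'r ucx \<Rightarrow> bool" where
  "perfect R X \<longleftrightarrow> cochain_complex R X \<and> (\<exists>Q \<in> Kb_proj R. D_iso R Q X)"

text \<open>The representatives in \<open>K\<^sup>b(proj R)\<close> of the objects of \<open>add T\<close>, for a perfect complex \<open>T\<close>.\<close>

definition add_closure :: "('r, 'z) ring_scheme \<Rightarrow> 'r ucx \<Rightarrow> 'r ucx set" where
  "add_closure R T = {Y \<in> Kb_proj R. \<exists>n. \<exists>Y' :: 'r ucx. cochain_complex R Y' \<and>
     D_iso R (complex_sum Y Y') (complex_power T n)}"

definition triangulated_subcategory :: "('r, 'z) ring_scheme \<Rightarrow> 'r ucx set \<Rightarrow> bool" where
  "triangulated_subcategory R C \<longleftrightarrow> C \<subseteq> Kb_proj R \<and> C \<noteq> {} \<and>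
     (\<forall>X\<in>C. \<forall>Y\<in>Kb_proj R. K_iso R X Y \<longrightarrow> Y \<in> C) \<and>
     (\<forall>X\<in>C. \<forall>m. shift X m \<in> C) \<and>
     (\<forall>X\<in>C. \<forall>Y\<in>C. \<forall>Z\<in>Kb_proj R. \<forall>u v w. triangle R X Y Z u v w \<longrightarrow> Z \<in> C)"

definition partial_tilting :: "('r, 'z) ring_scheme \<Rightarrow> 'r ucx \<Rightarrow> bool" where
  "partial_tilting R P \<longleftrightarrow> perfect R P \<and> (\<forall>n. n \<noteq> 0 \<longrightarrow> D_hom_zero R P (shift P n))"

definition tilting :: "('r, 'z) ring_scheme \<Rightarrow> 'r ucx \<Rightarrow> bool" where
  "tilting R T \<longleftrightarrow> partial_tilting R T \<and>
     (\<forall>C. triangulated_subcategory R C \<and> add_closure R T \<subseteq> C \<longrightarrow> C = Kb_proj R)"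


section \<open>The complexes \<open>\<Delta>\<^sub>n(P, M)\<close> and \<open>\<Theta>\<^sub>n(P, M)\<close>\<close>

text \<open>
  For \<open>P : P\<^sup>s\<^sup>-\<^sup>r \<rightarrow> \<dots> \<rightarrow> P\<^sup>s\<close> of length \<open>r + 1\<close>, the number \<open>s\<close> is the top degree of the
  cohomology of \<open>P\<close> (see \<open>cx_s_eq_last_degree\<close> below). Reading off \<open>r\<close> and \<open>s\<close> from the
  cohomology makes the construction insensitive to the representative of \<open>P\<close> in the homotopy
  category.
\<close>

definition cx_r :: "('r, 'm) cx \<Rightarrow> int" where
  "cx_r P = cx_length P - 1"

definition cx_s :: "('r, 'm) cx \<Rightarrow> int" where
  "cx_s P = Max (cohomology_degrees P)"

lemma cohomology_degrees_zero_term: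
  assumes X: "cochain_complex R X" and Z: "carrier (obj X n) = {\<zero>\<^bsub>obj X n\<^esub>}"
  shows "n \<notin> cohomology_degrees X"
proof -
  interpret M: right_module R "obj X n"
    using X by (simp add: cochain_complex_def)
  interpret L: right_module R "obj X (n - 1)"
    using X by (simp add: cochain_complex_def)
  interpret N: right_module R "obj X (n + 1)"
    using X by (simp add: cochain_complex_def)
  have d: "diff X (n - 1) \<in> module_homs R (obj X (n - 1)) (obj X n)"
    using X by (metis cochain_complex_def diff_add_cancel)
  have d': "diff X n \<in> module_homs R (obj X n) (obj X (n + 1))"
    using X by (simp add: cochain_complex_def)
  have B: "coboundaries X n = {\<zero>\<^bsub>obj X n\<^esub>}"
    using d Z L.M.zero_closed unfolding coboundaries_def module_homs_def Pi_def by fastforce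
  let ?y = "diff X n \<zero>\<^bsub>obj X n\<^esub>"
  have y: "?y \<in> carrier (obj X (n + 1))"
    using d' M.M.zero_closed by (auto simp: module_homs_def)
  have "diff X n (\<zero>\<^bsub>obj X n\<^esub> \<oplus>\<^bsub>obj X n\<^esub> \<zero>\<^bsub>obj X n\<^esub>) = ?y \<oplus>\<^bsub>obj X (n + 1)\<^esub> ?y"
    using d' M.M.zero_closed unfolding module_homs_def by blast
  then have "?y = \<zero>\<^bsub>obj X (n + 1)\<^esub>"
    using y N.M.add.l_cancel_one' M.M.l_zero M.M.zero_closed by metis
  then have "cocycles X n = {\<zero>\<^bsub>obj X n\<^esub>}"
    using Z by (auto simp: cocycles_def)
  then show ?thesis
    by (simp add: cohomology_degrees_def cohomology_def B a_r_coset_def r_coset_def)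
qed

lemma cx_s_eq_last_degree:
  assumes X: "cochain_complex R X"
    and supp: "\<And>i. i < s - r \<or> s < i \<Longrightarrow> carrier (obj X i) = {\<zero>\<^bsub>obj X i\<^esub>}"
    and len: "cx_length X = r + 1" and "r \<ge> 0"
  shows "cx_s X = s" and "cx_r X = r"
proof -
  let ?D = "cohomology_degrees X"
  have sub: "?D \<subseteq> {s - r..s}"
    using cohomology_degrees_zero_term[OF X] supp by force
  then have fin: "finite ?D"
    using finite_subset by blast
  have ne: "?D \<noteq> {}"
    using len \<open>r \<ge> 0\<close> by (auto simp: cx_length_def)
  then have "Max ?D - Min ?D = r"
    using len by (simp add: cx_length_def)
  moreover have "Max ?D \<le> s" "s - r \<le> Min ?D"
    using sub Max_in[OF fin ne] Min_in[OF fin ne] by auto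
  ultimately show "cx_s X = s" and "cx_r X = r"
    using len by (simp_all add: cx_s_def cx_r_def)
qed

text \<open>
  \<open>X\<close> arises from \<open>Y = \<Delta>\<^sub>n\<^sub>-\<^sub>1\<close> in step \<open>n\<close>. As \<open>P\<close> lies in \<open>K\<^sup>b(proj A)\<close>, its endomorphism rings
  in \<open>D(A)\<close> and in the homotopy category agree.
\<close>

definition Delta_step :: "('r, 'z) ring_scheme \<Rightarrow> 'r ucx \<Rightarrow> nat \<Rightarrow> 'r ucx \<Rightarrow> 'r ucx \<Rightarrow> bool" where
  "Delta_step R P n Y X \<longleftrightarrow>
     (let m = int n + cx_s P - cx_r P - 1 in
      \<exists>Pn g h w. triangle R (shift Pn m) Y X g h w \<and>
        (if carrier (K_hom R P (shift Y (- m))) = {\<zero>\<^bsub>K_hom R P (shift Y (- m))\<^esub>}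
         then zero_complex Pn
         else Pn \<in> add_closure R P \<and>
              (\<exists>g' \<in> chain_maps R Pn (shift Y (- m)).
                 projective_cover (K_end R P) (K_hom R P Pn) (K_hom R P (shift Y (- m)))
                   (K_hom_map R P Pn (shift Y (- m)) g') \<and>
                 g = shift_map g' m)))"

text \<open>
  The construction involves choices and determines its result up to isomorphism only, hence
  \<open>Delta R P M n\<close> and \<open>Theta R P M n\<close> are the sets of all complexes that it can produce.
\<close>

primrec Delta :: "('r, 'z) ring_scheme \<Rightarrow> 'r ucx \<Rightarrow> ('r, 'm) module \<Rightarrow> nat \<Rightarrow> 'r ucx set" where
  "Delta R P M 0 = {X. cochain_complex R X \<and> K_iso R X (stalk M)}"
| "Delta R P M (Suc n) = {X. \<exists>Y \<in> Delta R P M n. Delta_step R P (Suc n) Y X}"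

definition Theta :: "('r, 'z) ring_scheme \<Rightarrow> 'r ucx \<Rightarrow> ('r, 'm) module \<Rightarrow> nat \<Rightarrow> 'r ucx set" where
  "Theta R P M n = {T. cochain_complex R T \<and>
     (\<exists>X \<in> Delta R P M n. K_iso R T (complex_sum X (shift P (int n + cx_s P - cx_r P))))}"

end

theory Submission
  imports Defs "HOL-Library.Nat_Bijection"
begin

text \<open>
  The trace form of a symmetric algebra pairs the maps \<open>X \<rightarrow> Y\<close> with the maps \<open>Y \<rightarrow> X\<close>, and for \<open>X\<close> in
  \<open>K\<^sup>b(proj A)\<close> this shows that all maps \<open>Y \<rightarrow> X\<close> are null-homotopic as soon as all maps \<open>X \<rightarrow> Y\<close> are.
  Since \<open>P\<close> has length two, the maps \<open>A \<rightarrow> P[j]\<close> vanish except for two consecutive \<open>j\<close>, and by duality so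
  do the maps \<open>P[j] \<rightarrow> A\<close>. The first approximation leaves a single such \<open>j\<close>, each further one moves it by
  one, and vanishing of the maps \<open>\<Delta> \<rightarrow> \<Delta>[i]\<close> for \<open>i > 0\<close> passes to the cones of approximations; duality
  gives it for \<open>i < 0\<close>. For generation, approximations are applied to a finitely generated projective \<open>Q\<close>
  in place of \<open>A\<close>. The identity of the resulting \<open>Z\<^sub>n\<close> is a sum of maps through \<open>\<Delta>\<^sub>n\<close> and through a shift
  of \<open>P\<close>, so \<open>Z\<^sub>n\<close> lies in \<open>add \<Theta>\<^sub>n\<close>, and the triangles of the approximations lead from \<open>Z\<^sub>n\<close> back to \<open>Q\<close>.
\<close>


text \<open>Generation is the delicate point. The class \<open>C\<close> in the definition of
  \<open>tilting\<close> is closed under isomorphism, shifts and third terms of triangles, but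
  nothing is said about direct summands, so having \<open>A\<close> in \<open>C\<close> would not
  bring in the other projectives. Summands can be taken inside \<open>add T\<close> only; hence
  every finitely generated projective gets a tower of its own. Cones are not functorial, so a
  retract of one stage yields a retract of the next only modulo maps through a shift of
  \<open>P\<close>. That shift is a summand of \<open>T\<close>, which makes the error harmless.
  Length two enters through the degrees: the cone of an approximation by \<open>P[m]\<close> loses
  the degree \<open>m\<close> and may acquire \<open>m + 1\<close>. If the degrees at the start are
  \<open>s - 1\<close> and \<open>s\<close>, the acquired one was there already. In the duality
  \<open>Y\<close> is an arbitrary complex, so dimensions cannot be counted. The pairing with a
  fixed \<open>u\<close> is a functional of \<open>d v - v d\<close>; Zorn's lemma extends it to a
  full product of terms of \<open>Y\<close>, the form represents it over \<open>A\<close>, and the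
  coordinates of the representing map, with signs, are the null-homotopy of
  \<open>u\<close>.\<close>

lemmas (in abelian_group) abelian_group_simprules
  [algebra abelian_group "zero G" "add G" "a_inv G" "a_minus G"] =
  a_closed zero_closed a_inv_closed minus_closed a_assoc l_zero r_zero a_comm a_lcomm
  l_neg r_neg r_neg1 r_neg2 minus_add minus_minus minus_zero minus_eq

section \<open>Modules\<close>

lemma module_homsI:
  assumes "\<And>x. x \<in> carrier M \<Longrightarrow> f x \<in> carrier N"
    and "\<And>x y. x \<in> carrier M \<Longrightarrow> y \<in> carrier M \<Longrightarrow> f (x \<oplus>\<^bsub>M\<^esub> y) = f x \<oplus>\<^bsub>N\<^esub> f y"
    and "\<And>r x. r \<in> carrier R \<Longrightarrow> x \<in> carrier M \<Longrightarrow> f (r \<odot>\<^bsub>M\<^esub> x) = r \<odot>\<^bsub>N\<^esub> f x"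
  shows "f \<in> module_homs R M N"
  using assms by (simp add: module_homs_def Pi_def)

context right_module begin

lemma act_zero: "r \<in> carrier R \<Longrightarrow> r \<odot>\<^bsub>M\<^esub> \<zero>\<^bsub>M\<^esub> = \<zero>\<^bsub>M\<^esub>"
  using act_add[of r "\<zero>\<^bsub>M\<^esub>" "\<zero>\<^bsub>M\<^esub>"] act_closed[of r "\<zero>\<^bsub>M\<^esub>"]
  by (metis M.add.l_cancel_one' M.l_zero M.zero_closed)

lemma act_neg: "\<lbrakk>r \<in> carrier R; x \<in> carrier M\<rbrakk> \<Longrightarrow> r \<odot>\<^bsub>M\<^esub> (\<ominus>\<^bsub>M\<^esub> x) = \<ominus>\<^bsub>M\<^esub> (r \<odot>\<^bsub>M\<^esub> x)"
  by (metis M.a_inv_closed M.l_neg M.minus_equality act_add act_closed act_zero)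

lemma minus_simps:
  "\<ominus>\<^bsub>M\<^esub> \<zero>\<^bsub>M\<^esub> = \<zero>\<^bsub>M\<^esub>"
  "x \<in> carrier M \<Longrightarrow> x \<ominus>\<^bsub>M\<^esub> \<zero>\<^bsub>M\<^esub> = x" "x \<in> carrier M \<Longrightarrow> \<zero>\<^bsub>M\<^esub> \<ominus>\<^bsub>M\<^esub> x = \<ominus>\<^bsub>M\<^esub> x"
  "x \<in> carrier M \<Longrightarrow> x \<ominus>\<^bsub>M\<^esub> x = \<zero>\<^bsub>M\<^esub>"
  by (simp_all add: M.minus_eq M.r_neg)

lemmas module_simps = M.zero_closed M.a_closed M.a_inv_closed M.minus_closed act_closed M.l_zero M.r_zero
  M.minus_minus minus_simps M.r_neg M.l_neg act_zero

end

context ring begin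

text \<open>The terms of a complex form a family of modules, and interpreting the locale for each of
  them would be heavy. With the locale turned into a premise \<open>right_module R M\<close>, the
  simplifier discharges it term by term, later through \<open>cc_module\<close>.\<close>

lemmas rm_simps [simp] = right_module.module_simps[where R = R]

lemma rm_act_add:
  assumes "right_module R M" "r \<in> carrier R" "x \<in> carrier M" "y \<in> carrier M"
  shows "r \<odot>\<^bsub>M\<^esub> (x \<oplus>\<^bsub>M\<^esub> y) = r \<odot>\<^bsub>M\<^esub> x \<oplus>\<^bsub>M\<^esub> r \<odot>\<^bsub>M\<^esub> y"
  using assms by (simp add: right_module.act_add)

lemma rm_act_neg:
  assumes "right_module R M" "r \<in> carrier R" "x \<in> carrier M"
  shows "r \<odot>\<^bsub>M\<^esub> (\<ominus>\<^bsub>M\<^esub> x) = \<ominus>\<^bsub>M\<^esub> (r \<odot>\<^bsub>M\<^esub> x)"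
  using assms by (simp add: right_module.act_neg)

lemma rm_act_minus:
  assumes "right_module R M" "r \<in> carrier R" "x \<in> carrier M" "y \<in> carrier M"
  shows "r \<odot>\<^bsub>M\<^esub> (x \<ominus>\<^bsub>M\<^esub> y) = r \<odot>\<^bsub>M\<^esub> x \<ominus>\<^bsub>M\<^esub> r \<odot>\<^bsub>M\<^esub> y"
  using assms by (simp add: a_minus_def rm_act_add rm_act_neg)

lemmas rm_act = rm_act_add rm_act_neg rm_act_minus

lemma rm_swap:
  assumes M: "right_module R M" and "a \<in> carrier M" "b \<in> carrier M" "c \<in> carrier M" "d \<in> carrier M"
  shows "(a \<oplus>\<^bsub>M\<^esub> b) \<oplus>\<^bsub>M\<^esub> (c \<oplus>\<^bsub>M\<^esub> d) = (a \<oplus>\<^bsub>M\<^esub> c) \<oplus>\<^bsub>M\<^esub> (b \<oplus>\<^bsub>M\<^esub> d)"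
proof -
  interpret N: right_module R M by fact
  show "(a \<oplus>\<^bsub>M\<^esub> b) \<oplus>\<^bsub>M\<^esub> (c \<oplus>\<^bsub>M\<^esub> d) = (a \<oplus>\<^bsub>M\<^esub> c) \<oplus>\<^bsub>M\<^esub> (b \<oplus>\<^bsub>M\<^esub> d)"
    using assms by algebra
qed

lemma rm_neg_add:
  "\<lbrakk>right_module R M; a \<in> carrier M; b \<in> carrier M\<rbrakk>
    \<Longrightarrow> \<ominus>\<^bsub>M\<^esub> (a \<oplus>\<^bsub>M\<^esub> b) = \<ominus>\<^bsub>M\<^esub> a \<oplus>\<^bsub>M\<^esub> \<ominus>\<^bsub>M\<^esub> b"
  by (simp add: right_module_def abelian_group.minus_add)

lemma module_homs_closed: "\<lbrakk>f \<in> module_homs R M N; x \<in> carrier M\<rbrakk> \<Longrightarrow> f x \<in> carrier N"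
  by (auto simp: module_homs_def)

lemma module_homs_add:
  "\<lbrakk>f \<in> module_homs R M N; x \<in> carrier M; y \<in> carrier M\<rbrakk> \<Longrightarrow> f (x \<oplus>\<^bsub>M\<^esub> y) = f x \<oplus>\<^bsub>N\<^esub> f y"
  by (auto simp: module_homs_def)

lemma module_homs_act:
  "\<lbrakk>f \<in> module_homs R M N; r \<in> carrier R; x \<in> carrier M\<rbrakk> \<Longrightarrow> f (r \<odot>\<^bsub>M\<^esub> x) = r \<odot>\<^bsub>N\<^esub> f x"
  by (auto simp: module_homs_def)

lemma module_homs_zero:
  assumes "f \<in> module_homs R M N" "right_module R M" "right_module R N"
  shows "f \<zero>\<^bsub>M\<^esub> = \<zero>\<^bsub>N\<^esub>"
proof -
  interpret M: right_module R M by fact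
  interpret N: right_module R N by fact
  have "f \<zero>\<^bsub>M\<^esub> = f \<zero>\<^bsub>M\<^esub> \<oplus>\<^bsub>N\<^esub> f \<zero>\<^bsub>M\<^esub>"
    using module_homs_add[OF assms(1), of "\<zero>\<^bsub>M\<^esub>" "\<zero>\<^bsub>M\<^esub>"] by simp
  then show ?thesis
    using module_homs_closed[OF assms(1), of "\<zero>\<^bsub>M\<^esub>"] by simp
qed

lemma module_homs_neg:
  assumes "f \<in> module_homs R M N" "right_module R M" "right_module R N" "x \<in> carrier M"
  shows "f (\<ominus>\<^bsub>M\<^esub> x) = \<ominus>\<^bsub>N\<^esub> f x"
proof -
  interpret M: right_module R M by fact
  interpret N: right_module R N by fact
  have "f (\<ominus>\<^bsub>M\<^esub> x) \<oplus>\<^bsub>N\<^esub> f x = \<zero>\<^bsub>N\<^esub>"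
    using module_homs_add[OF assms(1), of "\<ominus>\<^bsub>M\<^esub> x" x] assms module_homs_zero[OF assms(1)]
    by (simp add: M.M.l_neg)
  then show ?thesis
    using module_homs_closed[OF assms(1)] assms(4) by (metis M.M.a_inv_closed N.M.minus_equality)
qed

lemma module_homs_minus:
  assumes "f \<in> module_homs R M N" "right_module R M" "right_module R N" "x \<in> carrier M" "y \<in> carrier M"
  shows "f (x \<ominus>\<^bsub>M\<^esub> y) = f x \<ominus>\<^bsub>N\<^esub> f y"
  using assms(2-) by (simp add: a_minus_def module_homs_add[OF assms(1)] module_homs_neg[OF assms(1)])

lemmas module_homs_simps = module_homs_closed module_homs_add module_homs_act module_homs_zero
  module_homs_neg module_homs_minus

lemma module_homs_comp:
  assumes "f \<in> module_homs R L M" "g \<in> module_homs R M N"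
  shows "(\<lambda>x. g (f x)) \<in> module_homs R L N"
  by (rule module_homsI)
    (simp_all add: module_homs_simps(1-3)[OF assms(1)] module_homs_simps(1-3)[OF assms(2)])

lemma module_homs_add_map:
  assumes f: "f \<in> module_homs R M N" and g: "g \<in> module_homs R M N" and N: "right_module R N"
  shows "(\<lambda>x. f x \<oplus>\<^bsub>N\<^esub> g x) \<in> module_homs R M N"
proof (rule module_homsI)
  fix x y assume xy: "x \<in> carrier M" "y \<in> carrier M"
  show "f (x \<oplus>\<^bsub>M\<^esub> y) \<oplus>\<^bsub>N\<^esub> g (x \<oplus>\<^bsub>M\<^esub> y) = (f x \<oplus>\<^bsub>N\<^esub> g x) \<oplus>\<^bsub>N\<^esub> (f y \<oplus>\<^bsub>N\<^esub> g y)"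
    unfolding module_homs_add[OF f xy] module_homs_add[OF g xy]
    by (rule rm_swap[OF N]) (use xy in \<open>simp_all add: module_homs_closed[OF f] module_homs_closed[OF g]\<close>)
qed (use N in \<open>simp_all add: module_homs_simps(1,3)[OF f] module_homs_simps(1,3)[OF g] rm_act\<close>)

lemma module_homs_neg_map:
  assumes f: "f \<in> module_homs R M N" and N: "right_module R N"
  shows "(\<lambda>x. \<ominus>\<^bsub>N\<^esub> f x) \<in> module_homs R M N"
  using N by (intro module_homsI) (simp_all add: module_homs_simps(1-3)[OF f] rm_act rm_neg_add)

lemma module_homs_zero_map: "right_module R N \<Longrightarrow> (\<lambda>x. \<zero>\<^bsub>N\<^esub>) \<in> module_homs R M N"
  by (intro module_homsI) simp_all

lemma module_homs_id: "(\<lambda>x. x) \<in> module_homs R M M"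
  by (intro module_homsI) simp_all

lemma right_moduleI:
  assumes "abelian_group M"
    and "\<And>r x. \<lbrakk>r \<in> carrier R; x \<in> carrier M\<rbrakk> \<Longrightarrow> r \<odot>\<^bsub>M\<^esub> x \<in> carrier M"
    and "\<And>r r' x. \<lbrakk>r \<in> carrier R; r' \<in> carrier R; x \<in> carrier M\<rbrakk>
      \<Longrightarrow> (r \<oplus> r') \<odot>\<^bsub>M\<^esub> x = r \<odot>\<^bsub>M\<^esub> x \<oplus>\<^bsub>M\<^esub> r' \<odot>\<^bsub>M\<^esub> x"
    and "\<And>r x y. \<lbrakk>r \<in> carrier R; x \<in> carrier M; y \<in> carrier M\<rbrakk>
      \<Longrightarrow> r \<odot>\<^bsub>M\<^esub> (x \<oplus>\<^bsub>M\<^esub> y) = r \<odot>\<^bsub>M\<^esub> x \<oplus>\<^bsub>M\<^esub> r \<odot>\<^bsub>M\<^esub> y"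
    and "\<And>r r' x. \<lbrakk>r \<in> carrier R; r' \<in> carrier R; x \<in> carrier M\<rbrakk>
      \<Longrightarrow> (r \<otimes> r') \<odot>\<^bsub>M\<^esub> x = r' \<odot>\<^bsub>M\<^esub> (r \<odot>\<^bsub>M\<^esub> x)"
    and "\<And>x. x \<in> carrier M \<Longrightarrow> \<one> \<odot>\<^bsub>M\<^esub> x = x"
  shows "right_module R M"
  by (intro right_module.intro right_module_axioms.intro ring_axioms) (fact assms)+

lemma rm_eqs:
  assumes "right_module R M"
  shows "\<lbrakk>r \<in> carrier R; r' \<in> carrier R; x \<in> carrier M\<rbrakk>
      \<Longrightarrow> (r \<oplus> r') \<odot>\<^bsub>M\<^esub> x = r \<odot>\<^bsub>M\<^esub> x \<oplus>\<^bsub>M\<^esub> r' \<odot>\<^bsub>M\<^esub> x"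
    and "\<lbrakk>r \<in> carrier R; r' \<in> carrier R; x \<in> carrier M\<rbrakk>
      \<Longrightarrow> (r \<otimes> r') \<odot>\<^bsub>M\<^esub> x = r' \<odot>\<^bsub>M\<^esub> (r \<odot>\<^bsub>M\<^esub> x)"
    and "x \<in> carrier M \<Longrightarrow> \<one> \<odot>\<^bsub>M\<^esub> x = x"
  using assms by (simp_all add: right_module.act_add_ring right_module.act_mult right_module.act_one)

lemma rm_abelian: "right_module R M \<Longrightarrow> abelian_group M"
  by (simp add: right_module_def)

lemma regular_module: "right_module R (regular R)"
proof (rule right_moduleI)
  show "abelian_group (regular R)"
    by (rule abelian_groupI) (auto simp: regular_def a_ac intro: l_neg)
qed (auto simp: regular_def l_distr r_distr m_assoc)

lemma module_sum_module:
  assumes "right_module R M" "right_module R N"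
  shows "right_module R (module_sum M N)"
proof (rule right_moduleI)
  interpret M: right_module R M by fact
  interpret N: right_module R N by fact
  show "abelian_group (module_sum M N)"
  proof (rule abelian_groupI)
    fix x assume "x \<in> carrier (module_sum M N)"
    then show "\<exists>y\<in>carrier (module_sum M N). y \<oplus>\<^bsub>module_sum M N\<^esub> x = \<zero>\<^bsub>module_sum M N\<^esub>"
      by (intro bexI[of _ "(\<ominus>\<^bsub>M\<^esub> fst x, \<ominus>\<^bsub>N\<^esub> snd x)"]) (auto simp: module_sum_def M.M.l_neg N.M.l_neg)
  qed (auto simp: module_sum_def M.M.a_ac N.M.a_ac)
qed (use assms in \<open>auto simp: module_sum_def rm_act rm_eqs\<close>)

lemma module_sum_simps [simp]:
  "carrier (module_sum M N) = carrier M \<times> carrier N"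
  "\<zero>\<^bsub>module_sum M N\<^esub> = (\<zero>\<^bsub>M\<^esub>, \<zero>\<^bsub>N\<^esub>)"
  "(x, y) \<oplus>\<^bsub>module_sum M N\<^esub> (x', y') = (x \<oplus>\<^bsub>M\<^esub> x', y \<oplus>\<^bsub>N\<^esub> y')"
  "r \<odot>\<^bsub>module_sum M N\<^esub> (x, y) = (r \<odot>\<^bsub>M\<^esub> x, r \<odot>\<^bsub>N\<^esub> y)"
  by (simp_all add: module_sum_def)

lemma module_sum_neg:
  assumes "right_module R M" "right_module R N" "x \<in> carrier M" "y \<in> carrier N"
  shows "\<ominus>\<^bsub>module_sum M N\<^esub> (x, y) = (\<ominus>\<^bsub>M\<^esub> x, \<ominus>\<^bsub>N\<^esub> y)"
proof -
  interpret S: right_module R "module_sum M N" using assms by (simp add: module_sum_module)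
  show ?thesis
    by (rule S.M.minus_equality) (use assms in simp_all)
qed

lemma module_power_module:
  assumes "right_module R M"
  shows "right_module R (module_power M n)"
proof (rule right_moduleI)
  interpret M: right_module R M by fact
  show "abelian_group (module_power M n)"
  proof (rule abelian_groupI)
    fix x assume x: "x \<in> carrier (module_power M n)"
    then show "\<exists>y\<in>carrier (module_power M n). y \<oplus>\<^bsub>module_power M n\<^esub> x = \<zero>\<^bsub>module_power M n\<^esub>"
      by (intro bexI[of _ "\<lambda>j\<in>{..<n}. \<ominus>\<^bsub>M\<^esub> x j"])
        (auto simp: module_power_def M.M.l_neg fun_eq_iff PiE_def Pi_def)
  next
    fix x assume x: "x \<in> carrier (module_power M n)"
    then show "\<zero>\<^bsub>module_power M n\<^esub> \<oplus>\<^bsub>module_power M n\<^esub> x = x"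
      by (auto simp: module_power_def fun_eq_iff PiE_def Pi_def extensional_def)
  qed (auto simp: module_power_def fun_eq_iff M.M.a_ac PiE_def Pi_def)
next
  fix x assume "x \<in> carrier (module_power M n)"
  then show "\<one> \<odot>\<^bsub>module_power M n\<^esub> x = x"
    using assms by (auto simp: module_power_def fun_eq_iff PiE_def Pi_def extensional_def rm_eqs)
qed (use assms in \<open>auto simp: module_power_def fun_eq_iff PiE_def Pi_def rm_eqs rm_act\<close>)

lemma module_power_carrier:
  "x \<in> carrier (module_power M n) \<longleftrightarrow> (\<forall>j<n. x j \<in> carrier M) \<and> x \<in> extensional {..<n}"
  by (auto simp: module_power_def PiE_def Pi_def)

lemma module_power_simps [simp]:
  "j < n \<Longrightarrow> \<zero>\<^bsub>module_power M n\<^esub> j = \<zero>\<^bsub>M\<^esub>"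
  "j < n \<Longrightarrow> (x \<oplus>\<^bsub>module_power M n\<^esub> y) j = x j \<oplus>\<^bsub>M\<^esub> y j"
  "j < n \<Longrightarrow> (r \<odot>\<^bsub>module_power M n\<^esub> x) j = r \<odot>\<^bsub>M\<^esub> x j"
  by (simp_all add: module_power_def)

lemma module_power_eqI:
  assumes "x \<in> carrier (module_power M n)" "y \<in> carrier (module_power M n)" "\<And>j. j < n \<Longrightarrow> x j = y j"
  shows "x = y"
  using assms by (auto simp: module_power_carrier intro: extensionalityI)

lemma module_power_proj: "j < n \<Longrightarrow> (\<lambda>x. x j) \<in> module_homs R (module_power M n) M"
  by (intro module_homsI) (auto simp: module_power_carrier)

lemma module_homs_power:
  assumes "right_module R N" and f: "\<And>j. j < n \<Longrightarrow> f j \<in> module_homs R M N"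
  shows "(\<lambda>x. \<lambda>j\<in>{..<n}. f j x) \<in> module_homs R M (module_power N n)"
proof (rule module_homsI)
  show "(\<lambda>j\<in>{..<n}. f j x) \<in> carrier (module_power N n)" if "x \<in> carrier M" for x
    using module_homs_closed[OF f] that by (simp add: module_power_carrier)
  show "(\<lambda>j\<in>{..<n}. f j (x \<oplus>\<^bsub>M\<^esub> y)) = (\<lambda>j\<in>{..<n}. f j x) \<oplus>\<^bsub>module_power N n\<^esub> (\<lambda>j\<in>{..<n}. f j y)"
    if "x \<in> carrier M" "y \<in> carrier M" for x y
    using module_homs_add[OF f that] by (auto simp: module_power_def fun_eq_iff)
  show "(\<lambda>j\<in>{..<n}. f j (r \<odot>\<^bsub>M\<^esub> x)) = r \<odot>\<^bsub>module_power N n\<^esub> (\<lambda>j\<in>{..<n}. f j x)"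
    if "r \<in> carrier R" "x \<in> carrier M" for r x
    using module_homs_act[OF f that] by (auto simp: module_power_def fun_eq_iff)
qed

end

section \<open>Complexes\<close>

text \<open>Degree \<open>- 1\<close> is that of homotopies. Degree \<open>0\<close> contains the
  chain maps, but also the families that ignore the differentials; on these the duality argument
  defines its functional.\<close>

definition graded_maps ::
    "('r, 'z) ring_scheme \<Rightarrow> int \<Rightarrow> ('r, 'm) cx \<Rightarrow> ('r, 'n) cx \<Rightarrow> (int \<Rightarrow> 'm \<Rightarrow> 'n) set" where
  "graded_maps R p X Y = {h. \<forall>i. h i \<in> module_homs R (obj X i) (obj Y (i + p))}"

definition homotopy_boundary ::
    "('r, 'm) cx \<Rightarrow> ('r, 'n) cx \<Rightarrow> (int \<Rightarrow> 'm \<Rightarrow> 'n) \<Rightarrow> int \<Rightarrow> 'm \<Rightarrow> 'n" where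
  "homotopy_boundary X Y h = (\<lambda>i x. diff Y (i - 1) (h i x) \<oplus>\<^bsub>obj Y i\<^esub> h (i + 1) (diff X i x))"

definition neg_map :: "('r, 'n) cx \<Rightarrow> (int \<Rightarrow> 'm \<Rightarrow> 'n) \<Rightarrow> int \<Rightarrow> 'm \<Rightarrow> 'n" where
  "neg_map Y f = (\<lambda>i x. \<ominus>\<^bsub>obj Y i\<^esub> f i x)"

text \<open>Vanishing of the morphism group in the homotopy category, without forming that group and
  for complexes whose elements may have different types.\<close>

definition hom_null :: "('r, 'z) ring_scheme \<Rightarrow> ('r, 'm) cx \<Rightarrow> ('r, 'n) cx \<Rightarrow> bool" where
  "hom_null R X Y \<longleftrightarrow> (\<forall>f\<in>chain_maps R X Y. homotopic R X Y f (zero_map Y))"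

context ring begin

lemma cc_module [simp]: "cochain_complex R X \<Longrightarrow> right_module R (obj X i)"
  by (simp add: cochain_complex_def)

lemma cc_diff_hom: "\<lbrakk>cochain_complex R X; j = i + 1\<rbrakk> \<Longrightarrow> diff X i \<in> module_homs R (obj X i) (obj X j)"
  by (simp add: cochain_complex_def)

lemma cc_abelian: "cochain_complex R X \<Longrightarrow> abelian_group (obj X i)"
  by (simp add: rm_abelian)

text \<open>The target degree is a variable \<open>j\<close> tied by an equation, so that the rules
  fire in whatever form a degree appears, \<open>i\<close> in place of \<open>i - 1 + 1\<close> for
  instance; the simplifier settles the equation.\<close>

lemma cc_simps [simp]:
  assumes X: "cochain_complex R X"
  shows "\<lbrakk>x \<in> carrier (obj X i); j = i + 1\<rbrakk> \<Longrightarrow> diff X i x \<in> carrier (obj X j)"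
    and "\<lbrakk>x \<in> carrier (obj X i); y \<in> carrier (obj X i)\<rbrakk>
      \<Longrightarrow> diff X i (x \<oplus>\<^bsub>obj X i\<^esub> y) = diff X i x \<oplus>\<^bsub>obj X (i + 1)\<^esub> diff X i y"
    and "diff X i \<zero>\<^bsub>obj X i\<^esub> = \<zero>\<^bsub>obj X (i + 1)\<^esub>"
    and "x \<in> carrier (obj X i) \<Longrightarrow> diff X i (\<ominus>\<^bsub>obj X i\<^esub> x) = \<ominus>\<^bsub>obj X (i + 1)\<^esub> diff X i x"
    and "\<lbrakk>x \<in> carrier (obj X i); y \<in> carrier (obj X i)\<rbrakk>
      \<Longrightarrow> diff X i (x \<ominus>\<^bsub>obj X i\<^esub> y) = diff X i x \<ominus>\<^bsub>obj X (i + 1)\<^esub> diff X i y"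
    and "\<lbrakk>r \<in> carrier R; x \<in> carrier (obj X i)\<rbrakk>
      \<Longrightarrow> diff X i (r \<odot>\<^bsub>obj X i\<^esub> x) = r \<odot>\<^bsub>obj X (i + 1)\<^esub> diff X i x"
    and "\<lbrakk>x \<in> carrier (obj X i); j = i + 1\<rbrakk> \<Longrightarrow> diff X j (diff X i x) = \<zero>\<^bsub>obj X (i + 2)\<^esub>"
  using X by (simp_all add: module_homs_simps[OF cc_diff_hom[OF X refl]]) (simp add: cochain_complex_def)

lemma gm_simps [simp]:
  assumes h: "h \<in> graded_maps R p X Y"
  shows "\<lbrakk>x \<in> carrier (obj X i); j = i + p\<rbrakk> \<Longrightarrow> h i x \<in> carrier (obj Y j)"
    and "\<lbrakk>x \<in> carrier (obj X i); y \<in> carrier (obj X i)\<rbrakk>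
      \<Longrightarrow> h i (x \<oplus>\<^bsub>obj X i\<^esub> y) = h i x \<oplus>\<^bsub>obj Y (i + p)\<^esub> h i y"
    and "\<lbrakk>cochain_complex R X; cochain_complex R Y\<rbrakk> \<Longrightarrow> h i \<zero>\<^bsub>obj X i\<^esub> = \<zero>\<^bsub>obj Y (i + p)\<^esub>"
    and "\<lbrakk>cochain_complex R X; cochain_complex R Y; x \<in> carrier (obj X i)\<rbrakk>
      \<Longrightarrow> h i (\<ominus>\<^bsub>obj X i\<^esub> x) = \<ominus>\<^bsub>obj Y (i + p)\<^esub> h i x"
    and "\<lbrakk>cochain_complex R X; cochain_complex R Y; x \<in> carrier (obj X i); y \<in> carrier (obj X i)\<rbrakk>
      \<Longrightarrow> h i (x \<ominus>\<^bsub>obj X i\<^esub> y) = h i x \<ominus>\<^bsub>obj Y (i + p)\<^esub> h i y"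
    and "\<lbrakk>r \<in> carrier R; x \<in> carrier (obj X i)\<rbrakk>
      \<Longrightarrow> h i (r \<odot>\<^bsub>obj X i\<^esub> x) = r \<odot>\<^bsub>obj Y (i + p)\<^esub> h i x"
  by (simp_all add: module_homs_simps[OF spec[OF CollectD[OF h[unfolded graded_maps_def]]]])

lemma chain_maps_graded: "f \<in> chain_maps R X Y \<Longrightarrow> f \<in> graded_maps R 0 X Y"
  by (simp add: graded_maps_def chain_maps_def)

lemma cm_simps [simp]:
  assumes f: "f \<in> chain_maps R X Y"
  shows "x \<in> carrier (obj X i) \<Longrightarrow> f i x \<in> carrier (obj Y i)"
    and "\<lbrakk>x \<in> carrier (obj X i); y \<in> carrier (obj X i)\<rbrakk>
      \<Longrightarrow> f i (x \<oplus>\<^bsub>obj X i\<^esub> y) = f i x \<oplus>\<^bsub>obj Y i\<^esub> f i y"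
    and "\<lbrakk>cochain_complex R X; cochain_complex R Y\<rbrakk> \<Longrightarrow> f i \<zero>\<^bsub>obj X i\<^esub> = \<zero>\<^bsub>obj Y i\<^esub>"
    and "\<lbrakk>cochain_complex R X; cochain_complex R Y; x \<in> carrier (obj X i)\<rbrakk>
      \<Longrightarrow> f i (\<ominus>\<^bsub>obj X i\<^esub> x) = \<ominus>\<^bsub>obj Y i\<^esub> f i x"
    and "\<lbrakk>cochain_complex R X; cochain_complex R Y; x \<in> carrier (obj X i); y \<in> carrier (obj X i)\<rbrakk>
      \<Longrightarrow> f i (x \<ominus>\<^bsub>obj X i\<^esub> y) = f i x \<ominus>\<^bsub>obj Y i\<^esub> f i y"
    and "\<lbrakk>r \<in> carrier R; x \<in> carrier (obj X i)\<rbrakk>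
      \<Longrightarrow> f i (r \<odot>\<^bsub>obj X i\<^esub> x) = r \<odot>\<^bsub>obj Y i\<^esub> f i x"
    and "\<lbrakk>x \<in> carrier (obj X i); j = i + 1\<rbrakk> \<Longrightarrow> f j (diff X i x) = diff Y i (f i x)"
  using gm_simps[OF chain_maps_graded[OF f]] f[unfolded chain_maps_def] by simp_all

lemma chain_mapsI:
  assumes "\<And>i. f i \<in> module_homs R (obj X i) (obj Y i)"
    and "\<And>i x. x \<in> carrier (obj X i) \<Longrightarrow> f (i + 1) (diff X i x) = diff Y i (f i x)"
  shows "f \<in> chain_maps R X Y"
  using assms unfolding chain_maps_def by blast

lemma chain_maps_hom: "f \<in> chain_maps R X Y \<Longrightarrow> f i \<in> module_homs R (obj X i) (obj Y i)"
  unfolding chain_maps_def by blast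

lemma gm_hom: "\<lbrakk>f \<in> graded_maps R p X Y; j = i + p\<rbrakk> \<Longrightarrow> f i \<in> module_homs R (obj X i) (obj Y j)"
  unfolding graded_maps_def by blast

lemma gmI: "(\<And>i. f i \<in> module_homs R (obj X i) (obj Y (i + p))) \<Longrightarrow> f \<in> graded_maps R p X Y"
  unfolding graded_maps_def by blast

lemma id_chain [simp]: "id_map \<in> chain_maps R X X"
  by (intro chain_mapsI) (simp_all add: id_map_def module_homs_id)

lemma zero_chain [simp]: "cochain_complex R Y \<Longrightarrow> zero_map Y \<in> chain_maps R X Y"
  by (intro chain_mapsI) (simp_all add: zero_map_def module_homs_zero_map)

lemma map_simps [simp]:
  "(v \<bullet> u) i z = v i (u i z)" "id_map i y = y" "zero_map Y i x = \<zero>\<^bsub>obj Y i\<^esub>"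
  "add_map Y f g i x = f i x \<oplus>\<^bsub>obj Y i\<^esub> g i x" "neg_map Y f i x = \<ominus>\<^bsub>obj Y i\<^esub> f i x"
  by (simp_all add: map_comp_cx_def id_map_def zero_map_def add_map_def neg_map_def)

lemma comp_chain [simp]:
  assumes "f \<in> chain_maps R X Y" "g \<in> chain_maps R Y Z"
  shows "g \<bullet> f \<in> chain_maps R X Z"
proof (rule chain_mapsI)
  show "(g \<bullet> f) i \<in> module_homs R (obj X i) (obj Z i)" for i
    using module_homs_comp[OF chain_maps_hom[OF assms(1)] chain_maps_hom[OF assms(2)]]
    by (simp add: map_comp_cx_def comp_def)
qed (use assms in simp)

lemma add_chain [simp]:
  assumes "cochain_complex R Y" "f \<in> chain_maps R X Y" "g \<in> chain_maps R X Y"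
  shows "add_map Y f g \<in> chain_maps R X Y"
proof (rule chain_mapsI)
  show "add_map Y f g i \<in> module_homs R (obj X i) (obj Y i)" for i
    unfolding add_map_def by (rule module_homs_add_map) (use assms in \<open>simp_all add: chain_maps_hom\<close>)
qed (use assms in simp)

lemma neg_chain [simp]:
  assumes "cochain_complex R Y" "f \<in> chain_maps R X Y"
  shows "neg_map Y f \<in> chain_maps R X Y"
proof (rule chain_mapsI)
  show "neg_map Y f i \<in> module_homs R (obj X i) (obj Y i)" for i
    unfolding neg_map_def by (rule module_homs_neg_map) (use assms in \<open>simp_all add: chain_maps_hom\<close>)
qed (use assms in simp)

lemma comp_gm:
  "\<lbrakk>f \<in> graded_maps R p X Y; g \<in> chain_maps R Y Z\<rbrakk> \<Longrightarrow> (\<lambda>i x. g (i + p) (f i x)) \<in> graded_maps R p X Z"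
  "\<lbrakk>f \<in> chain_maps R X Y; h \<in> graded_maps R p Y Z\<rbrakk> \<Longrightarrow> (\<lambda>i x. h i (f i x)) \<in> graded_maps R p X Z"
  by (rule gmI, rule module_homs_comp, rule gm_hom, assumption, rule refl, rule chain_maps_hom, assumption)
    (rule gmI, rule module_homs_comp, rule chain_maps_hom, assumption, rule gm_hom, assumption, rule refl)

lemma add_gm:
  "\<lbrakk>cochain_complex R Y; f \<in> graded_maps R p X Y; g \<in> graded_maps R p X Y\<rbrakk>
    \<Longrightarrow> (\<lambda>i x. f i x \<oplus>\<^bsub>obj Y (i + p)\<^esub> g i x) \<in> graded_maps R p X Y"
  by (intro gmI module_homs_add_map) (auto intro: gm_hom)

lemma neg_gm:
  "\<lbrakk>cochain_complex R Y; f \<in> graded_maps R p X Y\<rbrakk>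
    \<Longrightarrow> (\<lambda>i x. \<ominus>\<^bsub>obj Y (i + p)\<^esub> f i x) \<in> graded_maps R p X Y"
  by (intro gmI module_homs_neg_map) (auto intro: gm_hom)

lemma zero_gm:
  "cochain_complex R Y \<Longrightarrow> (\<lambda>i x. \<zero>\<^bsub>obj Y (i + p)\<^esub>) \<in> graded_maps R p X Y"
  by (intro gmI module_homs_zero_map) auto


section \<open>Homotopies\<close>

lemma homotopic_def': "homotopic R X Y f g \<longleftrightarrow> (\<exists>h\<in>graded_maps R (-1) X Y.
    \<forall>i. \<forall>x\<in>carrier (obj X i). f i x \<ominus>\<^bsub>obj Y i\<^esub> g i x = homotopy_boundary X Y h i x)"
  by (auto simp: homotopic_def graded_maps_def homotopy_boundary_def)

lemma homotopy_boundary_closed: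
  assumes "cochain_complex R X" "cochain_complex R Y" "h \<in> graded_maps R (-1) X Y" "x \<in> carrier (obj X i)"
  shows "homotopy_boundary X Y h i x \<in> carrier (obj Y i)"
  using assms by (simp add: homotopy_boundary_def)

text \<open>Solved for \<open>f i x\<close>, the condition can serve as a rewrite rule when
  homotopies are added and composed.\<close>

lemma homotopic_iff:
  assumes "cochain_complex R X" "cochain_complex R Y" "f \<in> chain_maps R X Y" "g \<in> chain_maps R X Y"
  shows "homotopic R X Y f g \<longleftrightarrow> (\<exists>h\<in>graded_maps R (-1) X Y.
    \<forall>i. \<forall>x\<in>carrier (obj X i). f i x = g i x \<oplus>\<^bsub>obj Y i\<^esub> homotopy_boundary X Y h i x)"
proof -
  interpret Y: abelian_group "obj Y i" for i using assms by (simp add: cc_abelian)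
  have "f i x \<ominus>\<^bsub>obj Y i\<^esub> g i x = homotopy_boundary X Y h i x \<longleftrightarrow>
      f i x = g i x \<oplus>\<^bsub>obj Y i\<^esub> homotopy_boundary X Y h i x"
    if "h \<in> graded_maps R (-1) X Y" "x \<in> carrier (obj X i)" for h i x
  proof -
    have "f i x \<in> carrier (obj Y i)" "g i x \<in> carrier (obj Y i)"
      "homotopy_boundary X Y h i x \<in> carrier (obj Y i)"
      using assms that homotopy_boundary_closed by auto
    then show ?thesis
      using Y.minus_eq Y.a_comm Y.r_neg1 Y.r_neg2 Y.a_inv_closed by metis
  qed
  then show ?thesis
    unfolding homotopic_def' by (meson)
qed

lemma homotopicI:
  assumes "cochain_complex R X" "cochain_complex R Y" "f \<in> chain_maps R X Y" "g \<in> chain_maps R X Y"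
    and "h \<in> graded_maps R (-1) X Y"
    and "\<And>i x. x \<in> carrier (obj X i) \<Longrightarrow>
      f i x = g i x \<oplus>\<^bsub>obj Y i\<^esub> (diff Y (i - 1) (h i x) \<oplus>\<^bsub>obj Y i\<^esub> h (i + 1) (diff X i x))"
  shows "homotopic R X Y f g"
  unfolding homotopic_iff[OF assms(1-4)] by (rule bexI[OF _ assms(5)]) (simp add: assms homotopy_boundary_def)

lemma homotopicE:
  assumes "homotopic R X Y f g"
    and "cochain_complex R X" "cochain_complex R Y" "f \<in> chain_maps R X Y" "g \<in> chain_maps R X Y"
  obtains h where "h \<in> graded_maps R (-1) X Y"
    and "\<And>i x. x \<in> carrier (obj X i) \<Longrightarrow>
      f i x = g i x \<oplus>\<^bsub>obj Y i\<^esub> (diff Y (i - 1) (h i x) \<oplus>\<^bsub>obj Y i\<^esub> h (i + 1) (diff X i x))"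
  using assms(1) unfolding homotopic_iff[OF assms(2-)] homotopy_boundary_def by blast

lemma null_homotopicI:
  assumes "cochain_complex R X" "cochain_complex R Y" "f \<in> chain_maps R X Y"
    and "h \<in> graded_maps R (-1) X Y"
    and "\<And>i x. x \<in> carrier (obj X i) \<Longrightarrow>
      f i x = diff Y (i - 1) (h i x) \<oplus>\<^bsub>obj Y i\<^esub> h (i + 1) (diff X i x)"
  shows "homotopic R X Y f (zero_map Y)"
  by (rule homotopicI[OF assms(1-3) _ assms(4)]) (use assms in simp_all)

lemma null_homotopicE:
  assumes "homotopic R X Y f (zero_map Y)"
    and "cochain_complex R X" "cochain_complex R Y" "f \<in> chain_maps R X Y"
  obtains h where "h \<in> graded_maps R (-1) X Y"
    and "\<And>i x. x \<in> carrier (obj X i) \<Longrightarrow>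
      f i x = diff Y (i - 1) (h i x) \<oplus>\<^bsub>obj Y i\<^esub> h (i + 1) (diff X i x)"
proof (rule homotopicE[OF assms zero_chain[OF assms(3)]])
  fix h assume h: "h \<in> graded_maps R (-1) X Y"
    and e: "\<And>i x. x \<in> carrier (obj X i) \<Longrightarrow> f i x = zero_map Y i x
      \<oplus>\<^bsub>obj Y i\<^esub> (diff Y (i - 1) (h i x) \<oplus>\<^bsub>obj Y i\<^esub> h (i + 1) (diff X i x))"
  show thesis
    by (rule that[OF h]) (use e h assms in simp)
qed

lemma homotopic_eqI:
  assumes "cochain_complex R X" "cochain_complex R Y" "f \<in> chain_maps R X Y"
    and "\<And>i x. x \<in> carrier (obj X i) \<Longrightarrow> f i x = g i x"
  shows "homotopic R X Y f g"
  unfolding homotopic_def' 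
  by (rule bexI[OF _ zero_gm[OF assms(2)]]) (use assms(1-3) in \<open>simp add: homotopy_boundary_def flip: assms(4)\<close>)

lemma homotopic_refl:
  "\<lbrakk>cochain_complex R X; cochain_complex R Y; f \<in> chain_maps R X Y\<rbrakk> \<Longrightarrow> homotopic R X Y f f"
  by (rule homotopic_eqI) auto

lemma homotopic_sym:
  assumes "homotopic R X Y f g"
    and X: "cochain_complex R X" and Y: "cochain_complex R Y"
    and f: "f \<in> chain_maps R X Y" and g: "g \<in> chain_maps R X Y"
  shows "homotopic R X Y g f"
proof -
  interpret Y: abelian_group "obj Y i" for i using Y by (rule cc_abelian)
  obtain h where h: "h \<in> graded_maps R (-1) X Y"
    and e: "\<And>i x. x \<in> carrier (obj X i) \<Longrightarrow>
      f i x = g i x \<oplus>\<^bsub>obj Y i\<^esub> (diff Y (i - 1) (h i x) \<oplus>\<^bsub>obj Y i\<^esub> h (i + 1) (diff X i x))"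
    using homotopicE[OF assms] by blast
  show ?thesis
  proof (rule homotopicI[OF X Y g f neg_gm[OF Y h]])
    fix i x assume x: "x \<in> carrier (obj X i)"
    have "diff Y (i - 1) (h i x) \<in> carrier (obj Y i)" "h (i + 1) (diff X i x) \<in> carrier (obj Y i)"
      "g i x \<in> carrier (obj Y i)"
      using h g x X Y by simp_all
    note c = this
    show "g i x = f i x \<oplus>\<^bsub>obj Y i\<^esub> (diff Y (i - 1) (\<ominus>\<^bsub>obj Y (i + - 1)\<^esub> h i x)
        \<oplus>\<^bsub>obj Y i\<^esub> (\<ominus>\<^bsub>obj Y (i + 1 + - 1)\<^esub> h (i + 1) (diff X i x)))"
      using h x X Y by (simp add: e) (insert c, algebra)
  qed
qed

lemma homotopic_add:
  assumes "homotopic R X Y f g" "homotopic R X Y f' g'"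
    and X: "cochain_complex R X" and Y: "cochain_complex R Y"
    and f: "f \<in> chain_maps R X Y" and g: "g \<in> chain_maps R X Y"
    and f': "f' \<in> chain_maps R X Y" and g': "g' \<in> chain_maps R X Y"
  shows "homotopic R X Y (add_map Y f f') (add_map Y g g')"
proof -
  interpret Y: abelian_group "obj Y i" for i using Y by (rule cc_abelian)
  obtain h where h: "h \<in> graded_maps R (-1) X Y"
    and e: "\<And>i x. x \<in> carrier (obj X i) \<Longrightarrow>
      f i x = g i x \<oplus>\<^bsub>obj Y i\<^esub> (diff Y (i - 1) (h i x) \<oplus>\<^bsub>obj Y i\<^esub> h (i + 1) (diff X i x))"
    using homotopicE[OF assms(1) X Y f g] by blast
  obtain h' where h': "h' \<in> graded_maps R (-1) X Y"
    and e': "\<And>i x. x \<in> carrier (obj X i) \<Longrightarrow>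
      f' i x = g' i x \<oplus>\<^bsub>obj Y i\<^esub> (diff Y (i - 1) (h' i x) \<oplus>\<^bsub>obj Y i\<^esub> h' (i + 1) (diff X i x))"
    using homotopicE[OF assms(2) X Y f' g'] by blast
  show ?thesis
  proof (rule homotopicI[OF X Y _ _ add_gm[OF Y h h']])
    fix i x assume x: "x \<in> carrier (obj X i)"
    have "diff Y (i - 1) (h i x) \<in> carrier (obj Y i)" "h (i + 1) (diff X i x) \<in> carrier (obj Y i)"
      "g i x \<in> carrier (obj Y i)" "g' i x \<in> carrier (obj Y i)"
      "diff Y (i - 1) (h' i x) \<in> carrier (obj Y i)" "h' (i + 1) (diff X i x) \<in> carrier (obj Y i)"
      using h g h' g' x X Y by simp_all
    note c = this
    show "add_map Y f f' i x = add_map Y g g' i x \<oplus>\<^bsub>obj Y i\<^esub>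
       (diff Y (i - 1) (h i x \<oplus>\<^bsub>obj Y (i + - 1)\<^esub> h' i x) \<oplus>\<^bsub>obj Y i\<^esub>
        (h (i + 1) (diff X i x) \<oplus>\<^bsub>obj Y (i + 1 + - 1)\<^esub> h' (i + 1) (diff X i x)))"
      using h h' x X Y by (simp add: e e') (insert c, algebra)
  qed (use f g f' g' Y in simp_all)
qed

lemma homotopic_trans:
  assumes "homotopic R X Y f g" "homotopic R X Y g k"
    and X: "cochain_complex R X" and Y: "cochain_complex R Y"
    and f: "f \<in> chain_maps R X Y" and g: "g \<in> chain_maps R X Y" and k: "k \<in> chain_maps R X Y"
  shows "homotopic R X Y f k"
proof -
  interpret Y: abelian_group "obj Y i" for i using Y by (rule cc_abelian)
  obtain h where h: "h \<in> graded_maps R (-1) X Y"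
    and e: "\<And>i x. x \<in> carrier (obj X i) \<Longrightarrow>
      f i x = g i x \<oplus>\<^bsub>obj Y i\<^esub> (diff Y (i - 1) (h i x) \<oplus>\<^bsub>obj Y i\<^esub> h (i + 1) (diff X i x))"
    using homotopicE[OF assms(1) X Y f g] by blast
  obtain h' where h': "h' \<in> graded_maps R (-1) X Y"
    and e': "\<And>i x. x \<in> carrier (obj X i) \<Longrightarrow>
      g i x = k i x \<oplus>\<^bsub>obj Y i\<^esub> (diff Y (i - 1) (h' i x) \<oplus>\<^bsub>obj Y i\<^esub> h' (i + 1) (diff X i x))"
    using homotopicE[OF assms(2) X Y g k] by blast
  show ?thesis
  proof (rule homotopicI[OF X Y f k add_gm[OF Y h h']])
    fix i x assume x: "x \<in> carrier (obj X i)"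
    have "diff Y (i - 1) (h i x) \<in> carrier (obj Y i)" "h (i + 1) (diff X i x) \<in> carrier (obj Y i)"
      "k i x \<in> carrier (obj Y i)"
      "diff Y (i - 1) (h' i x) \<in> carrier (obj Y i)" "h' (i + 1) (diff X i x) \<in> carrier (obj Y i)"
      using h h' k x X Y by simp_all
    note c = this
    show "f i x = k i x \<oplus>\<^bsub>obj Y i\<^esub>
       (diff Y (i - 1) (h i x \<oplus>\<^bsub>obj Y (i + - 1)\<^esub> h' i x) \<oplus>\<^bsub>obj Y i\<^esub>
        (h (i + 1) (diff X i x) \<oplus>\<^bsub>obj Y (i + 1 + - 1)\<^esub> h' (i + 1) (diff X i x)))"
      using h h' x X Y by (simp add: e e') (insert c, algebra)
  qed
qed

lemma homotopic_comp_left: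
  assumes "homotopic R X Y f g" "u \<in> chain_maps R Y Z"
    and X: "cochain_complex R X" and Y: "cochain_complex R Y" and Z: "cochain_complex R Z"
    and f: "f \<in> chain_maps R X Y" and g: "g \<in> chain_maps R X Y"
  shows "homotopic R X Z (u \<bullet> f) (u \<bullet> g)"
proof -
  obtain h where h: "h \<in> graded_maps R (-1) X Y"
    and e: "\<And>i x. x \<in> carrier (obj X i) \<Longrightarrow>
      f i x = g i x \<oplus>\<^bsub>obj Y i\<^esub> (diff Y (i - 1) (h i x) \<oplus>\<^bsub>obj Y i\<^esub> h (i + 1) (diff X i x))"
    using homotopicE[OF assms(1) X Y f g] by blast
  show ?thesis
    by (rule homotopicI[OF X Z _ _ comp_gm(1)[OF h assms(2)]])
      (use h X Y Z f g assms(2) in \<open>simp_all add: e\<close>)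
qed

lemma homotopic_comp_right:
  assumes "homotopic R Y Z f g" "u \<in> chain_maps R X Y"
    and X: "cochain_complex R X" and Y: "cochain_complex R Y" and Z: "cochain_complex R Z"
    and f: "f \<in> chain_maps R Y Z" and g: "g \<in> chain_maps R Y Z"
  shows "homotopic R X Z (f \<bullet> u) (g \<bullet> u)"
proof -
  obtain h where h: "h \<in> graded_maps R (-1) Y Z"
    and e: "\<And>i x. x \<in> carrier (obj Y i) \<Longrightarrow>
      f i x = g i x \<oplus>\<^bsub>obj Z i\<^esub> (diff Z (i - 1) (h i x) \<oplus>\<^bsub>obj Z i\<^esub> h (i + 1) (diff Y i x))"
    using homotopicE[OF assms(1) Y Z f g] by blast
  show ?thesis
    by (rule homotopicI[OF X Z _ _ comp_gm(2)[OF assms(2) h]])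
      (use h X Y Z f g assms(2) in \<open>simp_all add: e\<close>)
qed

end

text \<open>Homotopy bundled with all well-formedness conditions. The relation is then transitive
  and a congruence for composition with few side conditions, which permits calculational chains in
  the homotopy category.\<close>

definition K_eq ::
    "('r, 'z) ring_scheme \<Rightarrow> ('r, 'm) cx \<Rightarrow> ('r, 'n) cx \<Rightarrow>
     (int \<Rightarrow> 'm \<Rightarrow> 'n) \<Rightarrow> (int \<Rightarrow> 'm \<Rightarrow> 'n) \<Rightarrow> bool" where
  "K_eq R X Y f g \<longleftrightarrow> cochain_complex R X \<and> cochain_complex R Y \<and>
     f \<in> chain_maps R X Y \<and> g \<in> chain_maps R X Y \<and> homotopic R X Y f g"

text \<open>With the inverse as an argument, equivalences can be composed, shifted and added
  explicitly; \<open>homotopy_equivalence\<close> hides it behind a quantifier.\<close>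

definition K_inverse ::
    "('r, 'z) ring_scheme \<Rightarrow> ('r, 'm) cx \<Rightarrow> ('r, 'n) cx \<Rightarrow>
     (int \<Rightarrow> 'm \<Rightarrow> 'n) \<Rightarrow> (int \<Rightarrow> 'n \<Rightarrow> 'm) \<Rightarrow> bool" where
  "K_inverse R X Y f g \<longleftrightarrow> f \<in> chain_maps R X Y \<and> g \<in> chain_maps R Y X \<and>
     K_eq R X X (g \<bullet> f) id_map \<and> K_eq R Y Y (f \<bullet> g) id_map"

text \<open>The ideal of maps that factor through finite direct sums of copies of \<open>T\<close>,
  built summand by summand, so that no direct sum with elements of a new type has to be formed.
  \<open>K_factors R T Y Y id_map\<close> thus expresses that \<open>Y\<close> is, up to homotopy, a
  direct summand of such a sum.\<close>

inductive K_factors ::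
    "('r, 'z) ring_scheme \<Rightarrow> ('r, 't) cx \<Rightarrow> ('r, 'm) cx \<Rightarrow> ('r, 'n) cx \<Rightarrow> (int \<Rightarrow> 'm \<Rightarrow> 'n) \<Rightarrow> bool"
  for R T X Y where
  K_factors_zero: "\<lbrakk>cochain_complex R X; cochain_complex R Y\<rbrakk> \<Longrightarrow> K_factors R T X Y (zero_map Y)"
| K_factors_add: "\<lbrakk>K_factors R T X Y f; a \<in> chain_maps R X T; b \<in> chain_maps R T Y\<rbrakk>
    \<Longrightarrow> K_factors R T X Y (add_map Y f (b \<bullet> a))"
| K_factors_cong: "\<lbrakk>K_factors R T X Y f; K_eq R X Y f g\<rbrakk> \<Longrightarrow> K_factors R T X Y g"

text \<open>Unlike the generated rule, this one is free of eta-expanded arguments.\<close>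

lemma K_factors_induct [consumes 1, case_names K_factors_zero K_factors_add K_factors_cong]:
  assumes "K_factors R T X Y f"
    and "\<lbrakk>cochain_complex R X; cochain_complex R Y\<rbrakk> \<Longrightarrow> P (zero_map Y)"
    and "\<And>f a b. \<lbrakk>K_factors R T X Y f; P f; a \<in> chain_maps R X T; b \<in> chain_maps R T Y\<rbrakk>
      \<Longrightarrow> P (add_map Y f (b \<bullet> a))"
    and "\<And>f g. \<lbrakk>K_factors R T X Y f; P f; K_eq R X Y f g\<rbrakk> \<Longrightarrow> P g"
  shows "P f"
  using assms(1) by (rule K_factors.induct) (fact assms(2-4))+

context ring begin

lemma K_eqI:
  "\<lbrakk>homotopic R X Y f g; cochain_complex R X; cochain_complex R Y; f \<in> chain_maps R X Y; g \<in> chain_maps R X Y\<rbrakk>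
    \<Longrightarrow> K_eq R X Y f g"
  by (simp add: K_eq_def)

lemma K_eqD:
  assumes "K_eq R X Y f g"
  shows "homotopic R X Y f g" "cochain_complex R X" "cochain_complex R Y"
    "f \<in> chain_maps R X Y" "g \<in> chain_maps R X Y"
  using assms by (simp_all add: K_eq_def)

lemma K_eq_refl:
  "\<lbrakk>cochain_complex R X; cochain_complex R Y; f \<in> chain_maps R X Y\<rbrakk> \<Longrightarrow> K_eq R X Y f f"
  by (simp add: K_eq_def homotopic_refl)

lemma K_eq_sym: "K_eq R X Y f g \<Longrightarrow> K_eq R X Y g f"
  by (simp add: K_eq_def homotopic_sym)

lemma K_eq_trans [trans]: "\<lbrakk>K_eq R X Y f g; K_eq R X Y g k\<rbrakk> \<Longrightarrow> K_eq R X Y f k"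
  unfolding K_eq_def using homotopic_trans by blast

lemma K_eq_eqI:
  assumes "cochain_complex R X" "cochain_complex R Y" "f \<in> chain_maps R X Y" "g \<in> chain_maps R X Y"
    and "\<And>i x. x \<in> carrier (obj X i) \<Longrightarrow> f i x = g i x"
  shows "K_eq R X Y f g"
  using assms by (simp add: K_eq_def homotopic_eqI)

lemma K_eq_comp:
  assumes "K_eq R X Y f g" "K_eq R Y Z u v"
  shows "K_eq R X Z (u \<bullet> f) (v \<bullet> g)"
proof -
  note a = K_eqD[OF assms(1)] and b = K_eqD[OF assms(2)]
  have "homotopic R X Z (u \<bullet> f) (u \<bullet> g)"
    by (rule homotopic_comp_left) (use a b in simp_all)
  moreover have "homotopic R X Z (u \<bullet> g) (v \<bullet> g)"
    by (rule homotopic_comp_right) (use a b in simp_all)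
  ultimately show ?thesis
    using a b homotopic_trans[of X Z "u \<bullet> f" "u \<bullet> g" "v \<bullet> g"] by (simp add: K_eq_def)
qed

lemma K_eq_comp_left: "\<lbrakk>K_eq R X Y f g; u \<in> chain_maps R Y Z; cochain_complex R Z\<rbrakk>
    \<Longrightarrow> K_eq R X Z (u \<bullet> f) (u \<bullet> g)"
  by (rule K_eq_comp) (auto intro: K_eq_refl dest: K_eqD)

lemma K_eq_comp_right: "\<lbrakk>K_eq R Y Z f g; u \<in> chain_maps R X Y; cochain_complex R X\<rbrakk>
    \<Longrightarrow> K_eq R X Z (f \<bullet> u) (g \<bullet> u)"
  by (rule K_eq_comp) (auto intro: K_eq_refl dest: K_eqD)

lemma K_eq_add:
  assumes "K_eq R X Y f g" "K_eq R X Y f' g'"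
  shows "K_eq R X Y (add_map Y f f') (add_map Y g g')"
  using K_eqD[OF assms(1)] K_eqD[OF assms(2)] by (simp add: K_eq_def homotopic_add)

lemma K_eq_comp_zero:
  assumes "K_eq R X Y f (zero_map Y)" "u \<in> chain_maps R Y Z" "cochain_complex R Z"
  shows "K_eq R X Z (u \<bullet> f) (zero_map Z)"
proof -
  note a = K_eqD[OF assms(1)]
  have "K_eq R X Z (u \<bullet> f) (u \<bullet> zero_map Y)"
    by (rule K_eq_comp_left) (use assms in simp_all)
  also have "K_eq R X Z (u \<bullet> zero_map Y) (zero_map Z)"
    by (rule K_eq_eqI) (use a assms(2,3) comp_chain[OF zero_chain assms(2)] in simp_all)
  finally show ?thesis .
qed

lemma K_eq_zero_comp:
  assumes "K_eq R Y Z f (zero_map Z)" "u \<in> chain_maps R X Y" "cochain_complex R X"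
  shows "K_eq R X Z (f \<bullet> u) (zero_map Z)"
proof -
  note a = K_eqD[OF assms(1)]
  have "K_eq R X Z (f \<bullet> u) (zero_map Z \<bullet> u)"
    by (rule K_eq_comp_right) (use assms in simp_all)
  also have "K_eq R X Z (zero_map Z \<bullet> u) (zero_map Z)"
    by (rule K_eq_eqI) (use a assms(2,3) comp_chain[OF assms(2) zero_chain] in simp_all)
  finally show ?thesis .
qed

lemma K_eq_diff_zero:
  assumes "K_eq R X Y (add_map Y f (neg_map Y g)) (zero_map Y)" "f \<in> chain_maps R X Y" "g \<in> chain_maps R X Y"
  shows "K_eq R X Y f g"
proof -
  note a = K_eqD[OF assms(1)]
  interpret Y: abelian_group "obj Y i" for i using a(3) by (rule cc_abelian)
  have *: "K_eq R X Y (add_map Y (add_map Y f (neg_map Y g)) g) (add_map Y (zero_map Y) g)"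
    by (rule K_eq_add[OF assms(1) K_eq_refl]) (use a assms in simp_all)
  have "K_eq R X Y f (add_map Y (add_map Y f (neg_map Y g)) g)"
  proof (rule K_eq_eqI)
    fix i x assume "x \<in> carrier (obj X i)"
    then have "f i x \<in> carrier (obj Y i)" "g i x \<in> carrier (obj Y i)" using assms by simp_all
    then show "f i x = add_map Y (add_map Y f (neg_map Y g)) g i x" by simp algebra
  qed (use a assms in simp_all)
  also note *
  also have "K_eq R X Y (add_map Y (zero_map Y) g) g"
    by (rule K_eq_eqI) (use a assms in simp_all)
  finally show ?thesis .
qed

lemma K_eq_diff_zeroD:
  assumes "K_eq R X Y f g"
  shows "K_eq R X Y (add_map Y f (neg_map Y g)) (zero_map Y)"
proof -
  note a = K_eqD[OF assms(1)]
  interpret Y: abelian_group "obj Y i" for i using a(3) by (rule cc_abelian)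
  have "K_eq R X Y (add_map Y f (neg_map Y g)) (add_map Y g (neg_map Y g))"
    by (rule K_eq_add[OF assms K_eq_refl]) (use a in simp_all)
  also have "K_eq R X Y (add_map Y g (neg_map Y g)) (zero_map Y)"
    by (rule K_eq_eqI) (use a in simp_all)
  finally show ?thesis .
qed

lemma comp_assoc: "(h \<bullet> g) \<bullet> f = h \<bullet> (g \<bullet> f)"
  by (simp add: map_comp_cx_def o_assoc)

lemma comp_id [simp]: "id_map \<bullet> f = f" "g \<bullet> id_map = g"
  by (simp_all add: map_comp_cx_def id_map_def fun_eq_iff)

lemma hom_nullD: "\<lbrakk>hom_null R X Y; f \<in> chain_maps R X Y; cochain_complex R X; cochain_complex R Y\<rbrakk>
    \<Longrightarrow> K_eq R X Y f (zero_map Y)"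
  by (simp add: hom_null_def K_eq_def)

lemma hom_nullI: "(\<And>f. f \<in> chain_maps R X Y \<Longrightarrow> K_eq R X Y f (zero_map Y)) \<Longrightarrow> hom_null R X Y"
  by (simp add: hom_null_def K_eq_def)

section \<open>Homotopy equivalences\<close>

lemma K_inverse_sym: "K_inverse R X Y f g \<Longrightarrow> K_inverse R Y X g f"
  by (simp add: K_inverse_def)

lemma K_inverseD:
  assumes "K_inverse R X Y f g"
  shows "f \<in> chain_maps R X Y" "g \<in> chain_maps R Y X" "K_eq R X X (g \<bullet> f) id_map"
    "K_eq R Y Y (f \<bullet> g) id_map" "cochain_complex R X" "cochain_complex R Y"
  using assms by (auto simp: K_inverse_def K_eq_def)

lemma K_inverse_refl: "cochain_complex R X \<Longrightarrow> K_inverse R X X id_map id_map"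
  by (simp add: K_inverse_def K_eq_refl)

lemma K_inverse_trans:
  assumes "K_inverse R X Y f g" "K_inverse R Y Z f' g'"
  shows "K_inverse R X Z (f' \<bullet> f) (g \<bullet> g')"
proof -
  note a = K_inverseD[OF assms(1)] and b = K_inverseD[OF assms(2)]
  have 1: "K_eq R X X (g \<bullet> ((g' \<bullet> f') \<bullet> f)) (g \<bullet> (id_map \<bullet> f))"
    by (rule K_eq_comp_left[OF K_eq_comp_right]) (use a b in simp_all)
  have 2: "K_eq R Z Z (f' \<bullet> ((f \<bullet> g) \<bullet> g')) (f' \<bullet> (id_map \<bullet> g'))"
    by (rule K_eq_comp_left[OF K_eq_comp_right]) (use a b in simp_all)
  show ?thesis
    using a b K_eq_trans[OF 1] K_eq_trans[OF 2] by (simp add: K_inverse_def comp_assoc)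
qed

lemma homotopy_equivalenceD:
  assumes "homotopy_equivalence R X Y f" "cochain_complex R X" "cochain_complex R Y"
  obtains g where "K_inverse R X Y f g"
proof -
  obtain g where g: "g \<in> chain_maps R Y X" "homotopic R X X (g \<bullet> f) id_map" "homotopic R Y Y (f \<bullet> g) id_map"
    and f: "f \<in> chain_maps R X Y"
    using assms(1) unfolding homotopy_equivalence_def by blast
  have "K_inverse R X Y f g"
    using f g assms(2,3) comp_chain[OF f g(1)] comp_chain[OF g(1) f] by (simp add: K_inverse_def K_eq_def)
  then show thesis by (rule that)
qed

lemma K_inverse_equivalence: "K_inverse R X Y f g \<Longrightarrow> homotopy_equivalence R X Y f"
  by (auto simp: homotopy_equivalence_def K_inverse_def K_eq_def)

lemma K_isoD:
  assumes "K_iso R X Y" "cochain_complex R X" "cochain_complex R Y"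
  obtains f g where "K_inverse R X Y f g"
  using assms homotopy_equivalenceD unfolding K_iso_def by blast

lemma K_isoI: "K_inverse R X Y f g \<Longrightarrow> K_iso R X Y"
  unfolding K_iso_def using K_inverse_equivalence by blast

lemma K_iso_sym: "\<lbrakk>K_iso R X Y; cochain_complex R X; cochain_complex R Y\<rbrakk> \<Longrightarrow> K_iso R Y X"
  by (meson K_isoD K_isoI K_inverse_sym)

lemma K_iso_refl: "cochain_complex R X \<Longrightarrow> K_iso R X X"
  by (rule K_isoI[OF K_inverse_refl])

lemma K_iso_trans:
  "\<lbrakk>K_iso R X Y; K_iso R Y Z; cochain_complex R X; cochain_complex R Y; cochain_complex R Z\<rbrakk> \<Longrightarrow> K_iso R X Z"
  by (meson K_isoD K_isoI K_inverse_trans)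

lemma strict_iso:
  assumes "cochain_complex R X" "cochain_complex R Y" "f \<in> chain_maps R X Y" "g \<in> chain_maps R Y X"
    and "\<And>i x. x \<in> carrier (obj X i) \<Longrightarrow> g i (f i x) = x"
    and "\<And>i y. y \<in> carrier (obj Y i) \<Longrightarrow> f i (g i y) = y"
  shows "K_inverse R X Y f g"
  unfolding K_inverse_def using assms by (auto intro!: K_eq_eqI)

section \<open>Maps that factor through finite sums of copies of a complex\<close>

lemma K_factorsD:
  assumes "K_factors R T X Y f" "cochain_complex R T"
  shows "f \<in> chain_maps R X Y" "cochain_complex R X" "cochain_complex R Y"
proof -
  have "f \<in> chain_maps R X Y \<and> cochain_complex R X \<and> cochain_complex R Y"
    using assms(1)
  proof (induction rule: K_factors_induct)
    case K_factors_zero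
    then show "zero_map Y \<in> chain_maps R X Y \<and> cochain_complex R X \<and> cochain_complex R Y" by simp
  next
    case (K_factors_add f a b)
    then show "add_map Y f (b \<bullet> a) \<in> chain_maps R X Y \<and> cochain_complex R X \<and> cochain_complex R Y"
      by simp
  next
    case (K_factors_cong f g)
    then show ?case by (auto dest: K_eqD)
  qed
  then show "f \<in> chain_maps R X Y" "cochain_complex R X" "cochain_complex R Y" by auto
qed

lemma K_factors_single:
  assumes "a \<in> chain_maps R X T" "b \<in> chain_maps R T Y"
    "cochain_complex R T" "cochain_complex R X" "cochain_complex R Y"
  shows "K_factors R T X Y (b \<bullet> a)"
proof -
  have "K_factors R T X Y (add_map Y (zero_map Y) (b \<bullet> a))"
    by (intro K_factors_add K_factors_zero assms)
  then show ?thesis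
    by (rule K_factors_cong) (rule K_eq_eqI, use assms in simp_all)
qed

lemma K_factors_sum:
  assumes f: "K_factors R T X Y f" and g: "K_factors R T X Y g" and T: "cochain_complex R T"
  shows "K_factors R T X Y (add_map Y f g)"
  using g
proof (induction rule: K_factors_induct)
  case K_factors_zero
  note a = K_factorsD[OF f T]
  from f show "K_factors R T X Y (add_map Y f (zero_map Y))"
    by (rule K_factors_cong) (rule K_eq_eqI, use a in simp_all)
next
  case (K_factors_add g a b)
  note d = K_factorsD[OF f T] and e = K_factorsD[OF K_factors_add(1) T]
  interpret Y: abelian_group "obj Y i" for i using d(3) by (rule cc_abelian)
  have "K_factors R T X Y (add_map Y (add_map Y f g) (b \<bullet> a))"
    using K_factors_add by (intro K_factors.K_factors_add)
  then show "K_factors R T X Y (add_map Y f (add_map Y g (b \<bullet> a)))"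
  proof (rule K_factors_cong, intro K_eq_eqI)
    fix i x assume "x \<in> carrier (obj X i)"
    then have "f i x \<in> carrier (obj Y i)" "g i x \<in> carrier (obj Y i)" "b i (a i x) \<in> carrier (obj Y i)"
      using d e K_factors_add by simp_all
    then show "add_map Y (add_map Y f g) (b \<bullet> a) i x = add_map Y f (add_map Y g (b \<bullet> a)) i x"
      by (simp add: Y.a_assoc)
  qed (use d e K_factors_add in simp_all)
next
  case (K_factors_cong g g')
  then show ?case
    using K_factorsD[OF f T] by (meson K_eq_add K_eq_refl K_factors.K_factors_cong)
qed

lemma K_factors_comp_left:
  assumes f: "K_factors R T X Y f" and u: "u \<in> chain_maps R Y Z"
    and T: "cochain_complex R T" and Z: "cochain_complex R Z"
  shows "K_factors R T X Z (u \<bullet> f)"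
  using f
proof (induction rule: K_factors_induct)
  case K_factors_zero
  have "K_factors R T X Z (zero_map Z)" by (intro K_factors.K_factors_zero K_factors_zero Z)
  then show "K_factors R T X Z (u \<bullet> zero_map Y)" by (rule K_factors_cong)
      (rule K_eq_eqI, use K_factors_zero Z u comp_chain[OF zero_chain u] in simp_all)
next
  case (K_factors_add f a b)
  note d = K_factorsD[OF K_factors_add(1) T]
  have "K_factors R T X Z (add_map Z (u \<bullet> f) ((u \<bullet> b) \<bullet> a))"
    by (rule K_factors.K_factors_add[OF K_factors_add.IH K_factors_add.hyps(2) comp_chain[OF K_factors_add.hyps(3) u]])
  then show "K_factors R T X Z (u \<bullet> add_map Y f (b \<bullet> a))" by (rule K_factors_cong) (rule K_eq_eqI, use d K_factors_add Z u
      comp_chain[OF add_chain[OF d(3,1) comp_chain[OF K_factors_add.hyps(2,3)]] u]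
      comp_chain[OF K_factors_add.hyps(3) u] in simp_all)
next
  case (K_factors_cong f g)
  then show ?case using K_eq_comp_left u Z K_factors.K_factors_cong by blast
qed

lemma K_factors_comp_right:
  assumes f: "K_factors R T Y Z f" and u: "u \<in> chain_maps R X Y"
    and T: "cochain_complex R T" and X: "cochain_complex R X"
  shows "K_factors R T X Z (f \<bullet> u)"
  using f
proof (induction rule: K_factors_induct)
  case K_factors_zero
  have "K_factors R T X Z (zero_map Z)" by (intro K_factors.K_factors_zero K_factors_zero X)
  then show "K_factors R T X Z (zero_map Z \<bullet> u)" by (rule K_factors_cong)
      (rule K_eq_eqI, use K_factors_zero X u comp_chain[OF u zero_chain] in simp_all)
next
  case (K_factors_add f a b)
  note d = K_factorsD[OF K_factors_add(1) T]
  have "K_factors R T X Z (add_map Z (f \<bullet> u) (b \<bullet> (a \<bullet> u)))"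
    by (rule K_factors.K_factors_add[OF K_factors_add.IH comp_chain[OF u K_factors_add.hyps(2)] K_factors_add.hyps(3)])
  then show "K_factors R T X Z (add_map Z f (b \<bullet> a) \<bullet> u)" by (rule K_factors_cong) (rule K_eq_eqI, use d K_factors_add X u
      comp_chain[OF u add_chain[OF d(3,1) comp_chain[OF K_factors_add.hyps(2,3)]]]
      comp_chain[OF comp_chain[OF u K_factors_add.hyps(2)] K_factors_add.hyps(3)] in simp_all)
next
  case (K_factors_cong f g)
  then show ?case using K_eq_comp_right u X K_factors.K_factors_cong by blast
qed

text \<open>Each summand \<open>b \<bullet> a\<close> is read as
  \<open>b \<bullet> id_map \<bullet> a\<close>, and the identity in the middle is split through
  \<open>S\<close>.\<close>

lemma K_factors_trans:
  assumes f: "K_factors R T X Y f" and g: "K_factors R S T T id_map"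
    and T: "cochain_complex R T" and S: "cochain_complex R S"
  shows "K_factors R S X Y f"
  using f
proof (induction rule: K_factors_induct)
  case K_factors_zero
  then show "K_factors R S X Y (zero_map Y)" by (rule K_factors.K_factors_zero)
next
  case (K_factors_add f a b)
  have "K_factors R S X Y (b \<bullet> (id_map \<bullet> a))"
    using K_factors_add g T S K_factorsD[OF K_factors_add(1) T]
    by (intro K_factors_comp_left[where Y=T] K_factors_comp_right[where Y=T]) simp_all
  then show "K_factors R S X Y (add_map Y f (b \<bullet> a))" using K_factors_add S by (simp add: K_factors_sum)
next
  case (K_factors_cong f g)
  then show ?case using K_factors.K_factors_cong by blast
qed

lemma K_factors_null:
  assumes f: "K_factors R T X Y f" and T: "cochain_complex R T"
    and n: "\<And>a b. \<lbrakk>a \<in> chain_maps R X T; b \<in> chain_maps R T Y\<rbrakk> \<Longrightarrow> K_eq R X Y (b \<bullet> a) (zero_map Y)"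
  shows "K_eq R X Y f (zero_map Y)"
  using f
proof (induction rule: K_factors_induct)
  case K_factors_zero
  then show "K_eq R X Y (zero_map Y) (zero_map Y)" by (simp add: K_eq_refl)
next
  case (K_factors_add f a b)
  have "K_eq R X Y (add_map Y f (b \<bullet> a)) (add_map Y (zero_map Y) (zero_map Y))"
    by (rule K_eq_add[OF K_factors_add.IH n[OF K_factors_add.hyps(2,3)]])
  also have "K_eq R X Y (add_map Y (zero_map Y) (zero_map Y)) (zero_map Y)"
    using K_factorsD[OF K_factors_add(1) T] by (intro K_eq_eqI) simp_all
  finally show ?case .
next
  case (K_factors_cong f g)
  then show ?case using K_eq_sym K_eq_trans by blast
qed

text \<open>A map into \<open>Y\<close> followed by the identity of \<open>Y\<close> is a sum of
  maps through \<open>T\<close>, and each of them is null as soon as it reaches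
  \<open>T\<close>.\<close>

lemma hom_null_factors_right:
  assumes V: "hom_null R X T" and f: "K_factors R T Y Y id_map"
    and X: "cochain_complex R X" and T: "cochain_complex R T"
  shows "hom_null R X Y"
proof (rule hom_nullI)
  fix u assume u: "u \<in> chain_maps R X Y"
  note Y = K_factorsD(2)[OF f T]
  have "K_factors R T X Y (id_map \<bullet> u)"
    by (rule K_factors_comp_right[OF f u T X])
  then show "K_eq R X Y u (zero_map Y)"
    by (simp, elim K_factors_null[OF _ T]) (meson K_eq_comp_zero V hom_nullD X T Y)
qed

lemma hom_null_factors_left:
  assumes V: "hom_null R T X" and f: "K_factors R T Y Y id_map"
    and X: "cochain_complex R X" and T: "cochain_complex R T"
  shows "hom_null R Y X"
proof (rule hom_nullI)
  fix u assume u: "u \<in> chain_maps R Y X"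
  note Y = K_factorsD(2)[OF f T]
  have "K_factors R T Y X (u \<bullet> id_map)"
    by (rule K_factors_comp_left[OF f u T X])
  then show "K_eq R Y X u (zero_map X)"
    by (simp, elim K_factors_null[OF _ T]) (meson K_eq_zero_comp V hom_nullD X T Y)
qed

text \<open>An isomorphism makes each complex a retract of the other, so invariance under
  isomorphism becomes a case of passing to retracts.\<close>

lemma K_iso_factors:
  "\<lbrakk>K_iso R X Y; cochain_complex R X; cochain_complex R Y\<rbrakk> \<Longrightarrow> K_factors R Y X X id_map"
  by (meson K_isoD K_inverseD(1-3) K_factors_cong K_factors_single)

lemma hom_null_iso:
  assumes "hom_null R X Y" "K_iso R X' X" "K_iso R Y' Y" "cochain_complex R X" "cochain_complex R X'"
    "cochain_complex R Y" "cochain_complex R Y'"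
  shows "hom_null R X' Y'"
  by (meson assms K_iso_factors hom_null_factors_left hom_null_factors_right)

end

section \<open>Shifts, sums and cones\<close>

context ring begin

lemma shift_obj [simp]: "obj (shift X m) i = obj X (i + m)"
  by (simp add: shift_def)

lemma shift_diff: "diff (shift X m) i x
    = (if even m then diff X (i + m) x else \<ominus>\<^bsub>obj X (i + m + 1)\<^esub> diff X (i + m) x)"
  by (simp add: shift_def)

lemma shift_complex [simp]:
  assumes X: "cochain_complex R X"
  shows "cochain_complex R (shift X m)"
  unfolding cochain_complex_def
proof (intro allI conjI ballI)
  fix i
  have d: "diff X (i + m) \<in> module_homs R (obj X (i + m)) (obj X (i + m + 1))"
    by (rule cc_diff_hom) (use X in simp_all)
  have "diff (shift X m) i \<in> module_homs R (obj X (i + m)) (obj X (i + m + 1))"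
    using d module_homs_neg_map[OF d] X by (cases "even m") (simp_all add: shift_def)
  then show "diff (shift X m) i \<in> module_homs R (obj (shift X m) i) (obj (shift X m) (i + 1))"
    by (simp add: ac_simps)
  fix x assume x: "x \<in> carrier (obj (shift X m) i)"
  have [simp]: "i + 1 + m = i + m + 1" "i + 2 + m = i + m + 2" "i + m + 1 + 1 = i + m + 2" by simp_all
  show "diff (shift X m) (i + 1) (diff (shift X m) i x) = \<zero>\<^bsub>obj (shift X m) (i + 2)\<^esub>"
    using x X by (simp add: shift_diff)
qed (use X in simp)

lemma shift_map_apply [simp]: "shift_map f m i x = f (i + m) x"
  by (simp add: shift_map_def)

lemma shift_map_chain [simp]:
  assumes "f \<in> chain_maps R X Y" "cochain_complex R X" "cochain_complex R Y"
  shows "shift_map f m \<in> chain_maps R (shift X m) (shift Y m)"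
proof (rule chain_mapsI)
  show "shift_map f m i \<in> module_homs R (obj (shift X m) i) (obj (shift Y m) i)" for i
    using assms by (simp add: shift_map_def chain_maps_hom)
  fix i x assume x: "x \<in> carrier (obj (shift X m) i)"
  have [simp]: "i + 1 + m = i + m + 1" by simp
  have "f (i + m + 1) (\<ominus>\<^bsub>obj X (i + m + 1)\<^esub> diff X (i + m) x)
      = \<ominus>\<^bsub>obj Y (i + m + 1)\<^esub> f (i + m + 1) (diff X (i + m) x)"
    by (rule cm_simps(4)) (use assms x in simp_all)
  then show "shift_map f m (i + 1) (diff (shift X m) i x) = diff (shift Y m) i (shift_map f m i x)"
    using x assms by (simp add: shift_diff)
qed

lemma shift_map_K_eq:
  assumes "K_eq R X Y f g"
  shows "K_eq R (shift X m) (shift Y m) (shift_map f m) (shift_map g m)"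
proof -
  note a = K_eqD[OF assms]
  interpret Y: abelian_group "obj Y i" for i using a(3) by (rule cc_abelian)
  obtain h where h: "h \<in> graded_maps R (-1) X Y"
    and e: "\<And>i x. x \<in> carrier (obj X i) \<Longrightarrow>
      f i x = g i x \<oplus>\<^bsub>obj Y i\<^esub> (diff Y (i - 1) (h i x) \<oplus>\<^bsub>obj Y i\<^esub> h (i + 1) (diff X i x))"
    using homotopicE[OF a] by blast
  have h': "h i \<in> module_homs R (obj X i) (obj Y j)" if "j = i - 1" for i j
    using gm_hom[OF h] that by simp
  \<comment> \<open>For odd \<open>m\<close> both differentials change sign, and so must the
    homotopy: the two signs cancel in \<open>d k + k d\<close>.\<close>
  define k where "k i x = (if even m then h (i + m) x else \<ominus>\<^bsub>obj Y (i - 1 + m)\<^esub> h (i + m) x)" for i x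
  have k: "k \<in> graded_maps R (-1) (shift X m) (shift Y m)"
  proof (rule gmI)
    fix i
    show "k i \<in> module_homs R (obj (shift X m) i) (obj (shift Y m) (i + - 1))"
    proof (cases "even m")
      case True
      then have "k i = h (i + m)" by (simp add: k_def fun_eq_iff)
      then show ?thesis using h'[of "i - 1 + m" "i + m"] by simp
    next
      case False
      then have "k i = (\<lambda>x. \<ominus>\<^bsub>obj Y (i - 1 + m)\<^esub> h (i + m) x)" by (simp add: k_def fun_eq_iff)
      then show ?thesis using h'[of "i - 1 + m" "i + m"] a by (simp add: module_homs_neg_map)
    qed
  qed
  have "homotopic R (shift X m) (shift Y m) (shift_map f m) (shift_map g m)"
  proof (rule homotopicI[OF _ _ _ _ k])
    fix i x assume x: "x \<in> carrier (obj (shift X m) i)"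
    have [simp]: "i + 1 + m = i + m + 1" "i - 1 + m = i + m - 1" by simp_all
    have c: "h (i + m) x \<in> carrier (obj Y (i + m - 1))" "diff X (i + m) x \<in> carrier (obj X (i + m + 1))"
      "h (i + m + 1) (diff X (i + m) x) \<in> carrier (obj Y (i + m))"
      "diff Y (i + m - 1) (h (i + m) x) \<in> carrier (obj Y (i + m))"
      using x h a by simp_all
    have "h (i + m + 1) (\<ominus>\<^bsub>obj X (i + m + 1)\<^esub> diff X (i + m) x)
        = \<ominus>\<^bsub>obj Y (i + m + 1 + - 1)\<^esub> h (i + m + 1) (diff X (i + m) x)"
      by (rule gm_simps(4)[OF h]) (use a c in simp_all)
    moreover have "diff Y (i + m - 1) (\<ominus>\<^bsub>obj Y (i + m - 1)\<^esub> h (i + m) x)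
        = \<ominus>\<^bsub>obj Y (i + m - 1 + 1)\<^esub> diff Y (i + m - 1) (h (i + m) x)"
      by (rule cc_simps(4)) (use a c in simp_all)
    ultimately show "shift_map f m i x = shift_map g m i x \<oplus>\<^bsub>obj (shift Y m) i\<^esub>
         (diff (shift Y m) (i - 1) (k i x) \<oplus>\<^bsub>obj (shift Y m) i\<^esub>
          k (i + 1) (diff (shift X m) i x))"
      using x c a by (simp add: shift_diff k_def e)
  qed (use a in simp_all)
  then show ?thesis using a by (intro K_eqI) simp_all
qed

lemma shift_map_comp: "shift_map (g \<bullet> f) m = shift_map g m \<bullet> shift_map f m"
  by (simp add: fun_eq_iff)

lemma shift_map_id: "shift_map id_map m = id_map"
  by (simp add: fun_eq_iff)

lemma shift_map_zero: "shift_map (zero_map Y) m = zero_map (shift Y m)"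
  by (simp add: fun_eq_iff)

lemma K_inverse_shift:
  assumes "K_inverse R X Y f g"
  shows "K_inverse R (shift X m) (shift Y m) (shift_map f m) (shift_map g m)"
  using K_inverseD[OF assms] shift_map_K_eq[OF K_inverseD(3)[OF assms], of m]
    shift_map_K_eq[OF K_inverseD(4)[OF assms], of m]
  by (simp add: K_inverse_def shift_map_comp shift_map_id)

lemma K_iso_shift:
  "\<lbrakk>K_iso R X Y; cochain_complex R X; cochain_complex R Y\<rbrakk> \<Longrightarrow> K_iso R (shift X m) (shift Y m)"
  by (meson K_inverse_shift K_isoD K_isoI)

lemma K_factors_shift:
  assumes f: "K_factors R T X Y f" and T: "cochain_complex R T"
  shows "K_factors R (shift T m) (shift X m) (shift Y m) (shift_map f m)"
  using f
proof (induction rule: K_factors_induct)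
  case K_factors_zero
  from K_factors.K_factors_zero[of R "shift X m" "shift Y m" "shift T m"]
  show "K_factors R (shift T m) (shift X m) (shift Y m) (shift_map (zero_map Y) m)"
    using K_factors_zero by (simp add: shift_map_zero)
next
  case (K_factors_add f a b)
  note d = K_factorsD[OF K_factors_add(1) T]
  have "add_map (shift Y m) (shift_map f m) (shift_map b m \<bullet> shift_map a m) = shift_map (add_map Y f (b \<bullet> a)) m"
    by (simp add: fun_eq_iff)
  moreover have "K_factors R (shift T m) (shift X m) (shift Y m)
      (add_map (shift Y m) (shift_map f m) (shift_map b m \<bullet> shift_map a m))"
    by (rule K_factors.K_factors_add[OF K_factors_add.IH]) (use K_factors_add.hyps d T in simp_all)
  ultimately show "K_factors R (shift T m) (shift X m) (shift Y m) (shift_map (add_map Y f (b \<bullet> a)) m)"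
    by simp
next
  case (K_factors_cong f g)
  then show ?case using K_factors.K_factors_cong shift_map_K_eq by blast
qed

text \<open>The signs of the two shifts multiply to that of the total shift, so the identity is a
  chain map in both directions once the indices are reassociated.\<close>

lemma shift_shift:
  assumes X: "cochain_complex R X" and m: "k = m + n"
  shows "K_inverse R (shift (shift X m) n) (shift X k) id_map id_map"
proof -
  have [simp]: "i + n + m = i + (m + n)" "i + 1 + (m + n) = i + (m + n) + 1" for i :: int by simp_all
  have [simp]: "i + n + (m + 1) = i + (m + n) + 1" for i :: int by simp
  have "id_map \<in> chain_maps R (shift (shift X m) n) (shift X k)"
    by (rule chain_mapsI) (use X m in \<open>auto simp: id_map_def module_homs_id shift_diff ac_simps\<close>)
  moreover have "id_map \<in> chain_maps R (shift X k) (shift (shift X m) n)"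
    by (rule chain_mapsI) (use X m in \<open>auto simp: id_map_def module_homs_id shift_diff ac_simps\<close>)
  ultimately show ?thesis
    by (intro strict_iso) (use X in simp_all)
qed

lemma shift_zero:
  assumes X: "cochain_complex R X"
  shows "K_inverse R (shift X 0) X id_map id_map"
proof -
  have "id_map \<in> chain_maps R (shift X 0) X" "id_map \<in> chain_maps R X (shift X 0)"
    by (rule chain_mapsI; simp add: id_map_def module_homs_id shift_diff)+
  then show ?thesis
    by (intro strict_iso) (use X in simp_all)
qed

lemma shift_back:
  assumes X: "cochain_complex R X"
  shows "K_inverse R (shift (shift X m) (- m)) X id_map id_map"
  using K_inverse_trans[OF shift_shift[OF X, of 0 m "- m"] shift_zero[OF X]] by simp

text \<open>Shifting a map back by \<open>- m\<close> lands between double shifts, which are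
  identified with \<open>X\<close> and \<open>Y\<close> only through the identity maps of
  \<open>shift_back\<close>; these are composed on both sides.\<close>

lemma hom_null_shift:
  assumes n: "hom_null R X Y" and X: "cochain_complex R X" and Y: "cochain_complex R Y"
  shows "hom_null R (shift X m) (shift Y m)"
proof (rule hom_nullI)
  fix f assume f: "f \<in> chain_maps R (shift X m) (shift Y m)"
  have "shift_map f (- m) \<in> chain_maps R (shift (shift X m) (- m)) (shift (shift Y m) (- m))"
    using f X Y by simp
  from comp_chain[OF comp_chain[OF K_inverseD(2)[OF shift_back[OF X]] this] K_inverseD(1)[OF shift_back[OF Y]]]
  have "shift_map f (- m) \<in> chain_maps R X Y" by simp
  from shift_map_K_eq[OF hom_nullD[OF n this X Y], of m]
  have "K_eq R (shift X m) (shift Y m) (shift_map (shift_map f (- m)) m) (shift_map (zero_map Y) m)" .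
  moreover have "shift_map (shift_map f (- m)) m = f" by (simp add: fun_eq_iff)
  ultimately show "K_eq R (shift X m) (shift Y m) f (zero_map (shift Y m))" by (simp add: shift_map_zero)
qed

section \<open>Direct sums of complexes\<close>

lemma module_homs_pair:
  assumes f: "f \<in> module_homs R L M" and g: "g \<in> module_homs R L N"
  shows "(\<lambda>x. (f x, g x)) \<in> module_homs R L (module_sum M N)"
  by (rule module_homsI) (simp_all add: module_homs_simps(1-3)[OF f] module_homs_simps(1-3)[OF g])

lemma sum_complex [simp]:
  assumes "cochain_complex R X" "cochain_complex R Y"
  shows "cochain_complex R (complex_sum X Y)"
  unfolding cochain_complex_def
proof (intro allI conjI ballI)
  fix i
  show "right_module R (obj (complex_sum X Y) i)"
    using assms by (simp add: complex_sum_def module_sum_module)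
  show "diff (complex_sum X Y) i \<in> module_homs R (obj (complex_sum X Y) i) (obj (complex_sum X Y) (i + 1))"
    by (rule module_homsI) (use assms in \<open>auto simp: complex_sum_def\<close>)
qed (use assms in \<open>auto simp: complex_sum_def\<close>)

lemma sum_simps [simp]:
  "obj (complex_sum X Y) i = module_sum (obj X i) (obj Y i)"
  "diff (complex_sum X Y) i (x, y) = (diff X i x, diff Y i y)"
  by (simp_all add: complex_sum_def)

lemma sum_chain_maps:
  assumes "cochain_complex R X" "cochain_complex R Y"
  shows "(\<lambda>i x. (x, \<zero>\<^bsub>obj Y i\<^esub>)) \<in> chain_maps R X (complex_sum X Y)"
    and "(\<lambda>i y. (\<zero>\<^bsub>obj X i\<^esub>, y)) \<in> chain_maps R Y (complex_sum X Y)"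
    and "(\<lambda>i. fst) \<in> chain_maps R (complex_sum X Y) X"
    and "(\<lambda>i. snd) \<in> chain_maps R (complex_sum X Y) Y"
  by (rule chain_mapsI; (rule module_homsI)?; use assms in auto)+

section \<open>Mapping cones and the exactness of morphism groups along them\<close>

lemma cone_obj [simp]: "obj (cone X Y f) i = module_sum (obj X (i + 1)) (obj Y i)"
  by (simp add: cone_def)

lemma cone_diff [simp]: "diff (cone X Y f) i (x, y) =
    (\<ominus>\<^bsub>obj X (i + 2)\<^esub> diff X (i + 1) x, f (i + 1) x \<oplus>\<^bsub>obj Y (i + 1)\<^esub> diff Y i y)"
  by (simp add: cone_def)

text \<open>The sign on the first component makes the terms \<open>f d\<close> and
  \<open>d f\<close> of the squared differential cancel.\<close>

lemma cone_complex [simp]: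
  assumes X: "cochain_complex R X" and Y: "cochain_complex R Y" and f: "f \<in> chain_maps R X Y"
  shows "cochain_complex R (cone X Y f)"
  unfolding cochain_complex_def
proof (intro allI conjI ballI)
  fix i
  interpret X: abelian_group "obj X i" for i using X by (rule cc_abelian)
  interpret Y: abelian_group "obj Y i" for i using Y by (rule cc_abelian)
  have [simp]: "i + 1 + 1 = i + 2" "i + 2 + 1 = i + 3" "i + 1 + 2 = i + 3" for i :: int by simp_all
  show "right_module R (obj (cone X Y f) i)"
    using X Y by (simp add: module_sum_module)
  show "diff (cone X Y f) i \<in> module_homs R (obj (cone X Y f) i) (obj (cone X Y f) (i + 1))"
  proof (rule module_homsI)
    fix p q assume "p \<in> carrier (obj (cone X Y f) i)" "q \<in> carrier (obj (cone X Y f) i)"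
    then obtain x y x' y' where [simp]: "p = (x, y)" "q = (x', y')"
      and x: "x \<in> carrier (obj X (i + 1))" "x' \<in> carrier (obj X (i + 1))"
      and y: "y \<in> carrier (obj Y i)" "y' \<in> carrier (obj Y i)" by auto
    have c: "f (i + 1) x \<in> carrier (obj Y (i + 1))" "f (i + 1) x' \<in> carrier (obj Y (i + 1))"
      "diff Y i y \<in> carrier (obj Y (i + 1))" "diff Y i y' \<in> carrier (obj Y (i + 1))"
      using x y Y f by simp_all
    have c': "diff X (i + 1) x \<in> carrier (obj X (i + 2))" "diff X (i + 1) x' \<in> carrier (obj X (i + 2))"
      using x X by simp_all
    have "(f (i + 1) x \<oplus>\<^bsub>obj Y (i + 1)\<^esub> f (i + 1) x') \<oplus>\<^bsub>obj Y (i + 1)\<^esub> (diff Y i y \<oplus>\<^bsub>obj Y (i + 1)\<^esub> diff Y i y')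
        = (f (i + 1) x \<oplus>\<^bsub>obj Y (i + 1)\<^esub> diff Y i y) \<oplus>\<^bsub>obj Y (i + 1)\<^esub> (f (i + 1) x' \<oplus>\<^bsub>obj Y (i + 1)\<^esub> diff Y i y')"
      using c by algebra
    then show "diff (cone X Y f) i (p \<oplus>\<^bsub>obj (cone X Y f) i\<^esub> q) =
        diff (cone X Y f) i p \<oplus>\<^bsub>obj (cone X Y f) (i + 1)\<^esub> diff (cone X Y f) i q"
      using x y X Y f c' by (simp add: X.minus_add)
  qed (use X Y f in \<open>auto simp: rm_act\<close>)
  fix p assume "p \<in> carrier (obj (cone X Y f) i)"
  then obtain x y where [simp]: "p = (x, y)"
    and x: "x \<in> carrier (obj X (i + 1))" and y: "y \<in> carrier (obj Y i)" by auto
  have c: "diff Y (i + 1) (f (i + 1) x) \<in> carrier (obj Y (i + 2))" "diff X (i + 1) x \<in> carrier (obj X (i + 2))"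
    using x Y f X by simp_all
  have "f (i + 2) (\<ominus>\<^bsub>obj X (i + 2)\<^esub> diff X (i + 1) x) = \<ominus>\<^bsub>obj Y (i + 2)\<^esub> diff Y (i + 1) (f (i + 1) x)"
    using f X Y c x by simp
  moreover have "diff X (i + 2) (\<ominus>\<^bsub>obj X (i + 2)\<^esub> diff X (i + 1) x) = \<zero>\<^bsub>obj X (i + 3)\<^esub>"
    using c x X by simp
  ultimately show "diff (cone X Y f) (i + 1) (diff (cone X Y f) i p) = \<zero>\<^bsub>obj (cone X Y f) (i + 2)\<^esub>"
    using x y X Y f c by simp
qed

lemma cone_incl_chain [simp]:
  assumes X: "cochain_complex R X" and Y: "cochain_complex R Y" and f: "f \<in> chain_maps R X Y"
  shows "cone_incl X \<in> chain_maps R Y (cone X Y f)"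
proof -
  have [simp]: "i + 1 + 1 = i + 2" for i :: int by simp
  show ?thesis
    unfolding cone_incl_def
    by (rule chain_mapsI; (rule module_homsI)?; use assms in simp)
qed

lemma cone_proj_chain [simp]:
  assumes X: "cochain_complex R X" and Y: "cochain_complex R Y" and f: "f \<in> chain_maps R X Y"
  shows "cone_proj \<in> chain_maps R (cone X Y f) (shift X 1)"
proof -
  have [simp]: "i + 1 + 1 = i + 2" for i :: int by simp
  show ?thesis
    unfolding cone_proj_def
    by (rule chain_mapsI; (rule module_homsI)?; use assms in \<open>auto simp: shift_diff\<close>)
qed

lemma cone_apply [simp]: "cone_incl X i y = (\<zero>\<^bsub>obj X (i + 1)\<^esub>, y)" "cone_proj i p = fst p"
  by (simp_all add: cone_incl_def cone_proj_def)

lemma cone_incl_null: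
  assumes X: "cochain_complex R X" and Y: "cochain_complex R Y" and f: "f \<in> chain_maps R X Y"
  shows "K_eq R X (cone X Y f) (cone_incl X \<bullet> f) (zero_map (cone X Y f))"
proof (rule K_eqI)
  have [simp]: "i - 1 + 2 = i + 1" for i :: int by simp
  \<comment> \<open>The homotopy \<open>x \<mapsto> (x, 0)\<close> has boundary
    \<open>(- d x, f x) + (d x, 0)\<close>.\<close>
  have h: "(\<lambda>i x. (x, \<zero>\<^bsub>obj Y (i - 1)\<^esub>)) \<in> graded_maps R (-1) X (cone X Y f)"
    by (rule gmI, rule module_homsI) (use assms in simp_all)
  have c: "cone_incl X \<bullet> f \<in> chain_maps R X (cone X Y f)"
    by (rule comp_chain[OF f]) (use assms in simp)
  show "homotopic R X (cone X Y f) (cone_incl X \<bullet> f) (zero_map (cone X Y f))"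
    by (rule null_homotopicI[OF X _ c h]) (use assms in simp_all)
  show "cone_incl X \<bullet> f \<in> chain_maps R X (cone X Y f)" by (rule c)
qed (use assms in simp_all)

text \<open>The homotopy of the second component is carried over to the cone.\<close>

lemma cone_factor_left:
  assumes X: "cochain_complex R X" and Y: "cochain_complex R Y" and W: "cochain_complex R W"
    and f: "f \<in> chain_maps R X Y" and u: "u \<in> chain_maps R (cone X Y f) W"
    and n: "K_eq R Y W (u \<bullet> cone_incl X) (zero_map W)"
  obtains b where "b \<in> chain_maps R (shift X 1) W" "K_eq R (cone X Y f) W u (b \<bullet> cone_proj)"
proof -
  interpret W: abelian_group "obj W i" for i using W by (rule cc_abelian)
  have [simp]: "i + 1 + 1 = i + 2" for i :: int by simp
  have ui: "u \<bullet> cone_incl X \<in> chain_maps R Y W"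
    by (rule comp_chain[OF cone_incl_chain[OF X Y f] u])
  obtain k where k: "k \<in> graded_maps R (-1) Y W"
    and e: "\<And>i x. x \<in> carrier (obj Y i) \<Longrightarrow>
      (u \<bullet> cone_incl X) i x = diff W (i - 1) (k i x) \<oplus>\<^bsub>obj W i\<^esub> k (i + 1) (diff Y i x)"
    using null_homotopicE[OF K_eqD(1)[OF n] Y W ui] by blast
  have e': "u i (\<zero>\<^bsub>obj X (i + 1)\<^esub>, y) = diff W (i - 1) (k i y) \<oplus>\<^bsub>obj W i\<^esub> k (i + 1) (diff Y i y)"
    if "y \<in> carrier (obj Y i)" for i y
    using e[OF that] by simp
  have split: "u i (x, y) = u i (x, \<zero>\<^bsub>obj Y i\<^esub>) \<oplus>\<^bsub>obj W i\<^esub> u i (\<zero>\<^bsub>obj X (i + 1)\<^esub>, y)"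
    if "x \<in> carrier (obj X (i + 1))" "y \<in> carrier (obj Y i)" for i x y
    using cm_simps(2)[OF u, of "(x, \<zero>\<^bsub>obj Y i\<^esub>)" i "(\<zero>\<^bsub>obj X (i + 1)\<^esub>, y)"] that X Y by simp
  \<comment> \<open>The restriction of \<open>u\<close> to the first component is not a chain map,
    because the differential of the cone sends \<open>(x, 0)\<close> to \<open>(- d x, f x)\<close>.
    The term \<open>f x\<close> is absorbed by the homotopy \<open>k\<close> that kills
    \<open>u\<close> on \<open>Y\<close>.\<close>
  define b where "b i x = u i (x, \<zero>\<^bsub>obj Y i\<^esub>) \<oplus>\<^bsub>obj W i\<^esub> \<ominus>\<^bsub>obj W i\<^esub> k (i + 1) (f (i + 1) x)" for i x
  have u1: "(\<lambda>x. u i (x, \<zero>\<^bsub>obj Y i\<^esub>)) \<in> module_homs R (obj X (i + 1)) (obj W i)" for i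
  proof (rule module_homs_comp[OF _ chain_maps_hom[OF u]])
    show "(\<lambda>x. (x, \<zero>\<^bsub>obj Y i\<^esub>)) \<in> module_homs R (obj X (i + 1)) (obj (cone X Y f) i)"
      by (rule module_homsI) (use X Y in simp_all)
  qed
  have kf: "(\<lambda>x. k (i + 1) (f (i + 1) x)) \<in> module_homs R (obj X (i + 1)) (obj W i)" for i
    by (rule module_homs_comp[OF chain_maps_hom[OF f] gm_hom[OF k]]) simp
  have b: "b \<in> chain_maps R (shift X 1) W"
  proof (rule chain_mapsI)
    show "b i \<in> module_homs R (obj (shift X 1) i) (obj W i)" for i
      unfolding b_def shift_obj
      by (intro module_homs_add_map module_homs_neg_map u1 kf) (use W in simp_all)
    fix i x assume "x \<in> carrier (obj (shift X 1) i)"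
    then have x: "x \<in> carrier (obj X (i + 1))" by simp
    define dx where "dx = diff X (i + 1) x"
    have dx: "dx \<in> carrier (obj X (i + 2))" using x X by (simp add: dx_def)
    have fx: "f (i + 1) x \<in> carrier (obj Y (i + 1))" using x f by simp
    have p: "(x, \<zero>\<^bsub>obj Y i\<^esub>) \<in> carrier (obj (cone X Y f) i)" using x Y by simp
    have "u (i + 1) (diff (cone X Y f) i (x, \<zero>\<^bsub>obj Y i\<^esub>)) = diff W i (u i (x, \<zero>\<^bsub>obj Y i\<^esub>))"
      by (rule cm_simps(7)[OF u p refl])
    then have 1: "u (i + 1) (\<ominus>\<^bsub>obj X (i + 2)\<^esub> dx, f (i + 1) x) = diff W i (u i (x, \<zero>\<^bsub>obj Y i\<^esub>))"
      using fx Y by (simp add: dx_def)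
    have 2: "u (i + 1) (\<ominus>\<^bsub>obj X (i + 2)\<^esub> dx, f (i + 1) x)
        = u (i + 1) (\<ominus>\<^bsub>obj X (i + 2)\<^esub> dx, \<zero>\<^bsub>obj Y (i + 1)\<^esub>)
          \<oplus>\<^bsub>obj W (i + 1)\<^esub> (diff W i (k (i + 1) (f (i + 1) x)) \<oplus>\<^bsub>obj W (i + 1)\<^esub>
            k (i + 2) (f (i + 2) dx))"
      using split[of "\<ominus>\<^bsub>obj X (i + 2)\<^esub> dx" "i + 1" "f (i + 1) x"] e'[OF fx] dx fx X f x
      by (simp add: dx_def)
    have 3: "k (i + 2) (f (i + 2) (\<ominus>\<^bsub>obj X (i + 2)\<^esub> dx)) = \<ominus>\<^bsub>obj W (i + 1)\<^esub> k (i + 2) (f (i + 2) dx)"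
      using module_homs_neg[OF kf[of "i + 1"]] dx X W by simp
    have c: "u (i + 1) (\<ominus>\<^bsub>obj X (i + 2)\<^esub> dx, \<zero>\<^bsub>obj Y (i + 1)\<^esub>) \<in> carrier (obj W (i + 1))"
      "diff W i (k (i + 1) (f (i + 1) x)) \<in> carrier (obj W (i + 1))"
      "k (i + 2) (f (i + 2) dx) \<in> carrier (obj W (i + 1))"
      "u i (x, \<zero>\<^bsub>obj Y i\<^esub>) \<in> carrier (obj W i)" "k (i + 1) (f (i + 1) x) \<in> carrier (obj W i)"
      using module_homs_closed[OF u1, of _ "i + 1"] module_homs_closed[OF u1, of _ "i"] 
        module_homs_closed[OF kf, of _ "i + 1"] module_homs_closed[OF kf, of _ i] dx x X W by simp_all
    have "b (i + 1) (\<ominus>\<^bsub>obj X (i + 2)\<^esub> dx)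
        = u (i + 1) (\<ominus>\<^bsub>obj X (i + 2)\<^esub> dx, \<zero>\<^bsub>obj Y (i + 1)\<^esub>) \<oplus>\<^bsub>obj W (i + 1)\<^esub> k (i + 2) (f (i + 2) dx)"
      using 3 c W by (simp add: b_def)
    moreover have "diff W i (b i x) = diff W i (u i (x, \<zero>\<^bsub>obj Y i\<^esub>))
        \<oplus>\<^bsub>obj W (i + 1)\<^esub> \<ominus>\<^bsub>obj W (i + 1)\<^esub> diff W i (k (i + 1) (f (i + 1) x))"
      using c W by (simp add: b_def)
    ultimately have "b (i + 1) (\<ominus>\<^bsub>obj X (i + 2)\<^esub> dx) = diff W i (b i x)"
      using c by (simp add: 1[symmetric] 2) algebra
    then show "b (i + 1) (diff (shift X 1) i x) = diff W i (b i x)"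
      by (simp add: shift_diff dx_def)
  qed
  have bp: "b \<bullet> cone_proj \<in> chain_maps R (cone X Y f) W"
    by (rule comp_chain[OF cone_proj_chain[OF X Y f] b])
  have h: "(\<lambda>i p. k i (snd p)) \<in> graded_maps R (-1) (cone X Y f) W"
  proof (rule gmI)
    fix i
    have "snd \<in> module_homs R (obj (cone X Y f) i) (obj Y i)" by (rule module_homsI) auto
    then show "(\<lambda>p. k i (snd p)) \<in> module_homs R (obj (cone X Y f) i) (obj W (i + - 1))"
      by (rule module_homs_comp) (rule gm_hom[OF k refl])
  qed
  have "homotopic R (cone X Y f) W u (b \<bullet> cone_proj)"
  proof (rule homotopicI[OF _ W u bp h])
    fix i p assume "p \<in> carrier (obj (cone X Y f) i)"
    then obtain x y where [simp]: "p = (x, y)"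
      and x: "x \<in> carrier (obj X (i + 1))" and y: "y \<in> carrier (obj Y i)" by auto
    have c: "u i (x, \<zero>\<^bsub>obj Y i\<^esub>) \<in> carrier (obj W i)" "k (i + 1) (f (i + 1) x) \<in> carrier (obj W i)"
      "diff W (i - 1) (k i y) \<in> carrier (obj W i)" "k (i + 1) (diff Y i y) \<in> carrier (obj W i)"
      using module_homs_closed[OF u1, of _ "i"] module_homs_closed[OF kf, of _ i] x y k Y W by simp_all
    have "k (i + 1) (f (i + 1) x \<oplus>\<^bsub>obj Y (i + 1)\<^esub> diff Y i y)
        = k (i + 1) (f (i + 1) x) \<oplus>\<^bsub>obj W i\<^esub> k (i + 1) (diff Y i y)"
      using gm_simps(2)[OF k, of "f (i + 1) x" "i + 1" "diff Y i y"] x y f Y by simp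
    then show "u i p = (b \<bullet> cone_proj) i p \<oplus>\<^bsub>obj W i\<^esub>
        (diff W (i - 1) (k i (snd p)) \<oplus>\<^bsub>obj W i\<^esub> k (i + 1) (snd (diff (cone X Y f) i p)))"
      using c by (simp add: b_def split[OF x y] e'[OF y]) algebra
  qed (use assms in simp)
  then have "K_eq R (cone X Y f) W u (b \<bullet> cone_proj)"
    by (rule K_eqI) (use bp assms in simp_all)
  with b show thesis by (rule that)
qed

text \<open>Dual to \<open>cone_factor_left\<close>: the homotopy that kills the first component of
  \<open>v\<close> is pushed forward along \<open>f\<close> and subtracted from the second
  component.\<close>

lemma cone_factor_right:
  assumes X: "cochain_complex R X" and Y: "cochain_complex R Y" and V: "cochain_complex R V"
    and f: "f \<in> chain_maps R X Y" and v: "v \<in> chain_maps R V (cone X Y f)"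
    and n: "K_eq R V (shift X 1) (cone_proj \<bullet> v) (zero_map (shift X 1))"
  obtains y where "y \<in> chain_maps R V Y" "K_eq R V (cone X Y f) v (cone_incl X \<bullet> y)"
proof -
  interpret X: abelian_group "obj X i" for i using X by (rule cc_abelian)
  interpret Y: abelian_group "obj Y i" for i using Y by (rule cc_abelian)
  have [simp]: "i + 1 + 1 = i + 2" "i - 1 + 2 = i + 1" for i :: int by simp_all
  have pv: "cone_proj \<bullet> v \<in> chain_maps R V (shift X 1)"
    by (rule comp_chain[OF v cone_proj_chain[OF X Y f]])
  obtain h where h: "h \<in> graded_maps R (-1) V (shift X 1)"
    and e: "\<And>i x. x \<in> carrier (obj V i) \<Longrightarrow> (cone_proj \<bullet> v) i x
       = diff (shift X 1) (i - 1) (h i x) \<oplus>\<^bsub>obj (shift X 1) i\<^esub> h (i + 1) (diff V i x)"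
    using null_homotopicE[OF K_eqD(1)[OF n] V shift_complex[OF X] pv] by blast
  have hh: "h i \<in> module_homs R (obj V i) (obj X i)" for i
    using gm_hom[OF h refl] by simp
  have hc: "h i x \<in> carrier (obj X i)" if "x \<in> carrier (obj V i)" for i x
    using module_homs_closed[OF hh that] .
  have e1: "fst (v i x) = \<ominus>\<^bsub>obj X (i + 1)\<^esub> diff X i (h i x) \<oplus>\<^bsub>obj X (i + 1)\<^esub> h (i + 1) (diff V i x)"
    if "x \<in> carrier (obj V i)" for i x
    using e[OF that] by (simp add: shift_diff)
  have vc: "fst (v i x) \<in> carrier (obj X (i + 1))" "snd (v i x) \<in> carrier (obj Y i)"
    if "x \<in> carrier (obj V i)" for i x
    using cm_simps(1)[OF v that] by (auto simp: mem_Times_iff)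
  have v2: "(\<lambda>x. snd (v i x)) \<in> module_homs R (obj V i) (obj Y i)" for i
    by (rule module_homs_comp[OF chain_maps_hom[OF v]]) (rule module_homsI, auto)
  have vd: "snd (v (i + 1) (diff V i x)) = f (i + 1) (fst (v i x)) \<oplus>\<^bsub>obj Y (i + 1)\<^esub> diff Y i (snd (v i x))"
    if "x \<in> carrier (obj V i)" for i x
    using cm_simps(7)[OF v that refl] by (cases "v i x") simp
  define y where "y i x = snd (v i x) \<oplus>\<^bsub>obj Y i\<^esub> \<ominus>\<^bsub>obj Y i\<^esub> f i (h i x)" for i x
  have fh: "(\<lambda>x. f i (h i x)) \<in> module_homs R (obj V i) (obj Y i)" for i
    by (rule module_homs_comp[OF hh chain_maps_hom[OF f]])
  have y: "y \<in> chain_maps R V Y"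
  proof (rule chain_mapsI)
    show "y i \<in> module_homs R (obj V i) (obj Y i)" for i
      unfolding y_def by (intro module_homs_add_map module_homs_neg_map v2 fh) (use Y in simp_all)
    fix i x assume x: "x \<in> carrier (obj V i)"
    have dx: "diff V i x \<in> carrier (obj V (i + 1))" using x V by simp
    have c: "f (i + 1) (h (i + 1) (diff V i x)) \<in> carrier (obj Y (i + 1))"
      "diff Y i (f i (h i x)) \<in> carrier (obj Y (i + 1))" "f i (h i x) \<in> carrier (obj Y i)"
      "diff Y i (snd (v i x)) \<in> carrier (obj Y (i + 1))" "snd (v i x) \<in> carrier (obj Y i)"
      using hc x dx f Y vc by simp_all
    have "f (i + 1) (fst (v i x)) = \<ominus>\<^bsub>obj Y (i + 1)\<^esub> diff Y i (f i (h i x))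
        \<oplus>\<^bsub>obj Y (i + 1)\<^esub> f (i + 1) (h (i + 1) (diff V i x))"
      using e1[OF x] hc[OF x] hc[OF dx] f X Y by simp
    then show "y (i + 1) (diff V i x) = diff Y i (y i x)"
      using c(3-) Y by (simp add: y_def vd[OF x]) (insert c, algebra)
  qed
  have iy: "cone_incl X \<bullet> y \<in> chain_maps R V (cone X Y f)"
    by (rule comp_chain[OF y cone_incl_chain[OF X Y f]])
  have k: "(\<lambda>i x. (h i x, \<zero>\<^bsub>obj Y (i - 1)\<^esub>)) \<in> graded_maps R (-1) V (cone X Y f)"
    by (rule gmI, rule module_homsI) (use Y hc in \<open>simp_all add: module_homs_simps(2,3)[OF hh]\<close>)
  have "homotopic R V (cone X Y f) v (cone_incl X \<bullet> y)"
  proof (rule homotopicI[OF V _ v iy k])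
    fix i x assume x: "x \<in> carrier (obj V i)"
    have dx: "diff V i x \<in> carrier (obj V (i + 1))" using x V by simp
    have c: "f i (h i x) \<in> carrier (obj Y i)" "snd (v i x) \<in> carrier (obj Y i)"
      using hc x dx f Y vc by simp_all
    then have "snd (v i x) = snd (v i x) \<oplus>\<^bsub>obj Y i\<^esub> \<ominus>\<^bsub>obj Y i\<^esub> f i (h i x) \<oplus>\<^bsub>obj Y i\<^esub> f i (h i x)"
      by algebra
    then show "v i x = (cone_incl X \<bullet> y) i x \<oplus>\<^bsub>obj (cone X Y f) i\<^esub>
        (diff (cone X Y f) (i - 1) (h i x, \<zero>\<^bsub>obj Y (i - 1)\<^esub>) \<oplus>\<^bsub>obj (cone X Y f) i\<^esub>
          (h (i + 1) (diff V i x), \<zero>\<^bsub>obj Y (i + 1 - 1)\<^esub>))"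
      using hc[OF x] hc[OF dx] c X Y e1[OF x] by (cases "v i x") (simp add: y_def)
  qed (use assms in simp)
  then have "K_eq R V (cone X Y f) v (cone_incl X \<bullet> y)"
    by (rule K_eqI) (use iy assms in simp_all)
  with y show thesis by (rule that)
qed

lemma hom_null_cone_left:
  assumes X: "cochain_complex R X" and Y: "cochain_complex R Y" and W: "cochain_complex R W"
    and f: "f \<in> chain_maps R X Y" and "hom_null R Y W" and "hom_null R (shift X 1) W"
  shows "hom_null R (cone X Y f) W"
proof (rule hom_nullI)
  fix u assume u: "u \<in> chain_maps R (cone X Y f) W"
  have "K_eq R Y W (u \<bullet> cone_incl X) (zero_map W)"
    by (rule hom_nullD) (use assms comp_chain[OF cone_incl_chain[OF X Y f] u] in simp_all)
  then obtain b where b: "b \<in> chain_maps R (shift X 1) W" "K_eq R (cone X Y f) W u (b \<bullet> cone_proj)"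
    using cone_factor_left[OF X Y W f u] by blast
  have "K_eq R (cone X Y f) W (b \<bullet> cone_proj) (zero_map W)"
    by (rule K_eq_zero_comp[OF hom_nullD[OF assms(6) b(1)]]) (use assms in simp_all)
  with b(2) show "K_eq R (cone X Y f) W u (zero_map W)" by (rule K_eq_trans)
qed

text \<open>A map into the cone comes from \<open>Y\<close>, there it comes from \<open>X\<close>
  through \<open>f\<close>, and \<open>f\<close> dies in the cone. Maps
  \<open>V \<rightarrow> Y\<close> may well be nonzero as long as they lift along \<open>f\<close>;
  this is what an approximation provides.\<close>

lemma hom_null_cone_right:
  assumes X: "cochain_complex R X" and Y: "cochain_complex R Y" and V: "cochain_complex R V"
    and f: "f \<in> chain_maps R X Y" and n: "hom_null R V (shift X 1)"
    and approx: "\<And>y. y \<in> chain_maps R V Y \<Longrightarrow> \<exists>x\<in>chain_maps R V X. K_eq R V Y y (f \<bullet> x)"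
  shows "hom_null R V (cone X Y f)"
proof (rule hom_nullI)
  fix v assume v: "v \<in> chain_maps R V (cone X Y f)"
  have "K_eq R V (shift X 1) (cone_proj \<bullet> v) (zero_map (shift X 1))"
    by (rule hom_nullD[OF n]) (use assms comp_chain[OF v cone_proj_chain[OF X Y f]] in simp_all)
  then obtain y where y: "y \<in> chain_maps R V Y" "K_eq R V (cone X Y f) v (cone_incl X \<bullet> y)"
    using cone_factor_right[OF X Y V f v] by blast
  obtain x where x: "x \<in> chain_maps R V X" "K_eq R V Y y (f \<bullet> x)"
    using approx[OF y(1)] by blast
  note y(2)
  also have "K_eq R V (cone X Y f) (cone_incl X \<bullet> y) (cone_incl X \<bullet> (f \<bullet> x))"
    by (rule K_eq_comp_left[OF x(2)]) (use assms in simp_all)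
  also have "K_eq R V (cone X Y f) (cone_incl X \<bullet> (f \<bullet> x)) (zero_map (cone X Y f))"
    using K_eq_zero_comp[OF cone_incl_null[OF X Y f] x(1) V] by (simp add: comp_assoc)
  finally show "K_eq R V (cone X Y f) v (zero_map (cone X Y f))" .
qed

text \<open>The map is \<open>(x, y) \<mapsto> (a x, b y - h x)\<close> with \<open>h\<close> the
  homotopy that fills the square. At both ends it agrees strictly with \<open>b\<close> and
  \<open>a\<close>, so that composites of such maps can be computed there although the map itself
  depends on the choice of \<open>h\<close>.\<close>

lemma cone_map:
  assumes X: "cochain_complex R X" and Y: "cochain_complex R Y" and f: "f \<in> chain_maps R X Y"
    and X': "cochain_complex R X'" and Y': "cochain_complex R Y'" and f': "f' \<in> chain_maps R X' Y'"
    and a: "a \<in> chain_maps R X X'" and b: "b \<in> chain_maps R Y Y'"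
    and sq: "K_eq R X Y' (f' \<bullet> a) (b \<bullet> f)"
  obtains F where "F \<in> chain_maps R (cone X Y f) (cone X' Y' f')"
    and "\<And>i y. y \<in> carrier (obj Y i) \<Longrightarrow> F i (\<zero>\<^bsub>obj X (i + 1)\<^esub>, y) = (\<zero>\<^bsub>obj X' (i + 1)\<^esub>, b i y)"
    and "\<And>i p. fst (F i p) = a (i + 1) (fst p)"
proof -
  interpret X: abelian_group "obj X i" for i using X by (rule cc_abelian)
  interpret Y': abelian_group "obj Y' i" for i using Y' by (rule cc_abelian)
  have [simp]: "i + 1 + 1 = i + 2" for i :: int by simp
  obtain h where h: "h \<in> graded_maps R (-1) X Y'"
    and e: "\<And>i x. x \<in> carrier (obj X i) \<Longrightarrow> (f' \<bullet> a) i x = (b \<bullet> f) i x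
       \<oplus>\<^bsub>obj Y' i\<^esub> (diff Y' (i - 1) (h i x) \<oplus>\<^bsub>obj Y' i\<^esub> h (i + 1) (diff X i x))"
    using homotopicE[OF K_eqD[OF sq]] by blast
  have hh: "h (i + 1) \<in> module_homs R (obj X (i + 1)) (obj Y' i)" for i
    using gm_hom[OF h, of i "i + 1"] by simp
  define F where "F i p = (a (i + 1) (fst p), b i (snd p) \<oplus>\<^bsub>obj Y' i\<^esub> \<ominus>\<^bsub>obj Y' i\<^esub> h (i + 1) (fst p))" for i p
  have 1: "(\<lambda>p. b i (snd p)) \<in> module_homs R (obj (cone X Y f) i) (obj Y' i)" for i
    by (rule module_homs_comp[OF _ chain_maps_hom[OF b]]) (rule module_homsI, auto)
  have 2: "(\<lambda>p. h (i + 1) (fst p)) \<in> module_homs R (obj (cone X Y f) i) (obj Y' i)" for i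
    by (rule module_homs_comp[OF _ hh]) (rule module_homsI, auto)
  have 3: "(\<lambda>p. a (i + 1) (fst p)) \<in> module_homs R (obj (cone X Y f) i) (obj X' (i + 1))" for i
    by (rule module_homs_comp[OF _ chain_maps_hom[OF a]]) (rule module_homsI, auto)
  note 4 = module_homs_add_map[OF 1 module_homs_neg_map[OF 2]]
  have F: "F \<in> chain_maps R (cone X Y f) (cone X' Y' f')"
  proof (rule chain_mapsI)
    show "F i \<in> module_homs R (obj (cone X Y f) i) (obj (cone X' Y' f') i)" for i
      unfolding F_def cone_obj[of X' Y' f'] by (rule module_homs_pair[OF 3 4]) (use Y' in simp_all)
    fix i p assume "p \<in> carrier (obj (cone X Y f) i)"
    then obtain x y where [simp]: "p = (x, y)"
      and x: "x \<in> carrier (obj X (i + 1))" and y: "y \<in> carrier (obj Y i)" by auto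
    have c: "diff Y' i (h (i + 1) x) \<in> carrier (obj Y' (i + 1))"
      "h (i + 2) (diff X (i + 1) x) \<in> carrier (obj Y' (i + 1))"
      "diff Y' i (b i y) \<in> carrier (obj Y' (i + 1))" "b (i + 1) (f (i + 1) x) \<in> carrier (obj Y' (i + 1))"
      "h (i + 1) x \<in> carrier (obj Y' i)" "b i y \<in> carrier (obj Y' i)"
      using x y h X Y' b f by simp_all
    have n: "h (i + 2) (\<ominus>\<^bsub>obj X (i + 2)\<^esub> diff X (i + 1) x) = \<ominus>\<^bsub>obj Y' (i + 1)\<^esub> h (i + 2) (diff X (i + 1) x)"
      using module_homs_neg[OF hh[of "i + 1"]] x X Y' by simp
    have n': "a (i + 2) (\<ominus>\<^bsub>obj X (i + 2)\<^esub> diff X (i + 1) x) = \<ominus>\<^bsub>obj X' (i + 2)\<^esub> diff X' (i + 1) (a (i + 1) x)"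
      using a x X X' by simp
    have n'': "b (i + 1) (f (i + 1) x \<oplus>\<^bsub>obj Y (i + 1)\<^esub> diff Y i y)
        = b (i + 1) (f (i + 1) x) \<oplus>\<^bsub>obj Y' (i + 1)\<^esub> diff Y' i (b i y)"
      using b f x y Y by simp
    have e': "f' (i + 1) (a (i + 1) x) = b (i + 1) (f (i + 1) x)
       \<oplus>\<^bsub>obj Y' (i + 1)\<^esub> (diff Y' i (h (i + 1) x) \<oplus>\<^bsub>obj Y' (i + 1)\<^esub> h (i + 2) (diff X (i + 1) x))"
      using e[OF x] by simp
    have n3: "diff Y' i (b i y \<oplus>\<^bsub>obj Y' i\<^esub> \<ominus>\<^bsub>obj Y' i\<^esub> h (i + 1) x)
        = diff Y' i (b i y) \<oplus>\<^bsub>obj Y' (i + 1)\<^esub> \<ominus>\<^bsub>obj Y' (i + 1)\<^esub> diff Y' i (h (i + 1) x)"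
      using c Y' by simp
    show "F (i + 1) (diff (cone X Y f) i p) = diff (cone X' Y' f') i (F i p)"
      unfolding F_def using c by (simp add: n n' n'' e' n3) algebra
  qed
  have "F i (\<zero>\<^bsub>obj X (i + 1)\<^esub>, y) = (\<zero>\<^bsub>obj X' (i + 1)\<^esub>, b i y)" if "y \<in> carrier (obj Y i)" for i y
    using that X X' Y' a b module_homs_zero[OF hh] by (simp add: F_def)
  moreover have "fst (F i p) = a (i + 1) (fst p)" for i p
    unfolding F_def by simp
  ultimately show thesis using F that by blast
qed

end

section \<open>Finitely generated projective modules\<close>

lemma (in abelian_monoid) finsum_swap:
  assumes "finite I" "finite J" "\<And>i j. \<lbrakk>i \<in> I; j \<in> J\<rbrakk> \<Longrightarrow> f i j \<in> carrier G"
  shows "(\<Oplus>i\<in>I. \<Oplus>j\<in>J. f i j) = (\<Oplus>j\<in>J. \<Oplus>i\<in>I. f i j)"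
  using assms
proof (induction I rule: finite_induct)
  case empty
  then show ?case by (simp add: finsum_zero)
next
  case (insert a I)
  have "(\<Oplus>i\<in>insert a I. \<Oplus>j\<in>J. f i j) = (\<Oplus>j\<in>J. f a j) \<oplus> (\<Oplus>j\<in>J. \<Oplus>i\<in>I. f i j)"
    using insert by (subst finsum_insert) (auto intro!: finsum_closed)
  also have "\<dots> = (\<Oplus>j\<in>J. f a j \<oplus> (\<Oplus>i\<in>I. f i j))"
    using insert by (intro finsum_addf[symmetric]) (auto intro!: finsum_closed)
  also have "\<dots> = (\<Oplus>j\<in>J. \<Oplus>i\<in>insert a I. f i j)"
    using insert by (intro finsum_cong') (auto intro!: finsum_closed finsum_insert[symmetric])
  finally show ?case .
qed

lemma (in abelian_monoid) finsum_additive: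
  assumes "abelian_monoid H" "finite J" "x \<in> J \<rightarrow> carrier G"
    and "\<And>a. a \<in> carrier G \<Longrightarrow> f a \<in> carrier H"
    and "\<And>a b. \<lbrakk>a \<in> carrier G; b \<in> carrier G\<rbrakk> \<Longrightarrow> f (a \<oplus> b) = f a \<oplus>\<^bsub>H\<^esub> f b"
    and "f \<zero> = \<zero>\<^bsub>H\<^esub>"
  shows "f (\<Oplus>j\<in>J. x j) = (\<Oplus>\<^bsub>H\<^esub>j\<in>J. f (x j))"
proof -
  interpret H: abelian_monoid H by fact
  show ?thesis
    using assms(2,3)
  proof (induction J rule: finite_induct)
    case empty
    then show ?case using assms(6) by (simp add: H.finsum_empty)
  next
    case (insert a J)
    then have "f (\<Oplus>j\<in>insert a J. x j) = f (x a) \<oplus>\<^bsub>H\<^esub> (\<Oplus>\<^bsub>H\<^esub>j\<in>J. f (x j))"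
      by (subst finsum_insert) (auto simp: assms(5))
    also have "\<dots> = (\<Oplus>\<^bsub>H\<^esub>j\<in>insert a J. f (x j))"
      using insert by (subst H.finsum_insert) (auto simp: Pi_iff intro!: assms(4))
    finally show ?case .
  qed
qed

text \<open>The data of the dual basis lemma: generators and coordinate functionals, without
  independence. Lifts and traces are finite sums over it, whereas a complement in a free module
  would give no formula for them.\<close>

definition dual_basis ::
    "('r, 'z) ring_scheme \<Rightarrow> ('r, 'm) module \<Rightarrow> nat \<Rightarrow> (nat \<Rightarrow> 'm) \<Rightarrow> (nat \<Rightarrow> 'm \<Rightarrow> 'r) \<Rightarrow> bool" where
  "dual_basis R M n x \<xi> \<longleftrightarrow>
     (\<forall>q<n. x q \<in> carrier M \<and> \<xi> q \<in> module_homs R M (regular R)) \<and>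
     (\<forall>y\<in>carrier M. y = (\<Oplus>\<^bsub>M\<^esub>q\<in>{..<n}. \<xi> q y \<odot>\<^bsub>M\<^esub> x q))"

context ring begin

lemma regular_simps [simp]:
  "carrier (regular R) = carrier R" "\<zero>\<^bsub>regular R\<^esub> = \<zero>" "x \<oplus>\<^bsub>regular R\<^esub> y = x \<oplus> y"
  "r \<odot>\<^bsub>regular R\<^esub> x = x \<otimes> r"
  by (simp_all add: regular_def)

lemma module_homs_finsum:
  assumes f: "f \<in> module_homs R M N" and M: "right_module R M" and N: "right_module R N"
    and "finite J" "x \<in> J \<rightarrow> carrier M"
  shows "f (\<Oplus>\<^bsub>M\<^esub>j\<in>J. x j) = (\<Oplus>\<^bsub>N\<^esub>j\<in>J. f (x j))"
proof -
  interpret M: right_module R M by fact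
  interpret N: right_module R N by fact
  show ?thesis
    by (rule M.M.finsum_additive)
      (use assms N.M.abelian_monoid_axioms in \<open>auto simp: module_homs_simps(1,2,4)[OF f]\<close>)
qed

lemma module_homs_scale:
  assumes \<xi>: "\<xi> \<in> module_homs R M (regular R)" and N: "right_module R N" and z: "z \<in> carrier N"
  shows "(\<lambda>y. \<xi> y \<odot>\<^bsub>N\<^esub> z) \<in> module_homs R M N"
proof (rule module_homsI)
  show "\<xi> (x \<oplus>\<^bsub>M\<^esub> y) \<odot>\<^bsub>N\<^esub> z = \<xi> x \<odot>\<^bsub>N\<^esub> z \<oplus>\<^bsub>N\<^esub> \<xi> y \<odot>\<^bsub>N\<^esub> z"
    if "x \<in> carrier M" "y \<in> carrier M" for x y
    unfolding module_homs_add[OF \<xi> that]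
    using module_homs_closed[OF \<xi>] that z N by (simp add: rm_eqs)
  show "\<xi> (r \<odot>\<^bsub>M\<^esub> x) \<odot>\<^bsub>N\<^esub> z = r \<odot>\<^bsub>N\<^esub> (\<xi> x \<odot>\<^bsub>N\<^esub> z)" if "r \<in> carrier R" "x \<in> carrier M" for r x
    unfolding module_homs_act[OF \<xi> that]
    using module_homs_closed[OF \<xi>] that z N by (simp add: rm_eqs)
qed (use module_homs_closed[OF \<xi>] z N in simp)

lemma module_homs_cong:
  assumes "f \<in> module_homs R M N" "right_module R M" "\<And>x. x \<in> carrier M \<Longrightarrow> f x = g x"
  shows "g \<in> module_homs R M N"
proof (rule module_homsI)
  show "g x \<in> carrier N" if "x \<in> carrier M" for x
    using module_homs_closed[OF assms(1)] assms(3) that by metis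
  show "g (x \<oplus>\<^bsub>M\<^esub> y) = g x \<oplus>\<^bsub>N\<^esub> g y" if "x \<in> carrier M" "y \<in> carrier M" for x y
    using module_homs_add[OF assms(1)] assms(2,3) that rm_simps(2) by metis
  show "g (r \<odot>\<^bsub>M\<^esub> x) = r \<odot>\<^bsub>N\<^esub> g x" if "r \<in> carrier R" "x \<in> carrier M" for r x
    using module_homs_act[OF assms(1)] assms(2,3) that rm_simps(5) by metis
qed

lemma module_homs_sum_map:
  assumes "finite J" and f: "\<And>j. j \<in> J \<Longrightarrow> f j \<in> module_homs R M N"
    and M: "right_module R M" and N: "right_module R N"
  shows "(\<lambda>y. \<Oplus>\<^bsub>N\<^esub>j\<in>J. f j y) \<in> module_homs R M N"
  using assms(1,2)
proof (induction J rule: finite_induct)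
  case empty
  interpret N: right_module R N by fact
  show ?case using module_homs_zero_map[OF N] by (simp add: N.M.finsum_empty)
next
  case (insert a J)
  interpret N: right_module R N by fact
  have "(\<lambda>y. f a y \<oplus>\<^bsub>N\<^esub> (\<Oplus>\<^bsub>N\<^esub>j\<in>J. f j y)) \<in> module_homs R M N"
    by (rule module_homs_add_map) (use insert N in auto)
  moreover have "f a y \<oplus>\<^bsub>N\<^esub> (\<Oplus>\<^bsub>N\<^esub>j\<in>J. f j y) = (\<Oplus>\<^bsub>N\<^esub>j\<in>insert a J. f j y)" if "y \<in> carrier M" for y
    by (rule N.M.finsum_insert[symmetric])
      (use insert that in \<open>auto intro!: module_homs_closed[of "f _" M N]\<close>)
  ultimately show ?case by (rule module_homs_cong[OF _ M])
qed

lemma dual_basisD: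
  assumes "dual_basis R M n x \<xi>"
  shows "q < n \<Longrightarrow> x q \<in> carrier M" "q < n \<Longrightarrow> \<xi> q \<in> module_homs R M (regular R)"
    "\<lbrakk>q < n; y \<in> carrier M\<rbrakk> \<Longrightarrow> \<xi> q y \<in> carrier R"
    "y \<in> carrier M \<Longrightarrow> (\<Oplus>\<^bsub>M\<^esub>q\<in>{..<n}. \<xi> q y \<odot>\<^bsub>M\<^esub> x q) = y"
  using assms module_homs_closed[of "\<xi> q" M "regular R" y] by (auto simp: dual_basis_def)

text \<open>Only the images of the finitely many generators are lifted by choice; the coordinate
  functionals extend the choice to a homomorphism.\<close>

lemma dual_basis_lift:
  assumes b: "dual_basis R M n x \<xi>" and M: "right_module R M"
    and N: "right_module R N" and L: "right_module R L"
    and p: "p \<in> module_homs R N L" and f: "f \<in> module_homs R M L" and "f ` carrier M \<subseteq> p ` carrier N"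
  obtains g where "g \<in> module_homs R M N" "\<And>y. y \<in> carrier M \<Longrightarrow> p (g y) = f y"
proof -
  interpret N: right_module R N by fact
  interpret L: right_module R L by fact
  note d = dual_basisD[OF b]
  have "\<forall>q. \<exists>z. q < n \<longrightarrow> z \<in> carrier N \<and> p z = f (x q)"
    using d(1) assms(7) by (auto simp: image_subset_iff) (metis imageE)
  then obtain z where z: "\<And>q. q < n \<Longrightarrow> z q \<in> carrier N \<and> p (z q) = f (x q)" by metis
  define g where "g y = (\<Oplus>\<^bsub>N\<^esub>q\<in>{..<n}. \<xi> q y \<odot>\<^bsub>N\<^esub> z q)" for y
  have "g \<in> module_homs R M N"
    unfolding g_def by (rule module_homs_sum_map) (use d z M N in \<open>auto intro: module_homs_scale\<close>)
  moreover have "p (g y) = f y" if y: "y \<in> carrier M" for y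
  proof -
    have "p (g y) = (\<Oplus>\<^bsub>L\<^esub>q\<in>{..<n}. p (\<xi> q y \<odot>\<^bsub>N\<^esub> z q))"
      unfolding g_def by (rule module_homs_finsum[OF p N L]) (use d z N y in auto)
    also have "\<dots> = (\<Oplus>\<^bsub>L\<^esub>q\<in>{..<n}. f (\<xi> q y \<odot>\<^bsub>M\<^esub> x q))"
      by (rule L.M.finsum_cong')
        (use d z L M y in \<open>auto simp: module_homs_act[OF p] module_homs_act[OF f] module_homs_closed[OF f]\<close>)
    also have "\<dots> = f (\<Oplus>\<^bsub>M\<^esub>q\<in>{..<n}. \<xi> q y \<odot>\<^bsub>M\<^esub> x q)"
      by (rule module_homs_finsum[OF f M L, symmetric]) (use d M y in auto)
    finally show ?thesis using d(4)[OF y] by simp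
  qed
  ultimately show thesis by (rule that)
qed

lemma bij_module_inverse:
  assumes f: "f \<in> module_homs R M N" "bij_betw f (carrier M) (carrier N)"
    and M: "right_module R M"
  obtains g where "g \<in> module_homs R N M" "\<And>x. x \<in> carrier M \<Longrightarrow> g (f x) = x"
    "\<And>y. y \<in> carrier N \<Longrightarrow> f (g y) = y"
proof -
  define g where "g = inv_into (carrier M) f"
  have g: "g y \<in> carrier M" "f (g y) = y" if "y \<in> carrier N" for y
    using that f(2) unfolding g_def bij_betw_def
    by (auto intro: inv_into_into f_inv_into_f)
  have g': "g (f x) = x" if "x \<in> carrier M" for x
    using that f(2) unfolding g_def bij_betw_def by (auto intro: inv_into_f_f)
  have "g \<in> module_homs R N M"
  proof (rule module_homsI)
    fix x y assume "x \<in> carrier N" "y \<in> carrier N"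
    then show "g (x \<oplus>\<^bsub>N\<^esub> y) = g x \<oplus>\<^bsub>M\<^esub> g y"
      using module_homs_add[OF f(1), of "g x" "g y"] g M g'[of "g x \<oplus>\<^bsub>M\<^esub> g y"] by simp
  next
    fix r x assume "r \<in> carrier R" "x \<in> carrier N"
    then show "g (r \<odot>\<^bsub>N\<^esub> x) = r \<odot>\<^bsub>M\<^esub> g x"
      using module_homs_act[OF f(1), of r "g x"] g M g'[of "r \<odot>\<^bsub>M\<^esub> g x"] by simp
  qed (use g in simp)
  then show thesis by (rule that) (use g g' in auto)
qed

lemma power_regular_basis:
  assumes z: "z \<in> carrier (module_power (regular R) n)"
  shows "(\<Oplus>\<^bsub>module_power (regular R) n\<^esub>q\<in>{..<n}. z q \<odot>\<^bsub>module_power (regular R) n\<^esub>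
      (\<lambda>j\<in>{..<n}. if j = q then \<one> else \<zero>)) = z" (is "?s = z")
    and "(\<lambda>j\<in>{..<n}. if j = q then \<one> else \<zero>) \<in> carrier (module_power (regular R) n)"
proof -
  let ?F = "module_power (regular R) n"
  have F: "right_module R ?F" by (rule module_power_module[OF regular_module])
  interpret F: right_module R ?F by (rule F)
  interpret S: right_module R "regular R" by (rule regular_module)
  show e: "(\<lambda>j\<in>{..<n}. if j = q then \<one> else \<zero>) \<in> carrier ?F" for q
    by (simp add: module_power_carrier)
  have zc: "z q \<in> carrier R" if "q < n" for q using z that by (simp add: module_power_carrier)
  show "?s = z"
  proof (rule module_power_eqI)
    show "?s \<in> carrier ?F"
      using e zc F by (intro F.M.finsum_closed) auto
    fix j assume j: "j < n"
    have "?s j = (\<Oplus>\<^bsub>regular R\<^esub>q\<in>{..<n}. (z q \<odot>\<^bsub>?F\<^esub> (\<lambda>j\<in>{..<n}. if j = q then \<one> else \<zero>)) j)"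
      by (rule module_homs_finsum[OF module_power_proj[OF j] F regular_module]) (use e zc F in auto)
    also have "\<dots> = (\<Oplus>\<^bsub>regular R\<^esub>q\<in>{..<n}. if j = q then z q else \<zero>\<^bsub>regular R\<^esub>)"
      by (rule S.M.finsum_cong') (use j zc in auto)
    also have "\<dots> = z j"
      by (rule S.M.finsum_singleton) (use j zc in auto)
    finally show "?s j = z j" .
  qed (use z in simp)
qed

lemma dual_basis_retract:
  assumes b: "dual_basis R M n x \<xi>" and M: "right_module R M" and N: "right_module R N"
    and i: "i \<in> module_homs R N M" and p: "p \<in> module_homs R M N"
    and pi: "\<And>y. y \<in> carrier N \<Longrightarrow> p (i y) = y"
  shows "dual_basis R N n (\<lambda>q. p (x q)) (\<lambda>q y. \<xi> q (i y))"
  unfolding dual_basis_def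
proof (intro conjI allI impI ballI)
  note d = dual_basisD[OF b]
  interpret N: right_module R N by fact
  show "p (x q) \<in> carrier N" if "q < n" for q
    using d that module_homs_closed[OF p] by simp
  show "(\<lambda>y. \<xi> q (i y)) \<in> module_homs R N (regular R)" if "q < n" for q
    by (rule module_homs_comp[OF i d(2)[OF that]])
  fix y assume y: "y \<in> carrier N"
  have iy: "i y \<in> carrier M" using module_homs_closed[OF i y] .
  have "(\<Oplus>\<^bsub>N\<^esub>q\<in>{..<n}. \<xi> q (i y) \<odot>\<^bsub>N\<^esub> p (x q)) = (\<Oplus>\<^bsub>N\<^esub>q\<in>{..<n}. p (\<xi> q (i y) \<odot>\<^bsub>M\<^esub> x q))"
    by (rule N.M.finsum_cong')
      (use d M N iy in \<open>auto simp: module_homs_act[OF p] module_homs_closed[OF p]\<close>)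
  also have "\<dots> = p (\<Oplus>\<^bsub>M\<^esub>q\<in>{..<n}. \<xi> q (i y) \<odot>\<^bsub>M\<^esub> x q)"
    by (rule module_homs_finsum[OF p M N, symmetric]) (use d M iy in auto)
  also have "\<dots> = y" using d(4)[OF iy] pi[OF y] by simp
  finally show "y = (\<Oplus>\<^bsub>N\<^esub>q\<in>{..<n}. \<xi> q (i y) \<odot>\<^bsub>N\<^esub> p (x q))" ..
qed

lemma fg_projective_dual_basis:
  assumes "fg_projective R M"
  obtains n x \<xi> where "dual_basis R M n x \<xi>"
proof -
  have M: "right_module R M" using assms by (simp add: fg_projective_def)
  obtain n and N :: "('a, nat \<Rightarrow> 'a) module" and f
    where N: "right_module R N"
    and f: "f \<in> module_homs R (module_sum M N) (module_power (regular R) n)"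
      "bij_betw f (carrier (module_sum M N)) (carrier (module_power (regular R) n))"
    using assms unfolding fg_projective_def module_iso_def by blast
  let ?F = "module_power (regular R) n"
  have F: "right_module R ?F" by (rule module_power_module[OF regular_module])
  obtain g where g: "g \<in> module_homs R ?F (module_sum M N)"
    "\<And>x. x \<in> carrier (module_sum M N) \<Longrightarrow> g (f x) = x"
    by (rule bij_module_inverse[OF f module_sum_module[OF M N]]) simp
  have B: "dual_basis R ?F n (\<lambda>q. \<lambda>j\<in>{..<n}. if j = q then \<one> else \<zero>) (\<lambda>q z. z q)"
    unfolding dual_basis_def
    by (intro conjI allI impI ballI module_power_proj)
      (auto intro: power_regular_basis(2)[of "\<zero>\<^bsub>?F\<^esub>"] power_regular_basis(1)[symmetric] simp: F)
  have I: "(\<lambda>y. f (y, \<zero>\<^bsub>N\<^esub>)) \<in> module_homs R M ?F"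
    by (rule module_homs_comp[OF _ f(1)]) (rule module_homsI, use N in auto)
  have P: "(\<lambda>z. fst (g z)) \<in> module_homs R ?F M"
    by (rule module_homs_comp[OF g(1)]) (rule module_homsI, auto)
  have "dual_basis R M n (\<lambda>q. fst (g (\<lambda>j\<in>{..<n}. if j = q then \<one> else \<zero>)))
      (\<lambda>q y. f (y, \<zero>\<^bsub>N\<^esub>) q)"
    by (rule dual_basis_retract[OF B F M I P]) (use g(2) N in simp)
  then show thesis by (rule that)
qed

lemma submodule_kernel_module:
  assumes f: "f \<in> module_homs R M N" and M: "right_module R M" and N: "right_module R N"
  shows "right_module R (M\<lparr>carrier := {x \<in> carrier M. f x = \<zero>\<^bsub>N\<^esub>}\<rparr>)" (is "right_module R ?K")
proof (rule right_moduleI)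
  interpret M: right_module R M by fact
  show "abelian_group ?K"
  proof (rule abelian_groupI)
    fix x assume "x \<in> carrier ?K"
    then show "\<exists>y\<in>carrier ?K. y \<oplus>\<^bsub>?K\<^esub> x = \<zero>\<^bsub>?K\<^esub>"
      using M N by (intro bexI[of _ "\<ominus>\<^bsub>M\<^esub> x"]) (auto simp: module_homs_neg[OF f] M.M.l_neg)
  qed (use M N in \<open>auto simp: module_homs_add[OF f] module_homs_zero[OF f] M.M.a_ac\<close>)
qed (use M N in \<open>auto simp: module_homs_act[OF f] rm_act rm_eqs\<close>)

text \<open>The complement is the kernel of the projection of the free module onto \<open>M\<close>.\<close>

lemma dual_basis_fg_projective:
  assumes b: "dual_basis R M n x \<xi>" and M: "right_module R M"
  shows "fg_projective R M"
proof -
  note d = dual_basisD[OF b]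
  let ?F = "module_power (regular R) n"
  have F: "right_module R ?F" by (rule module_power_module[OF regular_module])
  define p where "p z = (\<Oplus>\<^bsub>M\<^esub>q\<in>{..<n}. z q \<odot>\<^bsub>M\<^esub> x q)" for z
  have p: "p \<in> module_homs R ?F M"
    unfolding p_def by (rule module_homs_sum_map)
      (use d M F in \<open>auto intro: module_homs_scale module_power_proj\<close>)
  define i where "i y = (\<lambda>q\<in>{..<n}. \<xi> q y)" for y
  have i: "i \<in> module_homs R M ?F"
    unfolding i_def by (rule module_homs_power[OF regular_module d(2)])
  have pi: "p (i y) = y" if "y \<in> carrier M" for y
  proof -
    interpret M: right_module R M by fact
    have "p (i y) = (\<Oplus>\<^bsub>M\<^esub>q\<in>{..<n}. \<xi> q y \<odot>\<^bsub>M\<^esub> x q)"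
      unfolding p_def by (rule M.M.finsum_cong') (use d M that in \<open>auto simp: i_def\<close>)
    then show ?thesis using d(4)[OF that] by simp
  qed
  let ?N = "?F\<lparr>carrier := {z \<in> carrier ?F. p z = \<zero>\<^bsub>M\<^esub>}\<rparr>"
  have N: "right_module R ?N" by (rule submodule_kernel_module[OF p F M])
  interpret F: right_module R ?F by (rule F)
  interpret M: right_module R M by (rule M)
  define f where "f u = i (fst u) \<oplus>\<^bsub>?F\<^esub> snd u" for u
  have "f \<in> module_homs R (module_sum M ?N) ?F"
    unfolding f_def
  proof (rule module_homs_add_map[OF _ _ F])
    show "(\<lambda>u. i (fst u)) \<in> module_homs R (module_sum M ?N) ?F"
      by (rule module_homs_comp[OF _ i]) (rule module_homsI, auto)
    show "snd \<in> module_homs R (module_sum M ?N) ?F"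
      by (rule module_homsI) auto
  qed
  moreover have "bij_betw f (carrier (module_sum M ?N)) (carrier ?F)"
  proof (rule bij_betw_byWitness[where f' = "\<lambda>z. (p z, z \<ominus>\<^bsub>?F\<^esub> i (p z))"])
    have "p (f u) = fst u" "f u \<ominus>\<^bsub>?F\<^esub> i (fst u) = snd u" if "u \<in> carrier (module_sum M ?N)" for u
    proof -
      have c: "i (fst u) \<in> carrier ?F" "snd u \<in> carrier ?F" "fst u \<in> carrier M" "p (snd u) = \<zero>\<^bsub>M\<^esub>"
        using that module_homs_closed[OF i] by (auto simp: mem_Times_iff)
      then show "p (f u) = fst u" using pi M by (simp add: f_def module_homs_add[OF p])
      show "f u \<ominus>\<^bsub>?F\<^esub> i (fst u) = snd u" using c(1,2) unfolding f_def by algebra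
    qed
    then show "\<forall>u\<in>carrier (module_sum M ?N). (p (f u), f u \<ominus>\<^bsub>?F\<^esub> i (p (f u))) = u" by simp
    have k: "p z \<in> carrier M" "i (p z) \<in> carrier ?F" "p (i (p z)) = p z" if "z \<in> carrier ?F" for z
      using that pi module_homs_closed[OF i] module_homs_closed[OF p] by simp_all
    show "\<forall>z\<in>carrier ?F. f (p z, z \<ominus>\<^bsub>?F\<^esub> i (p z)) = z"
    proof
      fix z assume "z \<in> carrier ?F"
      with k[OF this] show "f (p z, z \<ominus>\<^bsub>?F\<^esub> i (p z)) = z" unfolding f_def fst_conv snd_conv by algebra
    qed
    show "f ` carrier (module_sum M ?N) \<subseteq> carrier ?F"
      using F module_homs_closed[OF i] by (auto simp: f_def)
    show "(\<lambda>z. (p z, z \<ominus>\<^bsub>?F\<^esub> i (p z))) ` carrier ?F \<subseteq> carrier (module_sum M ?N)"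
      using k F M by (auto simp: module_homs_minus[OF p F M])
  qed
  ultimately have "module_iso R (module_sum M ?N) ?F" unfolding module_iso_def by blast
  then show ?thesis using M N unfolding fg_projective_def by blast
qed

lemma fg_projective_module: "fg_projective R M \<Longrightarrow> right_module R M"
  by (simp add: fg_projective_def)

lemma fg_projective_retract:
  assumes M: "fg_projective R M" and N: "right_module R N"
    and i: "i \<in> module_homs R N M" and p: "p \<in> module_homs R M N"
    and pi: "\<And>y. y \<in> carrier N \<Longrightarrow> p (i y) = y"
  shows "fg_projective R N"
  by (rule fg_projective_dual_basis[OF M])
    (rule dual_basis_fg_projective[OF dual_basis_retract[OF _ fg_projective_module[OF M] N i p pi] N])

lemma fg_projective_regular: "fg_projective R (regular R)"
proof (rule dual_basis_fg_projective[OF _ regular_module])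
  interpret S: right_module R "regular R" by (rule regular_module)
  show "dual_basis R (regular R) 1 (\<lambda>q. \<one>) (\<lambda>q y. y)"
    by (auto simp: dual_basis_def module_homs_id lessThan_Suc S.M.finsum_insert S.M.finsum_empty)
qed

lemma fg_projective_zero:
  assumes M: "right_module R M" and "carrier M = {\<zero>\<^bsub>M\<^esub>}"
  shows "fg_projective R M"
proof (rule dual_basis_fg_projective[OF _ M])
  interpret M: right_module R M by (rule M)
  show "dual_basis R M 0 (\<lambda>q. \<zero>\<^bsub>M\<^esub>) (\<lambda>q y. \<zero>)"
    using assms(2) by (auto simp: dual_basis_def M.M.finsum_empty)
qed

lemma fg_projective_sum:
  assumes M: "fg_projective R M" and N: "fg_projective R N"
  shows "fg_projective R (module_sum M N)"
proof -
  note [simp] = fg_projective_module[OF M] fg_projective_module[OF N]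
  let ?S = "module_sum M N"
  have S: "right_module R ?S" by (simp add: module_sum_module)
  interpret S: right_module R ?S by (rule S)
  obtain m x \<xi> where b: "dual_basis R M m x \<xi>" using fg_projective_dual_basis[OF M] .
  obtain n y \<eta> where c: "dual_basis R N n y \<eta>" using fg_projective_dual_basis[OF N] .
  note b = dual_basisD[OF b] and c = dual_basisD[OF c]
  define z where "z q = (if q < m then (x q, \<zero>\<^bsub>N\<^esub>) else (\<zero>\<^bsub>M\<^esub>, y (q - m)))" for q
  define \<zeta> where "\<zeta> q u = (if q < m then \<xi> q (fst u) else \<eta> (q - m) (snd u))" for q u
  have 1: "(\<lambda>u. \<xi> q (fst u)) \<in> module_homs R ?S (regular R)" if "q < m" for q
    by (rule module_homs_comp[OF _ b(2)[OF that]]) (rule module_homsI, auto)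
  have 2: "(\<lambda>u. \<eta> q (snd u)) \<in> module_homs R ?S (regular R)" if "q < n" for q
    by (rule module_homs_comp[OF _ c(2)[OF that]]) (rule module_homsI, auto)
  have i1: "(\<lambda>u. (u, \<zero>\<^bsub>N\<^esub>)) \<in> module_homs R M ?S" by (rule module_homsI) auto
  have i2: "(\<lambda>u. (\<zero>\<^bsub>M\<^esub>, u)) \<in> module_homs R N ?S" by (rule module_homsI) auto
  \<comment> \<open>The two bases are concatenated: indices below \<open>m\<close> belong to
    \<open>M\<close>, and \<open>m + q\<close> is the index of the \<open>q\<close>-th generator of
    \<open>N\<close>.\<close>
  have "dual_basis R ?S (m + n) z \<zeta>"
    unfolding dual_basis_def
  proof (intro conjI allI impI ballI)
    fix q assume "q < m + n"
    then show "z q \<in> carrier ?S" using b(1) c(1)[of "q - m"] by (auto simp: z_def)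
    show "\<zeta> q \<in> module_homs R ?S (regular R)"
      using 1[of q] 2[of "q - m"] \<open>q < m + n\<close> by (cases "q < m") (simp_all add: \<zeta>_def[abs_def])
  next
    fix u assume u: "u \<in> carrier ?S"
    obtain v w where [simp]: "u = (v, w)" and v: "v \<in> carrier M" and w: "w \<in> carrier N" using u by auto
    let ?t = "\<lambda>q. \<zeta> q u \<odot>\<^bsub>?S\<^esub> z q"
    have t1: "?t q = (\<xi> q v \<odot>\<^bsub>M\<^esub> x q, \<zero>\<^bsub>N\<^esub>)" if "q < m" for q
      using that b v by (simp add: z_def \<zeta>_def)
    have t2: "?t (q + m) = (\<zero>\<^bsub>M\<^esub>, \<eta> q w \<odot>\<^bsub>N\<^esub> y q)" if "q < n" for q
      using that c w by (simp add: z_def \<zeta>_def)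
    have cl: "?t q \<in> carrier ?S" if "q < m + n" for q
    proof (cases "q < m")
      case False
      then show ?thesis using t2[of "q - m"] that c w by simp
    qed (use t1 b v in simp)
    have "{..<m + n} = {..<m} \<union> (\<lambda>q. q + m) ` {..<n}"
    proof (intro equalityI subsetI)
      fix q assume "q \<in> {..<m + n}"
      then show "q \<in> {..<m} \<union> (\<lambda>q. q + m) ` {..<n}"
        by (cases "q < m") (auto simp: image_iff intro: bexI[of _ "q - m"])
    qed auto
    then have "(\<Oplus>\<^bsub>?S\<^esub>q\<in>{..<m + n}. ?t q) = (\<Oplus>\<^bsub>?S\<^esub>q\<in>{..<m}. ?t q) \<oplus>\<^bsub>?S\<^esub> (\<Oplus>\<^bsub>?S\<^esub>q\<in>(\<lambda>q. q + m) ` {..<n}. ?t q)"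
      using S.M.finsum_Un_disjoint[of "{..<m}" "(\<lambda>q. q + m) ` {..<n}" ?t] cl by auto
    also have "(\<Oplus>\<^bsub>?S\<^esub>q\<in>(\<lambda>q. q + m) ` {..<n}. ?t q) = (\<Oplus>\<^bsub>?S\<^esub>q\<in>{..<n}. ?t (q + m))"
      by (rule S.M.finsum_reindex) (use cl in \<open>auto intro: inj_onI\<close>)
    also have "\<dots> = (\<Oplus>\<^bsub>?S\<^esub>q\<in>{..<n}. (\<zero>\<^bsub>M\<^esub>, \<eta> q w \<odot>\<^bsub>N\<^esub> y q))"
      by (rule S.M.finsum_cong') (use t2 c w in auto)
    also have "\<dots> = (\<zero>\<^bsub>M\<^esub>, w)"
      using module_homs_finsum[OF i2, of "{..<n}" "\<lambda>q. \<eta> q w \<odot>\<^bsub>N\<^esub> y q"] S c w by (simp add: Pi_def)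
    also have "(\<Oplus>\<^bsub>?S\<^esub>q\<in>{..<m}. ?t q) = (\<Oplus>\<^bsub>?S\<^esub>q\<in>{..<m}. (\<xi> q v \<odot>\<^bsub>M\<^esub> x q, \<zero>\<^bsub>N\<^esub>))"
      by (rule S.M.finsum_cong') (use t1 b v in auto)
    also have "\<dots> = (v, \<zero>\<^bsub>N\<^esub>)"
      using module_homs_finsum[OF i1, of "{..<m}" "\<lambda>q. \<xi> q v \<odot>\<^bsub>M\<^esub> x q"] S b v by (simp add: Pi_def)
    finally show "u = (\<Oplus>\<^bsub>?S\<^esub>q\<in>{..<m + n}. ?t q)" using v w by simp
  qed
  then show ?thesis by (rule dual_basis_fg_projective[OF _ S])
qed

end

lemma (in abelian_group) eq_if_minus_zero:
  assumes "x \<ominus> y = \<zero>" "x \<in> carrier G" "y \<in> carrier G"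
  shows "x = y"
proof -
  have "x = (x \<ominus> y) \<oplus> y" using assms(2,3) by algebra
  then show ?thesis using assms by simp
qed

section \<open>Symmetrizing forms\<close>

text \<open>The map \<open>\<iota>\<close> is the structure map of the algebra; scalars act on a right module through it.\<close>

locale symmetrizing_form = A: ring A + K: field K
  for A :: "('a, 'y) ring_scheme" and K :: "('k, 'z) ring_scheme" +
  fixes \<iota> :: "'k \<Rightarrow> 'a" and tr :: "'a \<Rightarrow> 'k"
  assumes iota_closed [simp]: "c \<in> carrier K \<Longrightarrow> \<iota> c \<in> carrier A"
    and iota_one: "\<iota> \<one>\<^bsub>K\<^esub> = \<one>\<^bsub>A\<^esub>"
    and iota_add: "\<lbrakk>c \<in> carrier K; d \<in> carrier K\<rbrakk> \<Longrightarrow> \<iota> (c \<oplus>\<^bsub>K\<^esub> d) = \<iota> c \<oplus>\<^bsub>A\<^esub> \<iota> d"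
    and iota_mult: "\<lbrakk>c \<in> carrier K; d \<in> carrier K\<rbrakk> \<Longrightarrow> \<iota> (c \<otimes>\<^bsub>K\<^esub> d) = \<iota> c \<otimes>\<^bsub>A\<^esub> \<iota> d"
    and iota_central: "\<lbrakk>c \<in> carrier K; a \<in> carrier A\<rbrakk> \<Longrightarrow> \<iota> c \<otimes>\<^bsub>A\<^esub> a = a \<otimes>\<^bsub>A\<^esub> \<iota> c"
    and form_closed [simp]: "a \<in> carrier A \<Longrightarrow> tr a \<in> carrier K"
    and form_add: "\<lbrakk>a \<in> carrier A; b \<in> carrier A\<rbrakk> \<Longrightarrow> tr (a \<oplus>\<^bsub>A\<^esub> b) = tr a \<oplus>\<^bsub>K\<^esub> tr b"
    and form_scale: "\<lbrakk>c \<in> carrier K; a \<in> carrier A\<rbrakk> \<Longrightarrow> tr (a \<otimes>\<^bsub>A\<^esub> \<iota> c) = c \<otimes>\<^bsub>K\<^esub> tr a"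
    and form_sym: "\<lbrakk>a \<in> carrier A; b \<in> carrier A\<rbrakk> \<Longrightarrow> tr (a \<otimes>\<^bsub>A\<^esub> b) = tr (b \<otimes>\<^bsub>A\<^esub> a)"
    and form_nondegenerate:
      "\<lbrakk>a \<in> carrier A; \<And>b. b \<in> carrier A \<Longrightarrow> tr (a \<otimes>\<^bsub>A\<^esub> b) = \<zero>\<^bsub>K\<^esub>\<rbrakk> \<Longrightarrow> a = \<zero>\<^bsub>A\<^esub>"
    and form_represents:
      "\<lbrakk>\<And>a. a \<in> carrier A \<Longrightarrow> g a \<in> carrier K;
        \<And>a b. \<lbrakk>a \<in> carrier A; b \<in> carrier A\<rbrakk> \<Longrightarrow> g (a \<oplus>\<^bsub>A\<^esub> b) = g a \<oplus>\<^bsub>K\<^esub> g b;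
        \<And>c a. \<lbrakk>c \<in> carrier K; a \<in> carrier A\<rbrakk> \<Longrightarrow> g (a \<otimes>\<^bsub>A\<^esub> \<iota> c) = c \<otimes>\<^bsub>K\<^esub> g a\<rbrakk>
       \<Longrightarrow> \<exists>b\<in>carrier A. \<forall>a\<in>carrier A. g a = tr (b \<otimes>\<^bsub>A\<^esub> a)"
begin

lemma iota_zero: "\<iota> \<zero>\<^bsub>K\<^esub> = \<zero>\<^bsub>A\<^esub>"
  using iota_add[of "\<zero>\<^bsub>K\<^esub>" "\<zero>\<^bsub>K\<^esub>"] A.add.l_cancel_one'[of "\<iota> \<zero>\<^bsub>K\<^esub>" "\<iota> \<zero>\<^bsub>K\<^esub>"] by simp

lemma iota_neg: "c \<in> carrier K \<Longrightarrow> \<iota> (\<ominus>\<^bsub>K\<^esub> c) = \<ominus>\<^bsub>A\<^esub> \<iota> c"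
  using iota_add[of "\<ominus>\<^bsub>K\<^esub> c" c] by (simp add: K.l_neg iota_zero A.minus_equality)

lemma form_zero: "tr \<zero>\<^bsub>A\<^esub> = \<zero>\<^bsub>K\<^esub>"
  using form_scale[of "\<zero>\<^bsub>K\<^esub>" "\<zero>\<^bsub>A\<^esub>"] by simp

lemma form_neg: "a \<in> carrier A \<Longrightarrow> tr (\<ominus>\<^bsub>A\<^esub> a) = \<ominus>\<^bsub>K\<^esub> tr a"
  using form_add[of "\<ominus>\<^bsub>A\<^esub> a" a] by (simp add: A.l_neg form_zero K.minus_equality)

lemma form_finsum:
  "\<lbrakk>finite J; x \<in> J \<rightarrow> carrier A\<rbrakk> \<Longrightarrow> tr (\<Oplus>\<^bsub>A\<^esub>j\<in>J. x j) = (\<Oplus>\<^bsub>K\<^esub>j\<in>J. tr (x j))"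
  by (rule A.finsum_additive) (auto simp: form_add form_zero K.abelian_monoid_axioms)

definition functional :: "('a, 'm) module \<Rightarrow> ('m \<Rightarrow> 'k) \<Rightarrow> bool" where
  "functional N \<phi> \<longleftrightarrow> (\<forall>x\<in>carrier N. \<phi> x \<in> carrier K) \<and>
     (\<forall>x\<in>carrier N. \<forall>y\<in>carrier N. \<phi> (x \<oplus>\<^bsub>N\<^esub> y) = \<phi> x \<oplus>\<^bsub>K\<^esub> \<phi> y) \<and>
     (\<forall>c\<in>carrier K. \<forall>x\<in>carrier N. \<phi> (\<iota> c \<odot>\<^bsub>N\<^esub> x) = c \<otimes>\<^bsub>K\<^esub> \<phi> x)"

text \<open>Functionals on subspaces of \<open>N\<close>, as graphs, so that Zorn's lemma applies to inclusion.\<close>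

definition functional_graph :: "('a, 'm) module \<Rightarrow> ('m \<times> 'k) set \<Rightarrow> bool" where
  "functional_graph N g \<longleftrightarrow> g \<subseteq> carrier N \<times> carrier K \<and> (\<zero>\<^bsub>N\<^esub>, \<zero>\<^bsub>K\<^esub>) \<in> g \<and>
     (\<forall>x c y d. (x, c) \<in> g \<longrightarrow> (y, d) \<in> g \<longrightarrow> (x \<oplus>\<^bsub>N\<^esub> y, c \<oplus>\<^bsub>K\<^esub> d) \<in> g) \<and>
     (\<forall>t\<in>carrier K. \<forall>x c. (x, c) \<in> g \<longrightarrow> (\<iota> t \<odot>\<^bsub>N\<^esub> x, t \<otimes>\<^bsub>K\<^esub> c) \<in> g) \<and>
     (\<forall>c. (\<zero>\<^bsub>N\<^esub>, c) \<in> g \<longrightarrow> c = \<zero>\<^bsub>K\<^esub>)"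

lemma functional_graphD:
  assumes "functional_graph N g"
  shows "(x, c) \<in> g \<Longrightarrow> x \<in> carrier N" "(x, c) \<in> g \<Longrightarrow> c \<in> carrier K" "(\<zero>\<^bsub>N\<^esub>, \<zero>\<^bsub>K\<^esub>) \<in> g"
    "\<lbrakk>(x, c) \<in> g; (y, d) \<in> g\<rbrakk> \<Longrightarrow> (x \<oplus>\<^bsub>N\<^esub> y, c \<oplus>\<^bsub>K\<^esub> d) \<in> g"
    "\<lbrakk>t \<in> carrier K; (x, c) \<in> g\<rbrakk> \<Longrightarrow> (\<iota> t \<odot>\<^bsub>N\<^esub> x, t \<otimes>\<^bsub>K\<^esub> c) \<in> g"
    "(\<zero>\<^bsub>N\<^esub>, c) \<in> g \<Longrightarrow> c = \<zero>\<^bsub>K\<^esub>"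
  using assms unfolding functional_graph_def by blast+

lemma scale_neg_one:
  assumes "right_module A N" "x \<in> carrier N"
  shows "\<iota> (\<ominus>\<^bsub>K\<^esub> \<one>\<^bsub>K\<^esub>) \<odot>\<^bsub>N\<^esub> x = \<ominus>\<^bsub>N\<^esub> x"
proof -
  interpret N: right_module A N by fact
  have "\<iota> (\<ominus>\<^bsub>K\<^esub> \<one>\<^bsub>K\<^esub>) \<odot>\<^bsub>N\<^esub> x \<oplus>\<^bsub>N\<^esub> \<one>\<^bsub>A\<^esub> \<odot>\<^bsub>N\<^esub> x = (\<iota> (\<ominus>\<^bsub>K\<^esub> \<one>\<^bsub>K\<^esub>) \<oplus>\<^bsub>A\<^esub> \<one>\<^bsub>A\<^esub>) \<odot>\<^bsub>N\<^esub> x"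
    using assms by (simp add: A.rm_eqs(1))
  also have "\<dots> = \<zero>\<^bsub>N\<^esub>"
    using assms N.act_add_ring[of "\<zero>\<^bsub>A\<^esub>" "\<zero>\<^bsub>A\<^esub>" x] N.M.add.l_cancel_one'[of "\<zero>\<^bsub>A\<^esub> \<odot>\<^bsub>N\<^esub> x" "\<zero>\<^bsub>A\<^esub> \<odot>\<^bsub>N\<^esub> x"]
    by (simp add: iota_neg iota_one A.l_neg)
  finally show ?thesis
    using assms by (simp add: A.rm_eqs(3) N.M.minus_equality)
qed

lemma functional_graph_neg:
  assumes "functional_graph N g" "right_module A N" "(x, c) \<in> g"
  shows "(\<ominus>\<^bsub>N\<^esub> x, \<ominus>\<^bsub>K\<^esub> c) \<in> g"
  using functional_graphD(5)[OF assms(1), of "\<ominus>\<^bsub>K\<^esub> \<one>\<^bsub>K\<^esub>", OF _ assms(3)] scale_neg_one[OF assms(2), of x]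
    functional_graphD(1,2)[OF assms(1,3)] by (simp add: K.l_minus)

text \<open>The extension step of a Hahn-Banach argument, without any bound to respect: the value at
  the new vector is free.\<close>

lemma functional_graph_step:
  assumes g: "functional_graph N g" and N: "right_module A N" and v: "v \<in> carrier N"
    and nv: "\<And>c. (v, c) \<notin> g"
  obtains g' where "functional_graph N g'" "g \<subseteq> g'" "\<exists>c. (v, c) \<in> g'"
proof -
  interpret N: right_module A N by fact
  note gD = functional_graphD[OF g]
  \<comment> \<open>The value at \<open>v\<close> is chosen to be zero, so adding a multiple of
    \<open>v\<close> leaves the value unchanged.\<close>
  define g' where "g' = {(w \<oplus>\<^bsub>N\<^esub> \<iota> t \<odot>\<^bsub>N\<^esub> v, c) |w c t. (w, c) \<in> g \<and> t \<in> carrier K}"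
  have z: "\<zero>\<^bsub>A\<^esub> \<odot>\<^bsub>N\<^esub> v = \<zero>\<^bsub>N\<^esub>"
    using N.act_add_ring[of "\<zero>\<^bsub>A\<^esub>" "\<zero>\<^bsub>A\<^esub>" v] N.M.add.l_cancel_one'[of "\<zero>\<^bsub>A\<^esub> \<odot>\<^bsub>N\<^esub> v" "\<zero>\<^bsub>A\<^esub> \<odot>\<^bsub>N\<^esub> v"] v N
    by simp
  have g'I: "(w \<oplus>\<^bsub>N\<^esub> \<iota> t \<odot>\<^bsub>N\<^esub> v, c) \<in> g'" if "(w, c) \<in> g" "t \<in> carrier K" for w c t
    using that unfolding g'_def by blast
  have sub: "g \<subseteq> g'"
  proof clarify
    fix w c assume w: "(w, c) \<in> g"
    show "(w, c) \<in> g'"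
      using g'I[OF w, of "\<zero>\<^bsub>K\<^esub>"] gD(1)[OF w] N by (simp add: iota_zero z)
  qed
  have "functional_graph N g'"
    unfolding functional_graph_def
  proof (intro conjI allI impI ballI)
    show "g' \<subseteq> carrier N \<times> carrier K"
      using gD(1,2) v N by (auto simp: g'_def)
    show "(\<zero>\<^bsub>N\<^esub>, \<zero>\<^bsub>K\<^esub>) \<in> g'" using sub gD(3) by blast
  next
    fix x c y d assume "(x, c) \<in> g'" "(y, d) \<in> g'"
    then obtain w t w' t' where e: "x = w \<oplus>\<^bsub>N\<^esub> \<iota> t \<odot>\<^bsub>N\<^esub> v" "y = w' \<oplus>\<^bsub>N\<^esub> \<iota> t' \<odot>\<^bsub>N\<^esub> v"
      and w: "(w, c) \<in> g" "(w', d) \<in> g" and t: "t \<in> carrier K" "t' \<in> carrier K"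
      by (auto simp: g'_def)
    have c: "w \<in> carrier N" "w' \<in> carrier N" "\<iota> t \<odot>\<^bsub>N\<^esub> v \<in> carrier N" "\<iota> t' \<odot>\<^bsub>N\<^esub> v \<in> carrier N"
      using w t v gD(1) N by auto
    have "x \<oplus>\<^bsub>N\<^esub> y = (w \<oplus>\<^bsub>N\<^esub> w') \<oplus>\<^bsub>N\<^esub> (\<iota> t \<odot>\<^bsub>N\<^esub> v \<oplus>\<^bsub>N\<^esub> \<iota> t' \<odot>\<^bsub>N\<^esub> v)"
      unfolding e by (rule A.rm_swap[OF N c(1,3,2,4)])
    also have "\<dots> = (w \<oplus>\<^bsub>N\<^esub> w') \<oplus>\<^bsub>N\<^esub> \<iota> (t \<oplus>\<^bsub>K\<^esub> t') \<odot>\<^bsub>N\<^esub> v"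
      using t v N by (simp add: iota_add A.rm_eqs(1))
    finally show "(x \<oplus>\<^bsub>N\<^esub> y, c \<oplus>\<^bsub>K\<^esub> d) \<in> g'"
      using g'I[OF gD(4)[OF w], of "t \<oplus>\<^bsub>K\<^esub> t'"] t by simp
  next
    fix s x c assume s: "s \<in> carrier K" and "(x, c) \<in> g'"
    then obtain w t where e: "x = w \<oplus>\<^bsub>N\<^esub> \<iota> t \<odot>\<^bsub>N\<^esub> v" and w: "(w, c) \<in> g" and t: "t \<in> carrier K"
      by (auto simp: g'_def)
    have "\<iota> s \<odot>\<^bsub>N\<^esub> x = \<iota> s \<odot>\<^bsub>N\<^esub> w \<oplus>\<^bsub>N\<^esub> \<iota> (t \<otimes>\<^bsub>K\<^esub> s) \<odot>\<^bsub>N\<^esub> v"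
      using s t v N gD(1)[OF w] by (simp add: e A.rm_act iota_mult A.rm_eqs(2))
    then show "(\<iota> s \<odot>\<^bsub>N\<^esub> x, s \<otimes>\<^bsub>K\<^esub> c) \<in> g'"
      using g'I[OF gD(5)[OF s w], of "t \<otimes>\<^bsub>K\<^esub> s"] s t by simp
  next
    fix c assume "(\<zero>\<^bsub>N\<^esub>, c) \<in> g'"
    then obtain w t where e: "w \<oplus>\<^bsub>N\<^esub> \<iota> t \<odot>\<^bsub>N\<^esub> v = \<zero>\<^bsub>N\<^esub>" and w: "(w, c) \<in> g" and t: "t \<in> carrier K"
      unfolding g'_def by (smt (verit) mem_Collect_eq prod.inject)
    have wc: "w \<in> carrier N" using gD(1)[OF w] .
    show "c = \<zero>\<^bsub>K\<^esub>"
    proof (cases "t = \<zero>\<^bsub>K\<^esub>")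
      case True
      then have "w = \<zero>\<^bsub>N\<^esub>" using e wc N by (simp add: iota_zero z)
      then show ?thesis using w gD(6) by blast
    next
      \<comment> \<open>A nontrivial multiple of \<open>v\<close> in the domain would put
        \<open>v\<close> itself there, since \<open>K\<close> is a field; this contradicts
        \<open>nv\<close>.\<close>
      case False
      then have i: "inv\<^bsub>K\<^esub> t \<in> carrier K" "t \<otimes>\<^bsub>K\<^esub> inv\<^bsub>K\<^esub> t = \<one>\<^bsub>K\<^esub>"
        using t K.field_Units by (auto simp: K.Units_r_inv)
      have "\<iota> t \<odot>\<^bsub>N\<^esub> v = \<ominus>\<^bsub>N\<^esub> w"
        using N.M.minus_equality[of "\<iota> t \<odot>\<^bsub>N\<^esub> v" w] N.M.a_comm[of w "\<iota> t \<odot>\<^bsub>N\<^esub> v"] e wc v t N by simp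
      then have "\<iota> (t \<otimes>\<^bsub>K\<^esub> inv\<^bsub>K\<^esub> t) \<odot>\<^bsub>N\<^esub> v = \<iota> (inv\<^bsub>K\<^esub> t) \<odot>\<^bsub>N\<^esub> (\<ominus>\<^bsub>N\<^esub> w)"
        using t i(1) v N by (simp add: iota_mult A.rm_eqs(2))
      then have "v = \<iota> (inv\<^bsub>K\<^esub> t) \<odot>\<^bsub>N\<^esub> (\<ominus>\<^bsub>N\<^esub> w)"
        using v N by (simp add: i(2) iota_one A.rm_eqs(3))
      then show ?thesis
        using gD(5)[OF i(1) functional_graph_neg[OF g N w]] nv by metis
    qed
  qed
  moreover have "(v, \<zero>\<^bsub>K\<^esub>) \<in> g'"
    using g'I[OF gD(3), of "\<one>\<^bsub>K\<^esub>"] v N by (simp add: iota_one A.rm_eqs(3))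
  ultimately show thesis using sub that by blast
qed

text \<open>\<open>N\<close> will be built from terms of an arbitrary complex and may have infinite
  dimension over \<open>K\<close>. A maximal graph exists by Zorn's lemma, and
  \<open>functional_graph_step\<close> shows that it is defined everywhere.\<close>

lemma functional_extension:
  assumes g: "functional_graph N g" and N: "right_module A N"
  obtains \<phi> where "functional N \<phi>" "\<And>x c. (x, c) \<in> g \<Longrightarrow> \<phi> x = c"
proof -
  interpret N: right_module A N by fact
  let ?S = "{g'. functional_graph N g' \<and> g \<subseteq> g'}"
  have "\<exists>M\<in>?S. \<forall>X\<in>?S. M \<subseteq> X \<longrightarrow> X = M"
  proof (rule subset_Zorn_nonempty)
    show "?S \<noteq> {}" using g by blast
    fix C assume ne: "C \<noteq> {}" and ch: "subset.chain ?S C"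
    have C: "functional_graph N X" "g \<subseteq> X" if "X \<in> C" for X
      using ch that unfolding subset.chain_def by blast+
    have 2: "\<exists>Z\<in>C. X \<subseteq> Z \<and> Y \<subseteq> Z" if "X \<in> C" "Y \<in> C" for X Y
    proof -
      have "X \<subseteq> Y \<or> Y \<subseteq> X" using ch that unfolding subset.chain_def by blast
      then show ?thesis using that by blast
    qed
    have "functional_graph N (\<Union>C)"
      unfolding functional_graph_def
    proof (intro conjI allI impI ballI)
      show "\<Union>C \<subseteq> carrier N \<times> carrier K" using C(1) unfolding functional_graph_def by blast
      obtain X where "X \<in> C" using ne by blast
      then show "(\<zero>\<^bsub>N\<^esub>, \<zero>\<^bsub>K\<^esub>) \<in> \<Union>C" using functional_graphD(3)[OF C(1)] by blast
    next
      fix x c y d assume "(x, c) \<in> \<Union>C" "(y, d) \<in> \<Union>C"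
      then obtain X Y where "X \<in> C" "Y \<in> C" "(x, c) \<in> X" "(y, d) \<in> Y" by blast
      moreover from 2[OF this(1,2)] obtain Z where "Z \<in> C" "X \<subseteq> Z" "Y \<subseteq> Z" by blast
      ultimately show "(x \<oplus>\<^bsub>N\<^esub> y, c \<oplus>\<^bsub>K\<^esub> d) \<in> \<Union>C"
        using functional_graphD(4)[OF C(1)[of Z], of x c y d] by blast
    next
      fix t x c assume t: "t \<in> carrier K" and "(x, c) \<in> \<Union>C"
      then obtain X where "X \<in> C" "(x, c) \<in> X" by blast
      then show "(\<iota> t \<odot>\<^bsub>N\<^esub> x, t \<otimes>\<^bsub>K\<^esub> c) \<in> \<Union>C"
        using functional_graphD(5)[OF C(1) t] by blast
    next
      fix c assume "(\<zero>\<^bsub>N\<^esub>, c) \<in> \<Union>C"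
      then obtain X where "X \<in> C" "(\<zero>\<^bsub>N\<^esub>, c) \<in> X" by blast
      then show "c = \<zero>\<^bsub>K\<^esub>" using functional_graphD(6)[OF C(1)] by blast
    qed
    then show "\<Union>C \<in> ?S" using ne C(2) by blast
  qed
  then obtain M where M': "M \<in> ?S" and mx': "\<forall>X\<in>?S. M \<subseteq> X \<longrightarrow> X = M" by (elim bexE)
  from M' have M: "functional_graph N M" "g \<subseteq> M" by auto
  have mx: "X = M" if "functional_graph N X" "M \<subseteq> X" for X
    using mx' that M(2) by auto
  note MD = functional_graphD[OF M(1)]
  have ex: "\<exists>c. (v, c) \<in> M" if "v \<in> carrier N" for v
  proof (rule ccontr)
    assume "\<not> ?thesis"
    then have "(v, c) \<notin> M" for c by blast
    from functional_graph_step[OF M(1) N that this] obtain g'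
      where g': "functional_graph N g'" "M \<subseteq> g'" "\<exists>c. (v, c) \<in> g'" .
    with mx[OF g'(1,2)] \<open>\<not> ?thesis\<close> show False by simp
  qed
  have un: "c = d" if "(x, c) \<in> M" "(x, d) \<in> M" for x c d
  proof -
    have "(x \<oplus>\<^bsub>N\<^esub> \<ominus>\<^bsub>N\<^esub> x, c \<oplus>\<^bsub>K\<^esub> \<ominus>\<^bsub>K\<^esub> d) \<in> M"
      by (rule MD(4)[OF that(1) functional_graph_neg[OF M(1) N that(2)]])
    then have "c \<oplus>\<^bsub>K\<^esub> \<ominus>\<^bsub>K\<^esub> d = \<zero>\<^bsub>K\<^esub>" using MD(6) MD(1)[OF that(1)] N by simp
    then show ?thesis
      using K.eq_if_minus_zero[of c d] MD(2)[OF that(1)] MD(2)[OF that(2)] by (simp add: K.minus_eq)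
  qed
  define \<phi> where "\<phi> x = (THE c. (x, c) \<in> M)" for x
  have \<phi>: "\<phi> x = c" if "(x, c) \<in> M" for x c
    unfolding \<phi>_def by (rule the_equality) (rule that, erule un[OF _ that])
  have "functional N \<phi>"
    unfolding functional_def
  proof (intro conjI ballI)
    fix x assume "x \<in> carrier N"
    then obtain c where c: "(x, c) \<in> M" using ex by blast
    then show "\<phi> x \<in> carrier K" using \<phi>[OF c] MD(2)[OF c] by simp
    show "\<phi> (\<iota> t \<odot>\<^bsub>N\<^esub> x) = t \<otimes>\<^bsub>K\<^esub> \<phi> x" if "t \<in> carrier K" for t
      using \<phi>[OF c] \<phi>[OF MD(5)[OF that c]] by simp
    fix y assume "y \<in> carrier N"
    then obtain d where d: "(y, d) \<in> M" using ex by blast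
    show "\<phi> (x \<oplus>\<^bsub>N\<^esub> y) = \<phi> x \<oplus>\<^bsub>K\<^esub> \<phi> y"
      using \<phi>[OF c] \<phi>[OF d] \<phi>[OF MD(4)[OF c d]] by simp
  qed
  moreover have "\<phi> x = c" if "(x, c) \<in> g" for x c
    using that M(2) \<phi> by blast
  ultimately show thesis by (rule that)
qed

text \<open>This is the adjunction between \<open>K\<close>-linear functionals on \<open>N\<close>
  and homomorphisms from \<open>N\<close> to the dual of \<open>A\<close>, combined with the
  identification of that dual with \<open>A\<close>: \<open>\<gamma> x\<close> is the element that
  represents \<open>a \<mapsto> \<phi> (x a)\<close>. Nondegeneracy makes it unique, and uniqueness
  makes \<open>\<gamma>\<close> linear.\<close>

lemma functional_represented:
  assumes \<phi>: "functional N \<phi>" and N: "right_module A N"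
  obtains \<gamma> where "\<gamma> \<in> module_homs A N (regular A)" "\<And>x. x \<in> carrier N \<Longrightarrow> \<phi> x = tr (\<gamma> x)"
proof -
  interpret N: right_module A N by fact
  have "\<exists>b\<in>carrier A. \<forall>a\<in>carrier A. \<phi> (a \<odot>\<^bsub>N\<^esub> x) = tr (b \<otimes>\<^bsub>A\<^esub> a)" if x: "x \<in> carrier N" for x
  proof (rule form_represents)
    show "\<phi> (a \<odot>\<^bsub>N\<^esub> x) \<in> carrier K" if "a \<in> carrier A" for a
      using \<phi> x that N unfolding functional_def by simp
    show "\<phi> ((a \<oplus>\<^bsub>A\<^esub> b) \<odot>\<^bsub>N\<^esub> x) = \<phi> (a \<odot>\<^bsub>N\<^esub> x) \<oplus>\<^bsub>K\<^esub> \<phi> (b \<odot>\<^bsub>N\<^esub> x)" if "a \<in> carrier A" "b \<in> carrier A" for a b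
      using \<phi> x that N unfolding functional_def by (simp add: A.rm_eqs(1))
    show "\<phi> ((a \<otimes>\<^bsub>A\<^esub> \<iota> c) \<odot>\<^bsub>N\<^esub> x) = c \<otimes>\<^bsub>K\<^esub> \<phi> (a \<odot>\<^bsub>N\<^esub> x)" if "c \<in> carrier K" "a \<in> carrier A" for c a
      using \<phi> x that N unfolding functional_def by (simp add: A.rm_eqs(2))
  qed
  then obtain \<gamma> where \<gamma>c: "\<And>x. x \<in> carrier N \<Longrightarrow> \<gamma> x \<in> carrier A"
    and \<gamma>: "\<And>x a. \<lbrakk>x \<in> carrier N; a \<in> carrier A\<rbrakk> \<Longrightarrow> \<phi> (a \<odot>\<^bsub>N\<^esub> x) = tr (\<gamma> x \<otimes>\<^bsub>A\<^esub> a)" by metis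
  have uniq: "b = c" if "b \<in> carrier A" "c \<in> carrier A"
    "\<And>a. a \<in> carrier A \<Longrightarrow> tr (b \<otimes>\<^bsub>A\<^esub> a) = tr (c \<otimes>\<^bsub>A\<^esub> a)" for b c
  proof -
    have "b \<ominus>\<^bsub>A\<^esub> c = \<zero>\<^bsub>A\<^esub>"
      by (rule form_nondegenerate)
        (use that in \<open>simp_all add: A.minus_eq A.l_distr A.l_minus form_add form_neg K.r_neg\<close>)
    then show ?thesis using that(1,2) by (rule A.eq_if_minus_zero)
  qed
  have "\<gamma> \<in> module_homs A N (regular A)"
  proof (rule module_homsI)
    show "\<gamma> (x \<oplus>\<^bsub>N\<^esub> y) = \<gamma> x \<oplus>\<^bsub>regular A\<^esub> \<gamma> y" if "x \<in> carrier N" "y \<in> carrier N" for x y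
      unfolding A.regular_simps
    proof (rule uniq)
      fix a assume a: "a \<in> carrier A"
      have "\<phi> (a \<odot>\<^bsub>N\<^esub> (x \<oplus>\<^bsub>N\<^esub> y)) = \<phi> (a \<odot>\<^bsub>N\<^esub> x) \<oplus>\<^bsub>K\<^esub> \<phi> (a \<odot>\<^bsub>N\<^esub> y)"
        using \<phi> that a N unfolding functional_def by (simp add: A.rm_act)
      then show "tr (\<gamma> (x \<oplus>\<^bsub>N\<^esub> y) \<otimes>\<^bsub>A\<^esub> a) = tr ((\<gamma> x \<oplus>\<^bsub>A\<^esub> \<gamma> y) \<otimes>\<^bsub>A\<^esub> a)"
        using that a N \<gamma>c by (simp add: \<gamma> A.l_distr form_add)
    qed (use that \<gamma>c N in simp_all)
    show "\<gamma> (r \<odot>\<^bsub>N\<^esub> x) = r \<odot>\<^bsub>regular A\<^esub> \<gamma> x" if "r \<in> carrier A" "x \<in> carrier N" for r x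
      unfolding A.regular_simps
    proof (rule uniq)
      fix a assume a: "a \<in> carrier A"
      have "\<phi> (a \<odot>\<^bsub>N\<^esub> (r \<odot>\<^bsub>N\<^esub> x)) = \<phi> ((r \<otimes>\<^bsub>A\<^esub> a) \<odot>\<^bsub>N\<^esub> x)"
        using that a N by (simp add: A.rm_eqs(2))
      then show "tr (\<gamma> (r \<odot>\<^bsub>N\<^esub> x) \<otimes>\<^bsub>A\<^esub> a) = tr ((\<gamma> x \<otimes>\<^bsub>A\<^esub> r) \<otimes>\<^bsub>A\<^esub> a)"
        using that a N \<gamma>c by (simp add: \<gamma> A.m_assoc)
    qed (use that \<gamma>c N in simp_all)
  qed (use \<gamma>c in simp)
  moreover have "\<phi> x = tr (\<gamma> x)" if "x \<in> carrier N" for x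
    using \<gamma>[OF that, of "\<one>\<^bsub>A\<^esub>"] that \<gamma>c N by (simp add: A.rm_eqs(3))
  ultimately show thesis by (rule that)
qed

end

lemma (in abelian_monoid) finsum_Sigma:
  assumes "finite I" "\<And>i. i \<in> I \<Longrightarrow> finite (B i)"
    "\<And>i q. \<lbrakk>i \<in> I; q \<in> B i\<rbrakk> \<Longrightarrow> f (i, q) \<in> carrier G"
  shows "(\<Oplus>p\<in>Sigma I B. f p) = (\<Oplus>i\<in>I. \<Oplus>q\<in>B i. f (i, q))"
  using assms
proof (induction I rule: finite_induct)
  case empty
  then show ?case by (simp add: finsum_empty)
next
  case (insert a I)
  have S: "Sigma (insert a I) B = Pair a ` B a \<union> Sigma I B" by auto
  have "(\<Oplus>p\<in>Sigma (insert a I) B. f p) = (\<Oplus>p\<in>Pair a ` B a. f p) \<oplus> (\<Oplus>p\<in>Sigma I B. f p)"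
    unfolding S using insert by (intro finsum_Un_disjoint) auto
  also have "(\<Oplus>p\<in>Pair a ` B a. f p) = (\<Oplus>q\<in>B a. f (a, q))"
    by (rule finsum_reindex) (use insert in \<open>auto intro: inj_onI\<close>)
  also have "(\<Oplus>p\<in>Sigma I B. f p) = (\<Oplus>i\<in>I. \<Oplus>q\<in>B i. f (i, q))"
    using insert by auto
  finally show ?case
    using insert by (subst finsum_insert) (auto intro!: finsum_closed)
qed

lemma (in abelian_group) add_cancel_middle:
  assumes "x \<in> carrier G" "y \<in> carrier G"
  shows "x \<oplus> y \<oplus> \<ominus> x = y" "\<ominus> (x \<oplus> y) \<oplus> x = \<ominus> y"
  using assms by algebra+

section \<open>Products of modules, and homomorphisms tested on a dual basis\<close>

definition product_module :: "'j set \<Rightarrow> ('j \<Rightarrow> ('r, 'm) module) \<Rightarrow> ('r, 'j \<Rightarrow> 'm) module" where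
  "product_module J M = \<lparr>carrier = (\<Pi>\<^sub>E j\<in>J. carrier (M j)), mult = undefined, one = undefined,
     zero = (\<lambda>j\<in>J. \<zero>\<^bsub>M j\<^esub>),
     add = (\<lambda>x y. \<lambda>j\<in>J. x j \<oplus>\<^bsub>M j\<^esub> y j),
     smult = (\<lambda>r x. \<lambda>j\<in>J. r \<odot>\<^bsub>M j\<^esub> x j)\<rparr>"

context ring begin

lemma product_module_module:
  assumes M: "\<And>j. right_module R (M j)"
  shows "right_module R (product_module J M)"
proof (rule right_moduleI)
  interpret M: right_module R "M j" for j by fact
  show "abelian_group (product_module J M)"
  proof (rule abelian_groupI)
    fix x assume x: "x \<in> carrier (product_module J M)"
    then show "\<exists>y\<in>carrier (product_module J M). y \<oplus>\<^bsub>product_module J M\<^esub> x = \<zero>\<^bsub>product_module J M\<^esub>"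
      by (intro bexI[of _ "\<lambda>j\<in>J. \<ominus>\<^bsub>M j\<^esub> x j"])
        (auto simp: product_module_def M.M.l_neg fun_eq_iff PiE_def Pi_def)
  next
    fix x assume x: "x \<in> carrier (product_module J M)"
    then show "\<zero>\<^bsub>product_module J M\<^esub> \<oplus>\<^bsub>product_module J M\<^esub> x = x"
      by (auto simp: product_module_def fun_eq_iff PiE_def Pi_def extensional_def)
  qed (auto simp: product_module_def fun_eq_iff M.M.a_ac PiE_def Pi_def)
next
  fix x assume "x \<in> carrier (product_module J M)"
  then show "\<one> \<odot>\<^bsub>product_module J M\<^esub> x = x"
    using assms by (auto simp: product_module_def fun_eq_iff PiE_def Pi_def extensional_def rm_eqs)
qed (use assms in \<open>auto simp: product_module_def fun_eq_iff PiE_def Pi_def rm_eqs rm_act\<close>)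

lemma product_module_carrier:
  "x \<in> carrier (product_module J M) \<longleftrightarrow> (\<forall>j\<in>J. x j \<in> carrier (M j)) \<and> x \<in> extensional J"
  by (auto simp: product_module_def PiE_def Pi_def)

lemma product_module_simps [simp]:
  "j \<in> J \<Longrightarrow> \<zero>\<^bsub>product_module J M\<^esub> j = \<zero>\<^bsub>M j\<^esub>"
  "j \<in> J \<Longrightarrow> (x \<oplus>\<^bsub>product_module J M\<^esub> y) j = x j \<oplus>\<^bsub>M j\<^esub> y j"
  "j \<in> J \<Longrightarrow> (r \<odot>\<^bsub>product_module J M\<^esub> x) j = r \<odot>\<^bsub>M j\<^esub> x j"
  by (simp_all add: product_module_def)

lemma product_module_eqI:
  assumes "x \<in> carrier (product_module J M)" "y \<in> carrier (product_module J M)" "\<And>j. j \<in> J \<Longrightarrow> x j = y j"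
  shows "x = y"
  using assms by (auto simp: product_module_carrier intro: extensionalityI)

lemma product_module_proj: "j \<in> J \<Longrightarrow> (\<lambda>x. x j) \<in> module_homs R (product_module J M) (M j)"
  by (intro module_homsI) (auto simp: product_module_carrier)

lemma product_module_incl:
  assumes M: "\<And>j. right_module R (M j)" and j: "j \<in> J"
  shows "(\<lambda>y. \<lambda>k\<in>J. if k = j then y else \<zero>\<^bsub>M k\<^esub>) \<in> module_homs R (M j) (product_module J M)"
proof -
  have N: "right_module R (product_module J M)" using M by (rule product_module_module)
  show ?thesis
  proof (rule module_homsI)
    show "(\<lambda>k\<in>J. if k = j then y else \<zero>\<^bsub>M k\<^esub>) \<in> carrier (product_module J M)" if "y \<in> carrier (M j)" for y
      using that M by (simp add: product_module_carrier)
    show "(\<lambda>k\<in>J. if k = j then x \<oplus>\<^bsub>M j\<^esub> y else \<zero>\<^bsub>M k\<^esub>) =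
        (\<lambda>k\<in>J. if k = j then x else \<zero>\<^bsub>M k\<^esub>) \<oplus>\<^bsub>product_module J M\<^esub> (\<lambda>k\<in>J. if k = j then y else \<zero>\<^bsub>M k\<^esub>)"
      for x y
      using M by (auto simp: product_module_def fun_eq_iff)
    show "(\<lambda>k\<in>J. if k = j then r \<odot>\<^bsub>M j\<^esub> x else \<zero>\<^bsub>M k\<^esub>) =
        r \<odot>\<^bsub>product_module J M\<^esub> (\<lambda>k\<in>J. if k = j then x else \<zero>\<^bsub>M k\<^esub>)" if "r \<in> carrier R" for r x
      using M that by (auto simp: product_module_def fun_eq_iff)
  qed
qed

lemma product_module_decompose:
  assumes M: "\<And>j. right_module R (M j)" and J: "finite J" and z: "z \<in> carrier (product_module J M)"
  shows "(\<Oplus>\<^bsub>product_module J M\<^esub>j\<in>J. (\<lambda>k\<in>J. if k = j then z j else \<zero>\<^bsub>M k\<^esub>)) = z" (is "?s = z")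
proof (rule product_module_eqI)
  let ?N = "product_module J M"
  have N: "right_module R ?N" using M by (rule product_module_module)
  interpret N: right_module R ?N by (rule N)
  interpret M: right_module R "M j" for j by (rule M)
  have c: "(\<lambda>k\<in>J. if k = j then z j else \<zero>\<^bsub>M k\<^esub>) \<in> carrier ?N" if "j \<in> J" for j
    using z that M by (simp add: product_module_carrier)
  then show "?s \<in> carrier ?N" by (intro N.M.finsum_closed) auto
  fix i assume i: "i \<in> J"
  have "?s i = (\<Oplus>\<^bsub>M i\<^esub>j\<in>J. (\<lambda>k\<in>J. if k = j then z j else \<zero>\<^bsub>M k\<^esub>) i)"
    by (rule module_homs_finsum[OF product_module_proj[OF i] N M J]) (use c in auto)
  also have "\<dots> = (\<Oplus>\<^bsub>M i\<^esub>j\<in>J. if i = j then z i else \<zero>\<^bsub>M i\<^esub>)"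
    using i by (intro M.M.finsum_cong') (use z in \<open>auto simp: product_module_carrier\<close>)
  also have "\<dots> = z i"
    by (rule M.M.finsum_singleton) (use i J z in \<open>auto simp: product_module_carrier\<close>)
  finally show "?s i = z i" .
qed (rule z)

lemma dual_basis_separates:
  assumes b: "dual_basis R M n x \<xi>" and M: "right_module R M" and y: "y \<in> carrier M"
    and z: "\<And>q. q < n \<Longrightarrow> \<xi> q y = \<zero>"
  shows "y = \<zero>\<^bsub>M\<^esub>"
proof -
  interpret M: right_module R M by (rule M)
  note d = dual_basisD[OF b]
  have zero: "\<zero> \<odot>\<^bsub>M\<^esub> w = \<zero>\<^bsub>M\<^esub>" if "w \<in> carrier M" for w
    using M.act_add_ring[of "\<zero>" "\<zero>" w] M.M.add.l_cancel_one'[of "\<zero> \<odot>\<^bsub>M\<^esub> w" "\<zero> \<odot>\<^bsub>M\<^esub> w"] that M by simp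
  have "(\<Oplus>\<^bsub>M\<^esub>q\<in>{..<n}. \<xi> q y \<odot>\<^bsub>M\<^esub> x q) = (\<Oplus>\<^bsub>M\<^esub>q\<in>{..<n}. \<zero>\<^bsub>M\<^esub>)"
    by (rule M.M.finsum_cong') (use z d zero in auto)
  then show ?thesis using d(4)[OF y] by (simp add: M.M.finsum_zero)
qed

lemma dual_basis_hom_eq:
  assumes b: "dual_basis R M n x \<xi>" and M: "right_module R M" and N: "right_module R N"
    and f: "f \<in> module_homs R M N" and g: "g \<in> module_homs R M N"
    and e: "\<And>q. q < n \<Longrightarrow> f (x q) = g (x q)" and y: "y \<in> carrier M"
  shows "f y = g y"
proof -
  interpret N: right_module R N by (rule N)
  note d = dual_basisD[OF b]
  have *: "k y = (\<Oplus>\<^bsub>N\<^esub>q\<in>{..<n}. \<xi> q y \<odot>\<^bsub>N\<^esub> k (x q))" if k: "k \<in> module_homs R M N" for k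
  proof -
    have "k y = k (\<Oplus>\<^bsub>M\<^esub>q\<in>{..<n}. \<xi> q y \<odot>\<^bsub>M\<^esub> x q)" using d(4)[OF y] by simp
    also have "\<dots> = (\<Oplus>\<^bsub>N\<^esub>q\<in>{..<n}. k (\<xi> q y \<odot>\<^bsub>M\<^esub> x q))"
      by (rule module_homs_finsum[OF k M N]) (use d y M in auto)
    also have "\<dots> = (\<Oplus>\<^bsub>N\<^esub>q\<in>{..<n}. \<xi> q y \<odot>\<^bsub>N\<^esub> k (x q))"
      by (rule N.M.finsum_cong') (use d y M N in \<open>auto simp: module_homs_act[OF k] module_homs_closed[OF k]\<close>)
    finally show ?thesis .
  qed
  have "(\<Oplus>\<^bsub>N\<^esub>q\<in>{..<n}. \<xi> q y \<odot>\<^bsub>N\<^esub> f (x q)) = (\<Oplus>\<^bsub>N\<^esub>q\<in>{..<n}. \<xi> q y \<odot>\<^bsub>N\<^esub> g (x q))"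
    by (rule N.M.finsum_cong') (use d y N e in \<open>auto simp: module_homs_closed[OF f] module_homs_closed[OF g]\<close>)
  then show ?thesis using *[OF f] *[OF g] by simp
qed

end

section \<open>Duality\<close>

context symmetrizing_form begin

text \<open>Linearity of \<open>\<zeta>\<close> takes the sum inside, and the symmetry of the form
  exchanges the two factors. With \<open>c q\<close> the coordinates of an element, the inner sum is
  that element; every trace computation below reduces to this.\<close>

lemma form_dual_basis_sum:
  assumes M: "right_module A M" and \<zeta>: "\<zeta> \<in> module_homs A M (regular A)"
    and "\<And>q. q < n \<Longrightarrow> c q \<in> carrier A" and "\<And>q. q < n \<Longrightarrow> e q \<in> carrier M"
  shows "(\<Oplus>\<^bsub>K\<^esub>q\<in>{..<n::nat}. tr (c q \<otimes>\<^bsub>A\<^esub> \<zeta> (e q))) = tr (\<zeta> (\<Oplus>\<^bsub>M\<^esub>q\<in>{..<n}. c q \<odot>\<^bsub>M\<^esub> e q))"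
proof -
  have \<zeta>c: "\<zeta> x \<in> carrier A" if "x \<in> carrier M" for x
    using A.module_homs_closed[OF \<zeta> that] by simp
  have "\<zeta> (\<Oplus>\<^bsub>M\<^esub>q\<in>{..<n}. c q \<odot>\<^bsub>M\<^esub> e q) = (\<Oplus>\<^bsub>regular A\<^esub>q\<in>{..<n}. \<zeta> (c q \<odot>\<^bsub>M\<^esub> e q))"
    by (rule A.module_homs_finsum[OF \<zeta> M A.regular_module]) (use assms in auto)
  also have "\<dots> = (\<Oplus>\<^bsub>A\<^esub>q\<in>{..<n}. \<zeta> (c q \<odot>\<^bsub>M\<^esub> e q))"
    by (simp add: finsum_def finprod_def regular_def)
  also have "\<dots> = (\<Oplus>\<^bsub>A\<^esub>q\<in>{..<n}. \<zeta> (e q) \<otimes>\<^bsub>A\<^esub> c q)"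
    by (rule A.finsum_cong') (use assms \<zeta>c in \<open>auto simp: A.module_homs_act[OF \<zeta>]\<close>)
  finally have "tr (\<zeta> (\<Oplus>\<^bsub>M\<^esub>q\<in>{..<n}. c q \<odot>\<^bsub>M\<^esub> e q)) = (\<Oplus>\<^bsub>K\<^esub>q\<in>{..<n}. tr (\<zeta> (e q) \<otimes>\<^bsub>A\<^esub> c q))"
    using form_finsum[of "{..<n}" "\<lambda>q. \<zeta> (e q) \<otimes>\<^bsub>A\<^esub> c q"] assms \<zeta>c by auto
  also have "\<dots> = (\<Oplus>\<^bsub>K\<^esub>q\<in>{..<n}. tr (c q \<otimes>\<^bsub>A\<^esub> \<zeta> (e q)))"
    by (rule K.finsum_cong') (use assms \<zeta>c in \<open>auto intro: form_sym\<close>)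
  finally show ?thesis ..
qed

text \<open>Expanding \<open>g (e' q)\<close> and \<open>f (e p)\<close> in the dual bases turns
  both sides into the same double sum, up to the order of the two factors under the form, which is
  symmetric.\<close>

lemma trace_commute:
  assumes b: "dual_basis A M m e \<xi>" and b': "dual_basis A N n e' \<xi>'"
    and M: "right_module A M" and N: "right_module A N"
    and f: "f \<in> module_homs A M N" and g: "g \<in> module_homs A N M"
  shows "(\<Oplus>\<^bsub>K\<^esub>q\<in>{..<n}. tr (\<xi>' q (f (g (e' q))))) = (\<Oplus>\<^bsub>K\<^esub>p\<in>{..<m}. tr (\<xi> p (g (f (e p)))))"
proof -
  note d = A.dual_basisD[OF b] and d' = A.dual_basisD[OF b']
  note fc = A.module_homs_closed[OF f] and gc = A.module_homs_closed[OF g]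
  have *: "tr (\<xi>' q (f (g (e' q)))) = (\<Oplus>\<^bsub>K\<^esub>p\<in>{..<m}. tr (\<xi> p (g (e' q)) \<otimes>\<^bsub>A\<^esub> \<xi>' q (f (e p))))" if "q < n" for q
    using form_dual_basis_sum[OF M A.module_homs_comp[OF f d'(2)[OF that]], of m "\<lambda>p. \<xi> p (g (e' q))" e]
      d d' gc that by simp
  have **: "tr (\<xi> p (g (f (e p)))) = (\<Oplus>\<^bsub>K\<^esub>q\<in>{..<n}. tr (\<xi>' q (f (e p)) \<otimes>\<^bsub>A\<^esub> \<xi> p (g (e' q))))" if "p < m" for p
    using form_dual_basis_sum[OF N A.module_homs_comp[OF g d(2)[OF that]], of n "\<lambda>q. \<xi>' q (f (e p))" e']
      d d' fc that by simp
  have "(\<Oplus>\<^bsub>K\<^esub>q\<in>{..<n}. tr (\<xi>' q (f (g (e' q)))))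
      = (\<Oplus>\<^bsub>K\<^esub>q\<in>{..<n}. \<Oplus>\<^bsub>K\<^esub>p\<in>{..<m}. tr (\<xi> p (g (e' q)) \<otimes>\<^bsub>A\<^esub> \<xi>' q (f (e p))))"
    by (rule K.finsum_cong') (use * d d' fc gc in auto)
  also have "\<dots> = (\<Oplus>\<^bsub>K\<^esub>p\<in>{..<m}. \<Oplus>\<^bsub>K\<^esub>q\<in>{..<n}. tr (\<xi> p (g (e' q)) \<otimes>\<^bsub>A\<^esub> \<xi>' q (f (e p))))"
    by (rule K.finsum_swap) (use d d' fc gc in auto)
  also have "\<dots> = (\<Oplus>\<^bsub>K\<^esub>p\<in>{..<m}. tr (\<xi> p (g (f (e p)))))"
  proof (rule K.finsum_cong')
    fix p assume p: "p \<in> {..<m}"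
    have "(\<Oplus>\<^bsub>K\<^esub>q\<in>{..<n}. tr (\<xi> p (g (e' q)) \<otimes>\<^bsub>A\<^esub> \<xi>' q (f (e p))))
        = (\<Oplus>\<^bsub>K\<^esub>q\<in>{..<n}. tr (\<xi>' q (f (e p)) \<otimes>\<^bsub>A\<^esub> \<xi> p (g (e' q))))"
      by (rule K.finsum_cong') (use p d d' fc gc in \<open>auto intro: form_sym\<close>)
    then show "(\<Oplus>\<^bsub>K\<^esub>q\<in>{..<n}. tr (\<xi> p (g (e' q)) \<otimes>\<^bsub>A\<^esub> \<xi>' q (f (e p)))) = tr (\<xi> p (g (f (e p))))"
      using ** p by simp
  qed (use d d' fc gc in auto)
  finally show ?thesis .
qed

text \<open>Shaped for the boundary of a homotopy, whose trace in each degree is a sum of two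
  neighbouring terms; the alternating signs cancel all of them but the last.\<close>

lemma alternating_telescope:
  assumes "\<And>i. T i \<in> carrier K" and "T (a - 1) = \<zero>\<^bsub>K\<^esub>"
  shows "(\<Oplus>\<^bsub>K\<^esub>i\<in>{a..a + int k}. if even i then T (i - 1) \<oplus>\<^bsub>K\<^esub> T i else \<ominus>\<^bsub>K\<^esub> (T (i - 1) \<oplus>\<^bsub>K\<^esub> T i))
     = (if even (a + int k) then T (a + int k) else \<ominus>\<^bsub>K\<^esub> T (a + int k))"
proof (induction k)
  case 0
  have "{a..a + int 0} = insert a {}" by auto
  then show ?case using assms by (simp add: K.finsum_insert K.finsum_empty)
next
  case (Suc k)
  let ?j = "a + int (Suc k)"
  have s: "{a..?j} = insert ?j {a..a + int k}" by auto
  have j: "?j - 1 = a + int k" by simp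
  have e: "even ?j \<longleftrightarrow> odd (a + int k)" by simp
  have c: "T (a + int k) \<in> carrier K" "T ?j \<in> carrier K" by (rule assms)+
  let ?S = "\<lambda>I. (\<Oplus>\<^bsub>K\<^esub>i\<in>I. if even i then T (i - 1) \<oplus>\<^bsub>K\<^esub> T i else \<ominus>\<^bsub>K\<^esub> (T (i - 1) \<oplus>\<^bsub>K\<^esub> T i))"
  have "?S {a..?j} = (if even ?j then T (?j - 1) \<oplus>\<^bsub>K\<^esub> T ?j else \<ominus>\<^bsub>K\<^esub> (T (?j - 1) \<oplus>\<^bsub>K\<^esub> T ?j)) \<oplus>\<^bsub>K\<^esub> ?S {a..a + int k}"
    unfolding s by (rule K.finsum_insert) (use assms(1) in auto)
  then show ?case
    unfolding Suc.IH j e using K.add_cancel_middle[OF c] by simp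
qed

end

section \<open>The supertrace on a bounded complex with chosen dual bases\<close>

locale based_complex = symmetrizing_form A K \<iota> tr
  for A :: "('a, 'y) ring_scheme" and K :: "('k, 'z) ring_scheme" and \<iota> tr +
  fixes X :: "('a, 'm) cx" and a b :: int and n :: "int \<Rightarrow> nat"
    and e :: "int \<Rightarrow> nat \<Rightarrow> 'm" and \<xi> :: "int \<Rightarrow> nat \<Rightarrow> 'm \<Rightarrow> 'a"
  assumes cx [simp]: "cochain_complex A X"
    and basis: "dual_basis A (obj X i) (n i) (e i) (\<xi> i)"
    and bounded: "i < a \<or> b < i \<Longrightarrow> carrier (obj X i) = {\<zero>\<^bsub>obj X i\<^esub>}"
begin

lemmas basisD = A.dual_basisD[OF basis]

lemma basis_closed [simp]: "q < n i \<Longrightarrow> e i q \<in> carrier (obj X i)"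
  by (rule basisD(1))

lemma cobasis_closed [simp]: "\<lbrakk>q < n i; x \<in> carrier (obj X i)\<rbrakk> \<Longrightarrow> \<xi> i q x \<in> carrier A"
  by (rule basisD(3))

lemma cobasis_zero: "q < n i \<Longrightarrow> \<xi> i q \<zero>\<^bsub>obj X i\<^esub> = \<zero>\<^bsub>A\<^esub>"
  using A.module_homs_zero[OF basisD(2)] A.regular_module by simp

text \<open>On endomorphisms of the module this is the Hattori-Stallings trace followed by the form;
  it is well defined because a symmetric form vanishes on commutators.\<close>

definition trace :: "int \<Rightarrow> ('m \<Rightarrow> 'm) \<Rightarrow> 'k" where
  "trace i \<phi> = (\<Oplus>\<^bsub>K\<^esub>q\<in>{..<n i}. tr (\<xi> i q (\<phi> (e i q))))"

definition supertrace :: "(int \<Rightarrow> 'm \<Rightarrow> 'm) \<Rightarrow> 'k" where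
  "supertrace f = (\<Oplus>\<^bsub>K\<^esub>i\<in>{a..b}. if even i then trace i (f i) else \<ominus>\<^bsub>K\<^esub> trace i (f i))"

lemma trace_closed [simp]:
  "(\<And>x. x \<in> carrier (obj X i) \<Longrightarrow> \<phi> x \<in> carrier (obj X i)) \<Longrightarrow> trace i \<phi> \<in> carrier K"
  unfolding trace_def by (intro K.finsum_closed) auto

lemma trace_cong:
  assumes "\<And>x. x \<in> carrier (obj X i) \<Longrightarrow> \<phi> x = \<psi> x"
    and "\<And>x. x \<in> carrier (obj X i) \<Longrightarrow> \<psi> x \<in> carrier (obj X i)"
  shows "trace i \<phi> = trace i \<psi>"
  unfolding trace_def by (rule K.finsum_cong') (use assms in auto)

lemma trace_zero: "trace i (\<lambda>x. \<zero>\<^bsub>obj X i\<^esub>) = \<zero>\<^bsub>K\<^esub>"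
proof -
  have "trace i (\<lambda>x. \<zero>\<^bsub>obj X i\<^esub>) = (\<Oplus>\<^bsub>K\<^esub>q\<in>{..<n i}. \<zero>\<^bsub>K\<^esub>)"
    unfolding trace_def by (rule K.finsum_cong') (auto simp: cobasis_zero form_zero)
  then show ?thesis by (simp add: K.finsum_zero)
qed

lemma trace_add:
  assumes "\<And>x. x \<in> carrier (obj X i) \<Longrightarrow> \<phi> x \<in> carrier (obj X i)"
    and "\<And>x. x \<in> carrier (obj X i) \<Longrightarrow> \<psi> x \<in> carrier (obj X i)"
  shows "trace i (\<lambda>x. \<phi> x \<oplus>\<^bsub>obj X i\<^esub> \<psi> x) = trace i \<phi> \<oplus>\<^bsub>K\<^esub> trace i \<psi>"
proof -
  have "trace i (\<lambda>x. \<phi> x \<oplus>\<^bsub>obj X i\<^esub> \<psi> x)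
      = (\<Oplus>\<^bsub>K\<^esub>q\<in>{..<n i}. tr (\<xi> i q (\<phi> (e i q))) \<oplus>\<^bsub>K\<^esub> tr (\<xi> i q (\<psi> (e i q))))"
    unfolding trace_def
    by (rule K.finsum_cong') (use assms in \<open>auto simp: A.module_homs_add[OF basisD(2)] form_add\<close>)
  also have "\<dots> = trace i \<phi> \<oplus>\<^bsub>K\<^esub> trace i \<psi>"
    unfolding trace_def by (rule K.finsum_addf) (use assms in auto)
  finally show ?thesis .
qed

lemma trace_scale:
  assumes "\<And>x. x \<in> carrier (obj X i) \<Longrightarrow> \<phi> x \<in> carrier (obj X i)" and c: "c \<in> carrier K"
  shows "trace i (\<lambda>x. \<iota> c \<odot>\<^bsub>obj X i\<^esub> \<phi> x) = c \<otimes>\<^bsub>K\<^esub> trace i \<phi>"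
proof -
  have "trace i (\<lambda>x. \<iota> c \<odot>\<^bsub>obj X i\<^esub> \<phi> x) = (\<Oplus>\<^bsub>K\<^esub>q\<in>{..<n i}. c \<otimes>\<^bsub>K\<^esub> tr (\<xi> i q (\<phi> (e i q))))"
    unfolding trace_def
    by (rule K.finsum_cong') (use assms in \<open>auto simp: A.module_homs_act[OF basisD(2)] form_scale\<close>)
  also have "\<dots> = c \<otimes>\<^bsub>K\<^esub> trace i \<phi>"
    unfolding trace_def
    by (rule K.finsum_additive[symmetric])
      (use assms in \<open>auto simp: K.r_distr K.abelian_monoid_axioms\<close>)
  finally show ?thesis .
qed

lemma supertrace_cong:
  assumes "\<And>i x. x \<in> carrier (obj X i) \<Longrightarrow> f i x = g i x"
    and "\<And>i x. x \<in> carrier (obj X i) \<Longrightarrow> g i x \<in> carrier (obj X i)"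
  shows "supertrace f = supertrace g"
proof -
  have "trace i (f i) = trace i (g i)" for i by (rule trace_cong) (use assms in auto)
  then show ?thesis unfolding supertrace_def by presburger
qed

lemma supertrace_closed:
  assumes "\<And>i x. x \<in> carrier (obj X i) \<Longrightarrow> f i x \<in> carrier (obj X i)"
  shows "supertrace f \<in> carrier K"
  unfolding supertrace_def by (intro K.finsum_closed) (use assms in auto)

lemma supertrace_add:
  assumes f: "\<And>i x. x \<in> carrier (obj X i) \<Longrightarrow> f i x \<in> carrier (obj X i)"
    and g: "\<And>i x. x \<in> carrier (obj X i) \<Longrightarrow> g i x \<in> carrier (obj X i)"
  shows "supertrace (\<lambda>i x. f i x \<oplus>\<^bsub>obj X i\<^esub> g i x) = supertrace f \<oplus>\<^bsub>K\<^esub> supertrace g"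
proof -
  have c: "trace i (f i) \<in> carrier K" "trace i (g i) \<in> carrier K" for i using f g by auto
  have t: "trace i (\<lambda>x. f i x \<oplus>\<^bsub>obj X i\<^esub> g i x) = trace i (f i) \<oplus>\<^bsub>K\<^esub> trace i (g i)" for i
    by (rule trace_add) (use f g in auto)
  have "supertrace (\<lambda>i x. f i x \<oplus>\<^bsub>obj X i\<^esub> g i x) =
     (\<Oplus>\<^bsub>K\<^esub>i\<in>{a..b}. (if even i then trace i (f i) else \<ominus>\<^bsub>K\<^esub> trace i (f i)) \<oplus>\<^bsub>K\<^esub>
        (if even i then trace i (g i) else \<ominus>\<^bsub>K\<^esub> trace i (g i)))"
    unfolding supertrace_def t by (rule K.finsum_cong') (use c in \<open>auto simp: K.minus_add\<close>)
  also have "\<dots> = supertrace f \<oplus>\<^bsub>K\<^esub> supertrace g"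
    unfolding supertrace_def by (rule K.finsum_addf) (use c in auto)
  finally show ?thesis .
qed

lemma supertrace_scale:
  assumes f: "\<And>i x. x \<in> carrier (obj X i) \<Longrightarrow> f i x \<in> carrier (obj X i)" and k: "k \<in> carrier K"
  shows "supertrace (\<lambda>i x. \<iota> k \<odot>\<^bsub>obj X i\<^esub> f i x) = k \<otimes>\<^bsub>K\<^esub> supertrace f"
proof -
  have c: "trace i (f i) \<in> carrier K" for i using f by auto
  have t: "trace i (\<lambda>x. \<iota> k \<odot>\<^bsub>obj X i\<^esub> f i x) = k \<otimes>\<^bsub>K\<^esub> trace i (f i)" for i
    by (rule trace_scale) (use f k in auto)
  have "supertrace (\<lambda>i x. \<iota> k \<odot>\<^bsub>obj X i\<^esub> f i x) =
     (\<Oplus>\<^bsub>K\<^esub>i\<in>{a..b}. k \<otimes>\<^bsub>K\<^esub> (if even i then trace i (f i) else \<ominus>\<^bsub>K\<^esub> trace i (f i)))"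
    unfolding supertrace_def t by (rule K.finsum_cong') (use c k in \<open>auto simp: K.r_minus\<close>)
  also have "\<dots> = k \<otimes>\<^bsub>K\<^esub> supertrace f"
    unfolding supertrace_def
    by (rule K.finsum_additive[symmetric])
      (use c k in \<open>auto simp: K.r_distr K.abelian_monoid_axioms\<close>)
  finally show ?thesis .
qed

text \<open>The rank-one maps that send \<open>x\<close> to the multiple of \<open>y\<close> by the
  \<open>l\<close>-th coordinate of \<open>x\<close> serve as probes: paired with \<open>u\<close>,
  they return the values of the form on the coordinates of \<open>u y\<close>, and these determine
  \<open>u\<close>.\<close>

lemma trace_single:
  assumes u: "u \<in> module_homs A M (obj X i)" and M: "right_module A M"
    and y: "y \<in> carrier M" and l: "l < n i"
  shows "trace i (\<lambda>x. u (\<xi> i l x \<odot>\<^bsub>M\<^esub> y)) = tr (\<xi> i l (u y))"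
proof -
  have uy: "u y \<in> carrier (obj X i)" using A.module_homs_closed[OF u y] .
  have "trace i (\<lambda>x. u (\<xi> i l x \<odot>\<^bsub>M\<^esub> y)) = (\<Oplus>\<^bsub>K\<^esub>q\<in>{..<n i}. tr (\<xi> i q (u y) \<otimes>\<^bsub>A\<^esub> \<xi> i l (e i q)))"
    unfolding trace_def
    by (rule K.finsum_cong')
      (use l y uy in \<open>auto simp: A.module_homs_act[OF basisD(2)] A.module_homs_act[OF u]\<close>)
  also have "\<dots> = tr (\<xi> i l (\<Oplus>\<^bsub>obj X i\<^esub>q\<in>{..<n i}. \<xi> i q (u y) \<odot>\<^bsub>obj X i\<^esub> e i q))"
    by (rule form_dual_basis_sum[OF _ basisD(2)[OF l]]) (use uy in auto)
  also have "\<dots> = tr (\<xi> i l (u y))" using basisD(4)[OF uy] by simp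
  finally show ?thesis .
qed

text \<open>In degree \<open>i\<close> the trace of \<open>u (d w + w d)\<close> is
  \<open>T (i - 1) + T i\<close>, where \<open>T i\<close> is the trace of \<open>u w d\<close>; the
  alternating sum then telescopes.\<close>

lemma supertrace_boundary:
  assumes Y: "cochain_complex A Y" and u: "u \<in> chain_maps A Y X" and w: "w \<in> graded_maps A (- 1) X Y"
  shows "supertrace (\<lambda>i x. u i (homotopy_boundary X Y w i x)) = \<zero>\<^bsub>K\<^esub>"
proof -
  define T where "T i = trace i (\<lambda>x. u i (w (i + 1) (diff X i x)))" for i
  have c1: "u i (w (i + 1) (diff X i x)) \<in> carrier (obj X i)" if "x \<in> carrier (obj X i)" for i x
    using u w Y cx that by simp
  have c2: "u i (diff Y (i - 1) (w i x)) \<in> carrier (obj X i)" if "x \<in> carrier (obj X i)" for i x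
    using u w Y cx that by simp
  have Tc: "T i \<in> carrier K" for i unfolding T_def using c1 by auto
  have uw: "(\<lambda>x. u (i - 1) (w i x)) \<in> module_homs A (obj X i) (obj X (i - 1))" for i
    by (rule A.module_homs_comp[OF A.gm_hom[OF w] A.chain_maps_hom[OF u]]) simp
  have d: "diff X (i - 1) \<in> module_homs A (obj X (i - 1)) (obj X i)" for i
    by (rule A.cc_diff_hom[OF cx]) simp
  \<comment> \<open>\<open>u\<close> commutes with \<open>d\<close>, and under the trace this
    \<open>d\<close> moves to the other end of the composite, which shifts the trace into degree
    \<open>i - 1\<close>.\<close>
  have swap: "trace i (\<lambda>x. u i (diff Y (i - 1) (w i x))) = T (i - 1)" for i
  proof -
    have "trace i (\<lambda>x. u i (diff Y (i - 1) (w i x))) = trace i (\<lambda>x. diff X (i - 1) (u (i - 1) (w i x)))"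
      by (rule trace_cong) (use u w Y cx in simp_all)
    also have "\<dots> = trace (i - 1) (\<lambda>x. u (i - 1) (w i (diff X (i - 1) x)))"
      unfolding trace_def by (rule trace_commute[OF basis basis _ _ d uw]) simp_all
    finally show ?thesis by (simp add: T_def)
  qed
  have t: "trace i (\<lambda>x. u i (homotopy_boundary X Y w i x)) = T (i - 1) \<oplus>\<^bsub>K\<^esub> T i" for i
  proof -
    have "trace i (\<lambda>x. u i (homotopy_boundary X Y w i x)) =
       trace i (\<lambda>x. u i (diff Y (i - 1) (w i x)) \<oplus>\<^bsub>obj X i\<^esub> u i (w (i + 1) (diff X i x)))"
      unfolding homotopy_boundary_def by (rule trace_cong) (use u w Y cx in simp_all)
    also have "\<dots> = trace i (\<lambda>x. u i (diff Y (i - 1) (w i x))) \<oplus>\<^bsub>K\<^esub> T i"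
      unfolding T_def by (rule trace_add) (use c1 c2 in auto)
    finally show ?thesis by (simp add: swap)
  qed
  \<comment> \<open>The two ends of the telescope: \<open>T (a - 1)\<close> is a trace on a zero
    module, and \<open>T b\<close> is that of a map through the zero module in degree
    \<open>b + 1\<close>.\<close>
  have z1: "T (a - 1) = \<zero>\<^bsub>K\<^esub>"
  proof -
    have "T (a - 1) = trace (a - 1) (\<lambda>x. \<zero>\<^bsub>obj X (a - 1)\<^esub>)"
      unfolding T_def by (rule trace_cong) (use c1[of _ "a - 1"] bounded[of "a - 1"] in auto)
    then show ?thesis by (simp add: trace_zero)
  qed
  have zb: "T b = \<zero>\<^bsub>K\<^esub>"
  proof -
    have "T b = trace b (\<lambda>x. \<zero>\<^bsub>obj X b\<^esub>)"
      unfolding T_def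
    proof (rule trace_cong)
      fix x assume "x \<in> carrier (obj X b)"
      then have "diff X b x \<in> carrier (obj X (b + 1))" using cx by simp
      then have "diff X b x = \<zero>\<^bsub>obj X (b + 1)\<^esub>" using bounded[of "b + 1"] by auto
      then show "u b (w (b + 1) (diff X b x)) = \<zero>\<^bsub>obj X b\<^esub>" using u w Y cx by simp
    qed simp
    then show ?thesis by (simp add: trace_zero)
  qed
  show ?thesis
  proof (cases "a \<le> b")
    case True
    then obtain k where k: "b = a + int k" by (metis zle_iff_zadd)
    have "supertrace (\<lambda>i x. u i (homotopy_boundary X Y w i x))
        = (\<Oplus>\<^bsub>K\<^esub>i\<in>{a..b}. if even i then T (i - 1) \<oplus>\<^bsub>K\<^esub> T i else \<ominus>\<^bsub>K\<^esub> (T (i - 1) \<oplus>\<^bsub>K\<^esub> T i))"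
      unfolding supertrace_def t ..
    also have "\<dots> = (if even b then T b else \<ominus>\<^bsub>K\<^esub> T b)"
      using alternating_telescope[of T a k, OF Tc z1] unfolding k .
    finally show ?thesis by (simp add: zb)
  next
    case False
    then show ?thesis by (simp add: supertrace_def K.finsum_empty)
  qed
qed

text \<open>The only point at which the vanishing of the maps \<open>X \<rightarrow> Y\<close>
  enters the duality.\<close>

lemma supertrace_null:
  assumes Y: "cochain_complex A Y" and u: "u \<in> chain_maps A Y X" and v: "v \<in> chain_maps A X Y"
    and n: "hom_null A X Y"
  shows "supertrace (\<lambda>i x. u i (v i x)) = \<zero>\<^bsub>K\<^esub>"
proof -
  obtain w where w: "w \<in> graded_maps A (- 1) X Y"
    and e: "\<And>i x. x \<in> carrier (obj X i) \<Longrightarrow>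
      v i x = diff Y (i - 1) (w i x) \<oplus>\<^bsub>obj Y i\<^esub> w (i + 1) (diff X i x)"
    using A.null_homotopicE[OF A.K_eqD(1)[OF A.hom_nullD[OF n v cx Y]] cx Y v] by blast
  have "supertrace (\<lambda>i x. u i (v i x)) = supertrace (\<lambda>i x. u i (homotopy_boundary X Y w i x))"
    by (rule supertrace_cong) (use e A.homotopy_boundary_closed[OF cx Y w] u in \<open>auto simp: homotopy_boundary_def\<close>)
  then show ?thesis using supertrace_boundary[OF Y u w] by simp
qed

end

lemma (in ring) regular_neg: "x \<in> carrier R \<Longrightarrow> \<ominus>\<^bsub>regular R\<^esub> x = \<ominus> x"
proof -
  interpret S: right_module R "regular R" by (rule regular_module)
  show "x \<in> carrier R \<Longrightarrow> \<ominus>\<^bsub>regular R\<^esub> x = \<ominus> x"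
    by (rule S.M.minus_equality) (simp_all add: l_neg)
qed

section \<open>Representing the pairing, and the homotopy that it yields\<close>

context based_complex begin

definition index_set :: "(int \<times> nat) set" where
  "index_set = Sigma {a..b} (\<lambda>i. {..<n i})"

text \<open>A map from degree \<open>i\<close> of \<open>X\<close> to degree \<open>i + 1\<close> of
  \<open>Y\<close> is determined by its values on the generators \<open>e i q\<close>, so families
  of such maps embed in this product. Not every tuple comes from a map \<open>d v - v d\<close>,
  which is why a functional known on those has to be extended before it is represented.\<close>

definition target_module :: "('a, 'n) cx \<Rightarrow> ('a, int \<times> nat \<Rightarrow> 'n) module" where
  "target_module Y = product_module index_set (\<lambda>j. obj Y (fst j + 1))"

text \<open>The values of \<open>d v - v d\<close> on the basis.\<close>

definition evaluation :: "('a, 'n) cx \<Rightarrow> (int \<Rightarrow> 'm \<Rightarrow> 'n) \<Rightarrow> int \<times> nat \<Rightarrow> 'n" where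
  "evaluation Y v = (\<lambda>j\<in>index_set. diff Y (fst j) (v (fst j) (e (fst j) (snd j)))
     \<ominus>\<^bsub>obj Y (fst j + 1)\<^esub> v (fst j + 1) (diff X (fst j) (e (fst j) (snd j))))"

lemma index_set_finite [simp]: "finite index_set"
  by (simp add: index_set_def)

lemma index_setD: "j \<in> index_set \<Longrightarrow> snd j < n (fst j)" "(i, q) \<in> index_set \<longleftrightarrow> i \<in> {a..b} \<and> q < n i"
  by (auto simp: index_set_def)

lemma target_module [simp]: "cochain_complex A Y \<Longrightarrow> right_module A (target_module Y)"
  unfolding target_module_def by (rule A.product_module_module) simp

lemma evaluation_closed:
  assumes Y: "cochain_complex A Y" and v: "v \<in> graded_maps A 0 X Y"
  shows "evaluation Y v \<in> carrier (target_module Y)"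
  unfolding target_module_def A.product_module_carrier
  using A.gm_simps(1)[OF v] Y cx index_setD(1) by (auto simp: evaluation_def)

lemma evaluation_add:
  assumes Y: "cochain_complex A Y" and v: "v \<in> graded_maps A 0 X Y" and w: "w \<in> graded_maps A 0 X Y"
  shows "evaluation Y (\<lambda>i x. v i x \<oplus>\<^bsub>obj Y i\<^esub> w i x) = evaluation Y v \<oplus>\<^bsub>target_module Y\<^esub> evaluation Y w"
proof
  fix j
  interpret Y: abelian_group "obj Y i" for i using Y by (rule A.cc_abelian)
  show "evaluation Y (\<lambda>i x. v i x \<oplus>\<^bsub>obj Y i\<^esub> w i x) j = (evaluation Y v \<oplus>\<^bsub>target_module Y\<^esub> evaluation Y w) j"
  proof (cases "j \<in> index_set")
    case True
    obtain i q where j: "j = (i, q)" by (cases j)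
    have q: "q < n i" using True j index_setD(1) by fastforce
    have c: "diff Y i (v i (e i q)) \<in> carrier (obj Y (i + 1))" "diff Y i (w i (e i q)) \<in> carrier (obj Y (i + 1))"
      "v (i + 1) (diff X i (e i q)) \<in> carrier (obj Y (i + 1))"
      "w (i + 1) (diff X i (e i q)) \<in> carrier (obj Y (i + 1))"
      "v i (e i q) \<in> carrier (obj Y i)" "w i (e i q) \<in> carrier (obj Y i)"
      using v w Y cx q by simp_all
    then show ?thesis
      using True Y by (simp add: target_module_def evaluation_def j) (insert c, algebra)
  qed (simp add: evaluation_def target_module_def product_module_def)
qed

lemma evaluation_scale:
  assumes Y: "cochain_complex A Y" and v: "v \<in> graded_maps A 0 X Y" and c: "c \<in> carrier K"
  shows "evaluation Y (\<lambda>i x. \<iota> c \<odot>\<^bsub>obj Y i\<^esub> v i x) = \<iota> c \<odot>\<^bsub>target_module Y\<^esub> evaluation Y v"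
proof
  fix j
  show "evaluation Y (\<lambda>i x. \<iota> c \<odot>\<^bsub>obj Y i\<^esub> v i x) j = (\<iota> c \<odot>\<^bsub>target_module Y\<^esub> evaluation Y v) j"
  proof (cases "j \<in> index_set")
    case True
    obtain i q where j: "j = (i, q)" by (cases j)
    have q: "q < n i" using True j index_setD(1) by fastforce
    have "diff Y i (v i (e i q)) \<in> carrier (obj Y (i + 1))"
      "v (i + 1) (diff X i (e i q)) \<in> carrier (obj Y (i + 1))" "v i (e i q) \<in> carrier (obj Y i)"
      using v Y cx q by simp_all
    then show ?thesis
      using True Y c by (simp add: target_module_def evaluation_def j A.rm_act)
  qed (simp add: evaluation_def target_module_def product_module_def)
qed

lemma evaluation_zero_chain:
  assumes Y: "cochain_complex A Y" and v: "v \<in> graded_maps A 0 X Y"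
    and z: "evaluation Y v = \<zero>\<^bsub>target_module Y\<^esub>"
  shows "v \<in> chain_maps A X Y"
proof (rule A.chain_mapsI)
  interpret Y: abelian_group "obj Y i" for i using Y by (rule A.cc_abelian)
  show vh: "v i \<in> module_homs A (obj X i) (obj Y i)" for i using A.gm_hom[OF v] by simp
  fix i x assume x: "x \<in> carrier (obj X i)"
  show "v (i + 1) (diff X i x) = diff Y i (v i x)"
  proof (cases "i \<in> {a..b}")
    case True
    show ?thesis
    proof (rule A.dual_basis_hom_eq[OF basis _ _ _ _ _ x])
      show "(\<lambda>x. v (i + 1) (diff X i x)) \<in> module_homs A (obj X i) (obj Y (i + 1))"
        by (rule A.module_homs_comp[OF A.cc_diff_hom[OF cx refl] vh])
      show "(\<lambda>x. diff Y i (v i x)) \<in> module_homs A (obj X i) (obj Y (i + 1))"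
        by (rule A.module_homs_comp[OF vh A.cc_diff_hom[OF Y refl]])
      fix q assume q: "q < n i"
      then have j: "(i, q) \<in> index_set" using True by (simp add: index_setD)
      have "evaluation Y v (i, q) = \<zero>\<^bsub>obj Y (i + 1)\<^esub>" using z j by (simp add: target_module_def)
      then have "diff Y i (v i (e i q)) \<ominus>\<^bsub>obj Y (i + 1)\<^esub> v (i + 1) (diff X i (e i q)) = \<zero>\<^bsub>obj Y (i + 1)\<^esub>"
        using j by (simp add: evaluation_def)
      then show "v (i + 1) (diff X i (e i q)) = diff Y i (v i (e i q))"
        by (rule Y.eq_if_minus_zero[symmetric]) (use v Y cx q in simp_all)
    qed (use Y in simp_all)
  next
    \<comment> \<open>Outside \<open>{a..b}\<close> the index set holds no generators to test on,
      but there the terms of \<open>X\<close> are zero.\<close>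
    case False
    then have "x = \<zero>\<^bsub>obj X i\<^esub>" using x bounded[of i] by auto
    then show ?thesis
      using A.module_homs_zero[OF vh] Y cx by simp
  qed
qed

text \<open>
  The supertrace pairing with \<open>u\<close> vanishes on chain maps, so it is a functional of \<open>d v - v d\<close>; a
  functional of the values of a map on the basis is represented by \<open>A\<close>-linear maps.
\<close>

lemma pairing_represented:
  assumes Y: "cochain_complex A Y" and u: "u \<in> chain_maps A Y X" and null: "hom_null A X Y"
  obtains \<gamma> where "\<gamma> \<in> module_homs A (target_module Y) (regular A)"
    "\<And>v. v \<in> graded_maps A 0 X Y \<Longrightarrow> supertrace (\<lambda>i x. u i (v i x)) = tr (\<gamma> (evaluation Y v))"
proof -
  let ?N = "target_module Y"
  let ?F = "\<lambda>v. supertrace (\<lambda>i x. u i (v i x))"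
  \<comment> \<open>The functional on the image of \<open>evaluation\<close>, as a graph. That it is
    single-valued amounts to the last clause of \<open>functional_graph\<close>: a \<open>v\<close>
    with zero evaluation is a chain map, and chain maps pair to zero.\<close>
  define g where "g = {(evaluation Y v, ?F v) |v. v \<in> graded_maps A 0 X Y}"
  have uv: "u i (v i x) \<in> carrier (obj X i)" if "v \<in> graded_maps A 0 X Y" "x \<in> carrier (obj X i)" for v i x
    using u that by simp
  have gI: "(evaluation Y v, ?F v) \<in> g" if "v \<in> graded_maps A 0 X Y" for v
    using that unfolding g_def by blast
  have zero: "?F v = \<zero>\<^bsub>K\<^esub>" if "v \<in> graded_maps A 0 X Y" "evaluation Y v = \<zero>\<^bsub>?N\<^esub>" for v
    by (rule supertrace_null[OF Y u evaluation_zero_chain[OF Y that] null])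
  have "functional_graph ?N g"
    unfolding functional_graph_def
  proof (intro conjI allI impI ballI)
    show "g \<subseteq> carrier ?N \<times> carrier K"
      unfolding g_def using evaluation_closed[OF Y] supertrace_closed uv by auto
    have z: "(\<lambda>i x. \<zero>\<^bsub>obj Y i\<^esub>) \<in> graded_maps A 0 X Y" using A.zero_gm[OF Y, of 0] by simp
    have "evaluation Y (\<lambda>i x. \<zero>\<^bsub>obj Y i\<^esub>) = \<zero>\<^bsub>?N\<^esub>"
      using Y by (auto simp: evaluation_def target_module_def product_module_def fun_eq_iff)
    with gI[OF z] zero[OF z] show "(\<zero>\<^bsub>?N\<^esub>, \<zero>\<^bsub>K\<^esub>) \<in> g" by simp
  next
    fix x c y d assume "(x, c) \<in> g" "(y, d) \<in> g"
    then obtain v w where v: "v \<in> graded_maps A 0 X Y" "x = evaluation Y v" "c = ?F v"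
      and w: "w \<in> graded_maps A 0 X Y" "y = evaluation Y w" "d = ?F w" unfolding g_def by auto
    have vw: "(\<lambda>i x. v i x \<oplus>\<^bsub>obj Y i\<^esub> w i x) \<in> graded_maps A 0 X Y"
      using A.add_gm[OF Y v(1) w(1)] by simp
    have "?F (\<lambda>i x. v i x \<oplus>\<^bsub>obj Y i\<^esub> w i x) = supertrace (\<lambda>i x. u i (v i x) \<oplus>\<^bsub>obj X i\<^esub> u i (w i x))"
      by (rule supertrace_cong) (use u v(1) w(1) Y cx in simp_all)
    also have "\<dots> = c \<oplus>\<^bsub>K\<^esub> d"
      unfolding v(3) w(3) by (rule supertrace_add) (use uv v(1) w(1) in auto)
    finally show "(x \<oplus>\<^bsub>?N\<^esub> y, c \<oplus>\<^bsub>K\<^esub> d) \<in> g"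
      using gI[OF vw] evaluation_add[OF Y v(1) w(1)] v(2) w(2) by simp
  next
    fix t x c assume t: "t \<in> carrier K" and "(x, c) \<in> g"
    then obtain v where v: "v \<in> graded_maps A 0 X Y" "x = evaluation Y v" "c = ?F v" unfolding g_def by auto
    \<comment> \<open>Scaling by \<open>\<iota> t\<close> keeps the maps linear over
      \<open>A\<close> because \<open>\<iota> t\<close> is central.\<close>
    have tv: "(\<lambda>i x. \<iota> t \<odot>\<^bsub>obj Y i\<^esub> v i x) \<in> graded_maps A 0 X Y"
    proof (rule A.gmI, rule module_homsI)
      fix i r x assume "r \<in> carrier A" "x \<in> carrier (obj X i)"
      then show "\<iota> t \<odot>\<^bsub>obj Y i\<^esub> v i (r \<odot>\<^bsub>obj X i\<^esub> x) = r \<odot>\<^bsub>obj Y (i + 0)\<^esub> (\<iota> t \<odot>\<^bsub>obj Y i\<^esub> v i x)"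
        using t v(1) Y cx iota_central[OF t, of r] by (simp flip: A.rm_eqs(2))
    qed (use t v(1) Y cx in \<open>simp_all add: A.rm_act\<close>)
    have "?F (\<lambda>i x. \<iota> t \<odot>\<^bsub>obj Y i\<^esub> v i x) = supertrace (\<lambda>i x. \<iota> t \<odot>\<^bsub>obj X i\<^esub> u i (v i x))"
      by (rule supertrace_cong) (use u v(1) Y cx t in simp_all)
    also have "\<dots> = t \<otimes>\<^bsub>K\<^esub> c"
      unfolding v(3) by (rule supertrace_scale) (use uv v(1) t in auto)
    finally show "(\<iota> t \<odot>\<^bsub>?N\<^esub> x, t \<otimes>\<^bsub>K\<^esub> c) \<in> g"
      using gI[OF tv] evaluation_scale[OF Y v(1) t] v(2) by simp
  next
    fix c assume "(\<zero>\<^bsub>?N\<^esub>, c) \<in> g"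
    then show "c = \<zero>\<^bsub>K\<^esub>" unfolding g_def using zero by auto
  qed
  from functional_extension[OF this target_module[OF Y]] obtain \<phi>
    where \<phi>: "functional ?N \<phi>" "\<And>x c. (x, c) \<in> g \<Longrightarrow> \<phi> x = c" by blast
  from functional_represented[OF \<phi>(1) target_module[OF Y]] obtain \<gamma>
    where \<gamma>: "\<gamma> \<in> module_homs A ?N (regular A)" "\<And>x. x \<in> carrier ?N \<Longrightarrow> \<phi> x = tr (\<gamma> x)" by blast
  show thesis
  proof (rule that[OF \<gamma>(1)])
    fix v assume v: "v \<in> graded_maps A 0 X Y"
    show "?F v = tr (\<gamma> (evaluation Y v))"
      using \<phi>(2)[OF gI[OF v]] \<gamma>(2)[OF evaluation_closed[OF Y v]] by simp
  qed
qed

definition inclusion :: "('a, 'n) cx \<Rightarrow> int \<times> nat \<Rightarrow> 'n \<Rightarrow> int \<times> nat \<Rightarrow> 'n" where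
  "inclusion Y j y = (\<lambda>k\<in>index_set. if k = j then y else \<zero>\<^bsub>obj Y (fst k + 1)\<^esub>)"

lemma inclusion_hom:
  "\<lbrakk>cochain_complex A Y; j \<in> index_set\<rbrakk> \<Longrightarrow> inclusion Y j \<in> module_homs A (obj Y (fst j + 1)) (target_module Y)"
  unfolding inclusion_def target_module_def
  by (rule A.product_module_incl[where M = "\<lambda>j. obj Y (fst j + 1)"]) simp_all

lemma functional_decompose:
  assumes Y: "cochain_complex A Y" and \<gamma>: "\<gamma> \<in> module_homs A (target_module Y) (regular A)"
    and z: "z \<in> carrier (target_module Y)"
  shows "tr (\<gamma> z) = (\<Oplus>\<^bsub>K\<^esub>i\<in>{a..b}. \<Oplus>\<^bsub>K\<^esub>q\<in>{..<n i}. tr (\<gamma> (inclusion Y (i, q) (z (i, q)))))"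
proof -
  have zc: "z j \<in> carrier (obj Y (fst j + 1))" if "j \<in> index_set" for j
    using z that unfolding target_module_def A.product_module_carrier by auto
  have ic: "inclusion Y j (z j) \<in> carrier (target_module Y)" if "j \<in> index_set" for j
    using A.module_homs_closed[OF inclusion_hom[OF Y that] zc[OF that]] .
  have \<gamma>c: "\<gamma> (inclusion Y j (z j)) \<in> carrier A" if "j \<in> index_set" for j
    using A.module_homs_closed[OF \<gamma> ic[OF that]] by simp
  have "\<gamma> z = \<gamma> (\<Oplus>\<^bsub>target_module Y\<^esub>j\<in>index_set. inclusion Y j (z j))"
    using A.product_module_decompose[of "\<lambda>j. obj Y (fst j + 1)" index_set z] Y z
    by (simp add: inclusion_def target_module_def)
  also have "\<dots> = (\<Oplus>\<^bsub>regular A\<^esub>j\<in>index_set. \<gamma> (inclusion Y j (z j)))"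
    by (rule A.module_homs_finsum[OF \<gamma> _ A.regular_module]) (use Y ic in auto)
  also have "\<dots> = (\<Oplus>\<^bsub>A\<^esub>j\<in>index_set. \<gamma> (inclusion Y j (z j)))"
    by (simp add: finsum_def finprod_def regular_def)
  finally have "tr (\<gamma> z) = (\<Oplus>\<^bsub>K\<^esub>j\<in>index_set. tr (\<gamma> (inclusion Y j (z j))))"
    using form_finsum[of index_set "\<lambda>j. \<gamma> (inclusion Y j (z j))"] \<gamma>c by auto
  also have "\<dots> = (\<Oplus>\<^bsub>K\<^esub>i\<in>{a..b}. \<Oplus>\<^bsub>K\<^esub>q\<in>{..<n i}. tr (\<gamma> (inclusion Y (i, q) (z (i, q)))))"
    unfolding index_set_def by (rule K.finsum_Sigma) (use \<gamma>c in \<open>auto simp: index_setD(2)\<close>)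
  finally show ?thesis .
qed

text \<open>Letting \<open>r\<close> act on \<open>y\<close> multiplies the coordinate of
  \<open>Z y\<close> by \<open>r\<close> on the right, so the hypothesis for all \<open>y\<close>
  makes that coordinate orthogonal to all of \<open>A\<close> under the form.\<close>

lemma form_separates:
  assumes M: "right_module A M" and Z: "Z \<in> module_homs A M (obj X i)"
    and z: "\<And>l y. \<lbrakk>l < n i; y \<in> carrier M\<rbrakk> \<Longrightarrow> tr (\<xi> i l (Z y)) = \<zero>\<^bsub>K\<^esub>"
    and y: "y \<in> carrier M"
  shows "Z y = \<zero>\<^bsub>obj X i\<^esub>"
proof (rule A.dual_basis_separates[OF basis])
  have Zc: "Z y \<in> carrier (obj X i)" using A.module_homs_closed[OF Z y] .
  then show "Z y \<in> carrier (obj X i)" .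
  fix l assume l: "l < n i"
  show "\<xi> i l (Z y) = \<zero>\<^bsub>A\<^esub>"
  proof (rule form_nondegenerate)
    fix r assume r: "r \<in> carrier A"
    have "\<xi> i l (Z (r \<odot>\<^bsub>M\<^esub> y)) = \<xi> i l (Z y) \<otimes>\<^bsub>A\<^esub> r"
      using A.module_homs_act[OF Z r y] A.module_homs_act[OF basisD(2)[OF l] r Zc] by simp
    then show "tr (\<xi> i l (Z y) \<otimes>\<^bsub>A\<^esub> r) = \<zero>\<^bsub>K\<^esub>"
      using z[OF l, of "r \<odot>\<^bsub>M\<^esub> y"] r y M by simp
  qed (use l Zc in simp)
qed simp

text \<open>A null-homotopy of \<open>u\<close> is found without solving equations: the pairing with
  \<open>u\<close> is represented by some \<open>\<gamma>\<close>, the components of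
  \<open>\<gamma>\<close> assemble to maps \<open>h\<close>, and testing the representation on
  rank-one maps gives the homotopy relation.\<close>

theorem hom_null_dual:
  assumes Y: "cochain_complex A Y" and null: "hom_null A X Y"
  shows "hom_null A Y X"
proof (rule A.hom_nullI)
  fix u assume u: "u \<in> chain_maps A Y X"
  interpret X: abelian_group "obj X i" for i using cx by (rule A.cc_abelian)
  obtain \<gamma> where \<gamma>: "\<gamma> \<in> module_homs A (target_module Y) (regular A)"
    and rep: "\<And>v. v \<in> graded_maps A 0 X Y \<Longrightarrow> supertrace (\<lambda>i x. u i (v i x)) = tr (\<gamma> (evaluation Y v))"
    using pairing_represented[OF Y u null] by blast
  let ?\<gamma> = "\<lambda>i q y. \<gamma> (inclusion Y (i, q) y)"
  have gh: "?\<gamma> i q \<in> module_homs A (obj Y (i + 1)) (regular A)" if "i \<in> {a..b}" "q < n i" for i q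
    using A.module_homs_comp[OF inclusion_hom[OF Y] \<gamma>, of "(i, q)"] that by (simp add: index_setD)
  have gc: "?\<gamma> i q y \<in> carrier A" if "i \<in> {a..b}" "q < n i" "y \<in> carrier (obj Y (i + 1))" for i q y
    using A.module_homs_closed[OF gh[OF that(1,2)] that(3)] by simp
  \<comment> \<open>The restriction of \<open>\<gamma>\<close> to the factor with index
    \<open>(i, q)\<close> becomes the \<open>q\<close>-th coordinate of \<open>h i\<close>.\<close>
  define h where "h i y = (if i \<in> {a..b} then \<Oplus>\<^bsub>obj X i\<^esub>q\<in>{..<n i}. ?\<gamma> i q y \<odot>\<^bsub>obj X i\<^esub> e i q
      else \<zero>\<^bsub>obj X i\<^esub>)" for i y
  have h: "h i \<in> module_homs A (obj Y (i + 1)) (obj X i)" for i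
  proof (cases "i \<in> {a..b}")
    case True
    have "(\<lambda>y. \<Oplus>\<^bsub>obj X i\<^esub>q\<in>{..<n i}. ?\<gamma> i q y \<odot>\<^bsub>obj X i\<^esub> e i q) \<in> module_homs A (obj Y (i + 1)) (obj X i)"
      by (rule A.module_homs_sum_map) (use True gh Y in \<open>auto intro: A.module_homs_scale\<close>)
    then show ?thesis using True by (simp add: h_def[abs_def])
  next
    case False
    then have "h i = (\<lambda>y. \<zero>\<^bsub>obj X i\<^esub>)" unfolding h_def by (simp only: if_False)
    then show ?thesis by (simp add: A.module_homs_zero_map)
  qed
  note hc = A.module_homs_closed[OF h]
  \<comment> \<open>The representation is tested on a rank-one map \<open>v\<close> concentrated in
    degree \<open>i\<close>. The supertrace then has a single term, and the sign is that of degree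
    \<open>i\<close>.\<close>
  have key: "(if even i then tr (\<xi> i l (u i y)) else \<ominus>\<^bsub>K\<^esub> tr (\<xi> i l (u i y)))
      = tr (\<xi> i l (h i (diff Y i y))) \<oplus>\<^bsub>K\<^esub> \<ominus>\<^bsub>K\<^esub> tr (\<xi> i l (diff X (i - 1) (h (i - 1) y)))"
    if i: "i \<in> {a..b}" and l: "l < n i" and y: "y \<in> carrier (obj Y i)" for i l y
  proof -
    define v where "v k x = (if k = i then \<xi> i l x \<odot>\<^bsub>obj Y i\<^esub> y else \<zero>\<^bsub>obj Y k\<^esub>)" for k x
    have sc: "(\<lambda>x. \<xi> i l x \<odot>\<^bsub>obj Y i\<^esub> y) \<in> module_homs A (obj X i) (obj Y i)"
      by (rule A.module_homs_scale[OF basisD(2)[OF l]]) (use Y y in simp_all)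
    have v: "v \<in> graded_maps A 0 X Y"
    proof (rule A.gmI)
      show "v k \<in> module_homs A (obj X k) (obj Y (k + 0))" for k
        using sc A.module_homs_zero_map[of "obj Y k"] Y by (cases "k = i") (simp_all add: v_def[abs_def])
    qed
    have yc: "diff Y i y \<in> carrier (obj Y (i + 1))" using Y y by simp
    have zc: "h i (diff Y i y) \<in> carrier (obj X i)" "h (i - 1) y \<in> carrier (obj X (i - 1))"
      using hc[OF yc] hc[of y "i - 1"] y by simp_all
    have dh: "diff X (i - 1) (h (i - 1) y) \<in> carrier (obj X i)" using zc(2) cx by simp
    have tc: "tr (\<xi> i l (h i (diff Y i y))) \<in> carrier K" "tr (\<xi> i l (diff X (i - 1) (h (i - 1) y))) \<in> carrier K"
      "tr (\<xi> i l (u i y)) \<in> carrier K"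
      using zc dh l y u by simp_all
    have tk: "trace k (\<lambda>x. u k (v k x)) = (if i = k then tr (\<xi> i l (u i y)) else \<zero>\<^bsub>K\<^esub>)" for k
    proof (cases "k = i")
      case True
      then show ?thesis
        using trace_single[OF A.chain_maps_hom[OF u] _ y l] Y by (simp add: v_def)
    next
      case False
      have "trace k (\<lambda>x. u k (v k x)) = trace k (\<lambda>x. \<zero>\<^bsub>obj X k\<^esub>)"
        by (rule trace_cong) (use False u Y cx in \<open>simp_all add: v_def\<close>)
      then show ?thesis using False by (simp add: trace_zero)
    qed
    have "supertrace (\<lambda>i x. u i (v i x)) = (\<Oplus>\<^bsub>K\<^esub>k\<in>{a..b}. if i = k then
        (if even i then tr (\<xi> i l (u i y)) else \<ominus>\<^bsub>K\<^esub> tr (\<xi> i l (u i y))) else \<zero>\<^bsub>K\<^esub>)"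
      unfolding supertrace_def tk by (rule K.finsum_cong') (use tc in auto)
    also have "\<dots> = (if even i then tr (\<xi> i l (u i y)) else \<ominus>\<^bsub>K\<^esub> tr (\<xi> i l (u i y)))"
      by (rule K.finsum_singleton) (use i tc in auto)
    finally have lhs: "supertrace (\<lambda>i x. u i (v i x))
        = (if even i then tr (\<xi> i l (u i y)) else \<ominus>\<^bsub>K\<^esub> tr (\<xi> i l (u i y)))" .
    \<comment> \<open>Since \<open>v\<close> sits in degree \<open>i\<close> alone,
      \<open>d v\<close> meets the indices of degree \<open>i\<close> and \<open>v d\<close> those
      of degree \<open>i - 1\<close>; the latter carry the minus sign of
      \<open>d v - v d\<close>.\<close>
    have G: "(\<Oplus>\<^bsub>K\<^esub>q\<in>{..<n k}. tr (?\<gamma> k q (evaluation Y v (k, q))))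
        = (if i = k then tr (\<xi> i l (h i (diff Y i y))) else \<zero>\<^bsub>K\<^esub>) \<oplus>\<^bsub>K\<^esub>
          (if i - 1 = k then \<ominus>\<^bsub>K\<^esub> tr (\<xi> i l (diff X (i - 1) (h (i - 1) y))) else \<zero>\<^bsub>K\<^esub>)"
      if k: "k \<in> {a..b}" for k
    proof -
      have ev: "evaluation Y v (k, q) = diff Y k (v k (e k q)) \<ominus>\<^bsub>obj Y (k + 1)\<^esub> v (k + 1) (diff X k (e k q))"
        if "q < n k" for q using that k by (simp add: evaluation_def index_setD)
      consider "k = i" | "k = i - 1" | "k \<noteq> i" "k \<noteq> i - 1" by blast
      then show ?thesis
      proof cases
        case 1
        have "(\<Oplus>\<^bsub>K\<^esub>q\<in>{..<n i}. tr (?\<gamma> i q (evaluation Y v (i, q))))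
            = (\<Oplus>\<^bsub>K\<^esub>q\<in>{..<n i}. tr (?\<gamma> i q (diff Y i y) \<otimes>\<^bsub>A\<^esub> \<xi> i l (e i q)))"
        proof (rule K.finsum_cong')
          fix q assume q: "q \<in> {..<n i}"
          have "evaluation Y v (i, q) = \<xi> i l (e i q) \<odot>\<^bsub>obj Y (i + 1)\<^esub> diff Y i y"
            using q ev 1 Y y l yc by (simp add: v_def)
          then show "tr (?\<gamma> i q (evaluation Y v (i, q))) = tr (?\<gamma> i q (diff Y i y) \<otimes>\<^bsub>A\<^esub> \<xi> i l (e i q))"
            using A.module_homs_act[OF gh[OF i]] q l yc by simp
        qed (use gc[OF i] yc l in auto)
        also have "\<dots> = tr (\<xi> i l (h i (diff Y i y)))"
          using i by (subst form_dual_basis_sum[OF _ basisD(2)[OF l]]) (use gc[OF i] yc in \<open>auto simp: h_def\<close>)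
        finally show ?thesis using 1 tc by simp
      next
        case 2
        have k1: "i - 1 \<in> {a..b}" "k + 1 = i" using k 2 by auto
        have y': "y \<in> carrier (obj Y (i - 1 + 1))" using y by simp
        have dx: "diff X (i - 1) x \<in> carrier (obj X i)" if "x \<in> carrier (obj X (i - 1))" for x
          using that cx by simp
        have xd: "(\<lambda>x. \<xi> i l (diff X (i - 1) x)) \<in> module_homs A (obj X (i - 1)) (regular A)"
          by (rule A.module_homs_comp[OF _ basisD(2)[OF l]]) (rule A.cc_diff_hom[OF cx], simp)
        have "(\<Oplus>\<^bsub>K\<^esub>q\<in>{..<n k}. tr (?\<gamma> k q (evaluation Y v (k, q))))
            = (\<Oplus>\<^bsub>K\<^esub>q\<in>{..<n (i - 1)}. \<ominus>\<^bsub>K\<^esub> tr (?\<gamma> (i - 1) q y \<otimes>\<^bsub>A\<^esub> \<xi> i l (diff X (i - 1) (e (i - 1) q))))"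
          unfolding 2
        proof (rule K.finsum_cong')
          fix q assume q: "q \<in> {..<n (i - 1)}"
          have c: "\<xi> i l (diff X (i - 1) (e (i - 1) q)) \<in> carrier A" using q l dx by simp
          have "evaluation Y v (i - 1, q) = \<ominus>\<^bsub>obj Y i\<^esub> (\<xi> i l (diff X (i - 1) (e (i - 1) q)) \<odot>\<^bsub>obj Y i\<^esub> y)"
            using q ev[unfolded 2, of q] Y y c by (simp add: v_def)
          then have "?\<gamma> (i - 1) q (evaluation Y v (i - 1, q))
              = \<ominus>\<^bsub>regular A\<^esub> (?\<gamma> (i - 1) q (\<xi> i l (diff X (i - 1) (e (i - 1) q)) \<odot>\<^bsub>obj Y (i - 1 + 1)\<^esub> y))"
            using A.module_homs_neg[OF gh[OF k1(1)] _ A.regular_module, of q] q c y Y by simp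
          also have "\<dots> = \<ominus>\<^bsub>A\<^esub> (?\<gamma> (i - 1) q y \<otimes>\<^bsub>A\<^esub> \<xi> i l (diff X (i - 1) (e (i - 1) q)))"
            using A.module_homs_act[OF gh[OF k1(1)] c y'] q c gc[OF k1(1) _ y'] by (simp add: A.regular_neg)
          finally show "tr (?\<gamma> (i - 1) q (evaluation Y v (i - 1, q)))
              = \<ominus>\<^bsub>K\<^esub> tr (?\<gamma> (i - 1) q y \<otimes>\<^bsub>A\<^esub> \<xi> i l (diff X (i - 1) (e (i - 1) q)))"
            using c gc[OF k1(1) _ y'] q by (simp add: form_neg)
        qed (use gc[OF k1(1) _ y'] l dx in auto)
        also have "\<dots> = \<ominus>\<^bsub>K\<^esub> (\<Oplus>\<^bsub>K\<^esub>q\<in>{..<n (i - 1)}. tr (?\<gamma> (i - 1) q y \<otimes>\<^bsub>A\<^esub> \<xi> i l (diff X (i - 1) (e (i - 1) q))))"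
          by (rule K.finsum_additive[symmetric])
            (use gc[OF k1(1) _ y'] l dx in \<open>auto simp: K.abelian_monoid_axioms K.minus_add\<close>)
        also have "(\<Oplus>\<^bsub>K\<^esub>q\<in>{..<n (i - 1)}. tr (?\<gamma> (i - 1) q y \<otimes>\<^bsub>A\<^esub> \<xi> i l (diff X (i - 1) (e (i - 1) q))))
            = tr (\<xi> i l (diff X (i - 1) (h (i - 1) y)))"
          using k1(1) by (subst form_dual_basis_sum[OF _ xd]) (use gc[OF k1(1) _ y'] in \<open>auto simp: h_def\<close>)
        finally show ?thesis using 2 tc by simp
      next
        case 3
        have ne: "k + 1 \<noteq> i" using 3 by auto
        have "(\<Oplus>\<^bsub>K\<^esub>q\<in>{..<n k}. tr (?\<gamma> k q (evaluation Y v (k, q)))) = (\<Oplus>\<^bsub>K\<^esub>q\<in>{..<n k}. \<zero>\<^bsub>K\<^esub>)"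
        proof (rule K.finsum_cong')
          fix q assume q: "q \<in> {..<n k}"
          have "evaluation Y v (k, q) = \<zero>\<^bsub>obj Y (k + 1)\<^esub>"
            using q ev 3 ne Y by (simp add: v_def)
          then show "tr (?\<gamma> k q (evaluation Y v (k, q))) = \<zero>\<^bsub>K\<^esub>"
            using A.module_homs_zero[OF gh[OF k] _ A.regular_module, of q] q Y by (simp add: form_zero)
        qed auto
        then show ?thesis using 3 by (simp add: K.finsum_zero)
      qed
    qed
    have "tr (\<gamma> (evaluation Y v)) = (\<Oplus>\<^bsub>K\<^esub>k\<in>{a..b}.
        (if i = k then tr (\<xi> i l (h i (diff Y i y))) else \<zero>\<^bsub>K\<^esub>) \<oplus>\<^bsub>K\<^esub>
        (if i - 1 = k then \<ominus>\<^bsub>K\<^esub> tr (\<xi> i l (diff X (i - 1) (h (i - 1) y))) else \<zero>\<^bsub>K\<^esub>))"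
      unfolding functional_decompose[OF Y \<gamma> evaluation_closed[OF Y v]]
      by (rule K.finsum_cong') (use G tc in auto)
    also have "\<dots> = (\<Oplus>\<^bsub>K\<^esub>k\<in>{a..b}. if i = k then tr (\<xi> i l (h i (diff Y i y))) else \<zero>\<^bsub>K\<^esub>) \<oplus>\<^bsub>K\<^esub>
        (\<Oplus>\<^bsub>K\<^esub>k\<in>{a..b}. if i - 1 = k then \<ominus>\<^bsub>K\<^esub> tr (\<xi> i l (diff X (i - 1) (h (i - 1) y))) else \<zero>\<^bsub>K\<^esub>)"
      by (rule K.finsum_addf) (use tc in auto)
    also have "(\<Oplus>\<^bsub>K\<^esub>k\<in>{a..b}. if i = k then tr (\<xi> i l (h i (diff Y i y))) else \<zero>\<^bsub>K\<^esub>) = tr (\<xi> i l (h i (diff Y i y)))"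
      by (rule K.finsum_singleton) (use i tc in auto)
    also have "(\<Oplus>\<^bsub>K\<^esub>k\<in>{a..b}. if i - 1 = k then \<ominus>\<^bsub>K\<^esub> tr (\<xi> i l (diff X (i - 1) (h (i - 1) y))) else \<zero>\<^bsub>K\<^esub>)
        = \<ominus>\<^bsub>K\<^esub> tr (\<xi> i l (diff X (i - 1) (h (i - 1) y)))"
    proof (cases "i - 1 \<in> {a..b}")
      case True
      then show ?thesis by (intro K.finsum_singleton) (use tc in auto)
    next
      \<comment> \<open>When \<open>i - 1\<close> falls below the range there is no such index, and
        \<open>h (i - 1)\<close> is zero by its definition.\<close>
      case False
      then have "h (i - 1) y = \<zero>\<^bsub>obj X (i - 1)\<^esub>" unfolding h_def by (simp only: if_False)
      then have z: "tr (\<xi> i l (diff X (i - 1) (h (i - 1) y))) = \<zero>\<^bsub>K\<^esub>"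
        using cx l by (simp add: cobasis_zero form_zero)
      have "(\<Oplus>\<^bsub>K\<^esub>k\<in>{a..b}. if i - 1 = k then \<ominus>\<^bsub>K\<^esub> tr (\<xi> i l (diff X (i - 1) (h (i - 1) y))) else \<zero>\<^bsub>K\<^esub>)
          = (\<Oplus>\<^bsub>K\<^esub>k\<in>{a..b}. \<zero>\<^bsub>K\<^esub>)"
        by (rule K.finsum_cong') (use z in auto)
      then show ?thesis using z by (simp add: K.finsum_zero)
    qed
    finally show ?thesis using rep[OF v] lhs by simp
  qed
  \<comment> \<open>\<open>key\<close> expresses \<open>u\<close>, up to the sign of the supertrace,
    as \<open>h d - d h\<close>. Alternating the sign of \<open>h\<close> turns this into a boundary
    \<open>d k + k d\<close>; the index drops by one because \<open>h i\<close> starts in degree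
    \<open>i + 1\<close>.\<close>
  define k where "k i y = (if even i then \<ominus>\<^bsub>obj X (i - 1)\<^esub> h (i - 1) y else h (i - 1) y)" for i y
  have h': "h (i - 1) \<in> module_homs A (obj Y i) (obj X (i - 1))" for i using h[of "i - 1"] by simp
  have kh: "k i \<in> module_homs A (obj Y i) (obj X (i - 1))" for i
    using h'[of i] A.module_homs_neg_map[OF h'] by (cases "even i") (simp_all add: k_def[abs_def])
  have km: "k \<in> graded_maps A (- 1) Y X" by (rule A.gmI) (use kh in simp)
  have "homotopic A Y X u (zero_map X)"
  proof (rule A.null_homotopicI[OF Y cx u km])
    fix i y assume y: "y \<in> carrier (obj Y i)"
    have yc: "diff Y i y \<in> carrier (obj Y (i + 1))" using Y y by simp
    have zc: "h i (diff Y i y) \<in> carrier (obj X i)" "h (i - 1) y \<in> carrier (obj X (i - 1))"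
      "u i y \<in> carrier (obj X i)"
      using hc[OF yc] hc[of y "i - 1"] y u by simp_all
    have dh: "diff X (i - 1) (h (i - 1) y) \<in> carrier (obj X i)" using zc(2) cx by simp
    have main: "(if even i then u i y else \<ominus>\<^bsub>obj X i\<^esub> u i y)
        = h i (diff Y i y) \<oplus>\<^bsub>obj X i\<^esub> \<ominus>\<^bsub>obj X i\<^esub> diff X (i - 1) (h (i - 1) y)"
    proof (cases "i \<in> {a..b}")
      case True
      define s where "s y = (if even i then u i y else \<ominus>\<^bsub>obj X i\<^esub> u i y)" for y
      define r where "r y = h i (diff Y i y) \<oplus>\<^bsub>obj X i\<^esub> \<ominus>\<^bsub>obj X i\<^esub> diff X (i - 1) (h (i - 1) y)" for y
      have sh: "s \<in> module_homs A (obj Y i) (obj X i)"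
        using A.chain_maps_hom[OF u, of i] A.module_homs_neg_map[OF A.chain_maps_hom[OF u], of i]
        by (cases "even i") (simp_all add: s_def[abs_def])
      have d1: "(\<lambda>y. h i (diff Y i y)) \<in> module_homs A (obj Y i) (obj X i)"
        by (rule A.module_homs_comp[OF A.cc_diff_hom[OF Y refl] h])
      have d2: "(\<lambda>y. diff X (i - 1) (h (i - 1) y)) \<in> module_homs A (obj Y i) (obj X i)"
        by (rule A.module_homs_comp[OF h' A.cc_diff_hom[OF cx]]) simp
      have rh: "r \<in> module_homs A (obj Y i) (obj X i)"
        unfolding r_def by (rule A.module_homs_add_map[OF d1 A.module_homs_neg_map[OF d2]]) simp_all
      have "s y \<oplus>\<^bsub>obj X i\<^esub> \<ominus>\<^bsub>obj X i\<^esub> r y = \<zero>\<^bsub>obj X i\<^esub>"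
      proof (rule form_separates[OF _ _ _ y, where Z = "\<lambda>y. s y \<oplus>\<^bsub>obj X i\<^esub> \<ominus>\<^bsub>obj X i\<^esub> r y"])
        show "(\<lambda>y. s y \<oplus>\<^bsub>obj X i\<^esub> \<ominus>\<^bsub>obj X i\<^esub> r y) \<in> module_homs A (obj Y i) (obj X i)"
          by (rule A.module_homs_add_map[OF sh A.module_homs_neg_map[OF rh]]) simp_all
        fix l y assume l: "l < n i" and y: "y \<in> carrier (obj Y i)"
        note xh = basisD(2)[OF l]
        have c: "s y \<in> carrier (obj X i)" "r y \<in> carrier (obj X i)"
          "h i (diff Y i y) \<in> carrier (obj X i)" "diff X (i - 1) (h (i - 1) y) \<in> carrier (obj X i)"
          "u i y \<in> carrier (obj X i)"
          using A.module_homs_closed[OF sh y] A.module_homs_closed[OF rh y] A.module_homs_closed[OF d1 y]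
            A.module_homs_closed[OF d2 y] u y by simp_all
        have neg: "tr (\<xi> i l (\<ominus>\<^bsub>obj X i\<^esub> w)) = \<ominus>\<^bsub>K\<^esub> tr (\<xi> i l w)" if "w \<in> carrier (obj X i)" for w
          using A.module_homs_neg[OF xh _ A.regular_module that] that l
          by (simp add: form_neg A.regular_neg)
        have add: "tr (\<xi> i l (w \<oplus>\<^bsub>obj X i\<^esub> w')) = tr (\<xi> i l w) \<oplus>\<^bsub>K\<^esub> tr (\<xi> i l w')"
          if "w \<in> carrier (obj X i)" "w' \<in> carrier (obj X i)" for w w'
          using A.module_homs_add[OF xh that] that l by (simp add: form_add)
        have "tr (\<xi> i l (s y)) = tr (\<xi> i l (r y))"
          using key[OF True l y] c by (cases "even i") (simp_all add: s_def r_def add neg)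
        then show "tr (\<xi> i l (s y \<oplus>\<^bsub>obj X i\<^esub> \<ominus>\<^bsub>obj X i\<^esub> r y)) = \<zero>\<^bsub>K\<^esub>"
          using c l by (simp add: add neg K.r_neg)
      qed (use Y in simp)
      then show ?thesis
        using X.eq_if_minus_zero[of i "s y" "r y"] A.module_homs_closed[OF sh y] A.module_homs_closed[OF rh y]
        by (simp add: X.minus_eq s_def r_def)
    next
      case False
      then have "carrier (obj X i) = {\<zero>\<^bsub>obj X i\<^esub>}" using bounded[of i] by auto
      with zc dh show ?thesis by simp
    qed
    show "u i y = diff X (i - 1) (k i y) \<oplus>\<^bsub>obj X i\<^esub> k (i + 1) (diff Y i y)"
    proof (cases "even i")
      case True
      then have "u i y = h i (diff Y i y) \<oplus>\<^bsub>obj X i\<^esub> \<ominus>\<^bsub>obj X i\<^esub> diff X (i - 1) (h (i - 1) y)" using main by simp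
      then show ?thesis using True zc dh cx X.a_comm by (simp add: k_def)
    next
      case False
      then have "\<ominus>\<^bsub>obj X i\<^esub> u i y = h i (diff Y i y) \<oplus>\<^bsub>obj X i\<^esub> \<ominus>\<^bsub>obj X i\<^esub> diff X (i - 1) (h (i - 1) y)" using main by simp
      then have "\<ominus>\<^bsub>obj X i\<^esub> (\<ominus>\<^bsub>obj X i\<^esub> u i y) = \<ominus>\<^bsub>obj X i\<^esub> (h i (diff Y i y) \<oplus>\<^bsub>obj X i\<^esub> \<ominus>\<^bsub>obj X i\<^esub> diff X (i - 1) (h (i - 1) y))" by simp
      then show ?thesis using False zc dh cx X.a_comm by (simp add: k_def X.minus_add)
    qed
  qed
  then show "K_eq A Y X u (zero_map X)" by (rule A.K_eqI) (use Y u in simp_all)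
qed

end

section \<open>Quasi-isomorphisms\<close>

definition acyclic :: "('r, 'm) cx \<Rightarrow> bool" where
  "acyclic X \<longleftrightarrow> (\<forall>n. cocycles X n \<subseteq> coboundaries X n)"

text \<open>\<open>Kb_proj\<close> for an arbitrary type of elements, so that sums, powers and cones
  are covered.\<close>

definition bounded_projective :: "('r, 'z) ring_scheme \<Rightarrow> ('r, 'm) cx \<Rightarrow> bool" where
  "bounded_projective R X \<longleftrightarrow> cochain_complex R X \<and> (\<forall>i. fg_projective R (obj X i)) \<and>
     (\<exists>a b. \<forall>i. i < a \<or> b < i \<longrightarrow> carrier (obj X i) = {\<zero>\<^bsub>obj X i\<^esub>})"

lemma Kb_proj_iff: "X \<in> Kb_proj R \<longleftrightarrow> bounded_projective R X"
  by (simp add: Kb_proj_def bounded_projective_def)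

context ring begin

lemma bounded_projective_complex [simp]: "bounded_projective R X \<Longrightarrow> cochain_complex R X"
  by (simp add: bounded_projective_def)

lemma cocyclesD: "z \<in> cocycles X n \<Longrightarrow> z \<in> carrier (obj X n)" "z \<in> cocycles X n \<Longrightarrow> diff X n z = \<zero>\<^bsub>obj X (n + 1)\<^esub>"
  by (simp_all add: cocycles_def)

lemma coboundariesI: "\<lbrakk>w \<in> carrier (obj X (n - 1)); z = diff X (n - 1) w\<rbrakk> \<Longrightarrow> z \<in> coboundaries X n"
  by (auto simp: coboundaries_def)

lemma coboundariesE:
  assumes "z \<in> coboundaries X n"
  obtains w where "w \<in> carrier (obj X (n - 1))" "z = diff X (n - 1) w"
  using assms by (auto simp: coboundaries_def)

lemma coboundaries_simps:
  assumes X: "cochain_complex R X"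
  shows "z \<in> coboundaries X n \<Longrightarrow> z \<in> carrier (obj X n)"
    and "z \<in> coboundaries X n \<Longrightarrow> z \<in> cocycles X n"
    and "\<zero>\<^bsub>obj X n\<^esub> \<in> coboundaries X n"
    and "\<lbrakk>z \<in> coboundaries X n; w \<in> coboundaries X n\<rbrakk> \<Longrightarrow> z \<oplus>\<^bsub>obj X n\<^esub> w \<in> coboundaries X n"
    and "z \<in> coboundaries X n \<Longrightarrow> \<ominus>\<^bsub>obj X n\<^esub> z \<in> coboundaries X n"
proof -
  show c: "z \<in> carrier (obj X n)" if "z \<in> coboundaries X n"
    using that X by (auto elim!: coboundariesE)
  show "z \<in> cocycles X n" if "z \<in> coboundaries X n"
    using that X by (elim coboundariesE) (simp add: cocycles_def, simp add: ac_simps)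
  show "\<zero>\<^bsub>obj X n\<^esub> \<in> coboundaries X n"
    by (rule coboundariesI[of "\<zero>\<^bsub>obj X (n - 1)\<^esub>"]) (use X in simp_all)
  show "z \<oplus>\<^bsub>obj X n\<^esub> w \<in> coboundaries X n" if z: "z \<in> coboundaries X n" and w: "w \<in> coboundaries X n"
  proof -
    obtain z' w' where "z' \<in> carrier (obj X (n - 1))" "z = diff X (n - 1) z'"
      "w' \<in> carrier (obj X (n - 1))" "w = diff X (n - 1) w'"
      using z w by (elim coboundariesE) blast
    then show ?thesis
      using X by (intro coboundariesI[of "z' \<oplus>\<^bsub>obj X (n - 1)\<^esub> w'"]) simp_all
  qed
  show "\<ominus>\<^bsub>obj X n\<^esub> z \<in> coboundaries X n" if z: "z \<in> coboundaries X n"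
  proof -
    obtain z' where "z' \<in> carrier (obj X (n - 1))" "z = diff X (n - 1) z'"
      using z by (elim coboundariesE) blast
    then show ?thesis
      using X by (intro coboundariesI[of "\<ominus>\<^bsub>obj X (n - 1)\<^esub> z'"]) simp_all
  qed
qed

lemma chain_map_cocycles:
  assumes f: "f \<in> chain_maps R X Y" and X: "cochain_complex R X" and Y: "cochain_complex R Y"
  shows "z \<in> cocycles X n \<Longrightarrow> f n z \<in> cocycles Y n"
    and "z \<in> coboundaries X n \<Longrightarrow> f n z \<in> coboundaries Y n"
proof -
  show "f n z \<in> cocycles Y n" if "z \<in> cocycles X n"
    using that cm_simps(7)[OF f, of z n "n + 1"] f X Y by (simp add: cocycles_def)
  show "f n z \<in> coboundaries Y n" if z: "z \<in> coboundaries X n"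
  proof -
    obtain z' where "z' \<in> carrier (obj X (n - 1))" "z = diff X (n - 1) z'"
      using z by (elim coboundariesE) blast
    then show ?thesis
      using f by (intro coboundariesI[of "f (n - 1) z'"]) simp_all
  qed
qed

lemma coset_eq_iff:
  assumes X: "cochain_complex R X" and z: "z \<in> carrier (obj X n)" and w: "w \<in> carrier (obj X n)"
  shows "coboundaries X n +>\<^bsub>obj X n\<^esub> z = coboundaries X n +>\<^bsub>obj X n\<^esub> w \<longleftrightarrow> z \<ominus>\<^bsub>obj X n\<^esub> w \<in> coboundaries X n"
    (is "?B z = ?B w \<longleftrightarrow> _")
proof -
  interpret X: abelian_group "obj X n" using X by (rule cc_abelian)
  note b = coboundaries_simps[OF X]
  have mem: "y \<in> ?B x \<longleftrightarrow> (\<exists>d\<in>coboundaries X n. y = d \<oplus>\<^bsub>obj X n\<^esub> x)" for x y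
    by (auto simp: a_r_coset_def r_coset_def)
  show ?thesis
  proof
    assume "?B z = ?B w"
    moreover have "z \<in> ?B z" unfolding mem using b(3)[of n] z by (intro bexI[of _ "\<zero>\<^bsub>obj X n\<^esub>"]) simp_all
    ultimately obtain d where d: "d \<in> coboundaries X n" "z = d \<oplus>\<^bsub>obj X n\<^esub> w" using mem by blast
    then have "z \<ominus>\<^bsub>obj X n\<^esub> w = d" using b(1)[OF d(1)] w by (simp only: d(2)) algebra
    then show "z \<ominus>\<^bsub>obj X n\<^esub> w \<in> coboundaries X n" using d(1) by simp
  next
    assume d: "z \<ominus>\<^bsub>obj X n\<^esub> w \<in> coboundaries X n"
    show "?B z = ?B w"
    proof (intro equalityI subsetI)
      fix y assume "y \<in> ?B z"
      then obtain c where c: "c \<in> coboundaries X n" "y = c \<oplus>\<^bsub>obj X n\<^esub> z" using mem by blast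
      have "y = (c \<oplus>\<^bsub>obj X n\<^esub> (z \<ominus>\<^bsub>obj X n\<^esub> w)) \<oplus>\<^bsub>obj X n\<^esub> w" unfolding c(2) using b(1)[OF c(1)] z w by algebra
      then show "y \<in> ?B w" unfolding mem using b(4)[OF c(1) d] by blast
    next
      fix y assume "y \<in> ?B w"
      then obtain c where c: "c \<in> coboundaries X n" "y = c \<oplus>\<^bsub>obj X n\<^esub> w" using mem by blast
      have "y = (c \<oplus>\<^bsub>obj X n\<^esub> \<ominus>\<^bsub>obj X n\<^esub> (z \<ominus>\<^bsub>obj X n\<^esub> w)) \<oplus>\<^bsub>obj X n\<^esub> z" unfolding c(2) using b(1)[OF c(1)] z w by algebra
      then show "y \<in> ?B z" unfolding mem using b(4)[OF c(1) b(5)[OF d]] by blast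
    qed
  qed
qed

lemma cohomology_map_coset:
  assumes f: "f \<in> chain_maps R X Y" and X: "cochain_complex R X" and Y: "cochain_complex R Y"
    and z: "z \<in> carrier (obj X n)"
  shows "cohomology_map Y f n (coboundaries X n +>\<^bsub>obj X n\<^esub> z) = coboundaries Y n +>\<^bsub>obj Y n\<^esub> f n z"
proof -
  interpret Y: abelian_group "obj Y n" using Y by (rule cc_abelian)
  have mem: "y \<in> coboundaries X n +>\<^bsub>obj X n\<^esub> z \<longleftrightarrow> (\<exists>d\<in>coboundaries X n. y = d \<oplus>\<^bsub>obj X n\<^esub> z)" for y
    by (auto simp: a_r_coset_def r_coset_def)
  have "coboundaries Y n +>\<^bsub>obj Y n\<^esub> f n y = coboundaries Y n +>\<^bsub>obj Y n\<^esub> f n z"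
    if y: "y \<in> coboundaries X n +>\<^bsub>obj X n\<^esub> z" for y
  proof -
    obtain d where d: "d \<in> coboundaries X n" "y = d \<oplus>\<^bsub>obj X n\<^esub> z"
      using iffD1[OF mem y] by (elim bexE)
    have dc: "d \<in> carrier (obj X n)" "f n d \<in> carrier (obj Y n)" "f n z \<in> carrier (obj Y n)"
      using coboundaries_simps(1)[OF X d(1)] f z by auto
    have fy: "f n y = f n d \<oplus>\<^bsub>obj Y n\<^esub> f n z" using f dc z by (simp add: d(2))
    have "f n y \<ominus>\<^bsub>obj Y n\<^esub> f n z = f n d" unfolding fy using dc(2,3) by algebra
    then show ?thesis
      using coset_eq_iff[OF Y, of "f n y" n "f n z"] chain_map_cocycles(2)[OF f X Y d(1)] fy dc Y by simp
  qed
  then have "cohomology_map Y f n (coboundaries X n +>\<^bsub>obj X n\<^esub> z)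
      = (\<Union>y\<in>coboundaries X n +>\<^bsub>obj X n\<^esub> z. coboundaries Y n +>\<^bsub>obj Y n\<^esub> f n z)"
    unfolding cohomology_map_def by (rule SUP_cong[OF refl])
  moreover have "z \<in> coboundaries X n +>\<^bsub>obj X n\<^esub> z"
    unfolding mem using coboundaries_simps(3)[OF X] z X by (intro bexI[of _ "\<zero>\<^bsub>obj X n\<^esub>"]) simp_all
  ultimately show ?thesis by (metis UN_constant empty_iff)
qed

text \<open>Cohomology consists of cosets; here injectivity and surjectivity are restated for
  cocycles, and cosets do not occur in the arguments with quasi-isomorphisms that follow.\<close>

lemma quasi_iso_iff:
  assumes f: "f \<in> chain_maps R X Y" and X: "cochain_complex R X" and Y: "cochain_complex R Y"
  shows "quasi_iso R X Y f \<longleftrightarrow>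
    (\<forall>n. \<forall>z\<in>cocycles X n. f n z \<in> coboundaries Y n \<longrightarrow> z \<in> coboundaries X n) \<and>
    (\<forall>n. \<forall>y\<in>cocycles Y n. \<exists>z\<in>cocycles X n. y \<ominus>\<^bsub>obj Y n\<^esub> f n z \<in> coboundaries Y n)"
    (is "_ \<longleftrightarrow> (\<forall>n. ?I n) \<and> (\<forall>n. ?S n)")
proof -
  have "bij_betw (cohomology_map Y f n) (cohomology X n) (cohomology Y n) \<longleftrightarrow> ?I n \<and> ?S n" for n
  proof -
    interpret X: abelian_group "obj X n" using X by (rule cc_abelian)
    let ?BX = "\<lambda>z. coboundaries X n +>\<^bsub>obj X n\<^esub> z"
    let ?BY = "\<lambda>z. coboundaries Y n +>\<^bsub>obj Y n\<^esub> z"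
    note m = cohomology_map_coset[OF f X Y cocyclesD(1)]
    have "inj_on (cohomology_map Y f n) (cohomology X n) \<longleftrightarrow>
      (\<forall>z\<in>cocycles X n. \<forall>w\<in>cocycles X n. ?BY (f n z) = ?BY (f n w) \<longrightarrow> ?BX z = ?BX w)"
      unfolding inj_on_def cohomology_def by (auto simp: m)
    also have "\<dots> \<longleftrightarrow> (\<forall>z\<in>cocycles X n. \<forall>w\<in>cocycles X n.
        f n (z \<ominus>\<^bsub>obj X n\<^esub> w) \<in> coboundaries Y n \<longrightarrow> z \<ominus>\<^bsub>obj X n\<^esub> w \<in> coboundaries X n)"
    proof (intro ball_cong refl)
      fix z w assume "z \<in> cocycles X n" "w \<in> cocycles X n"
      then have zw: "z \<in> carrier (obj X n)" "w \<in> carrier (obj X n)" by (simp_all add: cocyclesD)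
      show "(?BY (f n z) = ?BY (f n w) \<longrightarrow> ?BX z = ?BX w) =
          (f n (z \<ominus>\<^bsub>obj X n\<^esub> w) \<in> coboundaries Y n \<longrightarrow> z \<ominus>\<^bsub>obj X n\<^esub> w \<in> coboundaries X n)"
        unfolding coset_eq_iff[OF X zw] coset_eq_iff[OF Y cm_simps(1)[OF f zw(1)] cm_simps(1)[OF f zw(2)]]
          cm_simps(5)[OF f X Y zw] ..
    qed
    also have "\<dots> \<longleftrightarrow> ?I n"
    proof (intro iffI ballI impI)
      fix z assume a: "\<forall>z\<in>cocycles X n. \<forall>w\<in>cocycles X n.
        f n (z \<ominus>\<^bsub>obj X n\<^esub> w) \<in> coboundaries Y n \<longrightarrow> z \<ominus>\<^bsub>obj X n\<^esub> w \<in> coboundaries X n"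
        and z: "z \<in> cocycles X n" and fz: "f n z \<in> coboundaries Y n"
      have "\<zero>\<^bsub>obj X n\<^esub> \<in> cocycles X n" using X by (simp add: cocycles_def)
      with a z have "f n (z \<ominus>\<^bsub>obj X n\<^esub> \<zero>\<^bsub>obj X n\<^esub>) \<in> coboundaries Y n \<longrightarrow> z \<ominus>\<^bsub>obj X n\<^esub> \<zero>\<^bsub>obj X n\<^esub> \<in> coboundaries X n"
        by blast
      then show "z \<in> coboundaries X n" using fz cocyclesD(1)[OF z] X by simp
    next
      fix z w assume a: "?I n" and zw: "z \<in> cocycles X n" "w \<in> cocycles X n"
        "f n (z \<ominus>\<^bsub>obj X n\<^esub> w) \<in> coboundaries Y n"
      have "z \<ominus>\<^bsub>obj X n\<^esub> w \<in> cocycles X n"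
        using zw X by (simp add: cocycles_def)
      then show "z \<ominus>\<^bsub>obj X n\<^esub> w \<in> coboundaries X n" using a zw(3) by blast
    qed
    finally have inj: "inj_on (cohomology_map Y f n) (cohomology X n) \<longleftrightarrow> ?I n" .
    have "cohomology_map Y f n ` cohomology X n = cohomology Y n \<longleftrightarrow>
      (\<forall>y\<in>cocycles Y n. \<exists>z\<in>cocycles X n. ?BY y = ?BY (f n z))"
    proof -
      have "cohomology_map Y f n ` cohomology X n = (\<lambda>z. ?BY (f n z)) ` cocycles X n"
        unfolding cohomology_def image_image by (rule image_cong) (simp_all add: m)
      moreover have "(\<lambda>z. ?BY (f n z)) ` cocycles X n \<subseteq> cohomology Y n"
        unfolding cohomology_def using chain_map_cocycles(1)[OF f X Y] by blast
      ultimately have "cohomology_map Y f n ` cohomology X n = cohomology Y n \<longleftrightarrow>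
          cohomology Y n \<subseteq> (\<lambda>z. ?BY (f n z)) ` cocycles X n" by auto
      then show ?thesis by (simp add: cohomology_def image_subset_iff image_iff)
    qed
    also have "\<dots> \<longleftrightarrow> ?S n"
      using coset_eq_iff[OF Y] f cocyclesD(1) by (metis (no_types, lifting) cm_simps(1))
    finally show ?thesis unfolding bij_betw_def using inj by blast
  qed
  then show ?thesis using f unfolding quasi_iso_def by blast
qed

lemma quasi_isoD:
  assumes "quasi_iso R X Y f" and X: "cochain_complex R X" and Y: "cochain_complex R Y"
  shows "f \<in> chain_maps R X Y"
    and "\<lbrakk>z \<in> cocycles X n; f n z \<in> coboundaries Y n\<rbrakk> \<Longrightarrow> z \<in> coboundaries X n"
    and "y \<in> cocycles Y n \<Longrightarrow> \<exists>z\<in>cocycles X n. y \<ominus>\<^bsub>obj Y n\<^esub> f n z \<in> coboundaries Y n"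
proof -
  show f: "f \<in> chain_maps R X Y" using assms(1) by (simp add: quasi_iso_def)
  show "\<lbrakk>z \<in> cocycles X n; f n z \<in> coboundaries Y n\<rbrakk> \<Longrightarrow> z \<in> coboundaries X n"
    and "y \<in> cocycles Y n \<Longrightarrow> \<exists>z\<in>cocycles X n. y \<ominus>\<^bsub>obj Y n\<^esub> f n z \<in> coboundaries Y n"
    using assms(1) unfolding quasi_iso_iff[OF f X Y] by blast+
qed

lemma homotopic_cocycle:
  assumes "K_eq R X Y f g" and z: "z \<in> cocycles X n"
  shows "f n z \<ominus>\<^bsub>obj Y n\<^esub> g n z \<in> coboundaries Y n"
proof -
  note a = K_eqD[OF assms(1)]
  interpret Y: abelian_group "obj Y n" using a(3) by (rule cc_abelian)
  obtain h where h: "h \<in> graded_maps R (-1) X Y"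
    and e: "\<And>i x. x \<in> carrier (obj X i) \<Longrightarrow>
      f i x = g i x \<oplus>\<^bsub>obj Y i\<^esub> (diff Y (i - 1) (h i x) \<oplus>\<^bsub>obj Y i\<^esub> h (i + 1) (diff X i x))"
    using homotopicE[OF a] by blast
  have c: "z \<in> carrier (obj X n)" "h n z \<in> carrier (obj Y (n - 1))" "g n z \<in> carrier (obj Y n)"
    "diff Y (n - 1) (h n z) \<in> carrier (obj Y n)"
    using cocyclesD(1)[OF z] h a by simp_all
  have "h (n + 1) \<zero>\<^bsub>obj X (n + 1)\<^esub> = \<zero>\<^bsub>obj Y n\<^esub>" using gm_simps(3)[OF h a(2,3), of "n + 1"] by simp
  then have "f n z = g n z \<oplus>\<^bsub>obj Y n\<^esub> diff Y (n - 1) (h n z)"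
    using e[OF c(1)] cocyclesD(2)[OF z] c a by simp
  then have "f n z \<ominus>\<^bsub>obj Y n\<^esub> g n z = diff Y (n - 1) (h n z)" using c by simp algebra
  then show ?thesis using c(2) by (rule_tac coboundariesI)
qed

lemma K_inverse_quasi_iso:
  assumes "K_inverse R X Y f g"
  shows "quasi_iso R X Y f"
proof -
  note a = K_inverseD[OF assms]
  show ?thesis
    unfolding quasi_iso_iff[OF a(1,5,6)]
  proof (intro conjI allI ballI impI)
    fix n z assume z: "z \<in> cocycles X n" and fz: "f n z \<in> coboundaries Y n"
    interpret X: abelian_group "obj X n" using a(5) by (rule cc_abelian)
    have zc: "z \<in> carrier (obj X n)" "g n (f n z) \<in> carrier (obj X n)" using cocyclesD(1)[OF z] a by simp_all
    have 1: "g n (f n z) \<ominus>\<^bsub>obj X n\<^esub> z \<in> coboundaries X n" using homotopic_cocycle[OF a(3) z] by simp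
    have 2: "g n (f n z) \<in> coboundaries X n" using chain_map_cocycles(2)[OF a(2,6,5) fz] .
    have "g n (f n z) \<oplus>\<^bsub>obj X n\<^esub> \<ominus>\<^bsub>obj X n\<^esub> (g n (f n z) \<ominus>\<^bsub>obj X n\<^esub> z) = z" using zc by algebra
    then show "z \<in> coboundaries X n"
      using coboundaries_simps(4)[OF a(5) 2 coboundaries_simps(5)[OF a(5) 1]] by simp
  next
    fix n y assume y: "y \<in> cocycles Y n"
    interpret Y: abelian_group "obj Y n" using a(6) by (rule cc_abelian)
    have yc: "y \<in> carrier (obj Y n)" "f n (g n y) \<in> carrier (obj Y n)" using cocyclesD(1)[OF y] a by simp_all
    have 1: "f n (g n y) \<ominus>\<^bsub>obj Y n\<^esub> y \<in> coboundaries Y n" using homotopic_cocycle[OF a(4) y] by simp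
    have "\<ominus>\<^bsub>obj Y n\<^esub> (f n (g n y) \<ominus>\<^bsub>obj Y n\<^esub> y) = y \<ominus>\<^bsub>obj Y n\<^esub> f n (g n y)" using yc by algebra
    then have "y \<ominus>\<^bsub>obj Y n\<^esub> f n (g n y) \<in> coboundaries Y n"
      using coboundaries_simps(5)[OF a(6) 1] by simp
    then show "\<exists>z\<in>cocycles X n. y \<ominus>\<^bsub>obj Y n\<^esub> f n z \<in> coboundaries Y n"
      using chain_map_cocycles(1)[OF a(2,6,5) y] by blast
  qed
qed

lemma K_iso_quasi_iso:
  assumes "K_iso R X Y" "cochain_complex R X" "cochain_complex R Y"
  obtains f where "quasi_iso R X Y f"
  using assms by (meson K_isoD K_inverse_quasi_iso)

text \<open>For a cocycle \<open>(x, y)\<close> of the cone, \<open>f x\<close> is a coboundary up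
  to sign, so injectivity gives \<open>x = d x'\<close>. Then \<open>f x' + y\<close> is a cocycle,
  and surjectivity supplies the cocycle \<open>z\<close> of \<open>X\<close> that corrects
  \<open>x'\<close>.\<close>

lemma cone_acyclic:
  assumes q: "quasi_iso R X Y f" and X: "cochain_complex R X" and Y: "cochain_complex R Y"
  shows "acyclic (cone X Y f)"
  unfolding acyclic_def
proof (intro allI subsetI)
  fix i p assume p: "p \<in> cocycles (cone X Y f) i"
  note f = quasi_isoD(1)[OF q X Y]
  interpret Y: abelian_group "obj Y j" for j using Y by (rule cc_abelian)
  interpret X: abelian_group "obj X j" for j using X by (rule cc_abelian)
  obtain x y where [simp]: "p = (x, y)" by (cases p)
  have x: "x \<in> carrier (obj X (i + 1))" and y: "y \<in> carrier (obj Y i)" using cocyclesD(1)[OF p] by auto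
  have dx: "\<ominus>\<^bsub>obj X (i + 2)\<^esub> diff X (i + 1) x = \<zero>\<^bsub>obj X (i + 2)\<^esub>"
    and dy: "f (i + 1) x \<oplus>\<^bsub>obj Y (i + 1)\<^esub> diff Y i y = \<zero>\<^bsub>obj Y (i + 1)\<^esub>"
    using cocyclesD(2)[OF p] by (simp_all add: ac_simps)
  have xz: "x \<in> cocycles X (i + 1)"
  proof -
    have c: "diff X (i + 1) x \<in> carrier (obj X (i + 2))" using x X by simp
    have "diff X (i + 1) x = \<zero>\<^bsub>obj X (i + 2)\<^esub>"
      using arg_cong[OF dx, of "a_inv (obj X (i + 2))"] c X by simp
    then show ?thesis using x by (simp add: cocycles_def ac_simps)
  qed
  have "f (i + 1) x \<in> coboundaries Y (i + 1)"
  proof (rule coboundariesI)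
    show "\<ominus>\<^bsub>obj Y i\<^esub> y \<in> carrier (obj Y (i + 1 - 1))" using y by simp
    have c: "f (i + 1) x \<in> carrier (obj Y (i + 1))" "diff Y i y \<in> carrier (obj Y (i + 1))"
      using f x Y y by simp_all
    then have "f (i + 1) x = \<ominus>\<^bsub>obj Y (i + 1)\<^esub> diff Y i y" using dy by (simp add: Y.minus_equality)
    then show "f (i + 1) x = diff Y (i + 1 - 1) (\<ominus>\<^bsub>obj Y i\<^esub> y)" using y Y by simp
  qed
  then have "x \<in> coboundaries X (i + 1)" by (rule quasi_isoD(2)[OF q X Y xz])
  then obtain x' where x': "x' \<in> carrier (obj X i)" "x = diff X i x'"
    by (elim coboundariesE) simp
  have c: "f i x' \<in> carrier (obj Y i)" "diff Y i (f i x') \<in> carrier (obj Y (i + 1))"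
    "diff Y i y \<in> carrier (obj Y (i + 1))"
    using f x' Y y by simp_all
  have "diff Y i (f i x' \<oplus>\<^bsub>obj Y i\<^esub> y) = \<zero>\<^bsub>obj Y (i + 1)\<^esub>"
    using dy f x' Y y by simp
  then have "f i x' \<oplus>\<^bsub>obj Y i\<^esub> y \<in> cocycles Y i" using c y by (simp add: cocycles_def)
  then obtain z where z: "z \<in> cocycles X i"
    and b: "(f i x' \<oplus>\<^bsub>obj Y i\<^esub> y) \<ominus>\<^bsub>obj Y i\<^esub> f i z \<in> coboundaries Y i"
    using quasi_isoD(3)[OF q X Y] by blast
  obtain w where w: "w \<in> carrier (obj Y (i - 1))" "(f i x' \<oplus>\<^bsub>obj Y i\<^esub> y) \<ominus>\<^bsub>obj Y i\<^esub> f i z = diff Y (i - 1) w"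
    using b by (elim coboundariesE)
  have zc: "z \<in> carrier (obj X i)" "f i z \<in> carrier (obj Y i)" using cocyclesD(1)[OF z] f by simp_all
  have "y = f i (z \<ominus>\<^bsub>obj X i\<^esub> x') \<oplus>\<^bsub>obj Y i\<^esub> ((f i x' \<oplus>\<^bsub>obj Y i\<^esub> y) \<ominus>\<^bsub>obj Y i\<^esub> f i z)"
    using cm_simps(5)[OF f X Y zc(1) x'(1)] zc(2) c(1) y by simp algebra
  then have y': "y = f i (z \<ominus>\<^bsub>obj X i\<^esub> x') \<oplus>\<^bsub>obj Y i\<^esub> diff Y (i - 1) w" using w(2) by simp
  have xx: "\<ominus>\<^bsub>obj X (i + 1)\<^esub> diff X i (z \<ominus>\<^bsub>obj X i\<^esub> x') = x"
    using zc x' X cocyclesD(2)[OF z] x by simp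
  have [simp]: "i - 1 + 2 = i + 1" by simp
  show "p \<in> coboundaries (cone X Y f) i"
    by (rule coboundariesI[of "(z \<ominus>\<^bsub>obj X i\<^esub> x', w)"])
      (use zc x' w(1) X xx y' in simp_all)
qed

text \<open>The homotopy is built by descending recursion from the top degree of \<open>Q\<close>:
  at each stage the defect is a cocycle of \<open>N\<close>, hence a coboundary, and projectivity
  lifts it.\<close>

lemma hom_null_acyclic:
  assumes Q: "bounded_projective R Q" and N: "cochain_complex R N" and ac: "acyclic N"
  shows "hom_null R Q N"
proof (rule hom_nullI)
  fix f assume f: "f \<in> chain_maps R Q N"
  have Qc: "cochain_complex R Q" using Q by simp
  interpret N: abelian_group "obj N i" for i using N by (rule cc_abelian)
  obtain b where b: "\<And>i. b < i \<Longrightarrow> carrier (obj Q i) = {\<zero>\<^bsub>obj Q i\<^esub>}"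
    using Q unfolding bounded_projective_def by blast
  \<comment> \<open>Stage \<open>k\<close> produces the component \<open>h\<close> of the homotopy
    that starts in degree \<open>b + 1 - k\<close>. The second half of \<open>?P\<close>, that
    \<open>d h d\<close> equals \<open>f d\<close>, is the invariant that makes the next defect a
    cocycle; \<open>?R\<close> is the homotopy relation in degree \<open>b - k\<close>.\<close>
  let ?P = "\<lambda>k h. h \<in> module_homs R (obj Q (b + 1 - int k)) (obj N (b - int k)) \<and>
     (\<forall>x\<in>carrier (obj Q (b - int k)). diff N (b - int k) (h (diff Q (b - int k) x))
        = f (b + 1 - int k) (diff Q (b - int k) x))"
  let ?R = "\<lambda>k h h'. \<forall>x\<in>carrier (obj Q (b - int k)).
      f (b - int k) x = diff N (b - 1 - int k) (h' x) \<oplus>\<^bsub>obj N (b - int k)\<^esub> h (diff Q (b - int k) x)"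
  have "\<exists>g. \<forall>k. ?P k (g k) \<and> ?R k (g k) (g (Suc k))"
  proof (rule dependent_nat_choice)
    have z: "diff Q b x = \<zero>\<^bsub>obj Q (b + 1)\<^esub>" if "x \<in> carrier (obj Q b)" for x
    proof -
      have "diff Q b x \<in> carrier (obj Q (b + 1))" using that Qc by simp
      then show ?thesis using b[of "b + 1"] by auto
    qed
    show "\<exists>h. ?P 0 h"
      by (rule exI[of _ "\<lambda>x. \<zero>\<^bsub>obj N b\<^esub>"]) (use z N Qc f in \<open>simp add: module_homs_zero_map\<close>)
  next
    fix h k assume h: "?P k h"
    let ?i = "b - int k"
    have i1: "b + 1 - int k = ?i + 1" "b + 1 - int (Suc k) = ?i" "b - int (Suc k) = ?i - 1"
      "b - 1 - int k = ?i - 1" by simp_all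
    note h1 = conjunct1[OF h, unfolded i1] and h2 = conjunct2[OF h, unfolded i1]
    have fp: "fg_projective R (obj Q ?i)" using Q by (simp add: bounded_projective_def)
    obtain n e \<xi> where db: "dual_basis R (obj Q ?i) n e \<xi>" by (rule fg_projective_dual_basis[OF fp])
    let ?\<phi> = "\<lambda>x. f ?i x \<oplus>\<^bsub>obj N ?i\<^esub> \<ominus>\<^bsub>obj N ?i\<^esub> h (diff Q ?i x)"
    have hd: "(\<lambda>x. h (diff Q ?i x)) \<in> module_homs R (obj Q ?i) (obj N ?i)"
      by (rule module_homs_comp[OF cc_diff_hom[OF Qc refl] h1])
    have \<phi>: "?\<phi> \<in> module_homs R (obj Q ?i) (obj N ?i)"
      by (rule module_homs_add_map[OF chain_maps_hom[OF f] module_homs_neg_map[OF hd]]) (use N in simp_all)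
    have im: "?\<phi> ` carrier (obj Q ?i) \<subseteq> diff N (?i - 1) ` carrier (obj N (?i - 1))"
    proof (rule image_subsetI)
      fix x assume x: "x \<in> carrier (obj Q ?i)"
      have c: "h (diff Q ?i x) \<in> carrier (obj N ?i)" "f ?i x \<in> carrier (obj N ?i)"
        using module_homs_closed[OF hd x] f x by simp_all
      have "diff N ?i (?\<phi> x) = \<zero>\<^bsub>obj N (?i + 1)\<^esub>"
        using c x h2 f N Qc by simp
      then have "?\<phi> x \<in> cocycles N ?i" using module_homs_closed[OF \<phi> x] by (simp add: cocycles_def)
      then show "?\<phi> x \<in> diff N (?i - 1) ` carrier (obj N (?i - 1))"
        using ac unfolding acyclic_def coboundaries_def by blast
    qed
    have dN: "diff N (?i - 1) \<in> module_homs R (obj N (?i - 1)) (obj N ?i)"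
      by (rule cc_diff_hom[OF N]) simp
    obtain h' where h': "h' \<in> module_homs R (obj Q ?i) (obj N (?i - 1))"
      and e: "\<And>x. x \<in> carrier (obj Q ?i) \<Longrightarrow> diff N (?i - 1) (h' x) = ?\<phi> x"
      by (rule dual_basis_lift[OF db _ _ _ dN \<phi> im]) (use N Qc in simp_all)
    have r: "f ?i x = diff N (?i - 1) (h' x) \<oplus>\<^bsub>obj N ?i\<^esub> h (diff Q ?i x)" if x: "x \<in> carrier (obj Q ?i)" for x
    proof -
      have c: "h (diff Q ?i x) \<in> carrier (obj N ?i)" "f ?i x \<in> carrier (obj N ?i)"
        using module_homs_closed[OF hd x] f x by simp_all
      then show ?thesis unfolding e[OF x] by algebra
    qed
    have p: "diff N (?i - 1) (h' (diff Q (?i - 1) x)) = f ?i (diff Q (?i - 1) x)"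
      if x: "x \<in> carrier (obj Q (?i - 1))" for x
    proof -
      have dx: "diff Q (?i - 1) x \<in> carrier (obj Q ?i)" using x Qc by simp
      have "diff Q ?i (diff Q (?i - 1) x) = \<zero>\<^bsub>obj Q (?i + 1)\<^esub>"
        using cc_simps(7)[OF Qc x, of ?i] by (simp add: add.commute)
      then have "h (diff Q ?i (diff Q (?i - 1) x)) = \<zero>\<^bsub>obj N ?i\<^esub>"
        using module_homs_zero[OF h1] N Qc by simp
      then show ?thesis using e[OF dx] f dx N by simp
    qed
    show "\<exists>h'. ?P (Suc k) h' \<and> ?R k h h'"
      unfolding i1 using h' r p by (intro exI[of _ h']) blast
  qed
  then obtain g where g: "\<And>k. ?P k (g k)" "\<And>k. ?R k (g k) (g (Suc k))" by blast
  \<comment> \<open>\<open>nat (b + 1 - i)\<close> is the stage that produced the component starting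
    in degree \<open>i\<close>; above \<open>b + 1\<close> the terms of \<open>Q\<close> are
    zero.\<close>
  define h where "h i = (if i \<le> b + 1 then g (nat (b + 1 - i)) else (\<lambda>x. \<zero>\<^bsub>obj N (i - 1)\<^esub>))" for i
  have h: "h \<in> graded_maps R (-1) Q N"
  proof (rule gmI)
    show "h i \<in> module_homs R (obj Q i) (obj N (i + - 1))" for i
    proof (cases "i \<le> b + 1")
      case True
      then show ?thesis using g(1)[of "nat (b + 1 - i)"] by (simp add: h_def)
    qed (use N in \<open>simp add: h_def module_homs_zero_map\<close>)
  qed
  have "homotopic R Q N f (zero_map N)"
  proof (rule null_homotopicI[OF Qc N f h])
    fix i x assume x: "x \<in> carrier (obj Q i)"
    show "f i x = diff N (i - 1) (h i x) \<oplus>\<^bsub>obj N i\<^esub> h (i + 1) (diff Q i x)"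
    proof (cases "i \<le> b")
      case True
      have k: "b - int (nat (b - i)) = i" "b - 1 - int (nat (b - i)) = i - 1"
        "nat (b + 1 - i) = Suc (nat (b - i))" "nat (b + 1 - (i + 1)) = nat (b - i)"
        using True by auto
      show ?thesis using g(2)[of "nat (b - i)"] x True by (simp add: h_def k)
    next
      case False
      then have "x = \<zero>\<^bsub>obj Q i\<^esub>" using x b[of i] by auto
      then show ?thesis
        using f N Qc gm_simps(3)[OF h Qc N, of i] gm_simps(3)[OF h Qc N, of "i + 1"] by simp
    qed
  qed
  then show "K_eq R Q N f (zero_map N)" by (rule K_eqI) (use f N Qc in simp_all)
qed

text \<open>A null-homotopy with values in the cone has two components: the first is a chain map
  \<open>t\<close> into \<open>Z\<close>, and the second is a homotopy between
  \<open>s \<bullet> t\<close> and \<open>g\<close>.\<close>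

lemma cone_exact:
  assumes Q: "cochain_complex R Q" and Z: "cochain_complex R Z" and X: "cochain_complex R X"
    and sc: "s \<in> chain_maps R Z X" and g: "g \<in> chain_maps R Q X"
    and n: "K_eq R Q (cone Z X s) (cone_incl Z \<bullet> g) (zero_map (cone Z X s))"
  obtains t where "t \<in> chain_maps R Q Z" "K_eq R Q X (s \<bullet> t) g"
proof -
  interpret X: abelian_group "obj X i" for i using X by (rule cc_abelian)
  interpret Z: abelian_group "obj Z i" for i using Z by (rule cc_abelian)
  have [simp]: "i - 1 + 2 = i + 1" for i :: int by simp
  have ig: "cone_incl Z \<bullet> g \<in> chain_maps R Q (cone Z X s)"
    by (rule comp_chain[OF g cone_incl_chain[OF Z X sc]])
  obtain h where h: "h \<in> graded_maps R (-1) Q (cone Z X s)"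
    and e: "\<And>i x. x \<in> carrier (obj Q i) \<Longrightarrow> (cone_incl Z \<bullet> g) i x =
      diff (cone Z X s) (i - 1) (h i x) \<oplus>\<^bsub>obj (cone Z X s) i\<^esub> h (i + 1) (diff Q i x)"
    using null_homotopicE[OF K_eqD(1)[OF n] Q cone_complex[OF Z X sc] ig] by blast
  define t where "t i x = fst (h i x)" for i x
  define k where "k i x = snd (h i x)" for i x
  have hi: "h i \<in> module_homs R (obj Q i) (module_sum (obj Z i) (obj X (i - 1)))" for i
    using gm_hom[OF h refl, of i] by simp
  have th: "t i \<in> module_homs R (obj Q i) (obj Z i)" for i
    unfolding t_def by (rule module_homs_comp[OF hi]) (rule module_homsI, auto)
  have kh: "k i \<in> module_homs R (obj Q i) (obj X (i - 1))" for i
    unfolding k_def by (rule module_homs_comp[OF hi]) (rule module_homsI, auto)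
  have km: "k \<in> graded_maps R (-1) Q X" by (rule gmI) (use kh in simp)
  note tc = module_homs_closed[OF th] and kc = module_homs_closed[OF kh]
  have hx: "h i x = (t i x, k i x)" for i x by (simp add: t_def k_def)
  have dq: "diff Q i x \<in> carrier (obj Q (i + 1))" if "x \<in> carrier (obj Q i)" for i x using that Q by simp
  have e1: "\<zero>\<^bsub>obj Z (i + 1)\<^esub> = \<ominus>\<^bsub>obj Z (i + 1)\<^esub> diff Z i (t i x) \<oplus>\<^bsub>obj Z (i + 1)\<^esub> t (i + 1) (diff Q i x)"
    and e2: "g i x = (s i (t i x) \<oplus>\<^bsub>obj X i\<^esub> diff X (i - 1) (k i x)) \<oplus>\<^bsub>obj X i\<^esub> k (i + 1) (diff Q i x)"
    if x: "x \<in> carrier (obj Q i)" for i x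
    using e[OF x] by (simp_all add: hx)
  have t: "t \<in> chain_maps R Q Z"
  proof (rule chain_mapsI[OF th])
    fix i x assume x: "x \<in> carrier (obj Q i)"
    have c: "t (i + 1) (diff Q i x) \<in> carrier (obj Z (i + 1))" "diff Z i (t i x) \<in> carrier (obj Z (i + 1))"
      using tc[OF dq[OF x]] tc[OF x] Z by simp_all
    have "diff Z i (t i x) = diff Z i (t i x) \<oplus>\<^bsub>obj Z (i + 1)\<^esub>
        (\<ominus>\<^bsub>obj Z (i + 1)\<^esub> diff Z i (t i x) \<oplus>\<^bsub>obj Z (i + 1)\<^esub> t (i + 1) (diff Q i x))"
      unfolding e1[OF x, symmetric] using c Z by simp
    also have "\<dots> = t (i + 1) (diff Q i x)" using c by algebra
    finally show "t (i + 1) (diff Q i x) = diff Z i (t i x)" ..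
  qed
  have st: "s \<bullet> t \<in> chain_maps R Q X" by (rule comp_chain[OF t sc])
  have "homotopic R Q X g (s \<bullet> t)"
  proof (rule homotopicI[OF Q X g st km])
    fix i x assume x: "x \<in> carrier (obj Q i)"
    have c: "s i (t i x) \<in> carrier (obj X i)" "diff X (i - 1) (k i x) \<in> carrier (obj X i)"
      "k (i + 1) (diff Q i x) \<in> carrier (obj X i)"
      using tc[OF x] kc[OF x] kc[OF dq[OF x]] sc X by simp_all
    then show "g i x = (s \<bullet> t) i x \<oplus>\<^bsub>obj X i\<^esub> (diff X (i - 1) (k i x) \<oplus>\<^bsub>obj X i\<^esub> k (i + 1) (diff Q i x))"
      unfolding e2[OF x] by (simp add: X.a_assoc)
  qed
  then have "K_eq R Q X (s \<bullet> t) g" by (intro K_eq_sym[OF K_eqI]) (use g st Q X in simp_all)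
  with t show thesis by (rule that)
qed

text \<open>The obstruction to a lift is a map into the cone of \<open>s\<close>, which is acyclic,
  so that it is null on a bounded complex of projectives.\<close>

lemma quasi_iso_lift:
  assumes Q: "bounded_projective R Q" and s: "quasi_iso R Z X s"
    and Z: "cochain_complex R Z" and X: "cochain_complex R X" and g: "g \<in> chain_maps R Q X"
  obtains t where "t \<in> chain_maps R Q Z" "K_eq R Q X (s \<bullet> t) g"
proof (rule cone_exact[OF _ Z X quasi_isoD(1)[OF s Z X] g])
  note sc = quasi_isoD(1)[OF s Z X]
  show Qc: "cochain_complex R Q" using Q by simp
  show "K_eq R Q (cone Z X s) (cone_incl Z \<bullet> g) (zero_map (cone Z X s))"
    by (rule hom_nullD[OF hom_null_acyclic[OF Q _ cone_acyclic[OF s Z X]] comp_chain[OF g cone_incl_chain[OF Z X sc]]])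
      (use Z X sc Qc in simp_all)
qed (rule that)

lemma quasi_iso_comp:
  assumes f: "quasi_iso R X Y f" and g: "quasi_iso R Y Z g"
    and X: "cochain_complex R X" and Y: "cochain_complex R Y" and Z: "cochain_complex R Z"
  shows "quasi_iso R X Z (g \<bullet> f)"
proof -
  note a = quasi_isoD[OF f X Y] and b = quasi_isoD[OF g Y Z]
  have gf: "g \<bullet> f \<in> chain_maps R X Z" by (rule comp_chain[OF a(1) b(1)])
  show ?thesis
    unfolding quasi_iso_iff[OF gf X Z]
  proof (intro conjI allI ballI impI)
    fix n z assume "z \<in> cocycles X n" "(g \<bullet> f) n z \<in> coboundaries Z n"
    then show "z \<in> coboundaries X n" using a(2) b(2) chain_map_cocycles(1)[OF a(1) X Y] by simp
  next
    fix n y assume y: "y \<in> cocycles Z n"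
    interpret Z: abelian_group "obj Z n" using Z by (rule cc_abelian)
    interpret Y: abelian_group "obj Y n" using Y by (rule cc_abelian)
    obtain z where z: "z \<in> cocycles Y n" "y \<ominus>\<^bsub>obj Z n\<^esub> g n z \<in> coboundaries Z n" using b(3)[OF y] by blast
    obtain x where x: "x \<in> cocycles X n" "z \<ominus>\<^bsub>obj Y n\<^esub> f n x \<in> coboundaries Y n" using a(3)[OF z(1)] by blast
    have c: "y \<in> carrier (obj Z n)" "z \<in> carrier (obj Y n)" "f n x \<in> carrier (obj Y n)"
      "g n z \<in> carrier (obj Z n)" "g n (f n x) \<in> carrier (obj Z n)"
      using cocyclesD(1)[OF y] cocyclesD(1)[OF z(1)] cocyclesD(1)[OF x(1)] a(1) b(1) by simp_all
    have "g n (z \<ominus>\<^bsub>obj Y n\<^esub> f n x) = g n z \<ominus>\<^bsub>obj Z n\<^esub> g n (f n x)"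
      by (rule cm_simps(5)[OF b(1) Y Z c(2,3)])
    then have "y \<ominus>\<^bsub>obj Z n\<^esub> (g \<bullet> f) n x = (y \<ominus>\<^bsub>obj Z n\<^esub> g n z) \<oplus>\<^bsub>obj Z n\<^esub> g n (z \<ominus>\<^bsub>obj Y n\<^esub> f n x)"
      by simp (insert c, algebra)
    then show "\<exists>x\<in>cocycles X n. y \<ominus>\<^bsub>obj Z n\<^esub> (g \<bullet> f) n x \<in> coboundaries Z n"
      using coboundaries_simps(4)[OF Z z(2) chain_map_cocycles(2)[OF b(1) Y Z x(2)]] x(1)
      by (intro bexI[of _ x]) simp_all
  qed
qed

text \<open>Since \<open>t \<bullet> w\<close> is homotopic to the identity, \<open>w\<close>
  induces on cohomology the inverse of the bijection induced by \<open>t\<close>.\<close>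

lemma quasi_iso_section:
  assumes t: "quasi_iso R Z X t" and w: "w \<in> chain_maps R X Z" and tw: "K_eq R X X (t \<bullet> w) id_map"
    and Z: "cochain_complex R Z" and X: "cochain_complex R X"
  shows "quasi_iso R X Z w"
  unfolding quasi_iso_iff[OF w X Z]
proof (intro conjI allI ballI impI)
  note q = quasi_isoD[OF t Z X]
  interpret X: abelian_group "obj X n" for n using X by (rule cc_abelian)
  have diff: "t n (w n z) \<ominus>\<^bsub>obj X n\<^esub> z \<in> coboundaries X n" if "z \<in> cocycles X n" for n z
    using homotopic_cocycle[OF tw that] by simp
  show "z \<in> coboundaries X n" if z: "z \<in> cocycles X n" and B: "w n z \<in> coboundaries Z n" for n z
  proof -
    have c: "z \<in> carrier (obj X n)" "t n (w n z) \<in> carrier (obj X n)"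
      using cocyclesD(1)[OF z] w q(1) by simp_all
    have "z = t n (w n z) \<oplus>\<^bsub>obj X n\<^esub> \<ominus>\<^bsub>obj X n\<^esub> (t n (w n z) \<ominus>\<^bsub>obj X n\<^esub> z)" using c by algebra
    then show ?thesis
      using coboundaries_simps(4)[OF X chain_map_cocycles(2)[OF q(1) Z X B] coboundaries_simps(5)[OF X diff[OF z]]] by simp
  qed
  show "\<exists>z\<in>cocycles X n. y \<ominus>\<^bsub>obj Z n\<^esub> w n z \<in> coboundaries Z n" if y: "y \<in> cocycles Z n" for n y
  proof (rule bexI)
    show ty: "t n y \<in> cocycles X n" by (rule chain_map_cocycles(1)[OF q(1) Z X y])
    interpret Z: abelian_group "obj Z n" using Z by (rule cc_abelian)
    have c: "y \<in> carrier (obj Z n)" "w n (t n y) \<in> carrier (obj Z n)" "t n y \<in> carrier (obj X n)"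
      "t n (w n (t n y)) \<in> carrier (obj X n)"
      using cocyclesD(1)[OF y] w q(1) by simp_all
    have wy: "w n (t n y) \<in> cocycles Z n" by (rule chain_map_cocycles(1)[OF w X Z ty])
    have "t n (y \<ominus>\<^bsub>obj Z n\<^esub> w n (t n y)) = \<ominus>\<^bsub>obj X n\<^esub> (t n (w n (t n y)) \<ominus>\<^bsub>obj X n\<^esub> t n y)"
      unfolding cm_simps(5)[OF q(1) Z X c(1,2)] using c(3,4) by algebra
    then have 1: "t n (y \<ominus>\<^bsub>obj Z n\<^esub> w n (t n y)) \<in> coboundaries X n"
      using coboundaries_simps(5)[OF X diff[OF ty]] by simp
    have "y \<ominus>\<^bsub>obj Z n\<^esub> w n (t n y) \<in> cocycles Z n"
      using cc_simps(5)[OF Z c(1,2)] cocyclesD(2)[OF y] cocyclesD(2)[OF wy] Z c by (simp add: cocycles_def)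
    then show "y \<ominus>\<^bsub>obj Z n\<^esub> w n (t n y) \<in> coboundaries Z n" by (rule q(2)[OF _ 1])
  qed
qed

lemma bounded_projective_shift:
  assumes Q: "bounded_projective R Q"
  shows "bounded_projective R (shift Q m)"
proof -
  obtain a b where "\<And>i. i < a \<or> b < i \<Longrightarrow> carrier (obj Q i) = {\<zero>\<^bsub>obj Q i\<^esub>}"
    using Q unfolding bounded_projective_def by blast
  then have "\<forall>i. i < a - m \<or> b - m < i \<longrightarrow> carrier (obj (shift Q m) i) = {\<zero>\<^bsub>obj (shift Q m) i\<^esub>}"
    by (simp add: algebra_simps)
  then show ?thesis using Q unfolding bounded_projective_def by auto
qed

end

section \<open>Symmetric algebras\<close>

text \<open>The form is \<open>\<phi> \<one>\<close> for the bimodule isomorphism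
  \<open>\<phi>\<close> onto the dual. Left and right linearity express \<open>\<phi> a\<close>
  through it in two ways, which is its symmetry; injectivity of \<open>\<phi>\<close> is
  nondegeneracy, and surjectivity says that the form represents all functionals.\<close>

lemma symmetric_algebra_form:
  assumes "fd_algebra K A" and sym: "symmetric_algebra K A"
  shows "\<exists>tr. symmetrizing_form A K (\<lambda>c. c \<odot>\<^bsub>A\<^esub> \<one>\<^bsub>A\<^esub>) tr"
proof -
  interpret fd_algebra K A by fact
  obtain \<phi> where bij: "bij_betw \<phi> (carrier A) (linear_dual K A)"
    and add: "\<And>x x' y. \<lbrakk>x \<in> carrier A; x' \<in> carrier A; y \<in> carrier A\<rbrakk> \<Longrightarrow> \<phi> (x \<oplus>\<^bsub>A\<^esub> x') y = \<phi> x y \<oplus>\<^bsub>K\<^esub> \<phi> x' y"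
    and bim: "\<And>a x b y. \<lbrakk>a \<in> carrier A; x \<in> carrier A; b \<in> carrier A; y \<in> carrier A\<rbrakk>
      \<Longrightarrow> \<phi> (a \<otimes>\<^bsub>A\<^esub> x \<otimes>\<^bsub>A\<^esub> b) y = \<phi> x (b \<otimes>\<^bsub>A\<^esub> y \<otimes>\<^bsub>A\<^esub> a)"
    using sym unfolding symmetric_algebra_def by blast
  have dual: "\<phi> x \<in> linear_dual K A" if "x \<in> carrier A" for x
    using bij that by (rule bij_betw_apply)
  have az: "\<zero>\<^bsub>A\<^esub> \<in> carrier A" by simp
  define tr where "tr = \<phi> \<one>\<^bsub>A\<^esub>"
  have l: "\<phi> a y = tr (y \<otimes>\<^bsub>A\<^esub> a)" and r: "\<phi> a y = tr (a \<otimes>\<^bsub>A\<^esub> y)" if "a \<in> carrier A" "y \<in> carrier A" for a y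
    using bim[of a "\<one>\<^bsub>A\<^esub>" "\<one>\<^bsub>A\<^esub>" y] bim[of "\<one>\<^bsub>A\<^esub>" "\<one>\<^bsub>A\<^esub>" a y] that by (simp_all add: tr_def)
  have td: "tr x \<in> carrier K" "tr (x \<oplus>\<^bsub>A\<^esub> y) = tr x \<oplus>\<^bsub>K\<^esub> tr y" "c \<in> carrier K \<Longrightarrow> tr (c \<odot>\<^bsub>A\<^esub> x) = c \<otimes>\<^bsub>K\<^esub> tr x"
    if "x \<in> carrier A" "y \<in> carrier A" for x y c
    using dual[OF A.one_closed] that unfolding tr_def linear_dual_def by auto
  have sc: "a \<otimes>\<^bsub>A\<^esub> (c \<odot>\<^bsub>A\<^esub> \<one>\<^bsub>A\<^esub>) = c \<odot>\<^bsub>A\<^esub> a" "(c \<odot>\<^bsub>A\<^esub> \<one>\<^bsub>A\<^esub>) \<otimes>\<^bsub>A\<^esub> a = c \<odot>\<^bsub>A\<^esub> a"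
    if "a \<in> carrier A" "c \<in> carrier K" for a c
    using smult_mult_right[of c a "\<one>\<^bsub>A\<^esub>"] smult_mult_left[of c "\<one>\<^bsub>A\<^esub>" a] that by simp_all
  have zero: "\<phi> \<zero>\<^bsub>A\<^esub> y = \<zero>\<^bsub>K\<^esub>" if "y \<in> carrier A" for y
    using l[OF az that] that td(3)[of "\<zero>\<^bsub>A\<^esub>" "\<zero>\<^bsub>A\<^esub>" "\<zero>\<^bsub>K\<^esub>"] td(1)[of "\<zero>\<^bsub>A\<^esub>"] by simp
  have "symmetrizing_form A K (\<lambda>c. c \<odot>\<^bsub>A\<^esub> \<one>\<^bsub>A\<^esub>) tr"
  proof (intro symmetrizing_form.intro symmetrizing_form_axioms.intro)
    show "ring A" "field K" by (rule A.ring_axioms, rule K.field_axioms)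
    show "tr (a \<otimes>\<^bsub>A\<^esub> b) = tr (b \<otimes>\<^bsub>A\<^esub> a)" if "a \<in> carrier A" "b \<in> carrier A" for a b
      using l[OF that] r[OF that] by simp
    show "a = \<zero>\<^bsub>A\<^esub>" if a: "a \<in> carrier A" and z: "\<And>b. b \<in> carrier A \<Longrightarrow> tr (a \<otimes>\<^bsub>A\<^esub> b) = \<zero>\<^bsub>K\<^esub>" for a
    proof -
      have "\<phi> a = \<phi> \<zero>\<^bsub>A\<^esub>"
      proof (rule extensionalityI[of _ "carrier A"])
        show "\<phi> a \<in> extensional (carrier A)" "\<phi> \<zero>\<^bsub>A\<^esub> \<in> extensional (carrier A)"
          using dual[OF a] dual[OF az] by (auto simp: linear_dual_def PiE_def)
        show "\<phi> a y = \<phi> \<zero>\<^bsub>A\<^esub> y" if "y \<in> carrier A" for y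
          using r[OF a that] z[OF that] zero[OF that] by simp
      qed
      then show ?thesis
        using bij a unfolding bij_betw_def inj_on_def by simp
    qed
    show "\<exists>b\<in>carrier A. \<forall>a\<in>carrier A. g a = tr (b \<otimes>\<^bsub>A\<^esub> a)"
      if g: "\<And>a. a \<in> carrier A \<Longrightarrow> g a \<in> carrier K"
        "\<And>a b. \<lbrakk>a \<in> carrier A; b \<in> carrier A\<rbrakk> \<Longrightarrow> g (a \<oplus>\<^bsub>A\<^esub> b) = g a \<oplus>\<^bsub>K\<^esub> g b"
        "\<And>c a. \<lbrakk>c \<in> carrier K; a \<in> carrier A\<rbrakk> \<Longrightarrow> g (a \<otimes>\<^bsub>A\<^esub> (c \<odot>\<^bsub>A\<^esub> \<one>\<^bsub>A\<^esub>)) = c \<otimes>\<^bsub>K\<^esub> g a" for g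
    proof -
      have "restrict g (carrier A) \<in> linear_dual K A"
        unfolding linear_dual_def using g sc by (auto simp: PiE_def)
      then obtain b where "b \<in> carrier A" "restrict g (carrier A) = \<phi> b"
        using bij unfolding bij_betw_def by (metis imageE)
      then show ?thesis using r by (metis restrict_apply')
    qed
    show "tr (a \<otimes>\<^bsub>A\<^esub> (c \<odot>\<^bsub>A\<^esub> \<one>\<^bsub>A\<^esub>)) = c \<otimes>\<^bsub>K\<^esub> tr a" if "c \<in> carrier K" "a \<in> carrier A" for c a
      using that sc td(3) by simp
    show "(c \<otimes>\<^bsub>K\<^esub> d) \<odot>\<^bsub>A\<^esub> \<one>\<^bsub>A\<^esub> = (c \<odot>\<^bsub>A\<^esub> \<one>\<^bsub>A\<^esub>) \<otimes>\<^bsub>A\<^esub> (d \<odot>\<^bsub>A\<^esub> \<one>\<^bsub>A\<^esub>)"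
      if "c \<in> carrier K" "d \<in> carrier K" for c d
      using that sc(2)[of "d \<odot>\<^bsub>A\<^esub> \<one>\<^bsub>A\<^esub>" c] by (simp add: smult_assoc1)
  qed (use td sc in \<open>simp_all add: smult_l_distr\<close>)
  then show ?thesis by (rule exI[of _ tr])
qed

text \<open>Bases are chosen for the terms of \<open>X\<close> only, and they interpret
  \<open>based_complex\<close>; nothing is chosen on \<open>Y\<close>, which may be any
  complex.\<close>

lemma (in symmetrizing_form) hom_null_symmetric:
  assumes X: "bounded_projective A X" and Y: "cochain_complex A Y" and n: "hom_null A X Y"
  shows "hom_null A Y X"
proof -
  obtain a b where ab: "\<And>i. i < a \<or> b < i \<Longrightarrow> carrier (obj X i) = {\<zero>\<^bsub>obj X i\<^esub>}"
    and fg: "\<And>i. fg_projective A (obj X i)"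
    using X unfolding bounded_projective_def by blast
  have "\<exists>n e \<xi>. dual_basis A (obj X i) n e \<xi>" for i
    using A.fg_projective_dual_basis[OF fg] by metis
  then obtain n e \<xi> where "\<And>i. dual_basis A (obj X i) (n i) (e i) (\<xi> i)" by metis
  then interpret based_complex A K \<iota> tr X a b n e \<xi>
    using X ab by unfold_locales simp_all
  show ?thesis by (rule hom_null_dual[OF Y n])
qed

context ring begin

section \<open>Stalk complexes and cohomology\<close>

lemma zero_submodule_module:
  assumes "right_module R M"
  shows "right_module R (M\<lparr>carrier := {\<zero>\<^bsub>M\<^esub>}\<rparr>)"
proof -
  have "{x \<in> carrier M. x = \<zero>\<^bsub>M\<^esub>} = {\<zero>\<^bsub>M\<^esub>}" using assms by auto
  then show ?thesis
    using submodule_kernel_module[OF module_homs_id assms assms] by simp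
qed

lemma stalk_complex [simp]:
  assumes "right_module R M"
  shows "cochain_complex R (stalk M)"
  unfolding cochain_complex_def
  by (intro allI conjI) (use assms in \<open>auto simp: stalk_def zero_submodule_module intro!: module_homsI\<close>)

lemma stalk_simps [simp]:
  "obj (stalk M) 0 = M" "i \<noteq> 0 \<Longrightarrow> carrier (obj (stalk M) i) = {\<zero>\<^bsub>M\<^esub>}" "\<zero>\<^bsub>obj (stalk M) i\<^esub> = \<zero>\<^bsub>M\<^esub>"
  "diff (stalk M) i x = \<zero>\<^bsub>M\<^esub>"
  by (simp_all add: stalk_def)

text \<open>A map out of the algebra is given by the cocycle \<open>f 0 \<one>\<close>, and an
  element that bounds this cocycle is a null-homotopy.\<close>

lemma hom_null_stalk_regular:
  assumes Y: "cochain_complex R Y" and z: "cocycles Y 0 \<subseteq> coboundaries Y 0"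
  shows "hom_null R (stalk (regular R)) Y"
proof (rule hom_nullI)
  let ?S = "stalk (regular R)"
  have S: "cochain_complex R ?S" by (simp add: regular_module)
  fix f assume f: "f \<in> chain_maps R ?S Y"
  have f0: "f i \<zero> = \<zero>\<^bsub>obj Y i\<^esub>" for i
    using cm_simps(3)[OF f S Y, of i] by simp
  have c: "f 0 \<one> \<in> carrier (obj Y 0)" using cm_simps(1)[OF f, of \<one> 0] by simp
  have "f 0 \<one> \<in> cocycles Y 0"
    using cm_simps(7)[OF f, of \<one> 0 1] c f0 by (simp add: cocycles_def)
  then obtain w where w: "w \<in> carrier (obj Y (- 1))" "f 0 \<one> = diff Y (- 1) w"
    using z by (auto elim!: coboundariesE)
  define h where "h i x = (if i = 0 then x \<odot>\<^bsub>obj Y (- 1)\<^esub> w else \<zero>\<^bsub>obj Y (i - 1)\<^esub>)" for i x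
  have h: "h \<in> graded_maps R (-1) ?S Y"
  proof (rule gmI)
    show "h i \<in> module_homs R (obj ?S i) (obj Y (i + - 1))" for i
      using module_homs_scale[OF module_homs_id, of "obj Y (- 1)" w] w(1) Y
        module_homs_zero_map[of "obj Y (i - 1)" "obj ?S i"]
      by (cases "i = 0") (simp_all add: h_def[abs_def])
  qed
  have h0: "h i \<zero> = \<zero>\<^bsub>obj Y (i - 1)\<^esub>" for i
    using gm_simps(3)[OF h S Y, of i] by simp
  have "homotopic R ?S Y f (zero_map Y)"
  proof (rule null_homotopicI[OF S Y f h])
    fix i x assume x: "x \<in> carrier (obj ?S i)"
    show "f i x = diff Y (i - 1) (h i x) \<oplus>\<^bsub>obj Y i\<^esub> h (i + 1) (diff ?S i x)"
    proof (cases "i = 0")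
      case True
      have xc: "x \<in> carrier R" using x True by simp
      have "f 0 (x \<odot>\<^bsub>obj ?S 0\<^esub> \<one>) = x \<odot>\<^bsub>obj Y 0\<^esub> f 0 \<one>"
        by (rule cm_simps(6)[OF f xc]) simp
      then have "f 0 x = x \<odot>\<^bsub>obj Y 0\<^esub> f 0 \<one>" using xc by simp
      also have "\<dots> = diff Y (- 1) (x \<odot>\<^bsub>obj Y (- 1)\<^esub> w)"
        using w Y xc by simp
      finally show ?thesis using True w Y xc h0[of 1] by (simp add: h_def)
    next
      case False
      then have "x = \<zero>" using x by simp
      then show ?thesis using f0 h0[of i] h0[of "i + 1"] Y by simp
    qed
  qed
  then show "K_eq R ?S Y f (zero_map Y)" by (rule K_eqI) (use f S Y in simp_all)
qed

lemma cohomology_degrees_cocycles: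
  assumes X: "cochain_complex R X" and n: "n \<notin> cohomology_degrees X" and z: "z \<in> cocycles X n"
  shows "z \<in> coboundaries X n"
proof -
  have "cohomology X n = {coboundaries X n}" using n by (simp add: cohomology_degrees_def)
  moreover have "\<zero>\<^bsub>obj X n\<^esub> \<in> cocycles X n" using X by (simp add: cocycles_def)
  ultimately have "coboundaries X n +>\<^bsub>obj X n\<^esub> z = coboundaries X n +>\<^bsub>obj X n\<^esub> \<zero>\<^bsub>obj X n\<^esub>"
    using z unfolding cohomology_def by blast
  then show ?thesis
    using coset_eq_iff[OF X cocyclesD(1)[OF z]] X cocyclesD(1)[OF z] by simp
qed

text \<open>Morphisms from the algebra to \<open>X[n]\<close> are the cohomology of \<open>X\<close>
  in degree \<open>n\<close>. The two cases in the proof take care of the sign in the shifted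
  differential.\<close>

lemma hom_null_regular_shift:
  assumes X: "cochain_complex R X" and n: "n \<notin> cohomology_degrees X"
  shows "hom_null R (stalk (regular R)) (shift X n)"
proof (rule hom_null_stalk_regular)
  show "cochain_complex R (shift X n)" using X by simp
  show "cocycles (shift X n) 0 \<subseteq> coboundaries (shift X n) 0"
  proof
    fix z assume z: "z \<in> cocycles (shift X n) 0"
    have zc: "z \<in> carrier (obj X n)" using cocyclesD(1)[OF z] by simp
    have dz: "diff X n z \<in> carrier (obj X (n + 1))" using zc X by simp
    have "diff X n z = \<zero>\<^bsub>obj X (n + 1)\<^esub>"
    proof (cases "even n")
      case True
      then show ?thesis using cocyclesD(2)[OF z] by (simp add: shift_diff add.commute)
    next
      case False
      then have "\<ominus>\<^bsub>obj X (n + 1)\<^esub> diff X n z = \<zero>\<^bsub>obj X (n + 1)\<^esub>"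
        using cocyclesD(2)[OF z] by (simp add: shift_diff add.commute)
      then have "\<ominus>\<^bsub>obj X (n + 1)\<^esub> (\<ominus>\<^bsub>obj X (n + 1)\<^esub> diff X n z) = \<ominus>\<^bsub>obj X (n + 1)\<^esub> \<zero>\<^bsub>obj X (n + 1)\<^esub>" by simp
      then show ?thesis using dz X by simp
    qed
    then have "z \<in> cocycles X n" using zc by (simp add: cocycles_def)
    then obtain w where w: "w \<in> carrier (obj X (n - 1))" "z = diff X (n - 1) w"
      using coboundariesE[OF cohomology_degrees_cocycles[OF X n]] by blast
    have e: "- 1 + n = n - 1" by simp
    show "z \<in> coboundaries (shift X n) 0"
    proof (cases "even n")
      case True
      then show ?thesis
        by (intro coboundariesI[of w]) (use w in \<open>simp_all add: shift_diff e\<close>)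
    next
      case False
      then show ?thesis
        by (intro coboundariesI[of "\<ominus>\<^bsub>obj X (n - 1)\<^esub> w"])
          (use w X in \<open>simp_all add: shift_diff e\<close>)
    qed
  qed
qed

text \<open>For a bounded complex the set of these degrees is finite, so \<open>Max\<close> and
  \<open>Min\<close> have their meaning, and length two leaves room for no more than two
  neighbouring degrees.\<close>

lemma cohomology_degrees_length_two:
  assumes X: "bounded_projective R X" and l: "cx_length X = 2"
  shows "cx_r X = 1" "cohomology_degrees X \<subseteq> {cx_s X - 1, cx_s X}"
proof -
  obtain a b where ab: "\<And>i. i < a \<or> b < i \<Longrightarrow> carrier (obj X i) = {\<zero>\<^bsub>obj X i\<^esub>}"
    using X unfolding bounded_projective_def by blast
  have "cohomology_degrees X \<subseteq> {a..b}"
    using cohomology_degrees_zero_term[of R X] X ab by force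
  then have fin: "finite (cohomology_degrees X)" using finite_subset by blast
  show "cx_r X = 1" using l by (simp add: cx_r_def)
  have "Max (cohomology_degrees X) - Min (cohomology_degrees X) = 1"
    using l by (simp add: cx_length_def split: if_splits)
  then show "cohomology_degrees X \<subseteq> {cx_s X - 1, cx_s X}"
    using Max_ge[OF fin] Min_le[OF fin] unfolding cx_s_def by force
qed

section \<open>Morphisms in the derived category\<close>

lemma K_eq_quasi_iso:
  assumes "K_eq R X Y f g" and "quasi_iso R X Y f"
  shows "quasi_iso R X Y g"
proof -
  note a = K_eqD[OF assms(1)]
  have gf: "g n z \<ominus>\<^bsub>obj Y n\<^esub> f n z \<in> coboundaries Y n" if "z \<in> cocycles X n" for n z
    using homotopic_cocycle[OF K_eq_sym[OF assms(1)] that] .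
  note q = quasi_isoD[OF assms(2) a(2,3)]
  show ?thesis
    unfolding quasi_iso_iff[OF a(5,2,3)]
  proof (intro conjI allI ballI impI)
    fix n z assume z: "z \<in> cocycles X n" and gz: "g n z \<in> coboundaries Y n"
    interpret Y: abelian_group "obj Y n" using a(3) by (rule cc_abelian)
    have c: "f n z \<in> carrier (obj Y n)" "g n z \<in> carrier (obj Y n)" using cocyclesD(1)[OF z] a by simp_all
    have "g n z \<oplus>\<^bsub>obj Y n\<^esub> \<ominus>\<^bsub>obj Y n\<^esub> (g n z \<ominus>\<^bsub>obj Y n\<^esub> f n z) = f n z" using c by algebra
    then have "f n z \<in> coboundaries Y n"
      using coboundaries_simps(4)[OF a(3) gz coboundaries_simps(5)[OF a(3) gf[OF z]]] by simp
    then show "z \<in> coboundaries X n" by (rule q(2)[OF z])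
  next
    fix n y assume y: "y \<in> cocycles Y n"
    interpret Y: abelian_group "obj Y n" using a(3) by (rule cc_abelian)
    obtain z where z: "z \<in> cocycles X n" "y \<ominus>\<^bsub>obj Y n\<^esub> f n z \<in> coboundaries Y n" using q(3)[OF y] by blast
    have c: "f n z \<in> carrier (obj Y n)" "g n z \<in> carrier (obj Y n)" "y \<in> carrier (obj Y n)"
      using cocyclesD(1)[OF z(1)] cocyclesD(1)[OF y] a by simp_all
    have "(y \<ominus>\<^bsub>obj Y n\<^esub> f n z) \<oplus>\<^bsub>obj Y n\<^esub> \<ominus>\<^bsub>obj Y n\<^esub> (g n z \<ominus>\<^bsub>obj Y n\<^esub> f n z) = y \<ominus>\<^bsub>obj Y n\<^esub> g n z" using c by algebra
    then have "y \<ominus>\<^bsub>obj Y n\<^esub> g n z \<in> coboundaries Y n"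
      using coboundaries_simps(4)[OF a(3) z(2) coboundaries_simps(5)[OF a(3) gf[OF z(1)]]] by simp
    then show "\<exists>z\<in>cocycles X n. y \<ominus>\<^bsub>obj Y n\<^esub> g n z \<in> coboundaries Y n" using z(1) by blast
  qed
qed

text \<open>Any roof over \<open>X\<close> is dominated by one with apex \<open>Q\<close>: the
  equivalence from \<open>Q\<close> to \<open>X\<close> lifts along the quasi-isomorphism
  \<open>s\<close>, and from \<open>Q\<close> every map to \<open>Y\<close> is null.\<close>

lemma hom_null_D_hom_zero:
  fixes Q X Y :: "'a ucx"
  assumes Q: "bounded_projective R Q" and i: "K_iso R Q X" and n: "hom_null R X Y"
    and X: "cochain_complex R X" and Y: "cochain_complex R Y"
  shows "D_hom_zero R X Y"
  unfolding D_hom_zero_def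
proof (intro allI impI)
  fix Z s f assume "is_roof R X Y Z s f"
  then have Z: "cochain_complex R Z" and s: "quasi_iso R Z X s" and f: "f \<in> chain_maps R Z Y"
    by (auto simp: is_roof_def)
  have Qc: "cochain_complex R Q" using Q by simp
  obtain p p' where p: "K_inverse R Q X p p'" using K_isoD[OF i Qc X] .
  note pD = K_inverseD[OF p] and sc = quasi_isoD(1)[OF s Z X]
  obtain t where t: "t \<in> chain_maps R Q Z" "K_eq R Q X (s \<bullet> t) p"
    by (rule quasi_iso_lift[OF Q s Z X pD(1)])
  have "quasi_iso R Q X (s \<bullet> t)"
    by (rule K_eq_quasi_iso[OF K_eq_sym[OF t(2)] K_inverse_quasi_iso[OF p]])
  moreover have "hom_null R Q Y"
    by (rule hom_null_iso[OF n i K_iso_refl[OF Y] X Qc Y Y])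
  from hom_nullD[OF this comp_chain[OF t(1) f] Qc Y]
  have "K_eq R Q Y (f \<bullet> t) (zero_map Y)" .
  moreover have "zero_map Y \<bullet> p = zero_map Y" by (simp add: fun_eq_iff)
  ultimately show "roof_equiv R X Y Z s f X id_map (zero_map Y)"
    unfolding roof_equiv_def using Qc t pD(1) K_eqD(1) by (intro exI[of _ Q] exI[of _ t] exI[of _ p]) auto
qed

text \<open>As a roof with the identity as left leg, \<open>f\<close> becomes null after a
  quasi-isomorphism \<open>t\<close> onto \<open>X\<close>. Projectivity splits \<open>t\<close> up
  to homotopy, and the splitting brings the nullity back to \<open>f\<close>.\<close>

lemma D_hom_zero_hom_null:
  fixes X Y :: "'a ucx"
  assumes X: "bounded_projective R X" and Y: "cochain_complex R Y" and n: "D_hom_zero R X Y"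
  shows "hom_null R X Y"
proof (rule hom_nullI)
  fix f assume f: "f \<in> chain_maps R X Y"
  have Xc: "cochain_complex R X" using X by simp
  have "is_roof R X Y X id_map f"
    using Xc f K_inverse_quasi_iso[OF K_inverse_refl[OF Xc]] by (simp add: is_roof_def)
  then have "roof_equiv R X Y X id_map f X id_map (zero_map Y)" using n unfolding D_hom_zero_def by blast
  then obtain W t t' where W: "cochain_complex R (W :: 'a ucx)" and t: "t \<in> chain_maps R W X" "t' \<in> chain_maps R W X"
    and q: "quasi_iso R W X t" and h: "homotopic R W Y (f \<bullet> t) (zero_map Y \<bullet> t')"
    unfolding roof_equiv_def by auto
  obtain u where u: "u \<in> chain_maps R X W" "K_eq R X X (t \<bullet> u) id_map"
    by (rule quasi_iso_lift[OF X q W Xc id_chain])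
  have z: "zero_map Y \<bullet> t' = zero_map Y" by (simp add: fun_eq_iff)
  have "K_eq R W Y (f \<bullet> t) (zero_map Y)"
    by (rule K_eqI) (use h z W Y comp_chain[OF t(1) f] in simp_all)
  from K_eq_zero_comp[OF this u(1) Xc] have 1: "K_eq R X Y (f \<bullet> (t \<bullet> u)) (zero_map Y)"
    by (simp add: comp_assoc)
  have "K_eq R X Y (f \<bullet> (t \<bullet> u)) (f \<bullet> id_map)"
    by (rule K_eq_comp_left[OF u(2) f Y])
  then show "K_eq R X Y f (zero_map Y)" using K_eq_trans[OF K_eq_sym 1] by simp
qed

lemma K_iso_perfect:
  fixes Q X :: "'a ucx"
  assumes Q: "bounded_projective R Q" and i: "K_iso R Q X" and X: "cochain_complex R X"
  shows "perfect R X"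
proof -
  have Qc: "cochain_complex R Q" using Q by simp
  obtain p where p: "quasi_iso R Q X p" by (rule K_iso_quasi_iso[OF i Qc X])
  have "D_iso R Q X"
    unfolding D_iso_def using Qc p K_inverse_quasi_iso[OF K_inverse_refl[OF Qc]] by blast
  then show ?thesis unfolding perfect_def Kb_proj_iff[symmetric] using Q X by (auto simp: Kb_proj_iff)
qed

end

section \<open>Encoding\<close>

text \<open>Sums, cones and powers leave the element type \<open>nat \<Rightarrow> 'a\<close>. They
  are brought back along an injection \<open>e\<close> with left inverse \<open>d\<close>; the image
  of \<open>e\<close> is the new carrier, so \<open>e\<close> may fail to be surjective.\<close>

definition transport_module :: "('m \<Rightarrow> 'n) \<Rightarrow> ('n \<Rightarrow> 'm) \<Rightarrow> ('r, 'm) module \<Rightarrow> ('r, 'n) module" where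
  "transport_module e d M = \<lparr>carrier = e ` carrier M, mult = undefined, one = undefined,
     zero = e \<zero>\<^bsub>M\<^esub>, add = (\<lambda>x y. e (d x \<oplus>\<^bsub>M\<^esub> d y)), smult = (\<lambda>r x. e (r \<odot>\<^bsub>M\<^esub> d x))\<rparr>"

definition transport :: "('m \<Rightarrow> 'n) \<Rightarrow> ('n \<Rightarrow> 'm) \<Rightarrow> ('r, 'm) cx \<Rightarrow> ('r, 'n) cx" where
  "transport e d X = \<lparr>obj = (\<lambda>i. transport_module e d (obj X i)), diff = (\<lambda>i x. e (diff X i (d x)))\<rparr>"

definition pair_code :: "(nat \<Rightarrow> 'a) \<times> (nat \<Rightarrow> 'a) \<Rightarrow> nat \<Rightarrow> 'a" where
  "pair_code p = (\<lambda>k. if even k then fst p (k div 2) else snd p (k div 2))"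

definition pair_decode :: "(nat \<Rightarrow> 'a) \<Rightarrow> (nat \<Rightarrow> 'a) \<times> (nat \<Rightarrow> 'a)" where
  "pair_decode w = (\<lambda>k. w (2 * k), \<lambda>k. w (2 * k + 1))"

lemma pair_decode_code: "pair_decode \<circ> pair_code = id"
  by (simp add: pair_decode_def pair_code_def fun_eq_iff)

lemma pair_decode_code': "pair_decode (pair_code p) = p"
  using fun_cong[OF pair_decode_code, of p] by simp

context ring begin

lemma transport_module_module:
  assumes M: "right_module R M" and de: "d \<circ> e = id"
  shows "right_module R (transport_module e d M)"
proof (rule right_moduleI)
  interpret M: right_module R M by fact
  have d: "d (e x) = x" for x using fun_cong[OF de, of x] by simp
  show "abelian_group (transport_module e d M)"
  proof (rule abelian_groupI)
    fix x assume "x \<in> carrier (transport_module e d M)"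
    then show "\<exists>y\<in>carrier (transport_module e d M). y \<oplus>\<^bsub>transport_module e d M\<^esub> x = \<zero>\<^bsub>transport_module e d M\<^esub>"
      using M d by (intro bexI[of _ "e (\<ominus>\<^bsub>M\<^esub> d x)"]) (auto simp: transport_module_def M.M.l_neg)
  qed (use M d in \<open>auto simp: transport_module_def M.M.a_ac\<close>)
qed (use M fun_cong[OF de] in \<open>auto simp: transport_module_def rm_act rm_eqs\<close>)

lemma transport_homs:
  assumes M: "right_module R M" and de: "d \<circ> e = id"
  shows "e \<in> module_homs R M (transport_module e d M)" "d \<in> module_homs R (transport_module e d M) M"
  by (rule module_homsI; use M fun_cong[OF de] in \<open>auto simp: transport_module_def\<close>)+

lemma transport_iso:
  assumes X: "cochain_complex R X" and de: "d \<circ> e = id"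
  shows "cochain_complex R (transport e d X)"
    and "K_inverse R X (transport e d X) (\<lambda>i. e) (\<lambda>i. d)"
proof -
  note h = transport_homs[OF cc_module[OF X] de]
  have d: "d (e x) = x" for x using fun_cong[OF de, of x] by simp
  show t: "cochain_complex R (transport e d X)"
    unfolding cochain_complex_def
  proof (intro allI conjI ballI)
    fix i
    show "right_module R (obj (transport e d X) i)"
      using X de by (simp add: transport_def transport_module_module)
    show "diff (transport e d X) i \<in> module_homs R (obj (transport e d X) i) (obj (transport e d X) (i + 1))"
      using module_homs_comp[OF module_homs_comp[OF h(2) cc_diff_hom[OF X refl]] h(1)]
      by (simp add: transport_def)
  qed (use X d in \<open>auto simp: transport_def transport_module_def\<close>)
  have "(\<lambda>i. e) \<in> chain_maps R X (transport e d X)"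
    by (rule chain_mapsI) (use h(1) d in \<open>simp_all add: transport_def\<close>)
  moreover have "(\<lambda>i. d) \<in> chain_maps R (transport e d X) X"
    by (rule chain_mapsI) (use h(2) d in \<open>simp_all add: transport_def\<close>)
  ultimately show "K_inverse R X (transport e d X) (\<lambda>i. e) (\<lambda>i. d)"
    by (intro strict_iso) (use X t d in \<open>auto simp: transport_def transport_module_def\<close>)
qed

lemma bounded_projectiveI:
  assumes "cochain_complex R X" "\<And>i. fg_projective R (obj X i)"
    and "\<And>i. i < a \<or> b < i \<Longrightarrow> carrier (obj X i) = {\<zero>\<^bsub>obj X i\<^esub>}"
  shows "bounded_projective R X"
  using assms unfolding bounded_projective_def by blast

lemma bounded_projective_obj: "bounded_projective R X \<Longrightarrow> fg_projective R (obj X i)"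
  by (simp add: bounded_projective_def)

text \<open>Projectivity is a property of the terms and not of the homotopy type, so the retraction
  has to hold on the nose.\<close>

lemma strict_retract_bounded_projective:
  assumes X: "bounded_projective R X" and Y: "cochain_complex R Y"
    and u: "u \<in> chain_maps R Y X" and p: "p \<in> chain_maps R X Y"
    and pu: "\<And>i y. y \<in> carrier (obj Y i) \<Longrightarrow> p i (u i y) = y"
  shows "bounded_projective R Y"
proof -
  have Xc: "cochain_complex R X" using X by simp
  obtain a b where ab: "\<And>i. i < a \<or> b < i \<Longrightarrow> carrier (obj X i) = {\<zero>\<^bsub>obj X i\<^esub>}"
    using X unfolding bounded_projective_def by blast
  show ?thesis
  proof (rule bounded_projectiveI[OF Y, where a = a and b = b])
    show "fg_projective R (obj Y i)" for i
      by (rule fg_projective_retract[OF bounded_projective_obj[OF X] _ chain_maps_hom[OF u] chain_maps_hom[OF p] pu])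
        (use Y in simp)
    show "carrier (obj Y i) = {\<zero>\<^bsub>obj Y i\<^esub>}" if "i < a \<or> b < i" for i
    proof -
      have "y = \<zero>\<^bsub>obj Y i\<^esub>" if y: "y \<in> carrier (obj Y i)" for y
        using pu[OF y] cm_simps(1)[OF u y] ab[OF \<open>i < a \<or> b < i\<close>] cm_simps(3)[OF p Xc Y] by simp
      then show ?thesis using Y by auto
    qed
  qed
qed

lemma transport_bounded_projective:
  assumes X: "bounded_projective R X" and de: "d \<circ> e = id"
  shows "bounded_projective R (transport e d X)"
proof -
  have Xc: "cochain_complex R X" using X by simp
  note t = transport_iso[OF Xc de]
  show ?thesis
    by (rule strict_retract_bounded_projective[OF X t(1) K_inverseD(2,1)[OF t(2)]])
      (use fun_cong[OF de] in \<open>auto simp: transport_def transport_module_def\<close>)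
qed

text \<open>The form in which encoding is applied: cones and direct sums have pairs of sequences as
  elements and get a representative of type \<open>'a ucx\<close>.\<close>

lemma encode_pair:
  fixes X :: "('a, (nat \<Rightarrow> 'a) \<times> (nat \<Rightarrow> 'a)) cx"
  assumes "cochain_complex R X"
  obtains X' :: "'a ucx" and f g where "cochain_complex R X'" "K_inverse R X' X f g"
    "\<And>i x. x \<in> carrier (obj X' i) \<Longrightarrow> g i (f i x) = x" "\<And>i x. x \<in> carrier (obj X i) \<Longrightarrow> f i (g i x) = x"
    "bounded_projective R X \<Longrightarrow> bounded_projective R X'"
proof
  show "cochain_complex R (transport pair_code pair_decode X)"
    by (rule transport_iso(1)[OF assms pair_decode_code])
  show "K_inverse R (transport pair_code pair_decode X) X (\<lambda>i. pair_decode) (\<lambda>i. pair_code)"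
    by (rule K_inverse_sym[OF transport_iso(2)[OF assms pair_decode_code]])
  show "bounded_projective R (transport pair_code pair_decode X)" if "bounded_projective R X"
    by (rule transport_bounded_projective[OF that pair_decode_code])
qed (auto simp: transport_def transport_module_def pair_decode_code')

lemma sum_bounded_projective:
  assumes X: "bounded_projective R X" and Y: "bounded_projective R Y"
  shows "bounded_projective R (complex_sum X Y)"
proof -
  obtain a b where ab: "\<And>i. i < a \<or> b < i \<Longrightarrow> carrier (obj X i) = {\<zero>\<^bsub>obj X i\<^esub>}"
    using X unfolding bounded_projective_def by blast
  obtain c d where cd: "\<And>i. i < c \<or> d < i \<Longrightarrow> carrier (obj Y i) = {\<zero>\<^bsub>obj Y i\<^esub>}"
    using Y unfolding bounded_projective_def by blast
  show ?thesis
  proof (rule bounded_projectiveI[where a = "min a c" and b = "max b d"])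
    show "fg_projective R (obj (complex_sum X Y) i)" for i
      using X Y by (simp add: fg_projective_sum bounded_projective_obj)
  qed (use X Y ab cd in auto)
qed

lemma cone_bounded_projective:
  assumes X: "bounded_projective R X" and Y: "bounded_projective R Y" and f: "f \<in> chain_maps R X Y"
  shows "bounded_projective R (cone X Y f)"
proof -
  obtain a b where ab: "\<And>i. i < a \<or> b < i \<Longrightarrow> carrier (obj X i) = {\<zero>\<^bsub>obj X i\<^esub>}"
    using X unfolding bounded_projective_def by blast
  obtain c d where cd: "\<And>i. i < c \<or> d < i \<Longrightarrow> carrier (obj Y i) = {\<zero>\<^bsub>obj Y i\<^esub>}"
    using Y unfolding bounded_projective_def by blast
  show ?thesis
  proof (rule bounded_projectiveI[where a = "min (a - 1) c" and b = "max b d"])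
    show "fg_projective R (obj (cone X Y f) i)" for i
      using X Y by (simp add: fg_projective_sum bounded_projective_obj)
  qed (use X Y f ab cd in auto)
qed

lemma stalk_bounded_projective:
  assumes "fg_projective R M"
  shows "bounded_projective R (stalk M)"
proof -
  have M: "right_module R M" by (rule fg_projective_module[OF assms])
  have "fg_projective R (obj (stalk M) i)" for i
  proof (cases "i = 0")
    case False
    then show ?thesis
      by (intro fg_projective_zero) (use M in simp_all)
  qed (use assms in simp)
  moreover have "\<forall>i::int. i < 0 \<or> 0 < i \<longrightarrow> carrier (obj (stalk M) i) = {\<zero>\<^bsub>obj (stalk M) i\<^esub>}" by simp
  ultimately show ?thesis using M unfolding bounded_projective_def by fastforce
qed

section \<open>Powers\<close>

lemma complex_power_simps [simp]:
  "obj (complex_power X n) i = module_power (obj X i) n"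
  "diff (complex_power X n) i x = (\<lambda>j\<in>{..<n}. diff X i (x j))"
  by (simp_all add: complex_power_def)

lemma power_complex [simp]:
  assumes X: "cochain_complex R X"
  shows "cochain_complex R (complex_power X n)"
  unfolding cochain_complex_def
proof (intro allI conjI ballI)
  fix i
  show "right_module R (obj (complex_power X n) i)" using X by (simp add: module_power_module)
  have d: "diff (complex_power X n) i = (\<lambda>x. \<lambda>j\<in>{..<n}. diff X i (x j))" by (simp add: fun_eq_iff)
  show "diff (complex_power X n) i \<in> module_homs R (obj (complex_power X n) i) (obj (complex_power X n) (i + 1))"
    unfolding d complex_power_simps
    by (rule module_homs_power, use X in simp, rule module_homs_comp[OF module_power_proj cc_diff_hom[OF X refl]])
  show "diff (complex_power X n) (i + 1) (diff (complex_power X n) i x) = \<zero>\<^bsub>obj (complex_power X n) (i + 2)\<^esub>"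
    if "x \<in> carrier (obj (complex_power X n) i)" for x
    using that X by (auto simp: module_power_carrier module_power_def fun_eq_iff PiE_iff)
qed

definition power_proj :: "nat \<Rightarrow> int \<Rightarrow> (nat \<Rightarrow> 'm) \<Rightarrow> 'm" where
  "power_proj j = (\<lambda>i x. x j)"

lemma chain_map_power:
  assumes X: "cochain_complex R X" and f: "\<And>j. j < n \<Longrightarrow> f j \<in> chain_maps R V X"
  shows "(\<lambda>i x. \<lambda>j\<in>{..<n}. f j i x) \<in> chain_maps R V (complex_power X n)"
  by (rule chain_mapsI)
    (use X f in \<open>auto simp: fun_eq_iff intro!: module_homs_power chain_maps_hom\<close>)

lemma power_proj_chain [simp]:
  "j < n \<Longrightarrow> power_proj j \<in> chain_maps R (complex_power X n) X"
  unfolding power_proj_def by (rule chain_mapsI) (simp_all add: module_power_proj)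

lemma K_factors_sum_object:
  assumes X: "K_factors R P X X id_map" and Y: "K_factors R P Y Y id_map" and P: "cochain_complex R P"
  shows "K_factors R P (complex_sum X Y) (complex_sum X Y) id_map"
proof -
  note Xc = K_factorsD(2)[OF X P] and Yc = K_factorsD(2)[OF Y P]
  let ?S = "complex_sum X Y"
  have S: "cochain_complex R ?S" using Xc Yc by simp
  note sm = sum_chain_maps[OF Xc Yc]
  have 1: "K_factors R P ?S ?S ((\<lambda>i x. (x, \<zero>\<^bsub>obj Y i\<^esub>)) \<bullet> (id_map \<bullet> (\<lambda>i. fst)))"
    by (rule K_factors_comp_left[OF K_factors_comp_right[OF X sm(3) P S] sm(1) P S])
  have 2: "K_factors R P ?S ?S ((\<lambda>i y. (\<zero>\<^bsub>obj X i\<^esub>, y)) \<bullet> (id_map \<bullet> (\<lambda>i. snd)))"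
    by (rule K_factors_comp_left[OF K_factors_comp_right[OF Y sm(4) P S] sm(2) P S])
  note 3 = K_factors_sum[OF 1 2 P]
  show ?thesis
    by (rule K_factors_cong[OF 3 K_eq_eqI[OF S S K_factorsD(1)[OF 3 P] id_chain]]) (use Xc Yc in auto)
qed

text \<open>Makes powers accessible to induction through direct sums; the isomorphism is strict so
  that it also transfers projectivity of the terms.\<close>

lemma power_Suc:
  assumes X: "cochain_complex R X"
  obtains f g where "f \<in> chain_maps R (complex_sum (complex_power X n) X) (complex_power X (Suc n))"
    and "g \<in> chain_maps R (complex_power X (Suc n)) (complex_sum (complex_power X n) X)"
    and "\<And>i x. x \<in> carrier (obj (complex_sum (complex_power X n) X) i) \<Longrightarrow> g i (f i x) = x"
    and "\<And>i y. y \<in> carrier (obj (complex_power X (Suc n)) i) \<Longrightarrow> f i (g i y) = y"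
proof -
  let ?U = "complex_power X n" and ?V = "complex_power X (Suc n)"
  have U: "cochain_complex R ?U" using X by simp
  note sm = sum_chain_maps[OF U X]
  define f :: "int \<Rightarrow> (nat \<Rightarrow> 'c) \<times> 'c \<Rightarrow> nat \<Rightarrow> 'c"
    where "f = (\<lambda>i p. \<lambda>j\<in>{..<Suc n}. (if j < n then power_proj j \<bullet> (\<lambda>i. fst) else (\<lambda>i. snd)) i p)"
  define g :: "int \<Rightarrow> (nat \<Rightarrow> 'c) \<Rightarrow> (nat \<Rightarrow> 'c) \<times> 'c"
    where "g = (\<lambda>i w. (\<lambda>j\<in>{..<n}. power_proj j i w, power_proj n i w))"
  have f: "f \<in> chain_maps R (complex_sum ?U X) ?V"
    unfolding f_def by (rule chain_map_power[OF X]) (use sm(4) comp_chain[OF sm(3) power_proj_chain] in simp)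
  have r: "(\<lambda>i w. \<lambda>j\<in>{..<n}. power_proj j i w) \<in> chain_maps R ?V ?U"
    by (rule chain_map_power[OF X]) simp
  have g: "g \<in> chain_maps R ?V (complex_sum ?U X)"
    unfolding g_def by (rule chain_mapsI)
      (use chain_maps_hom[OF r] chain_maps_hom[OF power_proj_chain[of n "Suc n" X]] in
        \<open>auto simp: power_proj_def intro!: module_homs_pair\<close>)
  show thesis
    by (rule that[OF f g])
      (auto simp: f_def g_def power_proj_def module_power_carrier fun_eq_iff extensional_def less_Suc_eq)
qed

lemma power_bounded_projective:
  assumes X: "bounded_projective R X"
  shows "bounded_projective R (complex_power X n)"
proof (induction n)
  case 0
  have U: "cochain_complex R (complex_power X 0)" using X by simp
  have z: "carrier (obj (complex_power X 0) i) = {\<zero>\<^bsub>obj (complex_power X 0) i\<^esub>}" for i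
    by (simp add: module_power_def fun_eq_iff)
  show ?case
    by (rule bounded_projectiveI[OF U fg_projective_zero[OF cc_module[OF U] z] z])
next
  case (Suc n)
  have Xc: "cochain_complex R X" using X by simp
  obtain f g where f: "f \<in> chain_maps R (complex_sum (complex_power X n) X) (complex_power X (Suc n))"
    and g: "g \<in> chain_maps R (complex_power X (Suc n)) (complex_sum (complex_power X n) X)"
    and fg: "\<And>i y. y \<in> carrier (obj (complex_power X (Suc n)) i) \<Longrightarrow> f i (g i y) = y"
    by (rule power_Suc[OF Xc, of n]) (rule that)
  show ?case
    by (rule strict_retract_bounded_projective[OF sum_bounded_projective[OF Suc.IH X] power_complex[OF Xc] g f fg])
qed

lemma power_factors:
  assumes X: "cochain_complex R X"
  shows "K_factors R X (complex_power X n) (complex_power X n) id_map"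
proof (induction n)
  case 0
  have U: "cochain_complex R (complex_power X 0)" using X by simp
  have "K_eq R (complex_power X 0) (complex_power X 0) (zero_map (complex_power X 0)) id_map"
    by (rule K_eq_eqI[OF U U zero_chain[OF U] id_chain]) (simp add: module_power_def fun_eq_iff)
  then show ?case by (rule K_factors_cong[OF K_factors_zero[OF U U]])
next
  case (Suc n)
  let ?S = "complex_sum (complex_power X n) X"
  have S: "cochain_complex R ?S" and V: "cochain_complex R (complex_power X (Suc n))" using X by simp_all
  obtain f g where "K_inverse R (complex_power X (Suc n)) ?S g f"
    by (rule power_Suc[OF X, of n]) (rule that, rule strict_iso[OF V S])
  then show ?case
    by (rule K_factors_trans[OF K_iso_factors[OF K_isoI V S]
          K_factors_sum_object[OF Suc.IH K_iso_factors[OF K_iso_refl[OF X] X X] X] S X])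
qed

text \<open>Membership is defined through a roof in the derived category, with a complement
  \<open>Y'\<close> about whose terms nothing is known. Lifts are therefore taken from the power of
  \<open>P\<close> and from \<open>Q\<close> alone: a section of \<open>t\<close> turns the roof
  into a quasi-isomorphism out of the power, and the inclusion of \<open>Q\<close> lifts along
  it.\<close>

lemma add_closure_factors:
  fixes P Q :: "'a ucx"
  assumes P: "bounded_projective R P" and Q: "Q \<in> add_closure R P"
  shows "K_factors R P Q Q id_map"
proof -
  have Pc: "cochain_complex R P" using P by simp
  have Qb: "bounded_projective R Q" using Q by (simp add: add_closure_def Kb_proj_iff)
  then have Qc: "cochain_complex R Q" by simp
  obtain n and Y' Z :: "'a ucx" and s t where Y': "cochain_complex R Y'" and Z: "cochain_complex R Z"
    and s: "quasi_iso R Z (complex_sum Q Y') s" and t: "quasi_iso R Z (complex_power P n) t"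
    using Q unfolding add_closure_def D_iso_def by blast
  let ?S = "complex_sum Q Y'" and ?P = "complex_power P n"
  have Sc: "cochain_complex R ?S" and PPc: "cochain_complex R ?P" using Qc Y' Pc by simp_all
  note sm = sum_chain_maps[OF Qc Y']
  obtain w where w: "w \<in> chain_maps R ?P Z" "K_eq R ?P ?P (t \<bullet> w) id_map"
    by (rule quasi_iso_lift[OF power_bounded_projective[OF P] t Z PPc id_chain])
  have sw: "quasi_iso R ?P ?S (s \<bullet> w)"
    by (rule quasi_iso_comp[OF quasi_iso_section[OF t w Z PPc] s PPc Z Sc])
  obtain u where u: "u \<in> chain_maps R Q ?P" "K_eq R Q ?S ((s \<bullet> w) \<bullet> u) (\<lambda>i x. (x, \<zero>\<^bsub>obj Y' i\<^esub>))"
    by (rule quasi_iso_lift[OF Qb sw PPc Sc sm(1)])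
  let ?v = "(\<lambda>i. fst) \<bullet> (s \<bullet> w)"
  have v: "?v \<in> chain_maps R ?P Q" by (rule comp_chain[OF quasi_isoD(1)[OF sw PPc Sc] sm(3)])
  have "K_eq R Q Q (?v \<bullet> u) ((\<lambda>i. fst) \<bullet> (\<lambda>i x. (x, \<zero>\<^bsub>obj Y' i\<^esub>)))"
    using K_eq_comp_left[OF u(2) sm(3) Qc] by (simp add: comp_assoc)
  also have "(\<lambda>i. fst) \<bullet> (\<lambda>i x. (x, \<zero>\<^bsub>obj Y' i\<^esub>)) = (id_map :: int \<Rightarrow> (nat \<Rightarrow> 'a) \<Rightarrow> nat \<Rightarrow> 'a)"
    by (simp add: fun_eq_iff)
  finally have "K_eq R Q Q (?v \<bullet> u) id_map" .
  from K_factors_cong[OF K_factors_single[OF u(1) v PPc Qc Qc] this]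
  show ?thesis by (rule K_factors_trans[OF _ power_factors[OF Pc] PPc Pc])
qed

section \<open>Cones of equivalent maps\<close>

text \<open>Write \<open>e\<close> as \<open>1 + d\<close>; as the square of \<open>d\<close> is
  null, \<open>1 - d\<close> is inverse to \<open>e\<close>.\<close>

lemma K_unipotent:
  assumes Z: "cochain_complex R Z" and e: "e \<in> chain_maps R Z Z"
    and d: "d = add_map Z e (neg_map Z id_map)" and n: "K_eq R Z Z (d \<bullet> d) (zero_map Z)"
  obtains u where "K_inverse R Z Z e u"
proof -
  interpret Z: abelian_group "obj Z i" for i using Z by (rule cc_abelian)
  have dc: "d \<in> chain_maps R Z Z" unfolding d using Z e by simp
  have dd: "d \<bullet> d \<in> chain_maps R Z Z" by (rule comp_chain[OF dc dc])
  define u where "u = add_map Z id_map (neg_map Z d)"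
  have uc: "u \<in> chain_maps R Z Z" unfolding u_def using Z dc by simp
  have ex: "e i x = x \<oplus>\<^bsub>obj Z i\<^esub> d i x" if x: "x \<in> carrier (obj Z i)" for i x
  proof -
    have "e i x \<in> carrier (obj Z i)" using e x by simp
    with x show ?thesis unfolding d by simp algebra
  qed
  have 1: "K_eq R Z Z (add_map Z id_map (neg_map Z (d \<bullet> d))) id_map"
  proof (rule K_eq_diff_zero)
    have "K_eq R Z Z (add_map Z (add_map Z id_map (neg_map Z (d \<bullet> d))) (neg_map Z id_map)) (neg_map Z (d \<bullet> d))"
    proof (rule K_eq_eqI)
      fix i x assume x: "x \<in> carrier (obj Z i)"
      then have "d i (d i x) \<in> carrier (obj Z i)" using dc by simp
      with x show "add_map Z (add_map Z id_map (neg_map Z (d \<bullet> d))) (neg_map Z id_map) i x = neg_map Z (d \<bullet> d) i x"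
        by simp algebra
    qed (use Z dd in simp_all)
    also have "K_eq R Z Z (neg_map Z (d \<bullet> d)) (zero_map Z)"
    proof -
      have ni: "neg_map Z id_map \<in> chain_maps R Z Z" using Z by simp
      have "neg_map Z (d \<bullet> d) = neg_map Z id_map \<bullet> (d \<bullet> d)" by (simp add: fun_eq_iff)
      then show ?thesis using K_eq_comp_zero[OF n ni Z] by simp
    qed
    finally show "K_eq R Z Z (add_map Z (add_map Z id_map (neg_map Z (d \<bullet> d))) (neg_map Z id_map)) (zero_map Z)" .
  qed (use Z dd in simp_all)
  have c: "x \<in> carrier (obj Z i)" "d i x \<in> carrier (obj Z i)" "d i (d i x) \<in> carrier (obj Z i)"
    if "x \<in> carrier (obj Z i)" for i x using that dc by simp_all
  have "K_eq R Z Z (e \<bullet> u) (add_map Z id_map (neg_map Z (d \<bullet> d)))"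
  proof (rule K_eq_eqI)
    fix i x assume x: "x \<in> carrier (obj Z i)"
    have "d i (x \<oplus>\<^bsub>obj Z i\<^esub> \<ominus>\<^bsub>obj Z i\<^esub> d i x) = d i x \<oplus>\<^bsub>obj Z i\<^esub> \<ominus>\<^bsub>obj Z i\<^esub> d i (d i x)"
      using dc Z x by simp
    then show "(e \<bullet> u) i x = add_map Z id_map (neg_map Z (d \<bullet> d)) i x"
      using ex[of "u i x" i] cm_simps(1)[OF uc x] c[OF x] by (simp add: u_def) algebra
  qed (use Z e uc dd in simp_all)
  note eu = K_eq_trans[OF this 1]
  have "K_eq R Z Z (u \<bullet> e) (add_map Z id_map (neg_map Z (d \<bullet> d)))"
  proof (rule K_eq_eqI)
    fix i x assume x: "x \<in> carrier (obj Z i)"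
    have "d i (x \<oplus>\<^bsub>obj Z i\<^esub> d i x) = d i x \<oplus>\<^bsub>obj Z i\<^esub> d i (d i x)"
      using dc Z x by simp
    then show "(u \<bullet> e) i x = add_map Z id_map (neg_map Z (d \<bullet> d)) i x"
      using c[OF x] by (simp add: u_def ex[OF x]) algebra
  qed (use Z e uc dd in simp_all)
  note ue = K_eq_trans[OF this 1]
  show thesis by (rule that[of u]) (use e uc eu ue in \<open>simp add: K_inverse_def\<close>)
qed

text \<open>\<open>u \<bullet> g\<close> is a left inverse of \<open>f\<close> and
  \<open>g \<bullet> v\<close> a right inverse, and two such inverses agree.\<close>

lemma K_inverse_from_composites:
  assumes X: "cochain_complex R X" and Y: "cochain_complex R Y"
    and f: "f \<in> chain_maps R X Y" and g: "g \<in> chain_maps R Y X"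
    and u: "K_inverse R X X (g \<bullet> f) u" and v: "K_inverse R Y Y (f \<bullet> g) v"
  shows "K_inverse R X Y f (u \<bullet> g)"
proof -
  note uD = K_inverseD[OF u] and vD = K_inverseD[OF v]
  have ug: "u \<bullet> g \<in> chain_maps R Y X" by (rule comp_chain[OF g uD(2)])
  have gv: "g \<bullet> v \<in> chain_maps R Y X" by (rule comp_chain[OF vD(2) g])
  have l: "K_eq R X X ((u \<bullet> g) \<bullet> f) id_map" using uD(3) by (simp add: comp_assoc)
  have r: "K_eq R Y Y (f \<bullet> (g \<bullet> v)) id_map" using vD(4) by (simp add: comp_assoc)
  have "K_eq R Y X ((u \<bullet> g) \<bullet> id_map) ((u \<bullet> g) \<bullet> (f \<bullet> (g \<bullet> v)))"
    by (rule K_eq_comp_left[OF K_eq_sym[OF r] ug X])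
  also have "K_eq R Y X ((u \<bullet> g) \<bullet> (f \<bullet> (g \<bullet> v))) (id_map \<bullet> (g \<bullet> v))"
    using K_eq_comp_right[OF l gv Y] by (simp add: comp_assoc)
  finally have "K_eq R Y X (u \<bullet> g) (g \<bullet> v)" by simp
  from K_eq_comp_left[OF this f Y] have "K_eq R Y Y (f \<bullet> (u \<bullet> g)) (f \<bullet> (g \<bullet> v))" .
  from K_eq_trans[OF this r] show ?thesis using f ug l by (simp add: K_inverse_def)
qed

text \<open>An endomorphism \<open>e\<close> of a cone that restricts to the identity at both ends is invertible, since
  \<open>(e - 1)\<^sup>2\<close> is null-homotopic.\<close>

lemma cone_endomorphism_invertible:
  assumes X: "cochain_complex R X" and Y: "cochain_complex R Y" and f: "f \<in> chain_maps R X Y"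
    and e: "e \<in> chain_maps R (cone X Y f) (cone X Y f)"
    and i: "K_eq R Y (cone X Y f) (e \<bullet> cone_incl X) (cone_incl X)"
    and q: "K_eq R (cone X Y f) (shift X 1) (cone_proj \<bullet> e) cone_proj"
  obtains u where "K_inverse R (cone X Y f) (cone X Y f) e u"
proof -
  let ?C = "cone X Y f"
  have C: "cochain_complex R ?C" using X Y f by simp
  have ic: "cone_incl X \<in> chain_maps R Y ?C" and qc: "cone_proj \<in> chain_maps R ?C (shift X 1)"
    and S: "cochain_complex R (shift X 1)"
    using X Y f by simp_all
  define d where "d = add_map ?C e (neg_map ?C id_map)"
  have dc: "d \<in> chain_maps R ?C ?C" unfolding d_def by (intro add_chain neg_chain C e id_chain)
  \<comment> \<open>\<open>d\<close> vanishes on \<open>Y\<close>, hence it factors as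
    \<open>b \<bullet> cone_proj\<close>; and \<open>cone_proj\<close> also kills \<open>d\<close>
    from the left. Together these make \<open>d \<bullet> d\<close> null.\<close>
  have "K_eq R Y ?C (d \<bullet> cone_incl X) (add_map ?C (e \<bullet> cone_incl X) (neg_map ?C (cone_incl X)))"
    by (rule K_eq_eqI[OF Y C comp_chain[OF ic dc] add_chain[OF C comp_chain[OF ic e] neg_chain[OF C ic]]])
      (simp add: d_def del: cone_apply)
  also note K_eq_diff_zeroD[OF i]
  finally obtain b where b: "b \<in> chain_maps R (shift X 1) ?C" "K_eq R ?C ?C d (b \<bullet> cone_proj)"
    using cone_factor_left[OF X Y C f dc] by blast
  have "K_eq R ?C (shift X 1) (cone_proj \<bullet> d) (add_map (shift X 1) (cone_proj \<bullet> e) (neg_map (shift X 1) cone_proj))"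
  proof (rule K_eq_eqI[OF C S comp_chain[OF dc qc] add_chain[OF S comp_chain[OF e qc] neg_chain[OF S qc]]])
    fix j p assume p: "p \<in> carrier (obj ?C j)"
    show "(cone_proj \<bullet> d) j p = add_map (shift X 1) (cone_proj \<bullet> e) (neg_map (shift X 1) cone_proj) j p"
      using cm_simps(2)[OF qc, of "e j p" j "\<ominus>\<^bsub>obj ?C j\<^esub> p"] cm_simps(4)[OF qc C S p] cm_simps(1)[OF e p] p C
      by (simp add: d_def del: cone_apply cone_obj)
  qed
  also note K_eq_diff_zeroD[OF q]
  finally have qd: "K_eq R ?C (shift X 1) (cone_proj \<bullet> d) (zero_map (shift X 1))" .
  have "K_eq R ?C ?C (d \<bullet> d) ((b \<bullet> cone_proj) \<bullet> d)"
    by (rule K_eq_comp_right[OF b(2) dc C])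
  also have "K_eq R ?C ?C ((b \<bullet> cone_proj) \<bullet> d) (zero_map ?C)"
    using K_eq_comp_zero[OF qd b(1) C] by (simp add: comp_assoc)
  finally show thesis using K_unipotent[OF C e d_def] that by blast
qed

text \<open>The maps \<open>F\<close> and \<open>G\<close> induced on cones need not be inverse to
  each other, since they depend on chosen homotopies. Their composites restrict to the identity at
  both ends, however, and this suffices for invertibility.\<close>

lemma cone_equivalence:
  assumes X: "cochain_complex R X" and Y: "cochain_complex R Y" and f: "f \<in> chain_maps R X Y"
    and f': "f' \<in> chain_maps R X' Y'"
    and a: "K_inverse R X X' a a'" and b: "K_inverse R Y Y' b b'"
    and sq: "K_eq R X Y' (f' \<bullet> a) (b \<bullet> f)"
  shows "K_iso R (cone X Y f) (cone X' Y' f')"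
proof -
  note aD = K_inverseD[OF a] and bD = K_inverseD[OF b]
  note X' = aD(6) and Y' = bD(6)
  have fa: "f \<bullet> a' \<in> chain_maps R X' Y" by (rule comp_chain[OF aD(2) f])
  have sq': "K_eq R X' Y (f \<bullet> a') (b' \<bullet> f')"
  proof -
    have "K_eq R X' Y (id_map \<bullet> (f \<bullet> a')) ((b' \<bullet> b) \<bullet> (f \<bullet> a'))"
      by (rule K_eq_comp_right[OF K_eq_sym[OF bD(3)] fa X'])
    also have "K_eq R X' Y ((b' \<bullet> b) \<bullet> (f \<bullet> a')) (b' \<bullet> ((f' \<bullet> a) \<bullet> a'))"
      using K_eq_comp_left[OF K_eq_comp_right[OF K_eq_sym[OF sq] aD(2) X'] bD(2) Y]
      by (simp add: comp_assoc)
    also have "K_eq R X' Y (b' \<bullet> ((f' \<bullet> a) \<bullet> a')) ((b' \<bullet> f') \<bullet> id_map)"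
      using K_eq_comp_left[OF aD(4) comp_chain[OF f' bD(2)] Y] by (simp add: comp_assoc)
    finally show ?thesis by simp
  qed
  let ?C = "cone X Y f" and ?C' = "cone X' Y' f'"
  have C: "cochain_complex R ?C" and C': "cochain_complex R ?C'" using X Y f X' Y' f' by simp_all
  obtain F where F: "F \<in> chain_maps R ?C ?C'"
    "\<And>i y. y \<in> carrier (obj Y i) \<Longrightarrow> F i (\<zero>\<^bsub>obj X (i + 1)\<^esub>, y) = (\<zero>\<^bsub>obj X' (i + 1)\<^esub>, b i y)"
    "\<And>i p. fst (F i p) = a (i + 1) (fst p)"
    by (rule cone_map[OF X Y f X' Y' f' aD(1) bD(1) sq]) (rule that)
  obtain G where G: "G \<in> chain_maps R ?C' ?C"
    "\<And>i y. y \<in> carrier (obj Y' i) \<Longrightarrow> G i (\<zero>\<^bsub>obj X' (i + 1)\<^esub>, y) = (\<zero>\<^bsub>obj X (i + 1)\<^esub>, b' i y)"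
    "\<And>i p. fst (G i p) = a' (i + 1) (fst p)"
    by (rule cone_map[OF X' Y' f' X Y f aD(2) bD(2) sq']) (rule that)
  \<comment> \<open>Proved with type variables of its own, because it is applied to both composites
    and these are endomorphisms of cones whose elements may have different types.\<close>
  have key: "\<exists>u. K_inverse R (cone X Y f) (cone X Y f) (G \<bullet> F) u"
    if X: "cochain_complex R X" and Y: "cochain_complex R Y" and f: "f \<in> chain_maps R X Y"
    and X': "cochain_complex R X'" and Y': "cochain_complex R Y'" and f': "f' \<in> chain_maps R X' Y'"
    and a: "K_eq R X X (a' \<bullet> a) id_map" "a \<in> chain_maps R X X'" "a' \<in> chain_maps R X' X"
    and b: "K_eq R Y Y (b' \<bullet> b) id_map" "b \<in> chain_maps R Y Y'" "b' \<in> chain_maps R Y' Y"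
    and F: "F \<in> chain_maps R (cone X Y f) (cone X' Y' f')"
    "\<And>i y. y \<in> carrier (obj Y i) \<Longrightarrow> F i (\<zero>\<^bsub>obj X (i + 1)\<^esub>, y) = (\<zero>\<^bsub>obj X' (i + 1)\<^esub>, b i y)"
    "\<And>i p. fst (F i p) = a (i + 1) (fst p)"
    and G: "G \<in> chain_maps R (cone X' Y' f') (cone X Y f)"
    "\<And>i y. y \<in> carrier (obj Y' i) \<Longrightarrow> G i (\<zero>\<^bsub>obj X' (i + 1)\<^esub>, y) = (\<zero>\<^bsub>obj X (i + 1)\<^esub>, b' i y)"
    "\<And>i p. fst (G i p) = a' (i + 1) (fst p)"
    for X :: "('a, 'o) cx" and Y :: "('a, 'p) cx" and f and X' :: "('a, 'q) cx" and Y' :: "('a, 's) cx"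
      and f' a a' b b' F G
  proof -
    let ?C = "cone X Y f"
    have C: "cochain_complex R ?C" using X Y f by simp
    have GF: "G \<bullet> F \<in> chain_maps R ?C ?C" by (rule comp_chain[OF F(1) G(1)])
    have ic: "cone_incl X \<in> chain_maps R Y ?C" and qc: "cone_proj \<in> chain_maps R ?C (shift X 1)"
      and S: "cochain_complex R (shift X 1)" using X Y f by simp_all
    have bb: "b' \<bullet> b \<in> chain_maps R Y Y" by (rule comp_chain[OF b(2,3)])
    have "K_eq R Y ?C ((G \<bullet> F) \<bullet> cone_incl X) (cone_incl X \<bullet> (b' \<bullet> b))"
      by (rule K_eq_eqI[OF Y C comp_chain[OF ic GF] comp_chain[OF bb ic]]) (use F(2) G(2) b in simp)
    also have "K_eq R Y ?C (cone_incl X \<bullet> (b' \<bullet> b)) (cone_incl X \<bullet> id_map)"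
      by (rule K_eq_comp_left[OF b(1) ic C])
    finally have 1: "K_eq R Y ?C ((G \<bullet> F) \<bullet> cone_incl X) (cone_incl X)" by simp
    have aa: "shift_map (a' \<bullet> a) 1 \<in> chain_maps R (shift X 1) (shift X 1)"
      using comp_chain[OF a(2,3)] X by simp
    have "K_eq R ?C (shift X 1) (cone_proj \<bullet> (G \<bullet> F)) (shift_map (a' \<bullet> a) 1 \<bullet> cone_proj)"
      by (rule K_eq_eqI[OF C S comp_chain[OF GF qc] comp_chain[OF qc aa]]) (use F(3) G(3) in simp)
    also have "K_eq R ?C (shift X 1) (shift_map (a' \<bullet> a) 1 \<bullet> cone_proj) (shift_map id_map 1 \<bullet> cone_proj)"
      by (rule K_eq_comp_right[OF shift_map_K_eq[OF a(1)] qc C])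
    finally have 2: "K_eq R ?C (shift X 1) (cone_proj \<bullet> (G \<bullet> F)) cone_proj" by (simp add: shift_map_id)
    show ?thesis using cone_endomorphism_invertible[OF X Y f GF 1 2] by blast
  qed
  obtain u where u: "K_inverse R ?C ?C (G \<bullet> F) u"
    using key[OF X Y f X' Y' f' aD(3,1,2) bD(3,1,2) F G] by blast
  obtain v where v: "K_inverse R ?C' ?C' (F \<bullet> G) v"
    using key[OF X' Y' f' X Y f aD(4,2,1) bD(4,2,1) G F] by blast
  show ?thesis by (rule K_isoI[OF K_inverse_from_composites[OF C C' F(1) G(1) u v]])
qed

end

section \<open>Vanishing of morphisms\<close>

context ring begin

lemma shift_back': "cochain_complex R X \<Longrightarrow> K_inverse R (shift (shift X (- m)) m) X id_map id_map"
  using shift_back[of X "- m"] by simp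

text \<open>The construction speaks of maps from \<open>P\<close> to \<open>Y[-m]\<close>,
  approximations of maps from \<open>P[m]\<close> to \<open>Y\<close>; this passes between the
  two.\<close>

lemma shift_adjoint:
  assumes "f \<in> chain_maps R (shift X m) Y" "cochain_complex R X" "cochain_complex R Y"
  shows "shift_map f (- m) \<in> chain_maps R X (shift Y (- m))"
  using comp_chain[OF K_inverseD(2)[OF shift_back[OF assms(2), of m]], of "shift_map f (- m)" "shift Y (- m)"] assms
  by simp

lemma shift_adjoint_K_eq:
  assumes "K_eq R X (shift Y (- m)) f g" "cochain_complex R Y"
  shows "K_eq R (shift X m) Y (shift_map f m) (shift_map g m)"
  using K_eq_comp_left[OF shift_map_K_eq[OF assms(1)] K_inverseD(1)[OF shift_back'[OF assms(2), of m]] assms(2)]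
  by simp

lemma hom_null_adjoint:
  assumes X: "cochain_complex R X" and Y: "cochain_complex R Y"
  shows "hom_null R (shift X a) Y \<longleftrightarrow> hom_null R X (shift Y (- a))"
proof
  assume n: "hom_null R (shift X a) Y"
  have "hom_null R (shift (shift X a) (- a)) (shift Y (- a))"
    by (rule hom_null_shift[OF n]) (use X Y in simp_all)
  then show "hom_null R X (shift Y (- a))"
    by (rule hom_null_iso) (use X Y in \<open>auto intro: K_isoI[OF K_inverse_sym[OF shift_back]] K_iso_refl\<close>)
next
  assume n: "hom_null R X (shift Y (- a))"
  have "hom_null R (shift X a) (shift (shift Y (- a)) a)"
    by (rule hom_null_shift[OF n]) (use X Y in simp_all)
  then show "hom_null R (shift X a) Y"
    by (rule hom_null_iso) (use X Y in \<open>auto intro: K_isoI[OF K_inverse_sym[OF shift_back']] K_iso_refl\<close>)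
qed

lemma K_iso_shift_shift: "\<lbrakk>cochain_complex R X; k = m + n\<rbrakk> \<Longrightarrow> K_iso R (shift (shift X m) n) (shift X k)"
  by (rule K_isoI[OF shift_shift])

lemma hom_null_shifts:
  assumes X: "cochain_complex R X" and Y: "cochain_complex R Y"
  shows "hom_null R (shift X a) (shift Y b) \<longleftrightarrow> hom_null R X (shift Y (b - a))"
proof -
  let ?V = "shift (shift Y b) (- a)" and ?W = "shift Y (b - a)"
  have V: "cochain_complex R ?V" and W: "cochain_complex R ?W" using Y by simp_all
  have i: "K_iso R ?V ?W" by (rule K_iso_shift_shift[OF Y]) simp
  have "hom_null R X ?V \<longleftrightarrow> hom_null R X ?W"
    using hom_null_iso[OF _ K_iso_refl[OF X] i X X W V] hom_null_iso[OF _ K_iso_refl[OF X] K_iso_sym[OF i V W] X X V W]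
    by blast
  then show ?thesis using hom_null_adjoint[OF X shift_complex[OF Y, of b], of a] by blast
qed

lemma hom_null_sum_left:
  assumes X: "cochain_complex R X" and Y: "cochain_complex R Y" and V: "cochain_complex R V"
    and x: "hom_null R X V" and y: "hom_null R Y V"
  shows "hom_null R (complex_sum X Y) V"
proof (rule hom_nullI)
  fix f assume f: "f \<in> chain_maps R (complex_sum X Y) V"
  let ?S = "complex_sum X Y"
  have S: "cochain_complex R ?S" using X Y by simp
  note sm = sum_chain_maps[OF X Y]
  have 1: "K_eq R X V (f \<bullet> (\<lambda>i x. (x, \<zero>\<^bsub>obj Y i\<^esub>))) (zero_map V)"
    by (rule hom_nullD[OF x comp_chain[OF sm(1) f] X V])
  have 2: "K_eq R Y V (f \<bullet> (\<lambda>i y. (\<zero>\<^bsub>obj X i\<^esub>, y))) (zero_map V)"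
    by (rule hom_nullD[OF y comp_chain[OF sm(2) f] Y V])
  note c1 = comp_chain[OF sm(3) comp_chain[OF sm(1) f]]
  note c2 = comp_chain[OF sm(4) comp_chain[OF sm(2) f]]
  have "K_eq R ?S V f (add_map V ((f \<bullet> (\<lambda>i x. (x, \<zero>\<^bsub>obj Y i\<^esub>))) \<bullet> (\<lambda>i. fst)) ((f \<bullet> (\<lambda>i y. (\<zero>\<^bsub>obj X i\<^esub>, y))) \<bullet> (\<lambda>i. snd)))"
  proof (rule K_eq_eqI[OF S V f add_chain[OF V c1 c2]])
    fix i p assume "p \<in> carrier (obj ?S i)"
    then obtain x y where [simp]: "p = (x, y)" and xy: "x \<in> carrier (obj X i)" "y \<in> carrier (obj Y i)" by auto
    show "f i p = add_map V ((f \<bullet> (\<lambda>i x. (x, \<zero>\<^bsub>obj Y i\<^esub>))) \<bullet> (\<lambda>i. fst)) ((f \<bullet> (\<lambda>i y. (\<zero>\<^bsub>obj X i\<^esub>, y))) \<bullet> (\<lambda>i. snd)) i p"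
      using cm_simps(2)[OF f, of "(x, \<zero>\<^bsub>obj Y i\<^esub>)" i "(\<zero>\<^bsub>obj X i\<^esub>, y)"] xy X Y by simp
  qed
  also have "K_eq R ?S V \<dots> (add_map V (zero_map V) (zero_map V))"
    by (rule K_eq_add[OF K_eq_zero_comp[OF 1 sm(3) S] K_eq_zero_comp[OF 2 sm(4) S]])
  also have "K_eq R ?S V (add_map V (zero_map V) (zero_map V)) (zero_map V)"
    by (rule K_eq_eqI) (use S V in simp_all)
  finally show "K_eq R ?S V f (zero_map V)" .
qed

lemma hom_null_sum_right:
  assumes X: "cochain_complex R X" and Y: "cochain_complex R Y" and V: "cochain_complex R V"
    and x: "hom_null R V X" and y: "hom_null R V Y"
  shows "hom_null R V (complex_sum X Y)"
proof (rule hom_nullI)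
  fix f assume f: "f \<in> chain_maps R V (complex_sum X Y)"
  let ?S = "complex_sum X Y"
  have S: "cochain_complex R ?S" using X Y by simp
  note sm = sum_chain_maps[OF X Y]
  have 1: "K_eq R V X ((\<lambda>i. fst) \<bullet> f) (zero_map X)"
    by (rule hom_nullD[OF x comp_chain[OF f sm(3)] V X])
  have 2: "K_eq R V Y ((\<lambda>i. snd) \<bullet> f) (zero_map Y)"
    by (rule hom_nullD[OF y comp_chain[OF f sm(4)] V Y])
  note c1 = comp_chain[OF comp_chain[OF f sm(3)] sm(1)]
  note c2 = comp_chain[OF comp_chain[OF f sm(4)] sm(2)]
  have "K_eq R V ?S f (add_map ?S ((\<lambda>i x. (x, \<zero>\<^bsub>obj Y i\<^esub>)) \<bullet> ((\<lambda>i. fst) \<bullet> f)) ((\<lambda>i y. (\<zero>\<^bsub>obj X i\<^esub>, y)) \<bullet> ((\<lambda>i. snd) \<bullet> f)))"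
  proof (rule K_eq_eqI[OF V S f add_chain[OF S c1 c2]])
    fix i v assume v: "v \<in> carrier (obj V i)"
    show "f i v = add_map ?S ((\<lambda>i x. (x, \<zero>\<^bsub>obj Y i\<^esub>)) \<bullet> ((\<lambda>i. fst) \<bullet> f)) ((\<lambda>i y. (\<zero>\<^bsub>obj X i\<^esub>, y)) \<bullet> ((\<lambda>i. snd) \<bullet> f)) i v"
      using cm_simps(1)[OF f v] X Y by (cases "f i v") simp
  qed
  also have "K_eq R V ?S \<dots> (add_map ?S (zero_map ?S) (zero_map ?S))"
    by (rule K_eq_add[OF K_eq_comp_zero[OF 1 sm(1) S] K_eq_comp_zero[OF 2 sm(2) S]])
  also have "K_eq R V ?S (add_map ?S (zero_map ?S) (zero_map ?S)) (zero_map ?S)"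
    by (rule K_eq_eqI) (use S V X Y in simp_all)
  finally show "K_eq R V ?S f (zero_map ?S)" .
qed

lemma sum_map_chain:
  assumes X: "cochain_complex R X" and Y: "cochain_complex R Y"
    and X': "cochain_complex R X'" and Y': "cochain_complex R Y'"
    and f: "f \<in> chain_maps R X X'" and g: "g \<in> chain_maps R Y Y'"
  shows "(\<lambda>i. map_prod (f i) (g i)) \<in> chain_maps R (complex_sum X Y) (complex_sum X' Y')"
  by (rule chain_mapsI; (rule module_homsI)?; use assms in auto)

lemma sum_map_K_eq:
  assumes f: "K_eq R X X' f f'" and g: "K_eq R Y Y' g g'"
  shows "K_eq R (complex_sum X Y) (complex_sum X' Y') (\<lambda>i. map_prod (f i) (g i)) (\<lambda>i. map_prod (f' i) (g' i))"
proof -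
  note a = K_eqD[OF f] and b = K_eqD[OF g]
  obtain h where h: "h \<in> graded_maps R (-1) X X'"
    and e: "\<And>i x. x \<in> carrier (obj X i) \<Longrightarrow>
      f i x = f' i x \<oplus>\<^bsub>obj X' i\<^esub> (diff X' (i - 1) (h i x) \<oplus>\<^bsub>obj X' i\<^esub> h (i + 1) (diff X i x))"
    using homotopicE[OF a] by blast
  obtain k where k: "k \<in> graded_maps R (-1) Y Y'"
    and e': "\<And>i x. x \<in> carrier (obj Y i) \<Longrightarrow>
      g i x = g' i x \<oplus>\<^bsub>obj Y' i\<^esub> (diff Y' (i - 1) (k i x) \<oplus>\<^bsub>obj Y' i\<^esub> k (i + 1) (diff Y i x))"
    using homotopicE[OF b] by blast
  have hk: "(\<lambda>i. map_prod (h i) (k i)) \<in> graded_maps R (-1) (complex_sum X Y) (complex_sum X' Y')"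
    by (rule gmI, rule module_homsI) (use h k in auto)
  note m = sum_map_chain[OF a(2) b(2) a(3) b(3)]
  have "homotopic R (complex_sum X Y) (complex_sum X' Y') (\<lambda>i. map_prod (f i) (g i)) (\<lambda>i. map_prod (f' i) (g' i))"
    by (rule homotopicI[OF _ _ m[OF a(4) b(4)] m[OF a(5) b(5)] hk]) (use a b e e' in auto)
  then show ?thesis
    by (rule K_eqI) (use a b m in simp_all)
qed

lemma K_inverse_sum:
  assumes "K_inverse R X X' f f'" "K_inverse R Y Y' g g'"
  shows "K_inverse R (complex_sum X Y) (complex_sum X' Y') (\<lambda>i. map_prod (f i) (g i)) (\<lambda>i. map_prod (f' i) (g' i))"
proof -
  note a = K_inverseD[OF assms(1)] and b = K_inverseD[OF assms(2)]
  have c: "(\<lambda>i. map_prod (u i) (v i)) \<bullet> (\<lambda>i. map_prod (w i) (z i)) = (\<lambda>i. map_prod ((u \<bullet> w) i) ((v \<bullet> z) i))" for u v w z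
    by (simp add: fun_eq_iff map_prod_def split_def)
  have d: "(\<lambda>i. map_prod (id_map i) (id_map i)) = id_map" by (simp add: fun_eq_iff)
  show ?thesis
    unfolding K_inverse_def c
    using sum_map_chain[OF a(5) b(5) a(6) b(6) a(1) b(1)] sum_map_chain[OF a(6) b(6) a(5) b(5) a(2) b(2)]
      sum_map_K_eq[OF a(3) b(3)] sum_map_K_eq[OF a(4) b(4)] unfolding d by blast
qed

lemma K_iso_sum:
  assumes "K_iso R X X'" "K_iso R Y Y'" "cochain_complex R X" "cochain_complex R X'"
    "cochain_complex R Y" "cochain_complex R Y'"
  shows "K_iso R (complex_sum X Y) (complex_sum X' Y')"
  by (meson assms K_isoD K_isoI K_inverse_sum)

section \<open>Approximations\<close>

text \<open>A right \<open>add P\<close>-approximation of \<open>V\<close> in the homotopy category.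
  Minimality is not part of the notion, so approximations can be added and carried along
  retracts.\<close>

definition approximation :: "('a, 'p) cx \<Rightarrow> ('a, 'm) cx \<Rightarrow> ('a, 'n) cx \<Rightarrow> (int \<Rightarrow> 'm \<Rightarrow> 'n) \<Rightarrow> bool" where
  "approximation P Q V f \<longleftrightarrow> bounded_projective R Q \<and> K_factors R P Q Q id_map \<and> f \<in> chain_maps R Q V \<and>
     (\<forall>v\<in>chain_maps R P V. \<exists>w\<in>chain_maps R P Q. K_eq R P V v (f \<bullet> w))"

lemma approximationD:
  assumes "approximation P Q V f"
  shows "bounded_projective R Q" "K_factors R P Q Q id_map" "f \<in> chain_maps R Q V"
    "v \<in> chain_maps R P V \<Longrightarrow> \<exists>w\<in>chain_maps R P Q. K_eq R P V v (f \<bullet> w)" "cochain_complex R Q"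
  using assms unfolding approximation_def by auto

lemma K_hom_zeroD:
  assumes z: "carrier (K_hom R P Y) = {\<zero>\<^bsub>K_hom R P Y\<^esub>}"
    and P: "cochain_complex R P" and Y: "cochain_complex R Y" and f: "f \<in> chain_maps R P Y"
  shows "K_eq R P Y f (zero_map Y)"
proof -
  have "homotopy_class R P Y f \<in> carrier (K_hom R P Y)" using f by (simp add: K_hom_def)
  then have "homotopy_class R P Y f = homotopy_class R P Y (zero_map Y)"
    using z by (simp add: K_hom_def)
  moreover have "f \<in> homotopy_class R P Y f"
    using f homotopic_refl[OF P Y f] by (simp add: homotopy_class_def)
  ultimately show ?thesis
    using P Y f by (auto simp: homotopy_class_def intro: K_eqI)
qed

text \<open>The lifting property is the surjectivity of the cover, unwound from homotopy classes to
  representatives.\<close>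

lemma projective_cover_approximation:
  assumes c: "projective_cover E (K_hom R P Q) (K_hom R P Y) (K_hom_map R P Q Y g)"
    and P: "cochain_complex R P" and Q: "cochain_complex R Q" and Y: "cochain_complex R Y"
    and g: "g \<in> chain_maps R Q Y" and f: "f \<in> chain_maps R P Y"
  shows "\<exists>w\<in>chain_maps R P Q. K_eq R P Y f (g \<bullet> w)"
proof -
  have "homotopy_class R P Y f \<in> K_hom_map R P Q Y g ` carrier (K_hom R P Q)"
    using c f by (simp add: projective_cover_def K_hom_def)
  then obtain w where w: "w \<in> chain_maps R P Q"
    and e: "homotopy_class R P Y f = K_hom_map R P Q Y g (homotopy_class R P Q w)"
    by (auto simp: K_hom_def)
  have "f \<in> homotopy_class R P Y f"
    using f homotopic_refl[OF P Y f] by (simp add: homotopy_class_def)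
  then obtain g' w' where g': "g' \<in> homotopy_class R Q Y g" and w': "w' \<in> homotopy_class R P Q w"
    and h: "f \<in> homotopy_class R P Y (g' \<bullet> w')"
    unfolding e K_hom_map_def K_comp_def by auto
  have 1: "K_eq R Q Y g' g" using g' Q Y g by (auto simp: homotopy_class_def intro: K_eqI)
  have 2: "K_eq R P Q w' w" using w' P Q w by (auto simp: homotopy_class_def intro: K_eqI)
  have "K_eq R P Y f (g' \<bullet> w')"
    by (rule K_eqI) (use h P Y comp_chain[OF K_eqD(4)[OF 2] K_eqD(4)[OF 1]] in \<open>auto simp: homotopy_class_def\<close>)
  also have "K_eq R P Y (g' \<bullet> w') (g \<bullet> w)" by (rule K_eq_comp[OF 2 1])
  finally show ?thesis using w by blast
qed

text \<open>\<open>Y\<close> is known only up to isomorphism and its terms may fail to be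
  projective; the step is therefore transferred to an isomorphic \<open>M\<close> with projective
  terms, where its result is the cone of an approximation.\<close>

lemma Delta_step_approximation:
  fixes P Y X M :: "'a ucx"
  assumes D: "Delta_step R P n Y X" and P: "bounded_projective R P"
    and M: "bounded_projective R M" and i: "K_iso R M Y"
    and m: "m = int n + cx_s P - cx_r P - 1"
  obtains Q :: "'a ucx" and f where "cochain_complex R X" "approximation (shift P m) Q M f" "K_iso R X (cone Q M f)"
proof -
  have Pc: "cochain_complex R P" and Mc: "cochain_complex R M" using P M by simp_all
  obtain Pn g h w where tri: "Defs.triangle R (shift Pn m) Y X g h w"
    and cs: "if carrier (K_hom R P (shift Y (- m))) = {\<zero>\<^bsub>K_hom R P (shift Y (- m))\<^esub>}
         then zero_complex Pn
         else Pn \<in> add_closure R P \<and>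
              (\<exists>g' \<in> chain_maps R Pn (shift Y (- m)).
                 projective_cover (K_end R P) (K_hom R P Pn) (K_hom R P (shift Y (- m)))
                   (K_hom_map R P Pn (shift Y (- m)) g') \<and>
                 g = shift_map g' m)"
    using D unfolding Delta_step_def Let_def m by blast
  obtain X' Y' f a b c where Xc: "cochain_complex R X" and Sc: "cochain_complex R (shift Pn m)"
    and Yc: "cochain_complex R Y" and gc: "g \<in> chain_maps R (shift Pn m) Y"
    and X'c: "cochain_complex R (X' :: 'a ucx)" and Y'c: "cochain_complex R (Y' :: 'a ucx)" and fc: "f \<in> chain_maps R X' Y'"
    and a: "homotopy_equivalence R (shift Pn m) X' a" and b: "homotopy_equivalence R Y Y' b"
    and c: "homotopy_equivalence R X (cone X' Y' f) c"
    and sq: "homotopic R (shift Pn m) Y' (f \<bullet> a) (b \<bullet> g)"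
    using tri unfolding Defs.triangle_def by blast
  have C: "cochain_complex R (cone X' Y' f)" using X'c Y'c fc by simp
  obtain a' where a': "K_inverse R (shift Pn m) X' a a'" using homotopy_equivalenceD[OF a Sc X'c] .
  obtain b' where b': "K_inverse R Y Y' b b'" using homotopy_equivalenceD[OF b Yc Y'c] .
  obtain c' where c': "K_inverse R X (cone X' Y' f) c c'" using homotopy_equivalenceD[OF c Xc C] .
  obtain u u' where u: "K_inverse R M Y u u'" using K_isoD[OF i Mc Yc] .
  note uD = K_inverseD[OF u] and aD = K_inverseD[OF a'] and bD = K_inverseD[OF b']
  have sm: "shift_map (shift_map v (- m)) m = v" for v :: "int \<Rightarrow> (nat \<Rightarrow> 'a) \<Rightarrow> nat \<Rightarrow> 'a"
    by (simp add: shift_map_def)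
  have key: "bounded_projective R (shift Pn m) \<and> K_factors R (shift P m) (shift Pn m) (shift Pn m) id_map \<and>
    (\<forall>v\<in>chain_maps R (shift P m) Y. \<exists>w\<in>chain_maps R (shift P m) (shift Pn m). K_eq R (shift P m) Y v (g \<bullet> w))"
  proof (cases "carrier (K_hom R P (shift Y (- m))) = {\<zero>\<^bsub>K_hom R P (shift Y (- m))\<^esub>}")
    \<comment> \<open>The zero complex approximates a \<open>Y\<close> that receives no maps from
      the shift of \<open>P\<close> except null ones.\<close>
    case True
    then have z: "carrier (obj Pn i) = {\<zero>\<^bsub>obj Pn i\<^esub>}" for i
      using cs by (simp add: zero_complex_def)
    have bp: "bounded_projective R (shift Pn m)"
    proof (rule bounded_projectiveI[OF Sc])
      show "fg_projective R (obj (shift Pn m) i)" for i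
        by (rule fg_projective_zero) (use z cc_module[OF Sc] in \<open>auto simp: shift_obj\<close>)
      show "carrier (obj (shift Pn m) i) = {\<zero>\<^bsub>obj (shift Pn m) i\<^esub>}" if "i < 0 \<or> 0 < i" for i
        using z by (simp add: shift_obj)
    qed
    have e: "K_eq R (shift Pn m) (shift Pn m) (zero_map (shift Pn m)) id_map"
      by (rule K_eq_eqI) (use Sc z in auto)
    have kf: "K_factors R (shift P m) (shift Pn m) (shift Pn m) id_map"
      by (rule K_factors_cong[OF K_factors_zero e]) (use Sc in simp_all)
    have "\<exists>w\<in>chain_maps R (shift P m) (shift Pn m). K_eq R (shift P m) Y v (g \<bullet> w)"
      if v: "v \<in> chain_maps R (shift P m) Y" for v
    proof (intro bexI)
      have "K_eq R P (shift Y (- m)) (shift_map v (- m)) (zero_map (shift Y (- m)))"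
        by (rule K_hom_zeroD[OF True Pc]) (use Yc shift_adjoint[OF v Pc Yc] in simp_all)
      from shift_adjoint_K_eq[OF this Yc]
      have 1: "K_eq R (shift P m) Y v (zero_map Y)"
        unfolding sm by (simp add: shift_map_def zero_map_def shift_obj)
      have 2: "K_eq R (shift P m) Y (zero_map Y) (g \<bullet> zero_map (shift Pn m))"
        by (rule K_eq_eqI) (use Pc Yc Sc gc cm_simps(3)[OF gc] comp_chain[OF zero_chain gc, of "shift P m"] in auto)
      show "K_eq R (shift P m) Y v (g \<bullet> zero_map (shift Pn m))"
        by (rule K_eq_trans[OF 1 2])
      show "zero_map (shift Pn m) \<in> chain_maps R (shift P m) (shift Pn m)" using Pc Sc by simp
    qed
    then show ?thesis using bp kf by blast
  next
    case False
    then have ad: "Pn \<in> add_closure R P" using cs by simp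
    obtain g' where g': "g' \<in> chain_maps R Pn (shift Y (- m))"
      and pc: "projective_cover (K_end R P) (K_hom R P Pn) (K_hom R P (shift Y (- m)))
                   (K_hom_map R P Pn (shift Y (- m)) g')" and ge: "g = shift_map g' m"
      using cs False by auto
    have Pn: "bounded_projective R Pn" using ad by (simp add: add_closure_def Kb_proj_iff)
    then have Pnc: "cochain_complex R Pn" by simp
    have bp: "bounded_projective R (shift Pn m)" by (rule bounded_projective_shift[OF Pn])
    have kf: "K_factors R (shift P m) (shift Pn m) (shift Pn m) id_map"
      using K_factors_shift[OF add_closure_factors[OF P ad] Pc, of m] by (simp add: shift_map_id)
    have "\<exists>w\<in>chain_maps R (shift P m) (shift Pn m). K_eq R (shift P m) Y v (g \<bullet> w)"
      if v: "v \<in> chain_maps R (shift P m) Y" for v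
    proof -
      obtain w where w: "w \<in> chain_maps R P Pn"
        and e: "K_eq R P (shift Y (- m)) (shift_map v (- m)) (g' \<bullet> w)"
        using projective_cover_approximation[OF pc Pc Pnc _ g' shift_adjoint[OF v Pc Yc]] Yc by auto
      have "K_eq R (shift P m) Y v (g \<bullet> shift_map w m)"
        using shift_adjoint_K_eq[OF e Yc] unfolding sm ge shift_map_comp .
      then show ?thesis using shift_map_chain[OF w Pc Pnc] by blast
    qed
    then show ?thesis using bp kf by blast
  qed
  let ?S = "shift Pn m"
  have f0: "u' \<bullet> g \<in> chain_maps R ?S M" by (rule comp_chain[OF gc uD(2)])
  have app: "approximation (shift P m) ?S M (u' \<bullet> g)"
    unfolding approximation_def
  proof (intro conjI ballI)
    show "bounded_projective R ?S" "K_factors R (shift P m) ?S ?S id_map" using key by simp_all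
    show "u' \<bullet> g \<in> chain_maps R ?S M" by (rule f0)
    fix v assume v: "v \<in> chain_maps R (shift P m) M"
    obtain w where w: "w \<in> chain_maps R (shift P m) ?S" and e: "K_eq R (shift P m) Y (u \<bullet> v) (g \<bullet> w)"
      using key comp_chain[OF v uD(1)] by blast
    have "K_eq R (shift P m) M (id_map \<bullet> v) ((u' \<bullet> u) \<bullet> v)"
      by (rule K_eq_comp_right[OF K_eq_sym[OF uD(3)] v]) (use Pc in simp)
    also have "K_eq R (shift P m) M ((u' \<bullet> u) \<bullet> v) (u' \<bullet> (g \<bullet> w))"
      unfolding comp_assoc[symmetric] using K_eq_comp_left[OF e uD(2) Mc] by (simp add: comp_assoc)
    finally show "\<exists>w\<in>chain_maps R (shift P m) ?S. K_eq R (shift P m) M v (u' \<bullet> g \<bullet> w)"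
      using w by (auto simp: comp_assoc comp_id)
  qed
  \<comment> \<open>The triangle provides the cone of some \<open>f\<close> between complexes
    equivalent to those of the step; \<open>a\<close> and \<open>b \<bullet> u\<close> identify
    \<open>u' \<bullet> g\<close> with this \<open>f\<close> up to homotopy, so the cones are
    isomorphic.\<close>
  have bu: "K_inverse R M Y' (b \<bullet> u) (u' \<bullet> b')" by (rule K_inverse_trans[OF u b'])
  have e1: "K_eq R ?S Y' (f \<bullet> a) (b \<bullet> g)"
    by (rule K_eqI[OF sq Sc Y'c comp_chain[OF aD(1) fc] comp_chain[OF gc bD(1)]])
  have "K_eq R ?S Y' ((b \<bullet> u) \<bullet> (u' \<bullet> g)) (b \<bullet> g)"
    using K_eq_comp_right[OF K_eq_comp_left[OF uD(4) bD(1) Y'c] gc Sc] by (simp add: comp_assoc comp_id)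
  then have e2: "K_eq R ?S Y' (f \<bullet> a) ((b \<bullet> u) \<bullet> (u' \<bullet> g))" by (meson K_eq_trans K_eq_sym e1)
  have "K_iso R (cone ?S M (u' \<bullet> g)) (cone X' Y' f)"
    by (rule cone_equivalence[OF Sc Mc f0 fc a' bu e2])
  from K_iso_sym[OF this cone_complex[OF Sc Mc f0] C]
  have "K_iso R X (cone ?S M (u' \<bullet> g))"
    by (rule K_iso_trans[OF K_isoI[OF c'] _ Xc C cone_complex[OF Sc Mc f0]])
  then show thesis using that[OF Xc app] by blast
qed

end

section \<open>Towers of approximations\<close>

context ring begin

text \<open>The construction of \<open>Delta\<close> with any start \<open>V\<close> and any
  approximations, where each cone is replaced by an isomorphic complex over the fixed element type.
  From stage \<open>n\<close> to stage \<open>n + 1\<close> the shift is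
  \<open>(n + 1) + s - r - 1\<close>, that is \<open>n + s - 1\<close> for
  \<open>r = 1\<close>.\<close>

inductive approximation_tower :: "'a ucx \<Rightarrow> int \<Rightarrow> 'a ucx \<Rightarrow> nat \<Rightarrow> 'a ucx \<Rightarrow> bool" for P s V where
  tower_zero: "approximation_tower P s V 0 V"
| tower_step: "\<lbrakk>approximation_tower P s V n Y; approximation (shift P (int n + s - 1)) (Q :: 'a ucx) Y f;
     bounded_projective R X; K_iso R X (cone Q Y f)\<rbrakk> \<Longrightarrow> approximation_tower P s V (Suc n) X"

lemma tower_bounded_projective:
  "\<lbrakk>approximation_tower P s V n X; bounded_projective R V\<rbrakk> \<Longrightarrow> bounded_projective R X"
  by (induction rule: approximation_tower.induct) auto

text \<open>Members of \<open>Delta\<close> are determined up to homotopy equivalence only, so a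
  stage of a tower matches them up to isomorphism; the induction carries such a stage along.\<close>

lemma Delta_tower:
  fixes P V :: "'a ucx" and M :: "('a, 'm) module"
  assumes P: "bounded_projective R P" and r: "cx_r P = 1"
    and V: "bounded_projective R V" and i: "K_iso R V (stalk M)" and M: "right_module R M"
  shows "X \<in> Delta R P M n \<Longrightarrow>
    cochain_complex R X \<and> (\<exists>Y. approximation_tower P (cx_s P) V n Y \<and> K_iso R Y X)"
proof (induction n arbitrary: X)
  case 0
  have "K_iso R V X"
    by (rule K_iso_trans[OF i K_iso_sym]) (use 0 M V in auto)
  then show ?case using 0 by (auto intro: tower_zero)
next
  case (Suc n)
  then obtain Y where Y: "Y \<in> Delta R P M n" and D: "Delta_step R P (Suc n) Y X" by auto
  obtain Z where Z: "approximation_tower P (cx_s P) V n Z" and ZY: "K_iso R Z Y"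
    using Suc.IH[OF Y] by blast
  have Zb: "bounded_projective R Z" by (rule tower_bounded_projective[OF Z V])
  then have Zc: "cochain_complex R Z" by simp
  obtain Q :: "'a ucx" and f where X: "cochain_complex R X"
    and app: "approximation (shift P (int n + cx_s P - 1)) Q Z f" and XC: "K_iso R X (cone Q Z f)"
    by (rule Delta_step_approximation[OF D P Zb ZY]) (use r in auto)
  note a = approximationD[OF app]
  have C: "cochain_complex R (cone Q Z f)" using a Zc by simp
  \<comment> \<open>The elements of the cone are pairs, and \<open>X\<close> need not have
    projective terms; the encoded cone becomes the next stage.\<close>
  obtain X' :: "'a ucx" and u v where X': "cochain_complex R X'" "K_inverse R X' (cone Q Z f) u v"
    "bounded_projective R X'"
    using encode_pair[OF C] cone_bounded_projective[OF a(1) Zb a(3)] by metis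
  have i': "K_iso R X' (cone Q Z f)" by (rule K_isoI[OF X'(2)])
  have "approximation_tower P (cx_s P) V (Suc n) X'"
    by (rule tower_step[OF Z app X'(3) i'])
  moreover have "K_iso R X' X"
    by (rule K_iso_trans[OF i' K_iso_sym[OF XC X C] X'(1) C X])
  ultimately show ?case using X by blast
qed

lemma approximation_shift_factors:
  assumes f: "approximation (shift P m) Q V f" and P: "cochain_complex R P" and k: "k = m + n"
  shows "K_factors R (shift P k) (shift Q n) (shift Q n) id_map"
proof -
  note a = approximationD[OF f]
  have Pm: "cochain_complex R (shift P m)" using P by simp
  have "K_factors R (shift (shift P m) n) (shift Q n) (shift Q n) id_map"
    using K_factors_shift[OF a(2) Pm, of n] by (simp add: shift_map_id)
  from this K_iso_factors[OF K_iso_shift_shift[OF P k]]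
  show ?thesis by (rule K_factors_trans) (use P in simp_all)
qed

text \<open>Maps from \<open>P[j]\<close> to \<open>Q[1]\<close> vanish for
  \<open>j \<noteq> m + 1\<close>, as \<open>Q[1]\<close> is a summand of copies of
  \<open>P[m + 1]\<close> and \<open>P\<close> is rigid. Maps from \<open>P[j]\<close> to
  \<open>V\<close> vanish or, for \<open>j = m\<close>, lift along the approximation and die in the
  cone.\<close>

lemma cone_orthogonal:
  assumes P: "cochain_complex R P" and rigid: "\<And>k. k \<noteq> 0 \<Longrightarrow> hom_null R P (shift P k)"
    and f: "approximation (shift P m) Q V f" and V: "cochain_complex R V"
    and o: "j \<noteq> m \<Longrightarrow> hom_null R (shift P j) V" and j: "j \<noteq> m + 1"
  shows "hom_null R (shift P j) (cone Q V f)"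
proof (rule hom_null_cone_right)
  note a = approximationD[OF f]
  have Pj: "cochain_complex R (shift P j)" using P by simp
  have "hom_null R (shift P j) (shift P (m + 1))"
    unfolding hom_null_shifts[OF P P] by (rule rigid) (use j in simp)
  then show "hom_null R (shift P j) (shift Q 1)"
    by (rule hom_null_factors_right[OF _ approximation_shift_factors[OF f P refl]]) (use P in simp_all)
  show "\<exists>x\<in>chain_maps R (shift P j) Q. K_eq R (shift P j) V y (f \<bullet> x)"
    if y: "y \<in> chain_maps R (shift P j) V" for y
  proof (cases "j = m")
    case True
    then show ?thesis using a(4) y by blast
  next
    case False
    have "K_eq R (shift P j) V y (zero_map V)"
      by (rule hom_nullD[OF o[OF False] y Pj V])
    also have "K_eq R (shift P j) V (zero_map V) (f \<bullet> zero_map Q)"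
      by (rule K_eq_eqI) (use Pj V a cm_simps(3)[OF a(3)] comp_chain[OF zero_chain a(3), of "shift P j"] in auto)
    finally show ?thesis using zero_chain[OF a(5)] by blast
  qed
  show "cochain_complex R Q" "f \<in> chain_maps R Q V" using a by simp_all
qed (use P V in simp_all)

text \<open>The mutation argument: a map out of the cone vanishes once its parts from
  \<open>V\<close> and from \<open>Q[1]\<close> do. For \<open>V\<close> the target is split again,
  into \<open>V[i]\<close> and \<open>Q[i + 1]\<close>; for \<open>Q[1]\<close> orthogonality to the
  cone is used.\<close>

lemma cone_presilting:
  assumes P: "cochain_complex R P" and rigid: "\<And>k. k \<noteq> 0 \<Longrightarrow> hom_null R P (shift P k)"
    and f: "approximation (shift P m) Q V f" and V: "cochain_complex R V"
    and o: "\<And>j. \<lbrakk>j \<noteq> m; j \<noteq> m + 1\<rbrakk> \<Longrightarrow> hom_null R (shift P j) V"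
    and o': "\<And>j. j > m + 1 \<Longrightarrow> hom_null R V (shift P j)"
    and p: "\<And>i. i > 0 \<Longrightarrow> hom_null R V (shift V i)" and i: "i > 0"
  shows "hom_null R (cone Q V f) (shift (cone Q V f) i)"
proof -
  note a = approximationD[OF f]
  let ?C = "cone Q V f"
  have C: "cochain_complex R ?C" using a V by simp
  have "hom_null R V (shift ?C i)"
  proof -
    \<comment> \<open>The shift is moved to the source because \<open>hom_null_cone_right\<close>
      has an unshifted cone as target.\<close>
    have "hom_null R (shift V (- i)) ?C"
    proof (rule hom_null_cone_right[OF a(5) V _ a(3)])
      show "cochain_complex R (shift V (- i))" using V by simp
      have "hom_null R V (shift P (m + 1 + i))" by (rule o') (use i in simp)
      then have "hom_null R V (shift Q (1 + i))"
        by (rule hom_null_factors_right[OF _ approximation_shift_factors[OF f P]]) (use P V in simp_all)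
      then show "hom_null R (shift V (- i)) (shift Q 1)"
        unfolding hom_null_shifts[OF V a(5)] by simp
      show "\<exists>x\<in>chain_maps R (shift V (- i)) Q. K_eq R (shift V (- i)) V y (f \<bullet> x)"
        if y: "y \<in> chain_maps R (shift V (- i)) V" for y
      proof -
        have Vi: "cochain_complex R (shift V (- i))" using V by simp
        have "hom_null R (shift V (- i)) V"
          using p[OF i] unfolding hom_null_adjoint[OF V V] by simp
        then have "K_eq R (shift V (- i)) V y (zero_map V)"
          by (rule hom_nullD[OF _ y Vi V])
        also have "K_eq R (shift V (- i)) V (zero_map V) (f \<bullet> zero_map Q)"
          by (rule K_eq_eqI) (use Vi V a cm_simps(3)[OF a(3)] comp_chain[OF zero_chain a(3), of "shift V (- i)"] in auto)
        finally show ?thesis using zero_chain[OF a(5)] by blast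
      qed
    qed
    then show ?thesis unfolding hom_null_adjoint[OF V C] by simp
  qed
  moreover have "hom_null R (shift Q 1) (shift ?C i)"
  proof -
    \<comment> \<open>As \<open>i > 0\<close>, the degree \<open>m + 1 - i\<close> avoids the one
      exceptional degree \<open>m + 1\<close> of the cone.\<close>
    have "hom_null R (shift P (m + 1 - i)) ?C"
      by (rule cone_orthogonal[OF P rigid f V]) (use i o in auto)
    then have "hom_null R (shift P (m + 1)) (shift ?C i)"
      unfolding hom_null_shifts[OF P C] hom_null_adjoint[OF P C] by (simp add: algebra_simps)
    then show ?thesis
      by (rule hom_null_factors_left[OF _ approximation_shift_factors[OF f P refl]]) (use P C in simp_all)
  qed
  ultimately show ?thesis
    by (intro hom_null_cone_left[OF a(5) V _ a(3)]) (use C in simp_all)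
qed

end

text \<open>
  Every complex that is orthogonal to all shifts of \<open>P\<close> but those in degrees \<open>s - 1\<close> and \<open>s\<close>, such as
  the algebra, is turned by the first approximation into one that meets a single shift of \<open>P\<close>.
\<close>

lemma (in symmetrizing_form) tower_presilting:
  fixes P V :: "('a, nat \<Rightarrow> 'a) cx"
  assumes P: "bounded_projective A P" and rigid: "\<And>k. k \<noteq> 0 \<Longrightarrow> hom_null A P (shift P k)"
    and V: "bounded_projective A V"
    and o: "\<And>j. \<lbrakk>j \<noteq> s; j \<noteq> s - 1\<rbrakk> \<Longrightarrow> hom_null A (shift P j) V"
    and p: "\<And>i. i > 0 \<Longrightarrow> hom_null A V (shift V i)"
    and t: "A.approximation_tower P s V n X"
  shows "(\<forall>i>0. hom_null A X (shift X i)) \<and>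
    (\<forall>j. j \<noteq> int n + s - 1 \<longrightarrow> (n = 0 \<longrightarrow> j \<noteq> s) \<longrightarrow> hom_null A (shift P j) X)"
  using t
proof (induction rule: A.approximation_tower.induct)
  case tower_zero
  show ?case using o p by auto
next
  case (tower_step n Y Q f X)
  have Pc: "cochain_complex A P" using P by simp
  have Y: "bounded_projective A Y" by (rule A.tower_bounded_projective[OF tower_step.hyps(1) V])
  then have Yc: "cochain_complex A Y" by simp
  note f = tower_step.hyps(2) and a = A.approximationD[OF tower_step.hyps(2)]
  let ?C = "cone Q Y f"
  have C: "cochain_complex A ?C" using a Yc by simp
  have Xc: "cochain_complex A X" using tower_step.hyps by simp
  note i = tower_step.hyps(4)
  let ?m = "int n + s - 1"
  \<comment> \<open>For \<open>n = 0\<close> both degrees \<open>s - 1\<close> and \<open>s\<close>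
    can occur, for larger \<open>n\<close> only \<open>?m\<close>. Leaving out \<open>?m\<close> and
    \<open>?m + 1\<close> covers both cases.\<close>
  have o: "hom_null A (shift P j) Y" if "j \<noteq> ?m" "j \<noteq> ?m + 1" for j
    using tower_step.IH that by auto
  \<comment> \<open>Duality supplies the maps in the opposite direction, from \<open>Y\<close> to
    the shifts of \<open>P\<close>, which \<open>cone_presilting\<close> has to control.\<close>
  have o': "hom_null A Y (shift P j)" if "j > ?m + 1" for j
    by (rule hom_null_symmetric[OF A.bounded_projective_shift[OF P] Yc o]) (use that in auto)
  have "hom_null A X (shift X k)" if "k > 0" for k
  proof (rule A.hom_null_iso)
    show "hom_null A ?C (shift ?C k)"
      by (rule A.cone_presilting[OF Pc rigid f Yc o o' _ that]) (use tower_step.IH in auto)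
  qed (use i A.K_iso_shift[OF i] Xc C in auto)
  moreover have "hom_null A (shift P j) X" if "j \<noteq> int (Suc n) + s - 1" for j
  proof (rule A.hom_null_iso)
    show "hom_null A (shift P j) ?C"
    proof (rule A.cone_orthogonal[OF Pc rigid f Yc])
      show "hom_null A (shift P j) Y" if "j \<noteq> ?m"
        by (rule o) (use that \<open>j \<noteq> int (Suc n) + s - 1\<close> in auto)
    qed (use that in auto)
  qed (use i Pc Xc C A.K_iso_refl[OF A.shift_complex[OF Pc]] in auto)
  ultimately show ?case by auto
qed

lemma (in ring) hom_null_shift_sum:
  assumes X: "cochain_complex R X" and Y: "cochain_complex R Y"
    and "hom_null R X (shift X i)" "hom_null R X (shift Y i)" "hom_null R Y (shift X i)" "hom_null R Y (shift Y i)"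
  shows "hom_null R (complex_sum X Y) (shift (complex_sum X Y) i)"
proof -
  let ?S = "complex_sum X Y"
  have S: "cochain_complex R ?S" and Si: "cochain_complex R (shift ?S (- i))" using X Y by simp_all
  have "hom_null R ?S (shift X i)" "hom_null R ?S (shift Y i)"
    using assms by (auto intro!: hom_null_sum_left)
  then have "hom_null R (shift ?S (- i)) X" "hom_null R (shift ?S (- i)) Y"
    unfolding hom_null_adjoint[OF S X] hom_null_adjoint[OF S Y] by simp_all
  then have "hom_null R (shift ?S (- i)) ?S" by (rule hom_null_sum_right[OF X Y Si])
  then show ?thesis unfolding hom_null_adjoint[OF S S] by simp
qed

text \<open>Towers give vanishing in positive degrees only. Duality exchanges positive and negative
  degrees for \<open>M\<close>, and it also settles one of the two mixed cases between
  \<open>M\<close> and the shift of \<open>P\<close>.\<close>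

lemma (in symmetrizing_form) tower_partial_tilting:
  fixes P V M T :: "('a, nat \<Rightarrow> 'a) cx"
  assumes P: "bounded_projective A P" and rigid: "\<And>k. k \<noteq> 0 \<Longrightarrow> hom_null A P (shift P k)"
    and V: "bounded_projective A V"
    and o: "\<And>j. \<lbrakk>j \<noteq> s; j \<noteq> s - 1\<rbrakk> \<Longrightarrow> hom_null A (shift P j) V"
    and p: "\<And>i. i > 0 \<Longrightarrow> hom_null A V (shift V i)"
    and t: "A.approximation_tower P s V n M" and n: "n \<ge> 1"
    and T: "cochain_complex A T" and i: "K_iso A T (complex_sum M (shift P (int n + s - 1)))"
  shows "partial_tilting A T"
proof -
  let ?k = "int n + s - 1"
  let ?S = "complex_sum M (shift P ?k)"
  have Mb: "bounded_projective A M" by (rule A.tower_bounded_projective[OF t V])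
  have Pc: "cochain_complex A P" and Mc: "cochain_complex A M" and Kc: "cochain_complex A (shift P ?k)"
    using P Mb by simp_all
  have Sb: "bounded_projective A ?S"
    by (rule A.sum_bounded_projective[OF Mb A.bounded_projective_shift[OF P]])
  then have S: "cochain_complex A ?S" by simp
  \<comment> \<open>From the first step on, the shift by \<open>?k\<close> is the only one that
    meets \<open>M\<close>, and it is the shift that occurs in \<open>T\<close>; this is where
    \<open>n \<ge> 1\<close> enters.\<close>
  have pos: "\<And>i. i > 0 \<Longrightarrow> hom_null A M (shift M i)" and orth: "\<And>j. j \<noteq> ?k \<Longrightarrow> hom_null A (shift P j) M"
    using tower_presilting[OF P rigid V o p t] n by auto
  have MM: "hom_null A M (shift M i)" if "i \<noteq> 0" for i
  proof (cases "i > 0")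
    case False
    then have "hom_null A M (shift M (- i))" using pos that by simp
    then have "hom_null A (shift M i) M" unfolding A.hom_null_adjoint[OF Mc Mc] .
    from hom_null_symmetric[OF A.bounded_projective_shift[OF Mb] Mc this] show ?thesis .
  qed (use pos in simp)
  have "hom_null A ?S (shift ?S i)" if "i \<noteq> 0" for i
  proof (rule A.hom_null_shift_sum[OF Mc Kc MM[OF that]])
    have "hom_null A M (shift P (?k + i))"
      by (rule hom_null_symmetric[OF A.bounded_projective_shift[OF P] Mc orth]) (use that in simp)
    then show "hom_null A M (shift (shift P ?k) i)"
      by (rule A.hom_null_iso) (use Mc Pc A.K_iso_refl[OF Mc] A.K_iso_shift_shift[OF Pc refl, of ?k i] in auto)
    have "hom_null A (shift P (?k - i)) M" by (rule orth) (use that in simp)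
    then show "hom_null A (shift P ?k) (shift M i)"
      unfolding A.hom_null_shifts[OF Pc Mc] A.hom_null_adjoint[OF Pc Mc] by (simp add: algebra_simps)
    have "hom_null A (shift P ?k) (shift P (?k + i))"
      unfolding A.hom_null_shifts[OF Pc Pc] by (rule rigid) (use that in simp)
    then show "hom_null A (shift P ?k) (shift (shift P ?k) i)"
      by (rule A.hom_null_iso) (use Pc A.K_iso_refl[OF Kc] A.K_iso_shift_shift[OF Pc refl, of ?k i] in auto)
  qed
  then have null: "hom_null A T (shift T i)" if "i \<noteq> 0" for i
    by (rule A.hom_null_iso) (use that T S i A.K_iso_shift[OF i] in auto)
  \<comment> \<open>\<open>T\<close> is only isomorphic to the sum, so its terms may fail to be
    projective; \<open>W\<close> is the representative that certifies that \<open>T\<close> is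
    perfect.\<close>
  obtain W :: "('a, nat \<Rightarrow> 'a) cx" and u v where W: "cochain_complex A W" "K_inverse A W ?S u v"
    "bounded_projective A W"
    using A.encode_pair[OF S] Sb by metis
  have WT: "K_iso A W T"
    by (rule A.K_iso_trans[OF A.K_isoI[OF W(2)] A.K_iso_sym[OF i T S] W(1) S T])
  show ?thesis
    unfolding partial_tilting_def
    using A.K_iso_perfect[OF W(3) WT T] A.hom_null_D_hom_zero[OF W(3) WT null T A.shift_complex[OF T]] by blast
qed

section \<open>Retracts along towers\<close>

context ring begin

text \<open>A summand \<open>b \<bullet> a\<close> lifts because \<open>b\<close>, a map out of
  \<open>P\<close>, does; lifts of summands are added.\<close>

lemma approximation_lift:
  assumes f: "approximation P Q V f" and u: "K_factors R P X V u" and P: "cochain_complex R P"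
  shows "\<exists>w\<in>chain_maps R X Q. K_eq R X V u (f \<bullet> w)"
  using u
proof (induction rule: K_factors_induct)
  case K_factors_zero
  note a = approximationD[OF f]
  have "K_eq R X V (zero_map V) (f \<bullet> zero_map Q)"
    by (rule K_eq_eqI) (use K_factors_zero a cm_simps(3)[OF a(3)] comp_chain[OF zero_chain a(3), of X] in auto)
  then show "\<exists>w\<in>chain_maps R X Q. K_eq R X V (zero_map V) (f \<bullet> w)"
    using zero_chain[OF a(5)] by blast
next
  case (K_factors_add u a b)
  note d = approximationD[OF f] and k = K_factorsD[OF K_factors_add(1) P]
  obtain w where w: "w \<in> chain_maps R X Q" "K_eq R X V u (f \<bullet> w)" using K_factors_add.IH by blast
  obtain y where y: "y \<in> chain_maps R P Q" "K_eq R P V b (f \<bullet> y)" using d(4)[OF K_factors_add(3)] by blast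
  have ya: "y \<bullet> a \<in> chain_maps R X Q" by (rule comp_chain[OF K_factors_add(2) y(1)])
  have 1: "K_eq R X V (add_map V u (b \<bullet> a)) (add_map V (f \<bullet> w) ((f \<bullet> y) \<bullet> a))"
    by (rule K_eq_add[OF w(2) K_eq_comp_right[OF y(2) K_factors_add(2) k(2)]])
  have 2: "K_eq R X V (add_map V (f \<bullet> w) ((f \<bullet> y) \<bullet> a)) (f \<bullet> add_map Q w (y \<bullet> a))"
    by (rule K_eq_eqI[OF k(2,3) add_chain[OF k(3) comp_chain[OF w(1) d(3)] comp_chain[OF K_factors_add(2) comp_chain[OF y(1) d(3)]]]
          comp_chain[OF add_chain[OF d(5) w(1) ya] d(3)]])
      (use cm_simps(1)[OF w(1)] cm_simps(1)[OF ya] cm_simps(2)[OF d(3)] in simp)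
  show "\<exists>w\<in>chain_maps R X Q. K_eq R X V (add_map V u (b \<bullet> a)) (f \<bullet> w)"
    using K_eq_trans[OF 1 2] add_chain[OF d(5) w(1) ya] by blast
next
  case (K_factors_cong u v)
  then obtain w where w: "w \<in> chain_maps R X Q" "K_eq R X V u (f \<bullet> w)" by blast
  show "\<exists>w\<in>chain_maps R X Q. K_eq R X V v (f \<bullet> w)"
    using K_eq_trans[OF K_eq_sym[OF K_factors_cong(2)] w(2)] w(1) by blast
qed

text \<open>The composite of \<open>Q\<close>, \<open>V\<close> and \<open>Z\<close> factors through
  copies of \<open>P\<close>, as \<open>Q\<close> does, and hence lifts along the approximation
  \<open>g\<close>; this fills the square needed for a map of cones.\<close>

lemma approximation_cone_map:
  assumes f: "approximation P Q V f" and g: "approximation P S Z g" and P: "cochain_complex R P"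
    and V: "cochain_complex R V" and Z: "cochain_complex R Z" and b: "b \<in> chain_maps R V Z"
  obtains F where "F \<in> chain_maps R (cone Q V f) (cone S Z g)"
    and "\<And>i y. y \<in> carrier (obj V i) \<Longrightarrow> F i (\<zero>\<^bsub>obj Q (i + 1)\<^esub>, y) = (\<zero>\<^bsub>obj S (i + 1)\<^esub>, b i y)"
proof -
  note a = approximationD[OF f] and c = approximationD[OF g]
  have bf: "b \<bullet> f \<in> chain_maps R Q Z" by (rule comp_chain[OF a(3) b])
  have "K_factors R P Q Z (b \<bullet> f)" using K_factors_comp_left[OF a(2) bf P Z] by simp
  from approximation_lift[OF g this P]
  obtain w where w: "w \<in> chain_maps R Q S" "K_eq R Q Z (b \<bullet> f) (g \<bullet> w)" by blast
  show thesis
    by (rule cone_map[OF a(5) V a(3) c(5) Z c(3) w(1) b K_eq_sym[OF w(2)]]) (rule that)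
qed

text \<open>Cones are not functorial, so the lift of a sum of maps is defined summand by summand,
  and only its restriction along \<open>cone_incl\<close> is controlled.\<close>

lemma cone_factors_lift:
  assumes f: "approximation P Q V f" and g: "approximation P S Z g" and P: "cochain_complex R P"
    and V: "cochain_complex R V" and Z: "cochain_complex R Z" and e: "K_factors R V Z Z e"
  shows "\<exists>e'. K_factors R (cone Q V f) (cone S Z g) (cone S Z g) e' \<and>
    K_eq R Z (cone S Z g) (e' \<bullet> cone_incl S) (cone_incl S \<bullet> e)"
  using e
proof (induction rule: K_factors_induct)
  case K_factors_zero
  note c = approximationD[OF g]
  let ?D = "cone S Z g"
  have D: "cochain_complex R ?D" and i: "cone_incl S \<in> chain_maps R Z ?D" using c Z by simp_all
  have k: "K_factors R (cone Q V f) ?D ?D (zero_map ?D)" by (rule K_factors.K_factors_zero[OF D D])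
  have "K_eq R Z ?D (zero_map ?D \<bullet> cone_incl S) (cone_incl S \<bullet> zero_map Z)"
    by (rule K_eq_eqI[OF Z D comp_chain[OF i zero_chain[OF D]] comp_chain[OF zero_chain[OF Z] i]]) simp
  with k show "\<exists>e'. K_factors R (cone Q V f) ?D ?D e' \<and>
    K_eq R Z ?D (e' \<bullet> cone_incl S) (cone_incl S \<bullet> zero_map Z)" by blast
next
  case (K_factors_add e a b)
  note d = approximationD[OF f] and c = approximationD[OF g] and k = K_factorsD[OF K_factors_add(1) V]
  let ?D = "cone S Z g" and ?C = "cone Q V f"
  have D: "cochain_complex R ?D" and i: "cone_incl S \<in> chain_maps R Z ?D" and C: "cochain_complex R ?C"
    using c d V Z by simp_all
  interpret D: abelian_group "obj ?D i" for i using D by (rule cc_abelian)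
  obtain e' where e': "K_factors R ?C ?D ?D e'" and ee: "K_eq R Z ?D (e' \<bullet> cone_incl S) (cone_incl S \<bullet> e)"
    using K_factors_add.IH by blast
  obtain F where F: "F \<in> chain_maps R ?D ?C"
    and Fi: "\<And>i y. y \<in> carrier (obj Z i) \<Longrightarrow> F i (\<zero>\<^bsub>obj S (i + 1)\<^esub>, y) = (\<zero>\<^bsub>obj Q (i + 1)\<^esub>, a i y)"
    by (rule approximation_cone_map[OF g f P Z V K_factors_add(2)]) (rule that)
  obtain G where G: "G \<in> chain_maps R ?C ?D"
    and Gi: "\<And>i y. y \<in> carrier (obj V i) \<Longrightarrow> G i (\<zero>\<^bsub>obj Q (i + 1)\<^esub>, y) = (\<zero>\<^bsub>obj S (i + 1)\<^esub>, b i y)"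
    by (rule approximation_cone_map[OF f g P V Z K_factors_add(3)]) (rule that)
  have ec: "e' \<in> chain_maps R ?D ?D" using K_factorsD(1)[OF e' C] .
  have GF: "G \<bullet> F \<in> chain_maps R ?D ?D" by (rule comp_chain[OF F G])
  have ba: "b \<bullet> a \<in> chain_maps R Z Z" by (rule comp_chain[OF K_factors_add(2,3)])
  have 1: "K_factors R ?C ?D ?D (add_map ?D e' (G \<bullet> F))" by (rule K_factors.K_factors_add[OF e' F G])
  have 2: "K_eq R Z ?D (add_map ?D e' (G \<bullet> F) \<bullet> cone_incl S) (add_map ?D (e' \<bullet> cone_incl S) (cone_incl S \<bullet> (b \<bullet> a)))"
    by (rule K_eq_eqI[OF Z D comp_chain[OF i add_chain[OF D ec GF]] add_chain[OF D comp_chain[OF i ec] comp_chain[OF ba i]]])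
      (use Fi Gi cm_simps(1)[OF K_factors_add(2)] in simp)
  have 3: "K_eq R Z ?D (add_map ?D (e' \<bullet> cone_incl S) (cone_incl S \<bullet> (b \<bullet> a)))
      (add_map ?D (cone_incl S \<bullet> e) (cone_incl S \<bullet> (b \<bullet> a)))"
    by (rule K_eq_add[OF ee K_eq_refl[OF Z D comp_chain[OF ba i]]])
  have 4: "K_eq R Z ?D (add_map ?D (cone_incl S \<bullet> e) (cone_incl S \<bullet> (b \<bullet> a))) (cone_incl S \<bullet> add_map Z e (b \<bullet> a))"
    by (rule K_eq_eqI[OF Z D add_chain[OF D comp_chain[OF k(1) i] comp_chain[OF ba i]] comp_chain[OF add_chain[OF Z k(1) ba] i]])
      (use c Z in simp)
  from 1 K_eq_trans[OF 2 K_eq_trans[OF 3 4]]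
  show "\<exists>e'. K_factors R ?C ?D ?D e' \<and>
    K_eq R Z ?D (e' \<bullet> cone_incl S) (cone_incl S \<bullet> add_map Z e (b \<bullet> a))" by blast
next
  case (K_factors_cong e u)
  note c = approximationD[OF g]
  let ?D = "cone S Z g"
  have D: "cochain_complex R ?D" and i: "cone_incl S \<in> chain_maps R Z ?D" using c Z by simp_all
  obtain e' where "K_factors R (cone Q V f) ?D ?D e'" "K_eq R Z ?D (e' \<bullet> cone_incl S) (cone_incl S \<bullet> e)"
    using K_factors_cong.IH by blast
  then show "\<exists>e'. K_factors R (cone Q V f) ?D ?D e' \<and>
    K_eq R Z ?D (e' \<bullet> cone_incl S) (cone_incl S \<bullet> u)"
    using K_eq_trans[OF _ K_eq_comp_left[OF K_factors_cong(2) i D]] by blast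
qed

text \<open>
  An approximation of a retract \<open>Z\<close> of \<open>V\<close> is put together from approximations of \<open>V\<close> along the summands
  \<open>e\<close> of the identity of \<open>Z\<close>; no finiteness of morphism spaces is needed.
\<close>

definition approximable :: "'a ucx \<Rightarrow> 'a ucx \<Rightarrow> (int \<Rightarrow> (nat \<Rightarrow> 'a) \<Rightarrow> nat \<Rightarrow> 'a) \<Rightarrow> bool" where
  "approximable P Z e \<longleftrightarrow> (\<exists>(S :: 'a ucx) g. bounded_projective R S \<and> K_factors R P S S id_map \<and>
     g \<in> chain_maps R S Z \<and>
     (\<forall>v\<in>chain_maps R P Z. \<exists>w\<in>chain_maps R P S. K_eq R P Z (e \<bullet> v) (g \<bullet> w)))"

text \<open>The direct sum of the two approximating complexes works, encoded to stay within the
  element type.\<close>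

lemma approximable_add:
  assumes e: "approximable P Z e" and e': "approximable P Z e'"
    and P: "cochain_complex R P" and Z: "cochain_complex R Z"
    and ec: "e \<in> chain_maps R Z Z" "e' \<in> chain_maps R Z Z"
  shows "approximable P Z (add_map Z e e')"
proof -
  obtain S :: "'a ucx" and g where Sb: "bounded_projective R S" and Sf: "K_factors R P S S id_map" and g: "g \<in> chain_maps R S Z"
    and gw: "\<And>v. v \<in> chain_maps R P Z \<Longrightarrow> \<exists>w\<in>chain_maps R P S. K_eq R P Z (e \<bullet> v) (g \<bullet> w)"
    using e unfolding approximable_def by blast
  obtain S' :: "'a ucx" and g' where Sb': "bounded_projective R S'" and Sf': "K_factors R P S' S' id_map" and g': "g' \<in> chain_maps R S' Z"
    and gw': "\<And>v. v \<in> chain_maps R P Z \<Longrightarrow> \<exists>w\<in>chain_maps R P S'. K_eq R P Z (e' \<bullet> v) (g' \<bullet> w)"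
    using e' unfolding approximable_def by blast
  let ?D = "complex_sum S S'"
  have Sc: "cochain_complex R S" "cochain_complex R S'" using Sb Sb' by simp_all
  note sm = sum_chain_maps[OF Sc]
  have D: "cochain_complex R ?D" using Sc by simp
  have Db: "bounded_projective R ?D" by (rule sum_bounded_projective[OF Sb Sb'])
  obtain W :: "'a ucx" and p q where W: "cochain_complex R W" "K_inverse R W ?D p q" "bounded_projective R W"
    and pq: "\<And>i x. x \<in> carrier (obj ?D i) \<Longrightarrow> p i (q i x) = x"
    using encode_pair[OF D] Db by metis
  note u = K_inverseD[OF W(2)]
  define G where "G = add_map Z (g \<bullet> (\<lambda>i. fst)) (g' \<bullet> (\<lambda>i. snd))"
  have G: "G \<in> chain_maps R ?D Z" unfolding G_def by (rule add_chain[OF Z comp_chain[OF sm(3) g] comp_chain[OF sm(4) g']])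
  have Gp: "G \<bullet> p \<in> chain_maps R W Z" by (rule comp_chain[OF u(1) G])
  have Wf: "K_factors R P W W id_map"
    by (rule K_factors_trans[OF K_iso_factors[OF K_isoI[OF W(2)] W(1) D] K_factors_sum_object[OF Sf Sf' P] D P])
  have "\<exists>w\<in>chain_maps R P W. K_eq R P Z (add_map Z e e' \<bullet> v) ((G \<bullet> p) \<bullet> w)" if v: "v \<in> chain_maps R P Z" for v
  proof -
    obtain w where w: "w \<in> chain_maps R P S" "K_eq R P Z (e \<bullet> v) (g \<bullet> w)" using gw[OF v] by blast
    obtain w' where w': "w' \<in> chain_maps R P S'" "K_eq R P Z (e' \<bullet> v) (g' \<bullet> w')" using gw'[OF v] by blast
    define y where "y = (\<lambda>i x. (w i x, w' i x))"
    have y: "y \<in> chain_maps R P ?D" unfolding y_def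
      by (rule chain_mapsI) (use w(1) w'(1) in \<open>auto intro!: module_homs_pair chain_maps_hom\<close>)
    have qy: "q \<bullet> y \<in> chain_maps R P W" by (rule comp_chain[OF y u(2)])
    have "K_eq R P Z (add_map Z e e' \<bullet> v) (add_map Z (e \<bullet> v) (e' \<bullet> v))"
      by (rule K_eq_eqI[OF P Z comp_chain[OF v add_chain[OF Z ec]] add_chain[OF Z comp_chain[OF v ec(1)] comp_chain[OF v ec(2)]]]) simp
    also have "K_eq R P Z (add_map Z (e \<bullet> v) (e' \<bullet> v)) (add_map Z (g \<bullet> w) (g' \<bullet> w'))"
      by (rule K_eq_add[OF w(2) w'(2)])
    also have "K_eq R P Z (add_map Z (g \<bullet> w) (g' \<bullet> w')) ((G \<bullet> p) \<bullet> (q \<bullet> y))"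
      by (rule K_eq_eqI[OF P Z add_chain[OF Z comp_chain[OF w(1) g] comp_chain[OF w'(1) g']] comp_chain[OF qy Gp]])
        (use pq cm_simps(1)[OF y] in \<open>simp add: G_def, simp add: y_def\<close>)
    finally show ?thesis using qy by blast
  qed
  then show ?thesis unfolding approximable_def using W(3) Wf Gp by blast
qed

lemma approximable_cong:
  assumes "approximable P Z e" and e: "K_eq R Z Z e e'" and P: "cochain_complex R P"
  shows "approximable P Z e'"
proof -
  have *: "K_eq R P Z (e' \<bullet> v) (e \<bullet> v)" if "v \<in> chain_maps R P Z" for v
    by (rule K_eq_comp_right[OF K_eq_sym[OF e] that P])
  show ?thesis
    using assms(1) K_eq_trans[OF *] unfolding approximable_def by meson
qed

text \<open>For a single summand \<open>b \<bullet> a\<close>, a map from \<open>P\<close> to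
  \<open>Z\<close> followed by \<open>a\<close> lands in \<open>V\<close> and lifts along
  \<open>f\<close>; thus \<open>b \<bullet> f\<close> approximates \<open>Z\<close> along
  \<open>b \<bullet> a\<close>.\<close>

lemma approximable_factors:
  fixes P Q Z :: "'a ucx"
  assumes f: "approximation P Q V f" and e: "K_factors R V Z Z e" and P: "cochain_complex R P"
    and V: "cochain_complex R V"
  shows "approximable P Z e"
  using e
proof (induction rule: K_factors_induct)
  case K_factors_zero
  note a = approximationD[OF f]
  have "K_eq R P Z (zero_map Z \<bullet> v) (zero_map Z \<bullet> zero_map Q)" if v: "v \<in> chain_maps R P Z" for v
    by (rule K_eq_eqI[OF P K_factors_zero(1) comp_chain[OF v zero_chain] comp_chain[OF zero_chain zero_chain]])
      (use K_factors_zero a in simp_all)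
  then show "approximable P Z (zero_map Z)"
    unfolding approximable_def using a(1,2) zero_chain[OF K_factors_zero(1)] zero_chain[OF a(5)] by blast
next
  case (K_factors_add e a b)
  note d = approximationD[OF f] and k = K_factorsD[OF K_factors_add(1) V]
  have bf: "b \<bullet> f \<in> chain_maps R Q Z" by (rule comp_chain[OF d(3) K_factors_add(3)])
  have "\<exists>w\<in>chain_maps R P Q. K_eq R P Z ((b \<bullet> a) \<bullet> v) ((b \<bullet> f) \<bullet> w)" if v: "v \<in> chain_maps R P Z" for v
  proof -
    obtain w where w: "w \<in> chain_maps R P Q" "K_eq R P V (a \<bullet> v) (f \<bullet> w)"
      using d(4)[OF comp_chain[OF v K_factors_add(2)]] by blast
    show ?thesis
      using K_eq_comp_left[OF w(2) K_factors_add(3) k(3)] w(1) by (auto simp: comp_assoc)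
  qed
  then have "approximable P Z (b \<bullet> a)" unfolding approximable_def using d(1,2) bf by blast
  then show "approximable P Z (add_map Z e (b \<bullet> a))"
    by (rule approximable_add[OF K_factors_add.IH _ P k(3,1) comp_chain[OF K_factors_add(2,3)]])
next
  case (K_factors_cong e u)
  show "approximable P Z u" by (rule approximable_cong[OF K_factors_cong(3,2) P])
qed

lemma approximation_id: "\<lbrakk>bounded_projective R P\<rbrakk> \<Longrightarrow> approximation P P P id_map"
  unfolding approximation_def
  by (auto intro!: K_iso_factors K_iso_refl id_chain bexI K_eq_refl)


text \<open>The part \<open>e\<close> of the identity lifts to some \<open>e'\<close> on the cone.
  The part \<open>t\<close> goes through \<open>P\<close>, hence lifts along \<open>g\<close> and
  dies in the cone. So \<open>1 - e'\<close> vanishes on \<open>Z\<close> and factors through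
  \<open>S[1]\<close>, which is a summand of copies of \<open>P[1]\<close>: this is the new error
  term.\<close>

lemma cone_retract:
  assumes f: "approximation P Q V f" and g: "approximation P S Z g" and P: "cochain_complex R P"
    and V: "cochain_complex R V" and Z: "cochain_complex R Z"
    and e: "K_factors R V Z Z e" and t: "K_factors R P Z Z t"
    and et: "K_eq R Z Z id_map (add_map Z e t)"
  obtains e' t' where "K_factors R (cone Q V f) (cone S Z g) (cone S Z g) e'"
    and "K_factors R (shift P 1) (cone S Z g) (cone S Z g) t'"
    and "K_eq R (cone S Z g) (cone S Z g) id_map (add_map (cone S Z g) e' t')"
proof -
  note c = approximationD[OF g] and a = approximationD[OF f]
  let ?D = "cone S Z g" and ?C = "cone Q V f"
  have D: "cochain_complex R ?D" and i: "cone_incl S \<in> chain_maps R Z ?D" and C: "cochain_complex R ?C"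
    and q: "cone_proj \<in> chain_maps R ?D (shift S 1)" and S1: "cochain_complex R (shift S 1)"
    and P1: "cochain_complex R (shift P 1)"
    using a c V Z P by simp_all
  interpret D: abelian_group "obj ?D i" for i using D by (rule cc_abelian)
  note ec = K_factorsD(1)[OF e V] and tc = K_factorsD(1)[OF t P]
  obtain e' where e': "K_factors R ?C ?D ?D e'" and ee: "K_eq R Z ?D (e' \<bullet> cone_incl S) (cone_incl S \<bullet> e)"
    using cone_factors_lift[OF f g P V Z e] by blast
  have e'c: "e' \<in> chain_maps R ?D ?D" by (rule K_factorsD(1)[OF e' C])
  define u where "u = add_map ?D id_map (neg_map ?D e')"
  have u: "u \<in> chain_maps R ?D ?D" unfolding u_def by (intro add_chain neg_chain D id_chain e'c)
  obtain w where w: "w \<in> chain_maps R Z S" "K_eq R Z Z t (g \<bullet> w)" using approximation_lift[OF g t P] by blast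
  have it: "K_eq R Z ?D (cone_incl S \<bullet> t) (zero_map ?D)"
  proof -
    have "K_eq R Z ?D (cone_incl S \<bullet> t) ((cone_incl S \<bullet> g) \<bullet> w)"
      using K_eq_comp_left[OF w(2) i D] by (simp add: comp_assoc)
    also have "K_eq R Z ?D ((cone_incl S \<bullet> g) \<bullet> w) (zero_map ?D)"
      by (rule K_eq_zero_comp[OF cone_incl_null[OF c(5) Z c(3)] w(1) Z])
    finally show ?thesis .
  qed
  have 1: "K_eq R Z ?D (cone_incl S \<bullet> id_map) (e' \<bullet> cone_incl S)"
  proof -
    have "K_eq R Z ?D (cone_incl S \<bullet> id_map) (cone_incl S \<bullet> add_map Z e t)"
      by (rule K_eq_comp_left[OF et i D])
    also have "K_eq R Z ?D (cone_incl S \<bullet> add_map Z e t) (add_map ?D (cone_incl S \<bullet> e) (cone_incl S \<bullet> t))"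
      by (rule K_eq_eqI[OF Z D comp_chain[OF add_chain[OF Z ec tc] i] add_chain[OF D comp_chain[OF ec i] comp_chain[OF tc i]]])
        (use c Z in simp)
    also have "K_eq R Z ?D (add_map ?D (cone_incl S \<bullet> e) (cone_incl S \<bullet> t)) (add_map ?D (e' \<bullet> cone_incl S) (zero_map ?D))"
      by (rule K_eq_add[OF K_eq_sym[OF ee] it])
    also have "K_eq R Z ?D (add_map ?D (e' \<bullet> cone_incl S) (zero_map ?D)) (e' \<bullet> cone_incl S)"
      by (rule K_eq_eqI[OF Z D add_chain[OF D comp_chain[OF i e'c] zero_chain[OF D]] comp_chain[OF i e'c]])
        (use c Z cm_simps(1)[OF comp_chain[OF i e'c]] in \<open>simp del: cone_obj cone_apply\<close>)
    finally show ?thesis .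
  qed
  have "K_eq R Z ?D (u \<bullet> cone_incl S) (add_map ?D (cone_incl S) (neg_map ?D (e' \<bullet> cone_incl S)))"
    by (rule K_eq_eqI[OF Z D comp_chain[OF i u] add_chain[OF D i neg_chain[OF D comp_chain[OF i e'c]]]])
      (simp add: u_def del: cone_apply)
  also have "K_eq R Z ?D \<dots> (zero_map ?D)"
    by (rule K_eq_diff_zeroD) (use 1 in simp)
  finally have "K_eq R Z ?D (u \<bullet> cone_incl S) (zero_map ?D)" .
  then obtain b where b: "b \<in> chain_maps R (shift S 1) ?D" "K_eq R ?D ?D u (b \<bullet> cone_proj)"
    by (rule cone_factor_left[OF c(5) Z D c(3) u]) (rule that)
  have Sf: "K_factors R (shift P 1) (shift S 1) (shift S 1) id_map"
    using K_factors_shift[OF c(2) P, of 1] by (simp add: shift_map_id)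
  have t': "K_factors R (shift P 1) ?D ?D (b \<bullet> (id_map \<bullet> cone_proj))"
    by (rule K_factors_comp_left[OF K_factors_comp_right[OF Sf q P1 D] b(1) P1 D])
  have bq: "b \<bullet> cone_proj \<in> chain_maps R ?D ?D" by (rule comp_chain[OF q b(1)])
  have "K_eq R ?D ?D id_map (add_map ?D e' u)"
  proof (rule K_eq_eqI[OF D D id_chain add_chain[OF D e'c u]])
    fix i x assume x: "x \<in> carrier (obj ?D i)"
    have "e' i x \<in> carrier (obj ?D i)" by (rule cm_simps(1)[OF e'c x])
    with x have "x = e' i x \<oplus>\<^bsub>obj ?D i\<^esub> (x \<oplus>\<^bsub>obj ?D i\<^esub> \<ominus>\<^bsub>obj ?D i\<^esub> e' i x)" by algebra
    then show "id_map i x = add_map ?D e' u i x" by (simp add: u_def del: cone_obj)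
  qed
  also have "K_eq R ?D ?D (add_map ?D e' u) (add_map ?D e' (b \<bullet> (id_map \<bullet> cone_proj)))"
    using K_eq_add[OF K_eq_refl[OF D D e'c] b(2)] by simp
  finally show thesis using that[OF e' t'] by blast
qed

text \<open>The error term \<open>t\<close> cannot be avoided by this method, since cones of
  retracts are not retracts of cones in any canonical way. Each step replaces it by one through
  \<open>P\<close> shifted once more, so that at stage \<open>n\<close> it goes through the same
  shift that \<open>T\<close> contains.\<close>

lemma tower_retract:
  fixes P V Z\<^sub>0 :: "'a ucx"
  assumes P: "bounded_projective R P" and V: "bounded_projective R V"
    and Z: "bounded_projective R Z\<^sub>0" and f: "K_factors R V Z\<^sub>0 Z\<^sub>0 id_map"
    and t: "approximation_tower P s V n X"
  shows "\<exists>Z e t. approximation_tower P s Z\<^sub>0 n Z \<and> K_factors R X Z Z e \<and>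
    K_factors R (shift P (int n + s - 1)) Z Z t \<and> K_eq R Z Z id_map (add_map Z e t)"
  using t
proof (induction rule: approximation_tower.induct)
  case tower_zero
  have Zc: "cochain_complex R Z\<^sub>0" using Z by simp
  have "K_eq R Z\<^sub>0 Z\<^sub>0 id_map (add_map Z\<^sub>0 id_map (zero_map Z\<^sub>0))"
    by (rule K_eq_eqI) (use Zc in simp_all)
  then show ?case
    using approximation_tower.tower_zero[of P s Z\<^sub>0] f K_factors_zero[OF Zc Zc] by blast
next
  case (tower_step n Y Q f X)
  let ?m = "int n + s - 1"
  let ?P = "shift P ?m"
  have Pc: "cochain_complex R P" and Pb: "bounded_projective R ?P" and Pm: "cochain_complex R ?P"
    using P bounded_projective_shift[OF P] by simp_all
  have Yb: "bounded_projective R Y" by (rule tower_bounded_projective[OF tower_step.hyps(1) V])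
  then have Yc: "cochain_complex R Y" by simp
  have Xc: "cochain_complex R X" using tower_step.hyps(3) by simp
  obtain Z e t where tw: "approximation_tower P s Z\<^sub>0 n Z" and e: "K_factors R Y Z Z e"
    and t: "K_factors R ?P Z Z t" and et: "K_eq R Z Z id_map (add_map Z e t)"
    using tower_step.IH by blast
  have Zb: "bounded_projective R Z" by (rule tower_bounded_projective[OF tw \<open>bounded_projective R Z\<^sub>0\<close>])
  then have Zc: "cochain_complex R Z" by simp
  note a = approximationD[OF tower_step.hyps(2)]
  have C: "cochain_complex R (cone Q Y f)" using a Yc by simp
  \<comment> \<open>An approximation of \<open>Z\<close> has to be produced first. Of the two parts
    of its identity, \<open>e\<close> goes through \<open>Y\<close>, which has one by hypothesis,
    and \<open>t\<close> through \<open>?P\<close>, which is approximated by its identity.\<close>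
  have "approximable ?P Z e"
    by (rule approximable_factors[OF tower_step.hyps(2) e Pm Yc])
  moreover have "approximable ?P Z t"
    by (rule approximable_factors[OF approximation_id[OF Pb] t Pm Pm])
  ultimately have "approximable ?P Z (add_map Z e t)"
    by (rule approximable_add[OF _ _ Pm Zc K_factorsD(1)[OF e Yc] K_factorsD(1)[OF t Pm]])
  then have "approximable ?P Z id_map" by (rule approximable_cong[OF _ K_eq_sym[OF et] Pm])
  then obtain S :: "'a ucx" and g where g: "approximation ?P S Z g"
    unfolding approximable_def approximation_def by auto
  note c = approximationD[OF g]
  let ?D = "cone S Z g"
  have D: "cochain_complex R ?D" using c Zc by simp
  obtain e' t' where e': "K_factors R (cone Q Y f) ?D ?D e'" and t': "K_factors R (shift ?P 1) ?D ?D t'"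
    and et': "K_eq R ?D ?D id_map (add_map ?D e' t')"
    by (rule cone_retract[OF tower_step.hyps(2) g Pm Yc Zc e t et])
  obtain W :: "'a ucx" and p q where W: "cochain_complex R W" "K_inverse R W ?D p q" "bounded_projective R W"
    using encode_pair[OF D] cone_bounded_projective[OF c(1) Zb c(3)] by metis
  note u = K_inverseD[OF W(2)]
  have tw': "approximation_tower P s Z\<^sub>0 (Suc n) W"
    by (rule approximation_tower.tower_step[OF tw g W(3) K_isoI[OF W(2)]])
  have Pk: "cochain_complex R (shift P (int (Suc n) + s - 1))" and P1: "cochain_complex R (shift ?P 1)" using Pc by simp_all
  have e1: "K_factors R X ?D ?D e'"
    by (rule K_factors_trans[OF e' K_iso_factors[OF K_iso_sym[OF tower_step.hyps(4) Xc C] C Xc] C Xc])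
  have t1: "K_factors R (shift P (int (Suc n) + s - 1)) ?D ?D t'"
    by (rule K_factors_trans[OF t' K_iso_factors[OF K_iso_shift_shift[OF Pc] P1 Pk] P1 Pk]) simp
  note e1c = K_factorsD(1)[OF e1 Xc] and t1c = K_factorsD(1)[OF t1 Pk]
  have e2: "K_factors R X W W (q \<bullet> (e' \<bullet> p))"
    by (rule K_factors_comp_left[OF K_factors_comp_right[OF e1 u(1) Xc W(1)] u(2) Xc W(1)])
  have t2: "K_factors R (shift P (int (Suc n) + s - 1)) W W (q \<bullet> (t' \<bullet> p))"
    by (rule K_factors_comp_left[OF K_factors_comp_right[OF t1 u(1) Pk W(1)] u(2) Pk W(1)])
  have et2: "K_eq R W W id_map (add_map W (q \<bullet> (e' \<bullet> p)) (q \<bullet> (t' \<bullet> p)))"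
  proof -
    have "K_eq R W W (q \<bullet> (id_map \<bullet> p)) (q \<bullet> (add_map ?D e' t' \<bullet> p))"
      by (rule K_eq_comp_left[OF K_eq_comp_right[OF et' u(1) W(1)] u(2) W(1)])
    then have "K_eq R W W (q \<bullet> p) (q \<bullet> (add_map ?D e' t' \<bullet> p))" by simp
    moreover have "K_eq R W W (q \<bullet> (add_map ?D e' t' \<bullet> p)) (add_map W (q \<bullet> (e' \<bullet> p)) (q \<bullet> (t' \<bullet> p)))"
      by (rule K_eq_eqI[OF W(1) W(1) comp_chain[OF comp_chain[OF u(1) add_chain[OF D e1c t1c]] u(2)]
          add_chain[OF W(1) K_factorsD(1)[OF e2 Xc] K_factorsD(1)[OF t2 Pk]]])
        (use cm_simps(2)[OF u(2)] cm_simps(1)[OF u(1)] cm_simps(1)[OF e1c] cm_simps(1)[OF t1c] in \<open>simp del: cone_obj\<close>)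
    ultimately show ?thesis using K_eq_trans[OF K_eq_sym[OF u(3)]] K_eq_trans by blast
  qed
  show ?case using tw' e2 t2 et2 by blast
qed

end

section \<open>Objects of \<open>add T\<close>\<close>

context ring begin

lemma pair_chain:
  assumes "f \<in> chain_maps R V X" "g \<in> chain_maps R V Y"
  shows "(\<lambda>i x. (f i x, g i x)) \<in> chain_maps R V (complex_sum X Y)"
  by (rule chain_mapsI) (use assms in \<open>auto intro!: module_homs_pair chain_maps_hom\<close>)

lemma K_eq_pair:
  assumes f: "K_eq R V X f f'" and g: "K_eq R V Y g g'"
  shows "K_eq R V (complex_sum X Y) (\<lambda>i x. (f i x, g i x)) (\<lambda>i x. (f' i x, g' i x))"
  using K_eq_comp_right[OF sum_map_K_eq[OF f g] pair_chain[OF id_chain id_chain] K_eqD(2)[OF f]]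
  by (simp add: map_comp_cx_def comp_def id_map_def)

lemma cone_proj_null:
  assumes X: "cochain_complex R X" and Y: "cochain_complex R Y" and f: "f \<in> chain_maps R X Y"
  shows "K_eq R (cone X Y f) (shift Y 1) (shift_map f 1 \<bullet> cone_proj) (zero_map (shift Y 1))"
proof -
  let ?C = "cone X Y f"
  have C: "cochain_complex R ?C" and Y1: "cochain_complex R (shift Y 1)" using X Y f by simp_all
  interpret Y: abelian_group "obj Y i" for i using Y by (rule cc_abelian)
  have c: "shift_map f 1 \<bullet> cone_proj \<in> chain_maps R ?C (shift Y 1)"
    by (rule comp_chain[OF cone_proj_chain[OF X Y f] shift_map_chain[OF f X Y]])
  \<comment> \<open>The second component is itself the homotopy; the sign in the differential of
    \<open>shift Y 1\<close> removes the term \<open>d y\<close>.\<close>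
  have h: "(\<lambda>i. snd) \<in> graded_maps R (-1) ?C (shift Y 1)"
    by (rule gmI, rule module_homsI) auto
  show ?thesis
  proof (rule K_eqI[OF null_homotopicI[OF C Y1 c h] C Y1 c zero_chain[OF Y1]])
    fix i p assume p: "p \<in> carrier (obj ?C i)"
    obtain x y where [simp]: "p = (x, y)" by (cases p)
    have k: "f (i + 1) x \<in> carrier (obj Y (i + 1))" "diff Y i y \<in> carrier (obj Y (i + 1))" using p f Y by simp_all
    have "f (i + 1) x = \<ominus>\<^bsub>obj Y (i + 1)\<^esub> diff Y i y \<oplus>\<^bsub>obj Y (i + 1)\<^esub> (f (i + 1) x \<oplus>\<^bsub>obj Y (i + 1)\<^esub> diff Y i y)"
      using k by algebra
    then show "(shift_map f 1 \<bullet> cone_proj) i p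
        = diff (shift Y 1) (i - 1) (snd p) \<oplus>\<^bsub>obj (shift Y 1) i\<^esub> snd (diff ?C i p)"
      by (simp add: shift_diff)
  qed
qed

text \<open>
  A split monomorphism \<open>a\<close> has its cone as complement: its connecting map \<open>cone_proj\<close> vanishes, which
  gives a section of \<open>cone_incl\<close>.
\<close>

lemma split_mono_cone:
  assumes Z: "cochain_complex R Z" and U: "cochain_complex R U"
    and a: "a \<in> chain_maps R Z U" and b: "b \<in> chain_maps R U Z" and ba: "K_eq R Z Z (b \<bullet> a) id_map"
  shows "K_iso R U (complex_sum Z (cone Z U a))"
proof -
  let ?C = "cone Z U a"
  let ?S = "complex_sum Z ?C"
  have C: "cochain_complex R ?C" and i: "cone_incl Z \<in> chain_maps R U ?C"
    and q: "cone_proj \<in> chain_maps R ?C (shift Z 1)" and Z1: "cochain_complex R (shift Z 1)"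
    using Z U a by simp_all
  have S: "cochain_complex R ?S" using C Z by simp
  note sm = sum_chain_maps[OF Z C]
  interpret U: abelian_group "obj U i" for i using U by (rule cc_abelian)
  interpret C: abelian_group "obj ?C i" for i using C by (rule cc_abelian)
  have b1: "shift_map b 1 \<in> chain_maps R (shift U 1) (shift Z 1)" by (rule shift_map_chain[OF b U Z])
  have "K_eq R ?C (shift Z 1) (id_map \<bullet> cone_proj) ((shift_map b 1 \<bullet> shift_map a 1) \<bullet> cone_proj)"
    using K_eq_comp_right[OF K_eq_sym[OF shift_map_K_eq[OF ba, of 1]] q C] by (simp add: shift_map_comp shift_map_id)
  also have "K_eq R ?C (shift Z 1) ((shift_map b 1 \<bullet> shift_map a 1) \<bullet> cone_proj) (zero_map (shift Z 1))"
    using K_eq_comp_zero[OF cone_proj_null[OF Z U a] b1 Z1] by (simp add: comp_assoc)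
  finally have "K_eq R ?C (shift Z 1) (cone_proj \<bullet> id_map) (zero_map (shift Z 1))" by simp
  then obtain y where y: "y \<in> chain_maps R ?C U" "K_eq R ?C ?C id_map (cone_incl Z \<bullet> y)"
    by (rule cone_factor_right[OF Z U C a id_chain]) (rule that)
  have ab: "a \<bullet> b \<in> chain_maps R U U" by (rule comp_chain[OF b a])
  \<comment> \<open>The section \<open>y\<close> of \<open>cone_incl\<close> is corrected to
    \<open>e \<bullet> y\<close>, which \<open>b\<close> annihilates; otherwise the two inclusions
    into \<open>U\<close> would not match the two projections.\<close>
  define e where "e = add_map U id_map (neg_map U (a \<bullet> b))"
  have e: "e \<in> chain_maps R U U" unfolding e_def by (intro add_chain neg_chain U id_chain ab)
  have be: "K_eq R U Z (b \<bullet> e) (zero_map Z)"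
  proof -
    have bab: "(b \<bullet> a) \<bullet> b \<in> chain_maps R U Z" by (rule comp_chain[OF b comp_chain[OF a b]])
    have "K_eq R U Z (b \<bullet> e) (add_map Z b (neg_map Z ((b \<bullet> a) \<bullet> b)))"
      by (rule K_eq_eqI[OF U Z comp_chain[OF e b] add_chain[OF Z b neg_chain[OF Z bab]]])
        (use cm_simps(2,4)[OF b] cm_simps(1)[OF ab] U Z in \<open>simp add: e_def\<close>)
    also have "K_eq R U Z \<dots> (zero_map Z)"
      by (rule K_eq_diff_zeroD) (use K_eq_sym[OF K_eq_comp_right[OF ba b U]] in simp)
    finally show ?thesis .
  qed
  have ia: "K_eq R Z ?C (cone_incl Z \<bullet> a) (zero_map ?C)" by (rule cone_incl_null[OF Z U a])
  have ie: "K_eq R U ?C (cone_incl Z \<bullet> e) (cone_incl Z)"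
  proof -
    have ie: "cone_incl Z \<bullet> e \<in> chain_maps R U ?C" by (rule comp_chain[OF e i])
    have iab: "(cone_incl Z \<bullet> a) \<bullet> b \<in> chain_maps R U ?C" by (rule comp_chain[OF b comp_chain[OF a i]])
    have "K_eq R U ?C (cone_incl Z \<bullet> e) (add_map ?C (cone_incl Z \<bullet> e) (zero_map ?C))"
      by (rule K_eq_eqI[OF U C ie add_chain[OF C ie zero_chain[OF C]]])
        (use cm_simps(1)[OF ie] C in \<open>simp del: cone_obj cone_apply\<close>)
    also have "K_eq R U ?C \<dots> (add_map ?C (cone_incl Z \<bullet> e) ((cone_incl Z \<bullet> a) \<bullet> b))"
      by (rule K_eq_add[OF K_eq_refl[OF U C ie] K_eq_sym[OF K_eq_zero_comp[OF ia b U]]])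
    also have "K_eq R U ?C \<dots> (cone_incl Z)"
    proof (rule K_eq_eqI[OF U C add_chain[OF C ie iab] i])
      fix n x assume x: "x \<in> carrier (obj U n)"
      have "a n (b n x) \<in> carrier (obj U n)" using x a b by simp
      with x have "(x \<oplus>\<^bsub>obj U n\<^esub> \<ominus>\<^bsub>obj U n\<^esub> a n (b n x)) \<oplus>\<^bsub>obj U n\<^esub> a n (b n x) = x" by algebra
      then show "add_map ?C (cone_incl Z \<bullet> e) ((cone_incl Z \<bullet> a) \<bullet> b) n x = cone_incl Z n x"
        using Z by (simp add: e_def)
    qed
    finally show ?thesis .
  qed
  define \<phi> where "\<phi> = (\<lambda>n v. (b n v, cone_incl Z n v))"
  define \<psi> where "\<psi> = add_map U (a \<bullet> (\<lambda>n. fst)) ((e \<bullet> y) \<bullet> (\<lambda>n. snd))"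
  have \<phi>: "\<phi> \<in> chain_maps R U ?S" unfolding \<phi>_def by (rule pair_chain[OF b i])
  have ey: "e \<bullet> y \<in> chain_maps R ?C U" by (rule comp_chain[OF y(1) e])
  have c: "a \<bullet> (\<lambda>n. fst) \<in> chain_maps R ?S U" "(e \<bullet> y) \<bullet> (\<lambda>n. snd) \<in> chain_maps R ?S U"
    by (rule comp_chain[OF sm(3) a]) (rule comp_chain[OF sm(4) ey])
  have \<psi>: "\<psi> \<in> chain_maps R ?S U" unfolding \<psi>_def by (rule add_chain[OF U c])
  \<comment> \<open>Stated for any \<open>g\<close> out of \<open>U\<close>, since it is applied to
    both components \<open>b\<close> and \<open>cone_incl Z\<close> of \<open>\<phi>\<close>, whose
    targets have different types.\<close>
  have split: "K_eq R ?S W (g \<bullet> \<psi>) (add_map W ((g \<bullet> a) \<bullet> (\<lambda>n. fst)) (((g \<bullet> e) \<bullet> y) \<bullet> (\<lambda>n. snd)))"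
    if W: "cochain_complex R W" and g: "g \<in> chain_maps R U W" for g :: "int \<Rightarrow> _ \<Rightarrow> 'x" and W
  proof (rule K_eq_eqI[OF S W comp_chain[OF \<psi> g] add_chain[OF W]])
    show "(g \<bullet> a) \<bullet> (\<lambda>n. fst) \<in> chain_maps R ?S W" "((g \<bullet> e) \<bullet> y) \<bullet> (\<lambda>n. snd) \<in> chain_maps R ?S W"
      using comp_chain[OF c(1) g] comp_chain[OF c(2) g] by (simp_all add: comp_assoc)
  qed (use cm_simps(2)[OF g] cm_simps(1)[OF c(1)] cm_simps(1)[OF c(2)] in \<open>simp add: \<psi>_def del: sum_simps(1)\<close>)
  have b\<psi>: "K_eq R ?S Z (b \<bullet> \<psi>) (\<lambda>n. fst)"
  proof -
    note split[OF Z b]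
    also have "K_eq R ?S Z (add_map Z ((b \<bullet> a) \<bullet> (\<lambda>n. fst)) (((b \<bullet> e) \<bullet> y) \<bullet> (\<lambda>n. snd)))
        (add_map Z (id_map \<bullet> (\<lambda>n. fst)) (zero_map Z))"
      by (rule K_eq_add[OF K_eq_comp_right[OF ba sm(3) S] K_eq_zero_comp[OF K_eq_zero_comp[OF be y(1) C] sm(4) S]])
    also have "K_eq R ?S Z \<dots> (\<lambda>n. fst)"
      by (rule K_eq_eqI[OF S Z add_chain[OF Z _ zero_chain[OF Z]] sm(3)]) (use sm(3) Z in auto)
    finally show ?thesis .
  qed
  have i\<psi>: "K_eq R ?S ?C (cone_incl Z \<bullet> \<psi>) (\<lambda>n. snd)"
  proof -
    note split[OF C i]
    also have "K_eq R ?S ?C (add_map ?C ((cone_incl Z \<bullet> a) \<bullet> (\<lambda>n. fst)) (((cone_incl Z \<bullet> e) \<bullet> y) \<bullet> (\<lambda>n. snd)))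
        (add_map ?C (zero_map ?C) ((cone_incl Z \<bullet> y) \<bullet> (\<lambda>n. snd)))"
      by (rule K_eq_add[OF K_eq_zero_comp[OF ia sm(3) S] K_eq_comp_right[OF K_eq_comp_right[OF ie y(1) C] sm(4) S]])
    also have "K_eq R ?S ?C \<dots> (add_map ?C (zero_map ?C) (id_map \<bullet> (\<lambda>n. snd)))"
      by (rule K_eq_add[OF K_eq_refl[OF S C zero_chain[OF C]] K_eq_comp_right[OF K_eq_sym[OF y(2)] sm(4) S]])
    also have "K_eq R ?S ?C \<dots> (\<lambda>n. snd)"
      by (rule K_eq_eqI[OF S C add_chain[OF C zero_chain[OF C]] sm(4)]) (use sm(4) C in \<open>auto simp del: cone_obj\<close>)
    finally show ?thesis .
  qed
  have \<phi>\<psi>: "K_eq R ?S ?S (\<phi> \<bullet> \<psi>) id_map"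
    using K_eq_pair[OF b\<psi> i\<psi>] by (simp add: \<phi>_def map_comp_cx_def comp_def id_map_def)
  have \<psi>\<phi>: "\<psi> \<bullet> \<phi> \<in> chain_maps R U U" by (rule comp_chain[OF \<phi> \<psi>])
  \<comment> \<open>The defect \<open>d\<close> is killed by \<open>cone_incl\<close> and by
    \<open>b\<close>. The first makes it factor as \<open>a \<bullet> x\<close>, and then
    \<open>x\<close>, being homotopic to \<open>b \<bullet> d\<close>, is null.\<close>
  define d where "d = add_map U id_map (neg_map U (\<psi> \<bullet> \<phi>))"
  have d: "d \<in> chain_maps R U U" unfolding d_def by (intro add_chain neg_chain U id_chain \<psi>\<phi>)
  have gd: "K_eq R U W (g \<bullet> d) (zero_map W)"
    if W: "cochain_complex R W" and g: "g \<in> chain_maps R U W" and gp: "K_eq R U W ((g \<bullet> \<psi>) \<bullet> \<phi>) g"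
    for g :: "int \<Rightarrow> _ \<Rightarrow> 'x" and W
  proof -
    have "K_eq R U W (g \<bullet> d) (add_map W g (neg_map W ((g \<bullet> \<psi>) \<bullet> \<phi>)))"
      by (rule K_eq_eqI[OF U W comp_chain[OF d g] add_chain[OF W g neg_chain[OF W K_eqD(4)[OF gp]]]])
        (use cm_simps(2,4)[OF g] cm_simps(1)[OF \<psi>\<phi>] U W in \<open>simp add: d_def\<close>)
    also have "K_eq R U W \<dots> (zero_map W)" by (rule K_eq_diff_zeroD[OF K_eq_sym[OF gp]])
    finally show ?thesis .
  qed
  have "K_eq R U ?C (cone_incl Z \<bullet> d) (zero_map ?C)"
    by (rule gd[OF C i]) (use K_eq_comp_right[OF i\<psi> \<phi> U] in \<open>simp add: \<phi>_def map_comp_cx_def comp_def cone_incl_def\<close>)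
  then obtain x where x: "x \<in> chain_maps R U Z" "K_eq R U U (a \<bullet> x) d"
    by (rule cone_exact[OF U Z U a d]) (rule that)
  have "K_eq R U Z (b \<bullet> d) (zero_map Z)"
    by (rule gd[OF Z b]) (use K_eq_comp_right[OF b\<psi> \<phi> U] in \<open>simp add: \<phi>_def map_comp_cx_def comp_def\<close>)
  moreover have "K_eq R U Z x (b \<bullet> d)"
  proof -
    have "K_eq R U Z (id_map \<bullet> x) ((b \<bullet> a) \<bullet> x)" by (rule K_eq_comp_right[OF K_eq_sym[OF ba] x(1) U])
    also have "K_eq R U Z ((b \<bullet> a) \<bullet> x) (b \<bullet> d)" using K_eq_comp_left[OF x(2) b Z] by (simp add: comp_assoc)
    finally show ?thesis by simp
  qed
  ultimately have "K_eq R U Z x (zero_map Z)" by (meson K_eq_trans)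
  then have "K_eq R U U d (zero_map U)"
    by (meson K_eq_trans K_eq_sym K_eq_comp_zero x(2) a U)
  then have "K_eq R U U id_map (\<psi> \<bullet> \<phi>)"
    unfolding d_def by (rule K_eq_diff_zero[OF _ id_chain \<psi>\<phi>])
  then show ?thesis
    by (intro K_isoI[of _ _ \<phi> \<psi>]) (simp add: K_inverse_def \<phi> \<psi> \<phi>\<psi> K_eq_sym)
qed

text \<open>Here the ideal is turned back into a factorization through one direct sum, the form in
  which \<open>add_closure\<close> is defined.\<close>

lemma K_factors_power:
  fixes T :: "('a, 't) cx"
  assumes "K_factors R T X Y f" and T: "cochain_complex R T"
  shows "\<exists>n. \<exists>a\<in>chain_maps R X (complex_power T n). \<exists>b\<in>chain_maps R (complex_power T n) Y. K_eq R X Y f (b \<bullet> a)"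
  using assms(1)
proof (induction rule: K_factors_induct)
  case K_factors_zero
  have U: "cochain_complex R (complex_power T 0)" using T by simp
  have "K_eq R X Y (zero_map Y) (zero_map Y \<bullet> zero_map (complex_power T 0))"
    by (rule K_eq_eqI[OF K_factors_zero zero_chain comp_chain[OF zero_chain[OF U] zero_chain]])
      (use K_factors_zero in simp_all)
  then show "\<exists>n. \<exists>a\<in>chain_maps R X (complex_power T n). \<exists>b\<in>chain_maps R (complex_power T n) Y. K_eq R X Y (zero_map Y) (b \<bullet> a)"
    using zero_chain[OF U] zero_chain[OF K_factors_zero(2)] by blast
next
  case (K_factors_add f a' b')
  note k = K_factorsD[OF K_factors_add(1) T]
  interpret Y: abelian_group "obj Y i" for i using k(3) by (rule cc_abelian)
  obtain n a b where a: "a \<in> chain_maps R X (complex_power T n)" and b: "b \<in> chain_maps R (complex_power T n) Y"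
    and e: "K_eq R X Y f (b \<bullet> a)"
    using K_factors_add.IH by blast
  let ?U = "complex_power T (Suc n)" and ?W = "complex_power T n"
  have W: "cochain_complex R ?W" using T by simp
  obtain p q where p: "p \<in> chain_maps R (complex_sum ?W T) ?U" and q: "q \<in> chain_maps R ?U (complex_sum ?W T)"
    and qp: "\<And>i x. x \<in> carrier (obj (complex_sum ?W T) i) \<Longrightarrow> q i (p i x) = x"
    by (rule power_Suc[OF T, of n]) (rule that)
  note sm = sum_chain_maps[OF W T]
  define A where "A = p \<bullet> (\<lambda>i x. (a i x, a' i x))"
  have A: "A \<in> chain_maps R X ?U"
    unfolding A_def by (rule comp_chain[OF pair_chain[OF a K_factors_add(2)] p])
  define B where "B = add_map Y (b \<bullet> (\<lambda>i. fst)) (b' \<bullet> (\<lambda>i. snd)) \<bullet> q"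
  have B: "B \<in> chain_maps R ?U Y"
    unfolding B_def by (rule comp_chain[OF q add_chain[OF k(3) comp_chain[OF sm(3) b] comp_chain[OF sm(4) K_factors_add(3)]]])
  have ba: "b \<bullet> a \<in> chain_maps R X Y" "b' \<bullet> a' \<in> chain_maps R X Y"
    by (rule comp_chain[OF a b]) (rule comp_chain[OF K_factors_add(2,3)])
  have "K_eq R X Y (add_map Y f (b' \<bullet> a')) (add_map Y (b \<bullet> a) (b' \<bullet> a'))"
    by (rule K_eq_add[OF e K_eq_refl[OF k(2,3) ba(2)]])
  also have "K_eq R X Y (add_map Y (b \<bullet> a) (b' \<bullet> a')) (B \<bullet> A)"
    by (rule K_eq_eqI[OF k(2,3) add_chain[OF k(3) ba] comp_chain[OF A B]])
      (use cm_simps(1)[OF a] cm_simps(1)[OF K_factors_add(2)] qp in \<open>simp add: A_def B_def\<close>)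
  finally show "\<exists>n. \<exists>a\<in>chain_maps R X (complex_power T n). \<exists>b\<in>chain_maps R (complex_power T n) Y.
      K_eq R X Y (add_map Y f (b' \<bullet> a')) (b \<bullet> a)"
    using A B by blast
next
  case (K_factors_cong f g)
  then show "\<exists>n. \<exists>a\<in>chain_maps R X (complex_power T n). \<exists>b\<in>chain_maps R (complex_power T n) Y. K_eq R X Y g (b \<bullet> a)"
    using K_eq_trans[OF K_eq_sym[OF K_factors_cong(2)]] by blast
qed

lemma encode_power:
  fixes X :: "('a, nat \<Rightarrow> nat \<Rightarrow> 'a) cx"
  assumes "cochain_complex R X"
  obtains X' :: "'a ucx" and f g where "K_inverse R X' X f g"
  using K_inverse_sym[OF transport_iso(2)[OF assms, of "\<lambda>w i j. w (prod_encode (i, j))" "\<lambda>p k. p (fst (prod_decode k)) (snd (prod_decode k))"]]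
  by (auto simp: fun_eq_iff)

text \<open>Converse to \<open>add_closure_factors\<close>. The complement demanded by the
  definition is the cone of the split inclusion of \<open>Z\<close> into a power of
  \<open>T\<close>.\<close>

lemma factors_add_closure:
  fixes T Z :: "'a ucx"
  assumes Z: "bounded_projective R Z" and T: "cochain_complex R T" and f: "K_factors R T Z Z id_map"
  shows "Z \<in> add_closure R T"
proof -
  have Zc: "cochain_complex R Z" using Z by simp
  obtain n a b where a: "a \<in> chain_maps R Z (complex_power T n)" and b: "b \<in> chain_maps R (complex_power T n) Z"
    and ba: "K_eq R Z Z id_map (b \<bullet> a)"
    using K_factors_power[OF f T] by blast
  let ?U = "complex_power T n"
  have U: "cochain_complex R ?U" using T by simp
  obtain W :: "'a ucx" and p q where pq: "K_inverse R W ?U p q" by (rule encode_power[OF U])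
  note u = K_inverseD[OF pq]
  have qa: "q \<bullet> a \<in> chain_maps R Z W" and bp: "b \<bullet> p \<in> chain_maps R W Z"
    by (rule comp_chain[OF a u(2)]) (rule comp_chain[OF u(1) b])
  have "K_eq R Z Z ((b \<bullet> p) \<bullet> (q \<bullet> a)) (b \<bullet> (id_map \<bullet> a))"
    using K_eq_comp_left[OF K_eq_comp_right[OF u(4) a Zc] b Zc] by (simp add: comp_assoc)
  also have "K_eq R Z Z (b \<bullet> (id_map \<bullet> a)) id_map" using K_eq_sym[OF ba] by simp
  finally have ba': "K_eq R Z Z ((b \<bullet> p) \<bullet> (q \<bullet> a)) id_map" .
  let ?C = "cone Z W (q \<bullet> a)"
  have C: "cochain_complex R ?C" using Zc u(5) qa by simp
  obtain Y' :: "'a ucx" and r s where Y': "cochain_complex R Y'" "K_inverse R Y' ?C r s"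
    using encode_pair[OF C] by metis
  have S: "cochain_complex R (complex_sum Z ?C)" "cochain_complex R (complex_sum Z Y')" using Zc C Y' by simp_all
  have "K_iso R (complex_sum Z ?C) (complex_sum Z Y')"
    by (rule K_iso_sum[OF K_iso_refl[OF Zc] K_iso_sym[OF K_isoI[OF Y'(2)] Y'(1) C] Zc Zc C Y'(1)])
  from K_iso_trans[OF split_mono_cone[OF Zc u(5) qa bp ba'] this u(5) S]
  obtain g where "quasi_iso R W (complex_sum Z Y') g"
    by (rule K_iso_quasi_iso[OF _ u(5) S(2)]) (rule that)
  then have "D_iso R (complex_sum Z Y') ?U"
    unfolding D_iso_def using u(5) K_inverse_quasi_iso[OF pq] by blast
  then show ?thesis
    unfolding add_closure_def using Z Y'(1) by (auto simp: Kb_proj_iff)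
qed

section \<open>Generation\<close>

text \<open>All three terms of a triangle share one element type, while a cone has pairs as
  elements; closure under cones is therefore stated for a representative \<open>Z\<close>.\<close>

lemma triangulated_cone:
  fixes X Y Z :: "'a ucx"
  assumes C: "triangulated_subcategory R C" and X: "X \<in> C" and Y: "Y \<in> C"
    and f: "f \<in> chain_maps R X Y" and Z: "bounded_projective R Z" and i: "K_iso R Z (cone X Y f)"
  shows "Z \<in> C"
proof -
  have "bounded_projective R X" "bounded_projective R Y"
    using C X Y unfolding triangulated_subcategory_def Kb_proj_iff[symmetric] by blast+
  then have Xc: "cochain_complex R X" and Yc: "cochain_complex R Y" by simp_all
  have Zc: "cochain_complex R Z" using Z by simp
  let ?D = "cone X Y f"
  have D: "cochain_complex R ?D" and inc: "cone_incl X \<in> chain_maps R Y ?D"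
    and pr: "cone_proj \<in> chain_maps R ?D (shift X 1)" and X1: "cochain_complex R (shift X 1)" using Xc Yc f by simp_all
  obtain c c' where c: "K_inverse R Z ?D c c'" using K_isoD[OF i Zc D] .
  note u = K_inverseD[OF c]
  have "K_eq R Y ?D (cone_incl X) (c \<bullet> (c' \<bullet> cone_incl X))"
    using K_eq_sym[OF K_eq_comp_right[OF u(4) inc Yc]] by (simp add: comp_assoc)
  then have h: "homotopic R Y ?D (cone_incl X \<bullet> id_map) (c \<bullet> (c' \<bullet> cone_incl X))"
    by (auto dest: K_eqD)
  have pc: "cone_proj \<bullet> c \<in> chain_maps R Z (shift X 1)" by (rule comp_chain[OF u(1) pr])
  have "Defs.triangle R X Y Z f (c' \<bullet> cone_incl X) (cone_proj \<bullet> c)"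
    unfolding Defs.triangle_def
    by (intro conjI exI[of _ X] exI[of _ Y] exI[of _ f] exI[of _ "id_map :: int \<Rightarrow> (nat \<Rightarrow> 'a) \<Rightarrow> _"] exI[of _ c])
      (use Xc Yc Zc f h pc comp_chain[OF inc u(2)] K_inverse_equivalence[OF c]
        K_inverse_equivalence[OF K_inverse_refl[OF Xc]] K_inverse_equivalence[OF K_inverse_refl[OF Yc]]
        homotopic_refl[OF Xc Yc f] homotopic_refl[OF Zc X1 pc] in \<open>simp_all add: shift_map_id\<close>)
  then show ?thesis
    using C X Y Z unfolding triangulated_subcategory_def Kb_proj_iff[symmetric] by blast
qed

text \<open>Closure of a triangulated subcategory is given for third terms of triangles, so
  recovering the middle term needs a rotation: \<open>Z\<close> is again a cone, of the map from the
  shifted cone to \<open>S\<close>. The equivalence is \<open>z \<mapsto> ((0, z), 0)\<close> with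
  inverse \<open>((r, z), s) \<mapsto> z - g s\<close>, and \<open>s \<mapsto> ((s, 0), 0)\<close>
  is the homotopy.\<close>

lemma cone_rotate:
  assumes S: "cochain_complex R S" and Z: "cochain_complex R Z" and g: "g \<in> chain_maps R S Z"
  shows "(\<lambda>i. fst) \<in> chain_maps R (shift (cone S Z g) (- 1)) S" (is "?p \<in> _")
    and "K_iso R Z (cone (shift (cone S Z g) (- 1)) S (\<lambda>i. fst))"
proof -
  let ?D = "cone S Z g"
  let ?D' = "shift ?D (- 1)"
  let ?E = "cone ?D' S ?p"
  interpret S: abelian_group "obj S i" for i using S by (rule cc_abelian)
  interpret Z: abelian_group "obj Z i" for i using Z by (rule cc_abelian)
  have D': "cochain_complex R ?D'" using S Z g by simp
  have [simp]: "i + 1 - 1 = i" "i - 1 + 1 = i" "i - 1 + 2 = i + 1" "i + 1 + 1 = i + 2" "i + 2 - 1 = i + 1" for i :: int by simp_all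
  show p: "?p \<in> chain_maps R ?D' S"
    by (rule chain_mapsI; (rule module_homsI)?; use S Z g in \<open>auto simp: shift_diff module_sum_neg\<close>)
  have E: "cochain_complex R ?E" using D' S p by simp
  let ?a = "\<lambda>i z. ((\<zero>\<^bsub>obj S (i + 1)\<^esub>, z), \<zero>\<^bsub>obj S i\<^esub>)"
  let ?b = "\<lambda>i ((r, z), s). z \<ominus>\<^bsub>obj Z i\<^esub> g i s"
  have a: "?a \<in> chain_maps R Z ?E"
    by (rule chain_mapsI; (rule module_homsI)?; use S Z g in \<open>auto simp: shift_diff module_sum_neg module_sum_module\<close>)
  have b: "?b \<in> chain_maps R ?E Z"
  proof (rule chain_mapsI; (rule module_homsI)?)
    fix i x y assume x: "x \<in> carrier (obj ?E i)" and y: "y \<in> carrier (obj ?E i)"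
    obtain r z s where [simp]: "x = ((r, z), s)" by (metis surj_pair)
    obtain r' z' s' where [simp]: "y = ((r', z'), s')" by (metis surj_pair)
    have c: "z \<in> carrier (obj Z i)" "g i s \<in> carrier (obj Z i)" "z' \<in> carrier (obj Z i)" "g i s' \<in> carrier (obj Z i)"
      "s \<in> carrier (obj S i)" "s' \<in> carrier (obj S i)"
      using x y g by simp_all
    show "?b i x \<in> carrier (obj Z i)" using c Z by simp
    show "?b i (x \<oplus>\<^bsub>obj ?E i\<^esub> y) = ?b i x \<oplus>\<^bsub>obj Z i\<^esub> ?b i y"
      using c(5,6) g by simp (insert c(1-4), algebra)
  next
    fix i t x assume t: "t \<in> carrier R" and x: "x \<in> carrier (obj ?E i)"
    obtain r z s where [simp]: "x = ((r, z), s)" by (metis surj_pair)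
    show "?b i (t \<odot>\<^bsub>obj ?E i\<^esub> x) = t \<odot>\<^bsub>obj Z i\<^esub> ?b i x"
      using x t g Z S cm_simps(6)[OF g t, of s i] rm_act_add[OF cc_module[OF Z] t] rm_act_neg[OF cc_module[OF Z] t]
      by (simp add: a_minus_def)
  next
    fix i x assume x: "x \<in> carrier (obj ?E i)"
    obtain r z s where [simp]: "x = ((r, z), s)" by (metis surj_pair)
    have c: "g (i + 1) r \<in> carrier (obj Z (i + 1))" "diff Z i z \<in> carrier (obj Z (i + 1))"
      "diff Z i (g i s) \<in> carrier (obj Z (i + 1))" "z \<in> carrier (obj Z i)" "g i s \<in> carrier (obj Z i)"
      "r \<in> carrier (obj S (i + 1))" "s \<in> carrier (obj S i)"
      using x g S Z by simp_all
    have "g (i + 1) r \<oplus>\<^bsub>obj Z (i + 1)\<^esub> diff Z i z \<ominus>\<^bsub>obj Z (i + 1)\<^esub> (g (i + 1) r \<oplus>\<^bsub>obj Z (i + 1)\<^esub> diff Z i (g i s))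
        = diff Z i z \<ominus>\<^bsub>obj Z (i + 1)\<^esub> diff Z i (g i s)"
      using c(1-3) by algebra
    then show "?b (i + 1) (diff ?E i x) = diff Z i (?b i x)"
      using c(4-7) S Z g by (simp add: shift_diff module_sum_neg)
  qed
  have ba: "K_eq R Z Z (?b \<bullet> ?a) id_map"
    by (rule K_eq_eqI[OF Z Z comp_chain[OF a b] id_chain]) (use S Z g in simp)
  have ab: "K_eq R ?E ?E id_map (?a \<bullet> ?b)"
  proof (rule K_eqI[OF homotopicI[OF E E id_chain comp_chain[OF b a]] E E id_chain comp_chain[OF b a]])
    show "(\<lambda>i ((r, z), s). ((s, \<zero>\<^bsub>obj Z (i - 1)\<^esub>), \<zero>\<^bsub>obj S (i - 1)\<^esub>)) \<in> graded_maps R (-1) ?E ?E" (is "?h \<in> _")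
      by (rule gmI, rule module_homsI) (use S Z in auto)
    fix i x assume x: "x \<in> carrier (obj ?E i)"
    obtain r z s where [simp]: "x = ((r, z), s)" by (metis surj_pair)
    have c: "z \<in> carrier (obj Z i)" "g i s \<in> carrier (obj Z i)" "s \<in> carrier (obj S i)"
      "diff S i s \<in> carrier (obj S (i + 1))" "r \<in> carrier (obj S (i + 1))"
      using x g S by simp_all
    have 1: "z = z \<ominus>\<^bsub>obj Z i\<^esub> g i s \<oplus>\<^bsub>obj Z i\<^esub> g i s" using c(1,2) by algebra
    have 2: "r = \<ominus>\<^bsub>obj S (i + 1)\<^esub> diff S i s \<oplus>\<^bsub>obj S (i + 1)\<^esub> (r \<oplus>\<^bsub>obj S (i + 1)\<^esub> diff S i s)" using c(4,5) by algebra
    have "diff ?E (i - 1) (?h i x) = ((\<ominus>\<^bsub>obj S (i + 1)\<^esub> diff S i s, g i s), s)"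
      using c S Z g by (simp add: shift_diff module_sum_neg)
    moreover have "?h (i + 1) (diff ?E i x) = ((r \<oplus>\<^bsub>obj S (i + 1)\<^esub> diff S i s, \<zero>\<^bsub>obj Z i\<^esub>), \<zero>\<^bsub>obj S i\<^esub>)"
      using c S Z g by (simp add: shift_diff module_sum_neg)
    ultimately show "id_map i x = (?a \<bullet> ?b) i x \<oplus>\<^bsub>obj ?E i\<^esub> (diff ?E (i - 1) (?h i x) \<oplus>\<^bsub>obj ?E i\<^esub> ?h (i + 1) (diff ?E i x))"
      using c S Z g 1[symmetric] 2[symmetric] by simp
  qed
  show "K_iso R Z ?E"
    by (rule K_isoI) (unfold K_inverse_def, use a b ba K_eq_sym[OF ab] in blast)
qed

end

context ring begin

lemma stalk_map_chain:
  assumes f: "f \<in> module_homs R M N" and M: "right_module R M" and N: "right_module R N"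
  shows "(\<lambda>i. f) \<in> chain_maps R (stalk M) (stalk N)"
proof (rule chain_mapsI)
  have z: "f \<zero>\<^bsub>M\<^esub> = \<zero>\<^bsub>N\<^esub>" by (rule module_homs_zero[OF f M N])
  show "f \<in> module_homs R (obj (stalk M) i) (obj (stalk N) i)" for i
  proof (cases "i = 0")
    case False
    then show ?thesis
      by (intro module_homsI) (use z M N in \<open>simp_all add: stalk_def\<close>)
  qed (use f in simp)
  show "f (diff (stalk M) i x) = diff (stalk N) i (f x)" for i x using z by simp
qed

text \<open>The dual basis expansion writes the identity as a sum of maps through the algebra.
  Partial sums appear because \<open>K_factors\<close> grows by one summand at a time.\<close>

lemma stalk_factors:
  assumes "fg_projective R N"
  shows "K_factors R (stalk (regular R)) (stalk N) (stalk N) id_map"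
proof -
  have N: "right_module R N" by (rule fg_projective_module[OF assms])
  interpret N: right_module R N by (rule N)
  have S: "cochain_complex R (stalk N)" using N by simp
  have T: "cochain_complex R (stalk (regular R))" by (simp add: regular_module)
  obtain n x \<xi> where b: "dual_basis R N n x \<xi>" by (rule fg_projective_dual_basis[OF assms])
  note d = dual_basisD[OF b]
  have \<xi>c: "(\<lambda>i. \<xi> q) \<in> chain_maps R (stalk N) (stalk (regular R))" if "q < n" for q
    by (rule stalk_map_chain[OF d(2)[OF that] N regular_module])
  have xc: "(\<lambda>i r. r \<odot>\<^bsub>N\<^esub> x q) \<in> chain_maps R (stalk (regular R)) (stalk N)" if "q < n" for q
    by (rule stalk_map_chain[OF module_homsI regular_module N])
      (use d(1)[OF that] in \<open>simp_all add: N.act_closed N.act_add_ring N.act_mult\<close>)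
  have car: "y \<in> carrier N" if "y \<in> carrier (obj (stalk N) i)" for y i
    using that by (cases "i = 0") simp_all
  have F: "(\<lambda>i y. \<Oplus>\<^bsub>N\<^esub>q\<in>{..<k}. \<xi> q y \<odot>\<^bsub>N\<^esub> x q) \<in> chain_maps R (stalk N) (stalk N)" if "k \<le> n" for k
    by (rule stalk_map_chain[OF module_homs_sum_map N N])
      (use that d N in \<open>auto intro: module_homs_scale\<close>)
  have "k \<le> n \<Longrightarrow> K_factors R (stalk (regular R)) (stalk N) (stalk N) (\<lambda>i y. \<Oplus>\<^bsub>N\<^esub>q\<in>{..<k}. \<xi> q y \<odot>\<^bsub>N\<^esub> x q)" for k
  proof (induction k)
    case 0
    show ?case using K_factors_zero[OF S S, of "stalk (regular R)"] by (simp add: zero_map_def)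
  next
    case (Suc k)
    then have k: "k < n" by simp
    from Suc have IH: "K_factors R (stalk (regular R)) (stalk N) (stalk N) (\<lambda>i y. \<Oplus>\<^bsub>N\<^esub>q\<in>{..<k}. \<xi> q y \<odot>\<^bsub>N\<^esub> x q)" by simp
    note 1 = K_factors_add[OF IH \<xi>c[OF k] xc[OF k]]
    show ?case
    proof (rule K_factors_cong[OF 1 K_eq_eqI[OF S S K_factorsD(1)[OF 1 T] F[OF Suc.prems]]])
      fix i y assume "y \<in> carrier (obj (stalk N) i)"
      then have y: "y \<in> carrier N" by (rule car)
      have c: "\<xi> q y \<odot>\<^bsub>N\<^esub> x q \<in> carrier N" if "q < Suc k" for q
        by (rule N.act_closed[OF d(3)[OF _ y] d(1)]) (use that k in simp_all)
      have add: "(\<oplus>\<^bsub>obj (stalk N) i\<^esub>) = (\<oplus>\<^bsub>N\<^esub>)" by (simp add: stalk_def)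
      have "(\<Oplus>\<^bsub>N\<^esub>q\<in>{..<Suc k}. \<xi> q y \<odot>\<^bsub>N\<^esub> x q) = \<xi> k y \<odot>\<^bsub>N\<^esub> x k \<oplus>\<^bsub>N\<^esub> (\<Oplus>\<^bsub>N\<^esub>q\<in>{..<k}. \<xi> q y \<odot>\<^bsub>N\<^esub> x q)"
        unfolding lessThan_Suc by (rule N.M.finsum_insert) (use c in auto)
      also have "\<dots> = (\<Oplus>\<^bsub>N\<^esub>q\<in>{..<k}. \<xi> q y \<odot>\<^bsub>N\<^esub> x q) \<oplus>\<^bsub>N\<^esub> \<xi> k y \<odot>\<^bsub>N\<^esub> x k"
        by (rule N.M.a_comm) (use c in \<open>auto intro!: N.M.finsum_closed\<close>)
      finally show "add_map (stalk N) (\<lambda>i y. \<Oplus>\<^bsub>N\<^esub>q\<in>{..<k}. \<xi> q y \<odot>\<^bsub>N\<^esub> x q) ((\<lambda>i r. r \<odot>\<^bsub>N\<^esub> x k) \<bullet> (\<lambda>i. \<xi> k)) i y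
          = (\<Oplus>\<^bsub>N\<^esub>q\<in>{..<Suc k}. \<xi> q y \<odot>\<^bsub>N\<^esub> x q)"
        by (simp add: add_map_def add map_comp_cx_def)
    qed
  qed
  from this[of n] have 2: "K_factors R (stalk (regular R)) (stalk N) (stalk N) (\<lambda>i y. \<Oplus>\<^bsub>N\<^esub>q\<in>{..<n}. \<xi> q y \<odot>\<^bsub>N\<^esub> x q)" by simp
  show ?thesis
    by (rule K_factors_cong[OF 2 K_eq_eqI[OF S S K_factorsD(1)[OF 2 T] id_chain]])
      (use d(4) car in simp)
qed

lemma triangulated_shift: "\<lbrakk>triangulated_subcategory R C; X \<in> C\<rbrakk> \<Longrightarrow> shift X m \<in> C"
  and triangulated_iso: "\<lbrakk>triangulated_subcategory R C; X \<in> C; K_iso R X Y; bounded_projective R Y\<rbrakk> \<Longrightarrow> Y \<in> C"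
  and triangulated_projective: "\<lbrakk>triangulated_subcategory R C; X \<in> C\<rbrakk> \<Longrightarrow> bounded_projective R X"
  unfolding triangulated_subcategory_def Kb_proj_iff[symmetric] by blast+

lemma triangulated_unshift:
  assumes C: "triangulated_subcategory R C" and "shift X m \<in> C" and X: "bounded_projective R X"
  shows "X \<in> C"
  by (rule triangulated_iso[OF C triangulated_shift[OF C assms(2), of "- m"] K_isoI[OF shift_back] X])
    (use X in simp)

text \<open>The triangles of the tower are read backwards: with the cone and the approximating
  complex \<open>Q\<close> in \<open>C\<close>, the rotated triangle puts the previous stage in
  \<open>C\<close>.\<close>

lemma tower_back:
  fixes P Z\<^sub>0 :: "'a ucx"
  assumes C: "triangulated_subcategory R C" and Z: "bounded_projective R Z\<^sub>0"
    and add: "\<And>(Q :: 'a ucx) k. \<lbrakk>bounded_projective R Q; K_factors R (shift P k) Q Q id_map\<rbrakk> \<Longrightarrow> Q \<in> C"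
    and t: "approximation_tower P s Z\<^sub>0 n X" and X: "X \<in> C"
  shows "Z\<^sub>0 \<in> C"
  using t X
proof (induction rule: approximation_tower.induct)
  case (tower_step n Y Q f X)
  note a = approximationD[OF tower_step.hyps(2)]
  have Yb: "bounded_projective R Y" by (rule tower_bounded_projective[OF tower_step.hyps(1) Z])
  then have Yc: "cochain_complex R Y" by simp
  have Xc: "cochain_complex R X" using tower_step.hyps(3) by simp
  have Q: "Q \<in> C" by (rule add[OF a(1,2)])
  let ?D = "cone Q Y f"
  let ?p = "(\<lambda>i. fst) :: int \<Rightarrow> (nat \<Rightarrow> 'a) \<times> (nat \<Rightarrow> 'a) \<Rightarrow> nat \<Rightarrow> 'a"
  have D: "cochain_complex R ?D" using a Yc by simp
  have X1: "cochain_complex R (shift X (- 1))" and D1: "cochain_complex R (shift ?D (- 1))" using Xc D by simp_all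
  note rot = cone_rotate[OF a(5) Yc a(3)]
  obtain u v where uv: "K_inverse R X ?D u v" using K_isoD[OF tower_step.hyps(4) Xc D] .
  note uv1 = K_inverse_shift[OF uv, of "- 1"]
  note w = K_inverseD[OF uv1]
  let ?f = "?p \<bullet> shift_map u (- 1)"
  have f: "?f \<in> chain_maps R (shift X (- 1)) Q" by (rule comp_chain[OF w(1) rot(1)])
  have "K_iso R (cone (shift X (- 1)) Q ?f) (cone (shift ?D (- 1)) Q ?p)"
    by (rule cone_equivalence[OF X1 a(5) f rot(1) uv1 K_inverse_refl[OF a(5)]])
      (use K_eq_refl[OF X1 a(5) f] in simp)
  from K_iso_sym[OF this] have "K_iso R Y (cone (shift X (- 1)) Q ?f)"
    by (intro K_iso_trans[OF rot(2)]) (use X1 D1 a(5) f rot(1) Yc in simp_all)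
  then have "Y \<in> C"
    by (rule triangulated_cone[OF C triangulated_shift[OF C tower_step.prems] Q f Yb])
  then show ?case by (rule tower_step.IH)
qed

section \<open>Brutal truncation above a degree, and generation from stalk complexes\<close>

definition truncation :: "('a, 'm) cx \<Rightarrow> int \<Rightarrow> ('a, 'm) cx" where
  "truncation X a = \<lparr>obj = (\<lambda>i. if i \<le> a then (obj X i)\<lparr>carrier := {\<zero>\<^bsub>obj X i\<^esub>}\<rparr> else obj X i),
     diff = (\<lambda>i x. if i \<le> a then \<zero>\<^bsub>obj X (i + 1)\<^esub> else diff X i x)\<rparr>"

lemma truncation_simps [simp]:
  "i \<le> a \<Longrightarrow> carrier (obj (truncation X a) i) = {\<zero>\<^bsub>obj X i\<^esub>}"
  "a < i \<Longrightarrow> obj (truncation X a) i = obj X i"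
  "\<zero>\<^bsub>obj (truncation X a) i\<^esub> = \<zero>\<^bsub>obj X i\<^esub>"
  "(\<oplus>\<^bsub>obj (truncation X a) i\<^esub>) = (\<oplus>\<^bsub>obj X i\<^esub>)"
  "(\<odot>\<^bsub>obj (truncation X a) i\<^esub>) = (\<odot>\<^bsub>obj X i\<^esub>)"
  "i \<le> a \<Longrightarrow> diff (truncation X a) i x = \<zero>\<^bsub>obj X (i + 1)\<^esub>"
  "a < i \<Longrightarrow> diff (truncation X a) i x = diff X i x"
  by (simp_all add: truncation_def)

lemma truncation_module: "cochain_complex R X \<Longrightarrow> right_module R (obj (truncation X a) i)"
  by (cases "i \<le> a") (simp_all add: truncation_def zero_submodule_module)

lemma truncation_complex [simp]:
  assumes X: "cochain_complex R X"
  shows "cochain_complex R (truncation X a)"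
  unfolding cochain_complex_def
proof (intro allI conjI ballI)
  fix i
  show "right_module R (obj (truncation X a) i)" by (rule truncation_module[OF X])
  show "diff (truncation X a) i \<in> module_homs R (obj (truncation X a) i) (obj (truncation X a) (i + 1))"
  proof (cases "i \<le> a")
    case True
    then show ?thesis
      by (intro module_homsI) (use X in \<open>auto simp: truncation_def\<close>)
  next
    case False
    then show ?thesis using cc_diff_hom[OF X refl, of i] by (simp add: truncation_def)
  qed
  show "diff (truncation X a) (i + 1) (diff (truncation X a) i x) = \<zero>\<^bsub>obj (truncation X a) (i + 2)\<^esub>"
    if "x \<in> carrier (obj (truncation X a) i)" for x
    using that X by (cases "i \<le> a"; cases "i + 1 \<le> a") (auto simp: ac_simps)
qed


lemma truncation_bounded_projective:
  assumes X: "bounded_projective R X"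
  shows "bounded_projective R (truncation X a)"
proof -
  have Xc: "cochain_complex R X" using X by simp
  obtain b c where bc: "\<And>i. i < b \<or> c < i \<Longrightarrow> carrier (obj X i) = {\<zero>\<^bsub>obj X i\<^esub>}"
    using X unfolding bounded_projective_def by blast
  show ?thesis
  proof (rule bounded_projectiveI[where a = b and b = c])
    fix i
    show "fg_projective R (obj (truncation X a) i)"
    proof (cases "i \<le> a")
      case True
      then show ?thesis
        by (intro fg_projective_zero truncation_module[OF Xc]) simp
    qed (use bounded_projective_obj[OF X] in simp)
    show "carrier (obj (truncation X a) i) = {\<zero>\<^bsub>obj (truncation X a) i\<^esub>}" if "i < b \<or> c < i"
      using bc[OF that] by (cases "i \<le> a") simp_all
  qed (use Xc in simp)
qed

text \<open>The lowest differential of \<open>X\<close> is a chain map from its lowest term to the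
  rest. The shift \<open>- a - 1\<close> places that term in degree \<open>a + 1\<close>, because
  the cone moves its first component down by one.\<close>

lemma truncation_cone:
  fixes X :: "('a, 'm) cx"
  assumes X: "cochain_complex R X" and z: "\<And>i. i < a \<Longrightarrow> carrier (obj X i) = {\<zero>\<^bsub>obj X i\<^esub>}"
  obtains f where "f \<in> chain_maps R (shift (stalk (obj X a)) (- a - 1)) (truncation X a)"
    "K_iso R X (cone (shift (stalk (obj X a)) (- a - 1)) (truncation X a) f)"
proof -
  let ?M = "obj X a"
  let ?S = "shift (stalk ?M) (- a - 1)" and ?Y = "truncation X a"
  have M: "right_module R ?M" using X by simp
  have S: "cochain_complex R ?S" and Y: "cochain_complex R ?Y" using X by simp_all
  have S1: "obj ?S (a + 1) = ?M" by simp
  have S2: "carrier (obj ?S i) = {\<zero>\<^bsub>?M\<^esub>}" if "i \<noteq> a + 1" for i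
    using that by simp
  have S3: "\<zero>\<^bsub>obj ?S i\<^esub> = \<zero>\<^bsub>?M\<^esub>" "(\<oplus>\<^bsub>obj ?S i\<^esub>) = (\<oplus>\<^bsub>?M\<^esub>)" "(\<odot>\<^bsub>obj ?S i\<^esub>) = (\<odot>\<^bsub>?M\<^esub>)" for i
    by (simp_all add: stalk_def)
  have S4: "diff ?S i x = \<zero>\<^bsub>?M\<^esub>" for i x
  proof -
    have "\<ominus>\<^bsub>obj ?S (i + 1)\<^esub> \<zero>\<^bsub>obj ?S (i + 1)\<^esub> = \<zero>\<^bsub>obj ?S (i + 1)\<^esub>" by (rule rm_simps(9)[OF cc_module[OF S]])
    then show ?thesis by (simp add: shift_diff algebra_simps del: rm_simps)
  qed
  define f where "f i x = (if i = a + 1 then diff X a x else \<zero>\<^bsub>obj X i\<^esub>)" for i x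
  have f: "f \<in> chain_maps R ?S ?Y"
  proof (rule chain_mapsI)
    fix i
    show "f i \<in> module_homs R (obj ?S i) (obj ?Y i)"
    proof (cases "i = a + 1")
      case True
      then show ?thesis using cc_diff_hom[OF X refl, of a] by (simp add: f_def[abs_def])
    next
      case False
      have "zero_map ?Y i \<in> module_homs R (obj ?S i) (obj ?Y i)" by (rule chain_maps_hom[OF zero_chain[OF Y]])
      then show ?thesis using False by (simp add: f_def[abs_def] zero_map_def[abs_def])
    qed
    show "f (i + 1) (diff ?S i x) = diff ?Y i (f i x)" if "x \<in> carrier (obj ?S i)" for x
      using that X S4[of i x] by (cases "i \<le> a") (auto simp: f_def ac_simps)
  qed
  let ?E = "cone ?S ?Y f"
  have E: "cochain_complex R ?E" using S Y f by simp
  \<comment> \<open>In every degree at least one component of the cone is zero: the first away from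
    degree \<open>a\<close>, the second up to degree \<open>a\<close>.\<close>
  define p where "p i x = (if i = a then (x, \<zero>\<^bsub>obj X i\<^esub>) else (\<zero>\<^bsub>?M\<^esub>, x))" for i :: int and x
  define q :: "int \<Rightarrow> 'm \<times> 'm \<Rightarrow> 'm" where "q i = (if i = a then fst else snd)" for i :: int
  have Ec: "carrier (obj ?E i) = (if i = a then carrier ?M else {\<zero>\<^bsub>?M\<^esub>}) \<times> (if i \<le> a then {\<zero>\<^bsub>obj X i\<^esub>} else carrier (obj X i))" for i
    by (cases "i = a"; cases "i < a") simp_all
  have Ea: "x \<oplus>\<^bsub>obj ?E i\<^esub> y = (fst x \<oplus>\<^bsub>?M\<^esub> fst y, snd x \<oplus>\<^bsub>obj X i\<^esub> snd y)"
    "r \<odot>\<^bsub>obj ?E i\<^esub> x = (r \<odot>\<^bsub>?M\<^esub> fst x, r \<odot>\<^bsub>obj X i\<^esub> snd x)" for i r x y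
    by (simp_all add: module_sum_def S3 split_def del: shift_obj)
  have Ed: "diff ?E i x = (\<zero>\<^bsub>?M\<^esub>, f (i + 1) (fst x) \<oplus>\<^bsub>obj X (i + 1)\<^esub> diff ?Y i (snd x))" for i x
  proof -
    have "\<ominus>\<^bsub>obj ?S (i + 2)\<^esub> \<zero>\<^bsub>obj ?S (i + 2)\<^esub> = \<zero>\<^bsub>obj ?S (i + 2)\<^esub>" by (rule rm_simps(9)[OF cc_module[OF S]])
    then show ?thesis unfolding S3 by (simp add: cone_def S4 split_def del: shift_obj)
  qed
  have zX: "x = \<zero>\<^bsub>obj X i\<^esub>" if "x \<in> carrier (obj X i)" "i < a" for i x using z[OF that(2)] that(1) by simp
  have p: "p \<in> chain_maps R X ?E"
  proof (rule chain_mapsI)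
    fix i
    show "p i \<in> module_homs R (obj X i) (obj ?E i)"
      by (rule module_homsI) (use X M zX in \<open>auto simp: p_def Ec Ea simp del: cone_obj\<close>)
    fix x assume x: "x \<in> carrier (obj X i)"
    show "p (i + 1) (diff X i x) = diff ?E i (p i x)"
      using X M x zX[OF x] by (cases "i < a"; cases "i + 1 = a"; cases "i = a") (auto simp: p_def Ed f_def simp del: cone_diff)
  qed
  have q: "q \<in> chain_maps R ?E X"
  proof (rule chain_mapsI)
    fix i
    show "q i \<in> module_homs R (obj ?E i) (obj X i)"
      by (rule module_homsI) (use X M zX in \<open>auto simp: q_def Ec Ea split: if_splits simp del: cone_obj\<close>)
    fix x assume x: "x \<in> carrier (obj ?E i)"
    show "q (i + 1) (diff ?E i x) = diff X i (q i x)"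
      using X M x by (cases "i < a"; cases "i + 1 = a"; cases "i = a") (auto simp: q_def Ed Ec f_def simp del: cone_diff cone_obj)
  qed
  have "K_inverse R X ?E p q"
    by (rule strict_iso[OF X E p q]) (use zX in \<open>auto simp: p_def q_def Ec simp del: cone_obj split: if_splits\<close>)
  then show thesis using that[OF f K_isoI] by blast
qed

text \<open>Induction on the width of an interval outside of which the terms vanish;
  \<open>truncation_cone\<close> splits off the lowest term.\<close>

lemma triangulated_stalks:
  fixes X :: "'a ucx"
  assumes C: "triangulated_subcategory R C"
    and st: "\<And>N :: ('a, nat \<Rightarrow> 'a) module. fg_projective R N \<Longrightarrow> stalk N \<in> C"
    and X: "bounded_projective R X"
  shows "X \<in> C"
proof -
  have *: "\<lbrakk>bounded_projective R X; \<And>i. i < a \<or> a + int w \<le> i \<Longrightarrow> carrier (obj X i) = {\<zero>\<^bsub>obj X i\<^esub>}\<rbrakk> \<Longrightarrow> X \<in> C"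
    for a w and X :: "'a ucx"
  proof (induction w arbitrary: a X)
    case 0
    have Xc: "cochain_complex R X" using 0 by simp
    have N: "fg_projective R (obj X 0)" by (rule bounded_projective_obj[OF 0(1)])
    have z: "carrier (obj X i) = {\<zero>\<^bsub>obj X i\<^esub>}" for i by (rule 0(2)) auto
    have S: "cochain_complex R (stalk (obj X 0))" using Xc by simp
    have zS: "carrier (obj (stalk (obj X 0)) i) = {\<zero>\<^bsub>obj (stalk (obj X 0)) i\<^esub>}" for i
      using z[of 0] by (cases "i = 0") simp_all
    \<comment> \<open>With all terms zero, \<open>X\<close> is isomorphic to the stalk of its own
      zero term, and \<open>st\<close> places that stalk in \<open>C\<close>.\<close>
    have "K_inverse R (stalk (obj X 0)) X (zero_map X) (zero_map (stalk (obj X 0)))"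
      by (rule strict_iso[OF S Xc]) (use S Xc z zS in auto)
    then show ?case
      by (intro triangulated_iso[OF C st[OF N] _ 0(1)] K_isoI)
  next
    case (Suc w)
    have Xc: "cochain_complex R X" using Suc by simp
    have N: "fg_projective R (obj X a)" by (rule bounded_projective_obj[OF Suc.prems(1)])
    obtain f where f: "f \<in> chain_maps R (shift (stalk (obj X a)) (- a - 1)) (truncation X a)"
      "K_iso R X (cone (shift (stalk (obj X a)) (- a - 1)) (truncation X a) f)"
      by (rule truncation_cone[OF Xc, of a]) (use Suc.prems(2) in auto)
    have "truncation X a \<in> C"
    proof (rule Suc.IH[of _ "a + 1"])
      show "bounded_projective R (truncation X a)" by (rule truncation_bounded_projective[OF Suc.prems(1)])
      show "carrier (obj (truncation X a) i) = {\<zero>\<^bsub>obj (truncation X a) i\<^esub>}" if "i < a + 1 \<or> a + 1 + int w \<le> i" for i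
        using that Suc.prems(2)[of i] by (cases "i \<le> a") auto
    qed
    then show ?case
      by (rule triangulated_cone[OF C triangulated_shift[OF C st[OF N]] _ f(1) Suc.prems(1) f(2)])
  qed
  obtain a b where ab: "\<And>i. i < a \<or> b < i \<Longrightarrow> carrier (obj X i) = {\<zero>\<^bsub>obj X i\<^esub>}"
    using X unfolding bounded_projective_def by blast
  show ?thesis
    by (rule *[OF X, of a "nat (b - a + 1)"]) (rule ab, arith)
qed

text \<open>Each finitely generated projective \<open>N\<close> is a retract of copies of the
  algebra, so its tower ends in a complex of \<open>add T\<close>, and \<open>tower_back\<close>
  returns from there to the stalk of \<open>N\<close>. Treating each \<open>N\<close> separately
  replaces a closure of \<open>C\<close> under summands.\<close>

lemma tower_generates:
  fixes P V M T :: "'a ucx"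
  assumes P: "bounded_projective R P" and V: "bounded_projective R V" and i: "K_iso R V (stalk (regular R))"
    and t: "approximation_tower P s V n M"
    and T: "cochain_complex R T" and iT: "K_iso R T (complex_sum M (shift P (int n + s - 1)))"
    and C: "triangulated_subcategory R C" and TC: "add_closure R T \<subseteq> C"
  shows "C = Kb_proj R"
proof -
  let ?k = "int n + s - 1"
  have Mb: "bounded_projective R M" by (rule tower_bounded_projective[OF t V])
  have Pc: "cochain_complex R P" and Vc: "cochain_complex R V" and Mc: "cochain_complex R M"
    and Kc: "cochain_complex R (shift P ?k)"
    using P V Mb by simp_all
  let ?S = "complex_sum M (shift P ?k)"
  have S: "cochain_complex R ?S" using Mc Kc by simp
  note sm = sum_chain_maps[OF Mc Kc]
  have TS: "K_factors R T ?S ?S id_map" by (rule K_iso_factors[OF K_iso_sym[OF iT T S] S T])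
  have "K_eq R M M ((\<lambda>i. fst) \<bullet> (\<lambda>i x. (x, \<zero>\<^bsub>obj (shift P ?k) i\<^esub>))) id_map"
    by (rule K_eq_eqI[OF Mc Mc comp_chain[OF sm(1) sm(3)] id_chain]) simp
  from K_factors_cong[OF K_factors_single[OF sm(1) sm(3) S Mc Mc] this]
  have TM: "K_factors R T M M id_map" by (rule K_factors_trans[OF _ TS S T])
  have "K_eq R (shift P ?k) (shift P ?k) ((\<lambda>i. snd) \<bullet> (\<lambda>i x. (\<zero>\<^bsub>obj M i\<^esub>, x))) id_map"
    by (rule K_eq_eqI[OF Kc Kc comp_chain[OF sm(2) sm(4)] id_chain]) simp
  from K_factors_cong[OF K_factors_single[OF sm(2) sm(4) S Kc Kc] this]
  have TK: "K_factors R T (shift P ?k) (shift P ?k) id_map" by (rule K_factors_trans[OF _ TS S T])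
  have add: "Z \<in> C" if "bounded_projective R Z" "K_factors R T Z Z id_map" for Z
    using factors_add_closure[OF that(1) T that(2)] TC by blast
  \<comment> \<open>Only the shift of \<open>P\<close> by \<open>?k\<close> is a summand of
    \<open>T\<close>; a complex built from another shift is moved there and back, as
    \<open>C\<close> is closed under shifts.\<close>
  have addP: "Q \<in> C" if Q: "bounded_projective R Q" and f: "K_factors R (shift P k) Q Q id_map" for Q :: "'a ucx" and k
  proof (rule triangulated_unshift[OF C _ Q])
    have Pk: "cochain_complex R (shift P k)" using Pc by simp
    let ?Q = "shift Q (?k - k)"
    have 1: "K_factors R (shift (shift P k) (?k - k)) ?Q ?Q id_map"
      using K_factors_shift[OF f Pk, of "?k - k"] by (simp add: shift_map_id)
    have Pk': "cochain_complex R (shift (shift P k) (?k - k))" using Pc by simp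
    have 2: "K_factors R (shift P ?k) ?Q ?Q id_map"
      by (rule K_factors_trans[OF 1 K_iso_factors[OF K_iso_shift_shift[OF Pc] Pk' Kc] Pk' Kc]) simp
    show "?Q \<in> C"
      by (rule add[OF bounded_projective_shift[OF Q] K_factors_trans[OF 2 TK Kc T]])
  qed
  have "stalk N \<in> C" if N: "fg_projective R N" for N :: "('a, nat \<Rightarrow> 'a) module"
  proof -
    have R: "cochain_complex R (stalk (regular R))" by (simp add: regular_module)
    have Nb: "bounded_projective R (stalk N)" by (rule stalk_bounded_projective[OF N])
    have "K_factors R V (stalk N) (stalk N) id_map"
      by (rule K_factors_trans[OF stalk_factors[OF N] K_iso_factors[OF K_iso_sym[OF i Vc R] R Vc] R Vc])
    from tower_retract[OF P V Nb this t]
    obtain Z e t' where tw: "approximation_tower P s (stalk N) n Z" and e: "K_factors R M Z Z e"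
      and t': "K_factors R (shift P ?k) Z Z t'" and et: "K_eq R Z Z id_map (add_map Z e t')" by blast
    have Zb: "bounded_projective R Z" by (rule tower_bounded_projective[OF tw Nb])
    \<comment> \<open>Both \<open>M\<close> and the shift of \<open>P\<close> are summands of
      \<open>T\<close>, so both parts of the identity of \<open>Z\<close> factor through copies of
      \<open>T\<close>.\<close>
    have "K_factors R T Z Z (add_map Z e t')"
      by (rule K_factors_sum[OF K_factors_trans[OF e TM Mc T] K_factors_trans[OF t' TK Kc T] T])
    from K_factors_cong[OF this K_eq_sym[OF et]] have "Z \<in> C" by (rule add[OF Zb])
    from tower_back[OF C Nb addP tw this] show ?thesis .
  qed
  then have "X \<in> C" if "bounded_projective R X" for X :: "'a ucx"
    by (rule triangulated_stalks[OF C _ that])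
  moreover have "C \<subseteq> Kb_proj R" using C by (simp add: triangulated_subcategory_def)
  ultimately show ?thesis by (auto simp: Kb_proj_iff)
qed

end

section \<open>The tilting complex\<close>

context symmetrizing_form begin

text \<open>Towers have stages of type \<open>'a ucx\<close>, so the algebra needs a representative
  of that type to start from; elements become constant sequences.\<close>

lemma encode_regular:
  obtains V :: "('a, nat \<Rightarrow> 'a) cx" where "bounded_projective A V" "K_iso A V (stalk (regular A))"
proof -
  have S: "bounded_projective A (stalk (regular A))"
    by (rule A.stalk_bounded_projective[OF A.fg_projective_regular])
  then have Sc: "cochain_complex A (stalk (regular A))" by simp
  have de: "(\<lambda>w :: nat \<Rightarrow> 'a. w 0) \<circ> (\<lambda>x _. x) = id" by (simp add: fun_eq_iff)
  show thesis
    by (rule that[OF A.transport_bounded_projective[OF S de] A.K_isoI[OF A.K_inverse_sym[OF A.transport_iso(2)[OF Sc de]]]])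
qed

lemma Theta_tilting:
  fixes P T :: "('a, nat \<Rightarrow> 'a) cx"
  assumes P: "bounded_projective A P" and pt: "partial_tilting A P" and l: "cx_length P = 2"
    and n: "n \<ge> 1" and T: "T \<in> Theta A P (regular A) n"
  shows "tilting A T"
proof -
  let ?s = "cx_s P" and ?R = "stalk (regular A)"
  note deg = A.cohomology_degrees_length_two[OF P l]
  have Pc: "cochain_complex A P" using P by simp
  have rm: "right_module A (regular A)" by (rule A.regular_module)
  have Rc: "cochain_complex A ?R" using rm by simp
  obtain V :: "('a, nat \<Rightarrow> 'a) cx" where V: "bounded_projective A V" and VR: "K_iso A V ?R" by (rule encode_regular)
  have Vc: "cochain_complex A V" using V by simp
  have rigid: "hom_null A P (shift P k)" if "k \<noteq> 0" for k
    by (rule A.D_hom_zero_hom_null[OF P]) (use pt that Pc in \<open>simp_all add: partial_tilting_def\<close>)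
  \<comment> \<open>Maps from the algebra to \<open>P[j]\<close> are the cohomology of
    \<open>P\<close> in degree \<open>j\<close>, which length two confines to
    \<open>j = s - 1\<close> and \<open>j = s\<close>; duality reverses the direction.\<close>
  have o: "hom_null A (shift P j) V" if "j \<noteq> ?s" "j \<noteq> ?s - 1" for j
  proof (rule hom_null_symmetric[OF V])
    have "hom_null A ?R (shift P j)" by (rule A.hom_null_regular_shift[OF Pc]) (use deg that in auto)
    then show "hom_null A V (shift P j)"
      by (rule A.hom_null_iso) (use VR Vc Rc Pc A.K_iso_refl[OF A.shift_complex[OF Pc]] in auto)
  qed (use Pc in simp)
  have p: "hom_null A V (shift V i)" if "i > 0" for i
  proof (rule A.hom_null_iso)
    show "hom_null A ?R (shift ?R i)"
      by (rule A.hom_null_regular_shift[OF Rc cohomology_degrees_zero_term[OF Rc]]) (use that in simp)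
  qed (use VR Vc Rc A.K_iso_shift[OF VR Vc Rc] in auto)
  obtain X where Tc: "cochain_complex A T" and X: "X \<in> Delta A P (regular A) n"
    and TX: "K_iso A T (complex_sum X (shift P (int n + ?s - 1)))"
    using T deg(1) unfolding Theta_def by auto
  \<comment> \<open>\<open>X\<close> is exchanged for a stage \<open>M\<close> of a tower, which has
    projective terms.\<close>
  obtain M where Xc: "cochain_complex A X" and t: "A.approximation_tower P ?s V n M" and MX: "K_iso A M X"
    using A.Delta_tower[OF P deg(1) V VR rm X] by blast
  have Mc: "cochain_complex A M" using A.tower_bounded_projective[OF t V] by simp
  let ?P = "shift P (int n + ?s - 1)"
  have Kc: "cochain_complex A ?P" using Pc by simp
  have "K_iso A (complex_sum X ?P) (complex_sum M ?P)"
    by (rule A.K_iso_sum[OF A.K_iso_sym[OF MX Mc Xc] A.K_iso_refl[OF Kc] Xc Mc Kc Kc])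
  then have TM: "K_iso A T (complex_sum M ?P)"
    by (rule A.K_iso_trans[OF TX _ Tc]) (use Xc Mc Kc in simp_all)
  have "partial_tilting A T"
    by (rule tower_partial_tilting[OF P rigid V o p t n Tc TM])
  moreover have "C = Kb_proj A" if "triangulated_subcategory A C" "add_closure A T \<subseteq> C" for C
    by (rule A.tower_generates[OF P V VR t Tc TM that])
  ultimately show ?thesis unfolding tilting_def by blast
qed

end

theorem corollary4p8:
  fixes K :: "'k ring" and A :: "('k, 'a) module"
    and P T :: "('a, nat \<Rightarrow> 'a) cx" and n :: nat
  assumes "fd_algebra K A" and "symmetric_algebra K A"
    and "P \<in> Kb_proj A" and "partial_tilting A P" and "cx_length P = 2"
    and "n \<ge> 1" and "T \<in> Theta A P (regular A) n"
  shows "tilting A T"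
proof -
  obtain tr where "symmetrizing_form A K (\<lambda>c. c \<odot>\<^bsub>A\<^esub> \<one>\<^bsub>A\<^esub>) tr"
    using symmetric_algebra_form[OF assms(1,2)] by blast
  then show ?thesis
    by (rule symmetrizing_form.Theta_tilting) (use assms in \<open>simp_all add: Kb_proj_iff\<close>)
qed

end
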